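(* Let $\mathsf{X}$ be a regular diffusion with state space $J$, scale function $\mathfrak{s}$ and speed measure $\mathfrak{m}$, let $\zeta = \inf(t \in \mathbb{R}_+ : \mathsf{X}_t \notin J^\circ)$ and let $\mathsf{Y} = \mathfrak{s}(\mathsf{X}_{\cdot\wedge\zeta})$. Then the following are equivalent: (i) $\mathsf{X}$ is a Feller--Dynkin (FD) process. (ii) $\mathsf{Y}$ is a $\mathbb{P}_x$-martingale for every $x \in J^\circ$. (iii) Every open boundary point is natural.
   Context: Let $J\subset\mathbb{R}$ be a non-empty closed, open or half-open, possibly infinite interval, $J^\circ$ its interior, $\mathrm{cl}(J)$ its closure in $[-\infty,\infty]$ and $\partial J = \mathrm{cl}(J)\setminus J^\circ$. A diffusion is a path-continuous, temporally homogeneous, conservative strong Markov process $(\Omega,\mathcal{F},(\mathcal{F}_t)_{t\ge0},(\mathsf{X}_t)_{t\ge0},(\theta_t)_{t\ge0},(\mathbb{P}_x)_{x\in J})$ with state space $(J,\mathcal{B}(J))$. Put $\tau_u=\inf(t\in\mathbb{R}_+:\mathsf{X}_t=u)$. The diffusion is regular if $\mathbb{P}_x(\tau_y<\infty)>0$ for all $x\in J^\circ$, $y\in J$. Martingales are with respect to $(\mathcal{F}_t)_{t\ge 0}$. Semigroup: $T_tf(x)=\mathbb{E}_x[f(\mathsf{X}_t)]$. $C_0(J)$ is the Banach space of continuous functions $J\to\mathbb{R}$ vanishing at infinity, with the sup-norm. $\mathsf{X}$ is an FD process if $(T_t)_{t\ge0}$ is a strongly continuous semigroup on $C_0(J)$.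 Scale function: a continuous strictly increasing $\mathfrak{s}:J\to\mathbb{R}$ (unique up to increasing affine transformations) such that for any $I=(a,b)$ with $[a,b]\subset J$, $\mathbb{P}_x(\tau_b<\tau_a)=\frac{\mathfrak{s}(x)-\mathfrak{s}(a)}{\mathfrak{s}(b)-\mathfrak{s}(a)}$, $x\in I$. Speed measure: the unique Radon measure $\mathfrak{m}$ on $(J^\circ,\mathcal{B}(J^\circ))$ such that for every bounded $I=(a,b)$ with $[a,b]\subset J$, $\mathbb{E}_x[\tau_a\wedge\tau_b]=\int G_I(x,y)\,\mathfrak{m}(dy)$, $x\in I$, where $G_I(x,y)=\frac{2(\mathfrak{s}(x)\wedge\mathfrak{s}(y)-\mathfrak{s}(a))(\mathfrak{s}(b)-\mathfrak{s}(x)\vee\mathfrak{s}(y))}{\mathfrak{s}(b)-\mathfrak{s}(a)}$ for $x,y\in I$ and $G_I(x,y)=0$ otherwise. Boundary classification: fix $c\in J^\circ$. For $x\in J^\circ$ set $\mathfrak{u}(x)=\int_{(c,x]}\mathfrak{m}((c,z])\,\mathfrak{s}(dz)$ and $\mathfrak{v}(x)=\int_{(c,x]}(\mathfrak{s}(y)-\mathfrak{s}(c))\,\mathfrak{m}(dy)$ if $x\ge c$, and $\mathfrak{u}(x)=\int_{(x,c]}\mathfrak{m}((z,c])\,\mathfrak{s}(dz)$ and $\mathfrak{v}(x)=\int_{(x,c]}(\mathfrak{s}(c)-\mathfrak{s}(y))\,\mathfrak{m}(dy)$ if $x\le c$. For $b\in\partial J$ let $\mathfrak{u}(b),\mathfrak{v}(b)$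 be the monotone limits as $x\to b$. The point $b$ is regular if $\mathfrak{u}(b)<\infty,\mathfrak{v}(b)<\infty$; exit if $\mathfrak{u}(b)<\infty,\mathfrak{v}(b)=\infty$; entrance if $\mathfrak{u}(b)=\infty,\mathfrak{v}(b)<\infty$; natural if $\mathfrak{u}(b)=\mathfrak{v}(b)=\infty$ (independently of $c$). Regular and exit boundaries are called closed (they belong to $J$); entrance and natural boundaries are called open (they do not belong to $J$). *)

theory Defs
  imports "HOL-Probability.Probability"
begin

section \<open>Filtered spaces\<close>

text \<open>Time runs through the nonnegative reals; the values of the families below at negative
  times are irrelevant. Stopping times take values in \<open>[0, \<infinity>]\<close>. The library notions
  \<^const>\<open>stopping_time\<close> and \<open>pre_sigma\<close> want the filtration to be indexed by the value
  type of the stopping time, so the index \<open>\<infinity>\<close> is added with the ambient sigma-algebra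
  there. Thus \<open>pre_sigma T\<close> consists of the measurable \<open>A\<close> such that \<open>A \<inter> {T \<le> t}\<close> is in
  \<open>F t\<close> for all finite \<open>t\<close>.\<close>

definition extended_filtration :: "'a measure \<Rightarrow> (real \<Rightarrow> 'a measure) \<Rightarrow> ennreal \<Rightarrow> 'a measure" where
  "extended_filtration M F t = (if t = \<infinity> then M else F (enn2real t))"

locale filtered_space =
  fixes M :: "'a measure" and F :: "real \<Rightarrow> 'a measure"
  assumes subalgebra_F: "\<And>t. 0 \<le> t \<Longrightarrow> subalgebra M (F t)"
    and F_mono: "\<And>t u. 0 \<le> t \<Longrightarrow> t \<le> u \<Longrightarrow> sets (F t) \<subseteq> sets (F u)"

sublocale filtered_space \<subseteq> filtration "space M" "extended_filtration M F"
proof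
  show "space (extended_filtration M F i) = space M" for i
    using subalgebra_F[of "enn2real i"] by (auto simp: extended_filtration_def subalgebra_def)
  show "sets (extended_filtration M F i) \<le> sets (extended_filtration M F j)" if "i \<le> j" for i j
  proof (cases "j = \<infinity>")
    case True
    then show ?thesis
      using subalgebra_F[of "enn2real i"] by (auto simp: extended_filtration_def subalgebra_def)
  next
    case False
    then have "enn2real i \<le> enn2real j" "i \<noteq> \<infinity>"
      using that by (auto simp: enn2real_mono top.not_eq_extremum top_unique)
    with False show ?thesis
      using F_mono[of "enn2real i" "enn2real j"] by (simp add: extended_filtration_def)
  qed
qed

definition martingale :: "'a measure \<Rightarrow> (real \<Rightarrow> 'a measure) \<Rightarrow> (real \<Rightarrow> 'a \<Rightarrow> real) \<Rightarrow> bool" where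
  "martingale Q F Y \<longleftrightarrow>
     (\<forall>t\<ge>0. Y t \<in> borel_measurable (F t) \<and> integrable Q (Y t)) \<and>
     (\<forall>r t. 0 \<le> r \<and> r \<le> t \<longrightarrow> (AE \<omega> in Q. real_cond_exp Q (F r) (Y t) \<omega> = Y r \<omega>))"


section \<open>Diffusions\<close>

definition path_algebra :: "'a measure \<Rightarrow> (real \<Rightarrow> 'a \<Rightarrow> real) \<Rightarrow> 'a measure" where
  "path_algebra M X = sigma (space M) {X t -` B \<inter> space M | t B. 0 \<le> t \<and> B \<in> sets borel}"

text \<open>\<open>(space M, M)\<close> is the underlying measurable space (the measure of \<open>M\<close> plays no role), and
  \<open>P x\<close> is only meaningful for \<open>x \<in> J\<close>. The process is conservative: it stays in \<open>J\<close>
  forever and the \<open>P x\<close> are probability measures. Nothing beyond monotonicity (neither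
  right-continuity nor completeness) is required of the filtration.\<close>

locale diffusion = filtered_space M F
  for M :: "'a measure" and F :: "real \<Rightarrow> 'a measure" +
  fixes J :: "real set"
    and X :: "real \<Rightarrow> 'a \<Rightarrow> real"
    and \<theta> :: "real \<Rightarrow> 'a \<Rightarrow> 'a"
    and P :: "real \<Rightarrow> 'a measure"
  assumes interval: "is_interval J" "J \<noteq> {}"
    and in_state_space: "\<And>t \<omega>. 0 \<le> t \<Longrightarrow> \<omega> \<in> space M \<Longrightarrow> X t \<omega> \<in> J"
    and adapted: "\<And>t. 0 \<le> t \<Longrightarrow> X t \<in> borel_measurable (F t)"
    and continuous_paths: "\<And>\<omega>. \<omega> \<in> space M \<Longrightarrow> continuous_on {0..} (\<lambda>t. X t \<omega>)"
    and shift_in_space: "\<And>t \<omega>. 0 \<le> t \<Longrightarrow> \<omega> \<in> space M \<Longrightarrow> \<theta> t \<omega> \<in> space M"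
    and shift: "\<And>t u \<omega>. 0 \<le> t \<Longrightarrow> 0 \<le> u \<Longrightarrow> \<omega> \<in> space M \<Longrightarrow> X u (\<theta> t \<omega>) = X (u + t) \<omega>"
    and prob: "\<And>x. x \<in> J \<Longrightarrow> prob_space (P x)"
    and sets_P: "\<And>x. x \<in> J \<Longrightarrow> sets (P x) = sets M"
    and start: "\<And>x. x \<in> J \<Longrightarrow> AE \<omega> in P x. X 0 \<omega> = x"
    and kernel: "\<And>B. B \<in> sets (path_algebra M X) \<Longrightarrow>
          (\<lambda>x. measure (P x) B) \<in> borel_measurable (restrict_space borel J)"
    and strong_markov: "\<And>x T B. x \<in> J \<Longrightarrow> stopping_time (extended_filtration M F) T \<Longrightarrow>
          B \<in> sets (path_algebra M X) \<Longrightarrow>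
          AE \<omega> in P x. T \<omega> < \<infinity> \<longrightarrow>
            real_cond_exp (P x) (pre_sigma T)
              (indicator {\<omega> \<in> space M. T \<omega> < \<infinity> \<and> \<theta> (enn2real (T \<omega>)) \<omega> \<in> B}) \<omega>
            = measure (P (X (enn2real (T \<omega>)) \<omega>)) B"

definition entry_time :: "(real \<Rightarrow> 'a \<Rightarrow> real) \<Rightarrow> real set \<Rightarrow> 'a \<Rightarrow> ennreal" where
  "entry_time X A \<omega> = Inf (ennreal ` {t. 0 \<le> t \<and> X t \<omega> \<in> A})"

abbreviation hitting_time :: "(real \<Rightarrow> 'a \<Rightarrow> real) \<Rightarrow> real \<Rightarrow> 'a \<Rightarrow> ennreal" where
  "hitting_time X u \<equiv> entry_time X {u}"

locale regular_diffusion = diffusion M F J X \<theta> P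
  for M :: "'a measure" and F J X \<theta> P +
  assumes regular: "\<And>x y. x \<in> interior J \<Longrightarrow> y \<in> J \<Longrightarrow>
    measure (P x) {\<omega> \<in> space M. hitting_time X y \<omega> < \<infinity>} > 0"


section \<open>Feller--Dynkin processes\<close>

text \<open>Functions on \<open>J\<close> are represented by functions on the reals of which only the values on
  \<open>J\<close> matter.\<close>

definition C0 :: "real set \<Rightarrow> (real \<Rightarrow> real) set" where
  "C0 J = {f. continuous_on J f \<and> (\<forall>\<epsilon>>0. \<exists>K\<subseteq>J. compact K \<and> (\<forall>x\<in>J - K. \<bar>f x\<bar> < \<epsilon>))}"

definition sup_norm_on :: "real set \<Rightarrow> (real \<Rightarrow> real) \<Rightarrow> real" where
  "sup_norm_on J f = (SUP x\<in>J. \<bar>f x\<bar>)"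

definition strongly_continuous_semigroup ::
    "real set \<Rightarrow> (real \<Rightarrow> (real \<Rightarrow> real) \<Rightarrow> real \<Rightarrow> real) \<Rightarrow> bool" where
  "strongly_continuous_semigroup J T \<longleftrightarrow>
     (\<forall>t\<ge>0. \<forall>f\<in>C0 J. T t f \<in> C0 J) \<and>
     (\<forall>t\<ge>0. \<forall>f\<in>C0 J. \<forall>g\<in>C0 J. \<forall>\<alpha> \<beta>. \<forall>x\<in>J.
        T t (\<lambda>y. \<alpha> * f y + \<beta> * g y) x = \<alpha> * T t f x + \<beta> * T t g x) \<and>
     (\<forall>t\<ge>0. \<exists>C. \<forall>f\<in>C0 J. sup_norm_on J (T t f) \<le> C * sup_norm_on J f) \<and>
     (\<forall>f\<in>C0 J. \<forall>x\<in>J. T 0 f x = f x) \<and>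
     (\<forall>t\<ge>0. \<forall>u\<ge>0. \<forall>f\<in>C0 J. \<forall>x\<in>J. T (t + u) f x = T t (T u f) x) \<and>
     (\<forall>f\<in>C0 J. ((\<lambda>t. sup_norm_on J (\<lambda>x. T t f x - f x)) \<longlongrightarrow> 0) (at_right 0))"

definition transition_semigroup ::
    "(real \<Rightarrow> 'a \<Rightarrow> real) \<Rightarrow> (real \<Rightarrow> 'a measure) \<Rightarrow> real \<Rightarrow> (real \<Rightarrow> real) \<Rightarrow> real \<Rightarrow> real" where
  "transition_semigroup X P t f x = (LINT \<omega>|P x. f (X t \<omega>))"

definition FD_process ::
    "real set \<Rightarrow> (real \<Rightarrow> 'a \<Rightarrow> real) \<Rightarrow> (real \<Rightarrow> 'a measure) \<Rightarrow> bool" where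
  "FD_process J X P \<longleftrightarrow> strongly_continuous_semigroup J (transition_semigroup X P)"


section \<open>Scale function and speed measure\<close>

definition scale_function ::
    "'a measure \<Rightarrow> real set \<Rightarrow> (real \<Rightarrow> 'a \<Rightarrow> real) \<Rightarrow> (real \<Rightarrow> 'a measure) \<Rightarrow>
     (real \<Rightarrow> real) \<Rightarrow> bool" where
  "scale_function M J X P s \<longleftrightarrow>
     continuous_on J s \<and> strict_mono_on J s \<and>
     (\<forall>a b. a < b \<and> {a..b} \<subseteq> J \<longrightarrow> (\<forall>x\<in>{a<..<b}.
        measure (P x) {\<omega> \<in> space M. hitting_time X b \<omega> < hitting_time X a \<omega>}
        = (s x - s a) / (s b - s a)))"

definition green :: "(real \<Rightarrow> real) \<Rightarrow> real \<Rightarrow> real \<Rightarrow> real \<Rightarrow> real \<Rightarrow> real" where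
  "green s a b x y =
     (if x \<in> {a<..<b} \<and> y \<in> {a<..<b}
      then 2 * (min (s x) (s y) - s a) * (s b - max (s x) (s y)) / (s b - s a) else 0)"

text \<open>On an open interval the Radon measures are the Borel measures that are finite on compact
  sets.\<close>

definition speed_measure ::
    "real set \<Rightarrow> (real \<Rightarrow> 'a \<Rightarrow> real) \<Rightarrow> (real \<Rightarrow> 'a measure) \<Rightarrow>
     (real \<Rightarrow> real) \<Rightarrow> real measure \<Rightarrow> bool" where
  "speed_measure J X P s m \<longleftrightarrow>
     sets m = sets (restrict_space borel (interior J)) \<and>
     (\<forall>K. compact K \<and> K \<subseteq> interior J \<longrightarrow> emeasure m K < \<infinity>) \<and>
     (\<forall>a b. a < b \<and> {a..b} \<subseteq> J \<longrightarrow> (\<forall>x\<in>{a<..<b}.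
        (\<integral>\<^sup>+\<omega>. min (hitting_time X a \<omega>) (hitting_time X b \<omega>) \<partial>P x)
        = (\<integral>\<^sup>+y. ennreal (green s a b x y) \<partial>m)))"


section \<open>Boundary classification\<close>

text \<open>The Lebesgue--Stieltjes measure \<open>s(dz)\<close> on \<open>(a, b]\<close>, extended by zero. As \<open>s\<close> is only
  meaningful on the state space, it is frozen outside of \<open>[a, b]\<close> before
  \<^const>\<open>interval_measure\<close> is applied, which is meaningful only for functions that are
  nondecreasing and right-continuous on the whole real line.\<close>

definition stieltjes :: "(real \<Rightarrow> real) \<Rightarrow> real \<Rightarrow> real \<Rightarrow> real measure" where
  "stieltjes s a b = interval_measure (\<lambda>z. s (max a (min b z)))"

definition bdry_u :: "(real \<Rightarrow> real) \<Rightarrow> real measure \<Rightarrow> real \<Rightarrow> real \<Rightarrow> ennreal" where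
  "bdry_u s m c x =
     (if c \<le> x then \<integral>\<^sup>+z\<in>{c<..x}. emeasure m {c<..z} \<partial>stieltjes s c x
      else \<integral>\<^sup>+z\<in>{x<..c}. emeasure m {z<..c} \<partial>stieltjes s x c)"

definition bdry_v :: "(real \<Rightarrow> real) \<Rightarrow> real measure \<Rightarrow> real \<Rightarrow> real \<Rightarrow> ennreal" where
  "bdry_v s m c x =
     (if c \<le> x then \<integral>\<^sup>+y\<in>{c<..x}. ennreal (s y - s c) \<partial>m
      else \<integral>\<^sup>+y\<in>{x<..c}. ennreal (s c - s y) \<partial>m)"

definition boundary :: "real set \<Rightarrow> ereal set" where
  "boundary J = closure (ereal ` J) - ereal ` interior J"

definition boundary_value :: "real set \<Rightarrow> (real \<Rightarrow> ennreal) \<Rightarrow> ereal \<Rightarrow> ennreal" where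
  "boundary_value J f b = Lim (at b within ereal ` interior J) (\<lambda>x. f (real_of_ereal x))"

definition regular_boundary ::
    "real set \<Rightarrow> (real \<Rightarrow> real) \<Rightarrow> real measure \<Rightarrow> real \<Rightarrow> ereal \<Rightarrow> bool" where
  "regular_boundary J s m c b \<longleftrightarrow>
     boundary_value J (bdry_u s m c) b < \<infinity> \<and> boundary_value J (bdry_v s m c) b < \<infinity>"

definition exit_boundary ::
    "real set \<Rightarrow> (real \<Rightarrow> real) \<Rightarrow> real measure \<Rightarrow> real \<Rightarrow> ereal \<Rightarrow> bool" where
  "exit_boundary J s m c b \<longleftrightarrow>
     boundary_value J (bdry_u s m c) b < \<infinity> \<and> boundary_value J (bdry_v s m c) b = \<infinity>"

definition entrance_boundary ::
    "real set \<Rightarrow> (real \<Rightarrow> real) \<Rightarrow> real measure \<Rightarrow> real \<Rightarrow> ereal \<Rightarrow> bool" where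
  "entrance_boundary J s m c b \<longleftrightarrow>
     boundary_value J (bdry_u s m c) b = \<infinity> \<and> boundary_value J (bdry_v s m c) b < \<infinity>"

definition natural_boundary ::
    "real set \<Rightarrow> (real \<Rightarrow> real) \<Rightarrow> real measure \<Rightarrow> real \<Rightarrow> ereal \<Rightarrow> bool" where
  "natural_boundary J s m c b \<longleftrightarrow>
     boundary_value J (bdry_u s m c) b = \<infinity> \<and> boundary_value J (bdry_v s m c) b = \<infinity>"

definition closed_boundary ::
    "real set \<Rightarrow> (real \<Rightarrow> real) \<Rightarrow> real measure \<Rightarrow> real \<Rightarrow> ereal \<Rightarrow> bool" where
  "closed_boundary J s m c b \<longleftrightarrow> regular_boundary J s m c b \<or> exit_boundary J s m c b"

definition open_boundary ::
    "real set \<Rightarrow> (real \<Rightarrow> real) \<Rightarrow> real measure \<Rightarrow> real \<Rightarrow> ereal \<Rightarrow> bool" where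
  "open_boundary J s m c b \<longleftrightarrow> entrance_boundary J s m c b \<or> natural_boundary J s m c b"


section \<open>The diffusion on natural scale, stopped on leaving the interior\<close>

definition stopped_scaled ::
    "real set \<Rightarrow> (real \<Rightarrow> 'a \<Rightarrow> real) \<Rightarrow> (real \<Rightarrow> real) \<Rightarrow> real \<Rightarrow> 'a \<Rightarrow> real" where
  "stopped_scaled J X s t \<omega> =
     s (X (enn2real (min (ennreal t) (entry_time X (- interior J) \<omega>))) \<omega>)"

end

theory Submission
  imports Defs
begin


section \<open>Entry times of continuous paths\<close>

lemma ennreal_eqI_le_real:
  fixes a b :: ennreal
  assumes "\<And>u. 0 \<le> u \<Longrightarrow> a \<le> ennreal u \<longleftrightarrow> b \<le> ennreal u"
  shows "a = b"
proof (rule antisym)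
  show "a \<le> b" by (cases b) (use assms in auto)
  show "b \<le> a" by (cases a) (use assms in auto)
qed

lemma entry_time_empty [simp]: "entry_time X {} \<omega> = \<infinity>"
  by (simp add: entry_time_def)

lemma entry_time_Un: "entry_time X (A \<union> B) \<omega> = min (entry_time X A \<omega>) (entry_time X B \<omega>)"
proof -
  have "{t. 0 \<le> t \<and> X t \<omega> \<in> A \<union> B} = {t. 0 \<le> t \<and> X t \<omega> \<in> A} \<union> {t. 0 \<le> t \<and> X t \<omega> \<in> B}"
    by auto
  then show ?thesis
    by (simp add: entry_time_def image_Un Inf_union_distrib inf_min)
qed

lemma entry_time_insert:
  "entry_time X (insert a A) \<omega> = min (hitting_time X a \<omega>) (entry_time X A \<omega>)"
  using entry_time_Un[of X "{a}" A] by simp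

lemma entry_time_lower: "0 \<le> t \<Longrightarrow> X t \<omega> \<in> A \<Longrightarrow> entry_time X A \<omega> \<le> ennreal t"
  unfolding entry_time_def by (rule Inf_lower) auto

lemma not_in_before_entry_time:
  "ennreal t < entry_time X A \<omega> \<Longrightarrow> 0 \<le> t \<Longrightarrow> X t \<omega> \<notin> A"
  using entry_time_lower[of t X \<omega> A] by (auto simp: not_le)

context diffusion
begin

lemma space_extended [simp]: "space (extended_filtration M F t) = space M"
  by (rule space_F)

lemma space_paths [simp]: "space (path_algebra M X) = space M"
  by (auto simp: path_algebra_def intro!: space_measure_of)

lemma space_Ft [simp]: "0 \<le> t \<Longrightarrow> space (F t) = space M"
  using subalgebra_F by (auto simp: subalgebra_def)

lemma measurable_X [measurable (raw)]: "0 \<le> t \<Longrightarrow> X t \<in> borel_measurable M"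
  using adapted[of t] subalgebra_F[of t] by (rule measurable_from_subalg[rotated])

lemma measurable_X_paths: "0 \<le> t \<Longrightarrow> X t \<in> borel_measurable (path_algebra M X)"
  by (rule measurableI)
    (auto simp: path_algebra_def space_measure_of_conv intro!: sigma_sets.Basic)

lemma subalgebra_paths: "subalgebra M (path_algebra M X)"
proof -
  have "sets (path_algebra M X) \<subseteq> sets M"
    unfolding path_algebra_def
  proof (subst sets_measure_of)
    show "sigma_sets (space M) {X t -` B \<inter> space M |t B. 0 \<le> t \<and> B \<in> sets borel} \<subseteq> sets M"
      by (rule sets.sigma_sets_subset) (use measurable_sets[OF measurable_X] in blast)
  qed auto
  then show ?thesis
    by (simp add: subalgebra_def)
qed

lemma space_P [simp]: "x \<in> J \<Longrightarrow> space (P x) = space M"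
  using sets_P sets_eq_imp_space_eq by blast

lemma measurable_P_iff: "x \<in> J \<Longrightarrow> measurable (P x) N = measurable M N"
  by (rule measurable_cong_sets) (simp_all add: sets_P)

lemma subalgebra_P_paths: "x \<in> J \<Longrightarrow> subalgebra (P x) (path_algebra M X)"
  using subalgebra_paths by (simp add: subalgebra_def sets_P)

lemma measurable_paths_M: "f \<in> measurable (path_algebra M X) N \<Longrightarrow> f \<in> measurable M N"
  by (rule measurable_from_subalg[OF subalgebra_paths])

lemma measurable_paths_P: "x \<in> J \<Longrightarrow> f \<in> measurable (path_algebra M X) N \<Longrightarrow> f \<in> measurable (P x) N"
  by (simp add: measurable_P_iff measurable_paths_M)

lemma sets_paths_P: "x \<in> J \<Longrightarrow> A \<in> sets (path_algebra M X) \<Longrightarrow> A \<in> sets (P x)"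
  using subalgebra_P_paths by (auto simp: subalgebra_def)

text \<open>A continuous path that enters a closed set does so at a first time, so that entering by
  time \<open>u\<close> can be decided from the path on \<open>[0, u]\<close> alone.\<close>

lemma entry_time_le_iff:
  assumes "\<omega> \<in> space M" "closed C" "0 \<le> u"
  shows "entry_time X C \<omega> \<le> ennreal u \<longleftrightarrow> (\<exists>v\<in>{0..u}. X v \<omega> \<in> C)"
proof
  assume "\<exists>v\<in>{0..u}. X v \<omega> \<in> C"
  then obtain v where "v \<in> {0..u}" "X v \<omega> \<in> C" by auto
  then show "entry_time X C \<omega> \<le> ennreal u"
    by (meson atLeastAtMost_iff ennreal_leI entry_time_lower order_trans)
next
  assume le: "entry_time X C \<omega> \<le> ennreal u"
  let ?S = "{t. 0 \<le> t \<and> X t \<omega> \<in> C}"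
  have "?S = {0..} \<inter> (\<lambda>t. X t \<omega>) -` C" by auto
  then have cl: "closed ?S"
    using continuous_on_closed_vimage[of "{0::real..}" "\<lambda>t. X t \<omega>"] continuous_paths[OF assms(1)] assms(2)
    by (simp add: Int_commute)
  have ne: "?S \<noteq> {}"
  proof
    assume "?S = {}"
    then have "entry_time X C \<omega> = \<infinity>" unfolding entry_time_def by (simp only: image_empty) simp
    then show False using le by (simp add: top_unique)
  qed
  have bdd: "bdd_below ?S" by (auto intro!: bdd_belowI[of _ 0])
  have mem: "Inf ?S \<in> ?S"
    using closed_contains_Inf[OF ne bdd cl] .
  have "ennreal (Inf ?S) \<le> entry_time X C \<omega>"
    unfolding entry_time_def by (rule Inf_greatest) (auto intro!: ennreal_leI cInf_lower bdd)
  then have "ennreal (Inf ?S) \<le> ennreal u" using le by order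
  then have "Inf ?S \<le> u" using assms(3) by (simp add: ennreal_le_iff)
  then show "\<exists>v\<in>{0..u}. X v \<omega> \<in> C" using mem by auto
qed

lemma at_entry_time:
  assumes "\<omega> \<in> space M" "closed C" "entry_time X C \<omega> < \<infinity>"
  shows "X (enn2real (entry_time X C \<omega>)) \<omega> \<in> C"
proof -
  obtain u where u: "entry_time X C \<omega> = ennreal u" "0 \<le> u"
    using assms(3) by (cases "entry_time X C \<omega>") auto
  then obtain v where v: "v \<in> {0..u}" "X v \<omega> \<in> C"
    using entry_time_le_iff[OF assms(1,2), of u] by auto
  have "ennreal u \<le> ennreal v"
    using entry_time_lower[of v X \<omega> C] v u by auto
  then have "u = v" using v by (simp add: ennreal_le_iff)
  then show ?thesis using u v by simp
qed

lemma entry_time_shift: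
  assumes \<omega>: "\<omega> \<in> space M" and C: "closed C" and t: "0 \<le> t" "ennreal t \<le> entry_time X C \<omega>"
  shows "entry_time X C \<omega> = ennreal t + entry_time X C (\<theta> t \<omega>)"
proof (rule ennreal_eqI_le_real)
  fix u :: real assume u: "0 \<le> u"
  have \<theta>: "\<theta> t \<omega> \<in> space M" using shift_in_space t \<omega> by auto
  have before: "X v \<omega> \<notin> C" if "0 \<le> v" "v < t" for v
    using not_in_before_entry_time[of v X C \<omega>] that t
    by (meson ennreal_lessI le_less_trans less_le_trans not_in_before_entry_time)
  show "entry_time X C \<omega> \<le> ennreal u \<longleftrightarrow> ennreal t + entry_time X C (\<theta> t \<omega>) \<le> ennreal u"
  proof (cases "t \<le> u")
    case True
    have "ennreal t + entry_time X C (\<theta> t \<omega>) \<le> ennreal u \<longleftrightarrow>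
        entry_time X C (\<theta> t \<omega>) \<le> ennreal (u - t)"
      using True t u
    proof (cases "entry_time X C (\<theta> t \<omega>)")
      case (real r)
      have "ennreal t + ennreal r = ennreal (t + r)"
        using t real by (simp add: ennreal_plus)
      then show ?thesis
        using real True t u by (auto simp: ennreal_le_iff simp del: ennreal_plus)
    qed (simp add: top_unique)
    also have "\<dots> \<longleftrightarrow> (\<exists>v\<in>{0..u - t}. X (v + t) \<omega> \<in> C)"
      using True t \<omega> \<theta> C by (subst entry_time_le_iff) (auto simp: shift)
    also have "\<dots> \<longleftrightarrow> (\<exists>v\<in>{0..u}. X v \<omega> \<in> C)"
    proof
      assume "\<exists>v\<in>{0..u - t}. X (v + t) \<omega> \<in> C"
      then show "\<exists>v\<in>{0..u}. X v \<omega> \<in> C" using t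
        by (metis add_nonneg_nonneg atLeastAtMost_iff le_diff_eq)
    next
      assume "\<exists>v\<in>{0..u}. X v \<omega> \<in> C"
      then obtain v where "v \<in> {0..u}" "X v \<omega> \<in> C" by auto
      moreover from this have "t \<le> v" using before by force
      ultimately show "\<exists>v\<in>{0..u - t}. X (v + t) \<omega> \<in> C"
        by (intro bexI[of _ "v - t"]) auto
    qed
    finally show ?thesis using entry_time_le_iff[OF \<omega> C u] by simp
  next
    case False
    then have "ennreal u < ennreal t" using u by (simp add: ennreal_lessI)
    moreover have "ennreal t \<le> ennreal t + entry_time X C (\<theta> t \<omega>)" by simp
    ultimately show ?thesis using t by (meson leD order_trans)
  qed
qed

lemma entry_time_measurable_upto:
  assumes N: "space N = space M" and X: "\<And>v. 0 \<le> v \<Longrightarrow> v \<le> u \<Longrightarrow> X v \<in> borel_measurable N"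
    and C: "closed C" and u: "0 \<le> u"
  shows "{\<omega>\<in>space M. entry_time X C \<omega> \<le> ennreal u} \<in> sets N"
proof (cases "C = {}")
  case False
  let ?Q = "\<rat> \<inter> {0..u} \<union> {u}"
  have countQ: "countable ?Q" by (auto intro: countable_rat countable_Int1)
  have dense: "{0..u} \<subseteq> closure ?Q"
  proof (cases "u = 0")
    case False
    then have "{0..u} = closure {0<..<u}" using u by simp
    also have "\<dots> = closure ({0<..<u} \<inter> \<rat>)"
      using closure_open_Int_superset[of "{0<..<u}" \<rat>] by (simp add: Rats_closure_real)
    also have "\<dots> \<subseteq> closure ?Q" by (rule closure_mono) auto
    finally show ?thesis .
  qed (auto intro: closure_subset[THEN subsetD])
  \<comment> \<open>A continuous function on \<open>[0, u]\<close> that comes arbitrarily close to \<open>C\<close> meets it.\<close>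
  have eq: "entry_time X C \<omega> \<le> ennreal u \<longleftrightarrow> (\<forall>n. \<exists>q\<in>?Q. infdist (X q \<omega>) C < 1 / Suc n)"
    if \<omega>: "\<omega> \<in> space M" for \<omega>
  proof -
    let ?d = "\<lambda>v. infdist (X v \<omega>) C"
    have cont: "continuous_on {0..u} ?d"
      by (intro continuous_intros continuous_on_subset[OF continuous_paths[OF \<omega>]]) auto
    show ?thesis
    proof
      assume "entry_time X C \<omega> \<le> ennreal u"
      then obtain v where v: "v \<in> {0..u}" "X v \<omega> \<in> C"
        using entry_time_le_iff[OF \<omega> C u] by auto
      show "\<forall>n. \<exists>q\<in>?Q. infdist (X q \<omega>) C < 1 / Suc n"
      proof
        fix n
        obtain \<delta> where \<delta>: "\<delta> > 0" "\<And>w. w \<in> {0..u} \<Longrightarrow> dist w v < \<delta> \<Longrightarrow> dist (?d w) (?d v) < 1 / Suc n"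
          using cont[unfolded continuous_on_iff] v(1)
          by (metis divide_pos_pos of_nat_0_less_iff zero_less_Suc zero_less_one)
        obtain q where q: "q \<in> ?Q" "dist q v < \<delta>"
          using dense v(1) \<delta>(1) closure_approachable by (metis subsetD)
        then have "q \<in> {0..u}" using u by auto
        then have "?d q < 1 / Suc n" using \<delta>(2)[of q] q v(2) by (auto simp: dist_real_def)
        then show "\<exists>q\<in>?Q. infdist (X q \<omega>) C < 1 / Suc n" using q by blast
      qed
    next
      assume *: "\<forall>n. \<exists>q\<in>?Q. infdist (X q \<omega>) C < 1 / Suc n"
      obtain v where v: "v \<in> {0..u}" "\<And>w. w \<in> {0..u} \<Longrightarrow> ?d v \<le> ?d w"
        using continuous_attains_inf[OF _ _ cont] u by auto
      have "?d v \<le> 0"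
      proof (rule ccontr)
        assume "\<not> ?d v \<le> 0"
        then obtain n where "1 / Suc n < ?d v"
          by (metis not_le nat_approx_posE)
        moreover obtain q where "q \<in> ?Q" "?d q < 1 / Suc n" using * by blast
        moreover from this have "?d v \<le> ?d q" using u by (intro v) auto
        ultimately show False by linarith
      qed
      then have "?d v = 0" using infdist_nonneg[of "X v \<omega>" C] by linarith
      then have "X v \<omega> \<in> C"
        using in_closed_iff_infdist_zero[OF C False] by simp
      then show "entry_time X C \<omega> \<le> ennreal u"
        using entry_time_le_iff[OF \<omega> C u] v by auto
    qed
  qed
  have X': "(\<lambda>\<omega>. X q \<omega>) \<in> borel_measurable N" if "q \<in> ?Q" for q
    using X that u by auto
  have cnt: "countable ?Q" by (rule countQ)
  have "Measurable.pred N (\<lambda>\<omega>. \<forall>n::nat. \<exists>q\<in>?Q. infdist (X q \<omega>) C < 1 / Suc n)"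
  proof (intro pred_intros_countable(1) measurable_pred_countable(2) cnt)
    fix n q assume "q \<in> ?Q"
    have "(\<lambda>\<omega>. infdist (X q \<omega>) C) \<in> borel_measurable N"
      by (rule borel_measurable_continuous_on[OF _ X'[OF \<open>q \<in> ?Q\<close>]]) (auto intro!: continuous_intros)
    then show "Measurable.pred N (\<lambda>\<omega>. infdist (X q \<omega>) C < 1 / Suc n)" by measurable
  qed
  then have "{\<omega>\<in>space N. \<forall>n. \<exists>q\<in>?Q. infdist (X q \<omega>) C < 1 / Suc n} \<in> sets N"
    by (simp add: pred_def)
  also have "{\<omega>\<in>space N. \<forall>n. \<exists>q\<in>?Q. infdist (X q \<omega>) C < 1 / Suc n} = {\<omega>\<in>space M. entry_time X C \<omega> \<le> ennreal u}"
    by (rule Collect_cong) (use eq N in blast)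
  finally show ?thesis .
next
  case True
  have "{\<omega>\<in>space M. entry_time X C \<omega> \<le> ennreal u} = {}"
    unfolding True entry_time_empty by (auto simp: top_unique)
  then show ?thesis by (simp only: sets.empty_sets)
qed

lemma measurable_entry_time_paths [measurable]:
  assumes C: "closed C"
  shows "entry_time X C \<in> borel_measurable (path_algebra M X)"
proof (rule borel_measurableI_le)
  fix y :: ennreal
  show "{\<omega> \<in> space (path_algebra M X). entry_time X C \<omega> \<le> y} \<in> sets (path_algebra M X)"
  proof (cases y)
    case (real u)
    have "{\<omega> \<in> space M. entry_time X C \<omega> \<le> ennreal u} \<in> sets (path_algebra M X)"
      by (rule entry_time_measurable_upto[OF space_paths measurable_X_paths C real(1)])
    then show ?thesis using real by simp
  next
    case top
    then show ?thesis using sets.top[of "path_algebra M X"] by simp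
  qed
qed

lemma stopping_time_entry_time:
  assumes C: "closed C"
  shows "stopping_time (extended_filtration M F) (entry_time X C)"
proof (rule stopping_timeI, unfold pred_def)
  fix t :: ennreal
  show "{\<omega> \<in> space (extended_filtration M F t). entry_time X C \<omega> \<le> t} \<in> sets (extended_filtration M F t)"
  proof (cases t)
    case (real u)
    have "X v \<in> borel_measurable (F u)" if "0 \<le> v" "v \<le> u" for v
    proof (rule measurable_from_subalg)
      show "subalgebra (F u) (F v)"
        unfolding subalgebra_def using that F_mono[of v u] by simp
      show "X v \<in> borel_measurable (F v)" by (rule adapted) fact
    qed
    then show ?thesis
      using entry_time_measurable_upto[of "F u" u C] C real by (simp add: extended_filtration_def)
  next
    case top
    then show ?thesis using sets.top[of M] by (simp add: extended_filtration_def)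
  qed
qed

lemma measurable_at_random_time:
  assumes N: "space N = space M" and Z [measurable]: "Z \<in> borel_measurable N"
    and Z0: "\<And>\<omega>. \<omega> \<in> space M \<Longrightarrow> 0 \<le> Z \<omega>"
    and X: "\<And>u \<omega>. \<omega> \<in> space M \<Longrightarrow> 0 \<le> u \<Longrightarrow> u \<le> Z \<omega> \<Longrightarrow> X u \<in> borel_measurable N"
  shows "(\<lambda>\<omega>. X (Z \<omega>) \<omega>) \<in> borel_measurable N"
proof (rule borel_measurable_LIMSEQ_real)
  \<comment> \<open>Rounding down to the grid of mesh \<open>1 / (n + 1)\<close> looks only at times before \<open>Z\<close>.\<close>
  let ?k = "\<lambda>n \<omega>. nat \<lfloor>Z \<omega> * Suc n\<rfloor>"
  let ?Y = "\<lambda>n i \<omega>. if X (real i / Suc n) \<in> borel_measurable N then X (real i / Suc n) \<omega> else 0"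
  have le: "real (?k n \<omega>) / Suc n \<le> Z \<omega>" "Z \<omega> - 1 / Suc n \<le> real (?k n \<omega>) / Suc n"
    if "\<omega> \<in> space M" for n \<omega>
  proof -
    have "0 \<le> Z \<omega> * Suc n" using Z0[OF that] by simp
    then have "real (?k n \<omega>) = of_int \<lfloor>Z \<omega> * Suc n\<rfloor>" by simp
    then show "real (?k n \<omega>) / Suc n \<le> Z \<omega>" "Z \<omega> - 1 / Suc n \<le> real (?k n \<omega>) / Suc n"
      by (simp_all only:, simp_all add: divide_simps)
  qed
  show "(\<lambda>n. ?Y n (?k n \<omega>) \<omega>) \<longlonglongrightarrow> X (Z \<omega>) \<omega>" if "\<omega> \<in> space N" for \<omega>
  proof -
    have \<omega>: "\<omega> \<in> space M" using that N by simp
    have "?Y n (?k n \<omega>) \<omega> = X (real (?k n \<omega>) / Suc n) \<omega>" for n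
      using X[OF \<omega> _ le(1)[OF \<omega>]] by simp
    moreover have "(\<lambda>n. real (?k n \<omega>) / Suc n) \<longlonglongrightarrow> Z \<omega>"
    proof (rule tendsto_sandwich[OF _ _ _ tendsto_const])
      show "(\<lambda>n. Z \<omega> - 1 / Suc n) \<longlonglongrightarrow> Z \<omega>"
        using tendsto_diff[OF tendsto_const LIMSEQ_inverse_real_of_nat, of "Z \<omega>"]
        by (simp add: inverse_eq_divide)
    qed (use le[OF \<omega>] in auto)
    then have "(\<lambda>n. X (real (?k n \<omega>) / Suc n) \<omega>) \<longlonglongrightarrow> X (Z \<omega>) \<omega>"
      by (rule continuous_on_tendsto_compose[OF continuous_paths[OF \<omega>]]) (use Z0[OF \<omega>] in auto)
    ultimately show ?thesis by simp
  qed
  show "(\<lambda>\<omega>. ?Y n (?k n \<omega>) \<omega>) \<in> borel_measurable N" for n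
  proof (rule measurable_compose_countable[where f="\<lambda>i. ?Y n i" and g="?k n"])
    show "?Y n i \<in> borel_measurable N" for i
      by (cases "X (real i / Suc n) \<in> borel_measurable N") simp_all
    show "?k n \<in> measurable N (count_space UNIV)"
      by measurable
  qed
qed

end

section \<open>The strong Markov property for functionals\<close>

context diffusion
begin

lemma subalgebra_pre_sigma:
  assumes "stopping_time (extended_filtration M F) T" "x \<in> J"
  shows "subalgebra (P x) (pre_sigma T)"
proof -
  have "A \<in> sets M" if "A \<in> sets (pre_sigma T)" for A
    using sets_pre_sigmaD[OF assms(1) that, of \<infinity>] by (simp add: extended_filtration_def)
  then show ?thesis
    using assms(2) by (auto simp: subalgebra_def space_pre_sigma sets_P)
qed

lemma measurable_stopping_time_M:
  assumes "stopping_time (extended_filtration M F) T"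
  shows "T \<in> borel_measurable M"
  by (rule measurable_stopping_time[OF assms])
    (use sets_F_mono[of _ \<infinity>] in \<open>auto simp: extended_filtration_def\<close>)

lemma X_in_J: "0 \<le> t \<Longrightarrow> \<omega> \<in> space M \<Longrightarrow> X t \<omega> \<in> J"
  by (rule in_state_space)

lemma measurable_X_at [measurable (raw)]:
  assumes [measurable]: "T \<in> borel_measurable M"
  shows "(\<lambda>\<omega>. X (enn2real (T \<omega>)) \<omega>) \<in> borel_measurable M"
  by (rule measurable_at_random_time) (auto intro: measurable_X)

lemma measurable_shift_at:
  assumes [measurable]: "T \<in> borel_measurable M"
  shows "(\<lambda>\<omega>. \<theta> (enn2real (T \<omega>)) \<omega>) \<in> measurable M (path_algebra M X)"
  unfolding path_algebra_def
proof (rule measurable_measure_of)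
  show "(\<lambda>\<omega>. \<theta> (enn2real (T \<omega>)) \<omega>) \<in> space M \<rightarrow> space M"
    using shift_in_space by auto
  fix A assume "A \<in> {X t -` B \<inter> space M |t B. 0 \<le> t \<and> B \<in> sets borel}"
  then obtain t B where A: "A = X t -` B \<inter> space M" "0 \<le> t" and B [measurable]: "B \<in> sets borel"
    by auto
  have "(\<lambda>\<omega>. X (t + enn2real (T \<omega>)) \<omega>) \<in> borel_measurable M"
    by (rule measurable_at_random_time) (use A in \<open>auto intro: measurable_X\<close>)
  then have "(\<lambda>\<omega>. X (t + enn2real (T \<omega>)) \<omega>) -` B \<inter> space M \<in> sets M"
    by measurable
  also have "(\<lambda>\<omega>. X (t + enn2real (T \<omega>)) \<omega>) -` B \<inter> space M =
      (\<lambda>\<omega>. \<theta> (enn2real (T \<omega>)) \<omega>) -` A \<inter> space M"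
    using A shift_in_space by (auto simp: shift)
  finally show "(\<lambda>\<omega>. \<theta> (enn2real (T \<omega>)) \<omega>) -` A \<inter> space M \<in> sets M" .
qed auto

lemma measurable_kernel:
  assumes "f \<in> borel_measurable (path_algebra M X)"
  shows "(\<lambda>x. \<integral>\<^sup>+\<omega>. f \<omega> \<partial>P x) \<in> borel_measurable (restrict_space borel J)"
  using assms
proof (induction rule: borel_measurable_induct)
  case (cong f g)
  moreover have "(\<integral>\<^sup>+\<omega>. f \<omega> \<partial>P x) = (\<integral>\<^sup>+\<omega>. g \<omega> \<partial>P x)" if "x \<in> J" for x
    using cong(3) that by (intro nn_integral_cong) auto
  ultimately show ?case
    using measurable_cong[of "restrict_space borel J" "\<lambda>x. \<integral>\<^sup>+\<omega>. f \<omega> \<partial>P x" "\<lambda>x. \<integral>\<^sup>+\<omega>. g \<omega> \<partial>P x"]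
    by (simp add: space_restrict_space)
next
  case (set A)
  have "(\<integral>\<^sup>+\<omega>. indicator A \<omega> \<partial>P x) = ennreal (measure (P x) A)" if "x \<in> J" for x
  proof -
    interpret prob_space "P x" using prob that .
    show ?thesis using sets_paths_P[OF that set] by (simp add: emeasure_eq_measure)
  qed
  then show ?case
    using kernel[OF set]
    by (subst measurable_cong[where g="\<lambda>x. ennreal (measure (P x) A)"]) (auto simp: space_restrict_space)
next
  case (mult u c)
  then have "(\<integral>\<^sup>+\<omega>. c * u \<omega> \<partial>P x) = c * (\<integral>\<^sup>+\<omega>. u \<omega> \<partial>P x)" if "x \<in> J" for x
    using that by (intro nn_integral_cmult measurable_paths_P)
  then show ?case
    using mult by (subst measurable_cong[where g="\<lambda>x. c * (\<integral>\<^sup>+\<omega>. u \<omega> \<partial>P x)"])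
      (auto simp: space_restrict_space)
next
  case (add u v)
  then have "(\<integral>\<^sup>+\<omega>. v \<omega> + u \<omega> \<partial>P x) = (\<integral>\<^sup>+\<omega>. v \<omega> \<partial>P x) + (\<integral>\<^sup>+\<omega>. u \<omega> \<partial>P x)" if "x \<in> J" for x
    using that by (intro nn_integral_add measurable_paths_P)
  then show ?case
    using add by (subst measurable_cong[where g="\<lambda>x. (\<integral>\<^sup>+\<omega>. v \<omega> \<partial>P x) + (\<integral>\<^sup>+\<omega>. u \<omega> \<partial>P x)"])
      (auto simp: space_restrict_space)
next
  case (seq U)
  then have "integral\<^sup>N (P x) (SUP i. U i) = (SUP i. \<integral>\<^sup>+\<omega>. U i \<omega> \<partial>P x)" if "x \<in> J" for x
    using that nn_integral_monotone_convergence_SUP[OF seq(3) measurable_paths_P[OF that seq(1)]]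
    by (simp add: SUP_apply[abs_def] image_comp)
  then show ?case
    using seq by (subst measurable_cong[where g="\<lambda>x. SUP i. \<integral>\<^sup>+\<omega>. U i \<omega> \<partial>P x"])
      (auto simp: space_restrict_space)
qed

lemma measurable_kernel_at:
  assumes "f \<in> borel_measurable (path_algebra M X)" "T \<in> borel_measurable M"
  shows "(\<lambda>\<omega>. \<integral>\<^sup>+\<omega>'. f \<omega>' \<partial>P (X (enn2real (T \<omega>)) \<omega>)) \<in> borel_measurable M"
  by (rule measurable_compose[OF _ measurable_kernel[OF assms(1)]])
    (auto intro!: measurable_restrict_space2 measurable_X_at assms X_in_J)

lemma strong_markov_sets:
  assumes x: "x \<in> J" and T: "stopping_time (extended_filtration M F) T"
    and A: "A \<in> sets (pre_sigma T)" "\<And>\<omega>. \<omega> \<in> A \<Longrightarrow> T \<omega> < \<infinity>" and B: "B \<in> sets (path_algebra M X)"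
  shows "(\<integral>\<^sup>+\<omega>. indicator A \<omega> * indicator B (\<theta> (enn2real (T \<omega>)) \<omega>) \<partial>P x)
    = (\<integral>\<^sup>+\<omega>. indicator A \<omega> * emeasure (P (X (enn2real (T \<omega>)) \<omega>)) B \<partial>P x)"
proof -
  interpret prob_space "P x" using prob x .
  note sub = subalgebra_pre_sigma[OF T x]
  interpret finite_measure_subalgebra "P x" "pre_sigma T"
    by unfold_locales (rule sub)
  have T_M [measurable]: "T \<in> borel_measurable M" by (rule measurable_stopping_time_M[OF T])
  have A_P [measurable]: "A \<in> sets (P x)" using A(1) sub by (auto simp: subalgebra_def)
  have shiftM: "(\<lambda>\<omega>. \<theta> (enn2real (T \<omega>)) \<omega>) \<in> measurable M (path_algebra M X)"
    by (rule measurable_shift_at) fact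
  define C where "C = {\<omega> \<in> space M. T \<omega> < \<infinity> \<and> \<theta> (enn2real (T \<omega>)) \<omega> \<in> B}"
  have "C = {\<omega>\<in>space M. T \<omega> < \<infinity>} \<inter> ((\<lambda>\<omega>. \<theta> (enn2real (T \<omega>)) \<omega>) -` B \<inter> space M)"
    by (auto simp: C_def)
  also have "\<dots> \<in> sets M"
    using measurable_sets[OF shiftM B] by measurable
  finally have C_P: "C \<in> sets (P x)" using x by (simp add: sets_P)
  let ?h = "\<lambda>\<omega>. measure (P (X (enn2real (T \<omega>)) \<omega>)) B"
  have h_eq: "emeasure (P (X (enn2real (T \<omega>)) \<omega>)) B = ennreal (?h \<omega>)" if "\<omega> \<in> space M" for \<omega>
  proof -
    interpret Q: prob_space "P (X (enn2real (T \<omega>)) \<omega>)" using prob X_in_J[OF _ that] by simp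
    show ?thesis by (rule Q.emeasure_eq_measure)
  qed
  have h_le: "?h \<omega> \<le> 1" if "\<omega> \<in> space M" for \<omega>
  proof -
    interpret Q: prob_space "P (X (enn2real (T \<omega>)) \<omega>)" using prob X_in_J[OF _ that] by simp
    show ?thesis by (rule Q.prob_le_1)
  qed
  have h_M: "?h \<in> borel_measurable (P x)"
    unfolding measurable_P_iff[OF x]
    by (rule measurable_compose[OF _ kernel[OF B]])
      (auto intro!: measurable_restrict_space2 measurable_X_at X_in_J)
  have int: "integrable (P x) (\<lambda>\<omega>. indicator A \<omega> * ?h \<omega>)"
    by (rule integrable_const_bound[where B=1])
      (use h_M h_le x in \<open>auto simp: indicator_def intro!: borel_measurable_times\<close>)
  have "(\<integral>\<omega>\<in>A. indicator C \<omega> \<partial>P x) =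
      (\<integral>\<omega>\<in>A. real_cond_exp (P x) (pre_sigma T) (indicator C) \<omega> \<partial>P x)"
    by (rule real_cond_exp_intA) (use C_P A in \<open>auto intro!: integrable_const_bound[where B=1]\<close>)
  also have "\<dots> = (\<integral>\<omega>\<in>A. ?h \<omega> \<partial>P x)"
    unfolding set_lebesgue_integral_def
  proof (rule integral_cong_AE)
    show "AE \<omega> in P x. indicator A \<omega> *\<^sub>R real_cond_exp (P x) (pre_sigma T) (indicator C) \<omega> =
        indicator A \<omega> *\<^sub>R ?h \<omega>"
      using strong_markov[OF x T B]
      by eventually_elim (use A(2) in \<open>auto simp: C_def indicator_def\<close>)
  qed (use h_M in \<open>auto intro!: borel_measurable_times borel_measurable_scaleR\<close>)
  finally have *: "measure (P x) (A \<inter> C) = (\<integral>\<omega>. indicator A \<omega> * ?h \<omega> \<partial>P x)"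
    using C_P by (simp add: set_lebesgue_integral_def indicator_inter_arith[symmetric] Int_commute)
  have "(\<integral>\<^sup>+\<omega>. indicator A \<omega> * indicator B (\<theta> (enn2real (T \<omega>)) \<omega>) \<partial>P x) =
      (\<integral>\<^sup>+\<omega>. indicator (A \<inter> C) \<omega> \<partial>P x)"
    by (rule nn_integral_cong) (use A(2) x in \<open>auto simp: C_def indicator_def\<close>)
  also have "\<dots> = ennreal (\<integral>\<omega>. indicator A \<omega> * ?h \<omega> \<partial>P x)"
    using C_P by (simp add: emeasure_eq_measure *)
  also have "\<dots> = (\<integral>\<^sup>+\<omega>. ennreal (indicator A \<omega> * ?h \<omega>) \<partial>P x)"
    by (rule nn_integral_eq_integral[symmetric, OF int]) auto
  also have "\<dots> = (\<integral>\<^sup>+\<omega>. indicator A \<omega> * emeasure (P (X (enn2real (T \<omega>)) \<omega>)) B \<partial>P x)"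
    by (rule nn_integral_cong) (use x h_eq in \<open>auto simp: indicator_def\<close>)
  finally show ?thesis .
qed

theorem strong_markov_nn:
  assumes x: "x \<in> J" and T: "stopping_time (extended_filtration M F) T"
    and g: "g \<in> borel_measurable (pre_sigma T)" and g0: "\<And>\<omega>. \<omega> \<in> space M \<Longrightarrow> T \<omega> = \<infinity> \<Longrightarrow> g \<omega> = 0"
    and f: "f \<in> borel_measurable (path_algebra M X)"
  shows "(\<integral>\<^sup>+\<omega>. g \<omega> * f (\<theta> (enn2real (T \<omega>)) \<omega>) \<partial>P x)
    = (\<integral>\<^sup>+\<omega>. g \<omega> * (\<integral>\<^sup>+\<omega>'. f \<omega>' \<partial>P (X (enn2real (T \<omega>)) \<omega>)) \<partial>P x)"
proof -
  let ?T = "\<lambda>\<omega>. enn2real (T \<omega>)"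
  note sub = subalgebra_pre_sigma[OF T x]
  have T_M: "T \<in> borel_measurable M" by (rule measurable_stopping_time_M[OF T])
  have shiftP: "(\<lambda>\<omega>. f (\<theta> (?T \<omega>) \<omega>)) \<in> borel_measurable (P x)" if "f \<in> borel_measurable (path_algebra M X)" for f :: "'a \<Rightarrow> ennreal"
    using measurable_compose[OF measurable_shift_at[OF T_M] that] by (simp add: measurable_P_iff x)
  have kerP: "(\<lambda>\<omega>. \<integral>\<^sup>+\<omega>'. f \<omega>' \<partial>P (X (?T \<omega>) \<omega>)) \<in> borel_measurable (P x)" if "f \<in> borel_measurable (path_algebra M X)" for f
    using measurable_kernel_at[OF that T_M] by (simp add: measurable_P_iff x)
  have X_J: "X (?T \<omega>) \<omega> \<in> J" if "\<omega> \<in> space (P x)" for \<omega>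
    using X_in_J[of "?T \<omega>" \<omega>] that x by simp
  define D where "D = {\<omega>\<in>space M. T \<omega> < \<infinity>}"
  have D: "D \<in> sets (pre_sigma T)"
  proof -
    have [measurable]: "T \<in> borel_measurable (pre_sigma T)"
      by (rule measurable_stopping_time_pre_sigma[OF T])
    have "{\<omega>\<in>space (pre_sigma T). T \<omega> < \<infinity>} \<in> sets (pre_sigma T)" by measurable
    then show ?thesis by (simp add: D_def space_pre_sigma)
  qed
  have ind: "(\<integral>\<^sup>+\<omega>. indicator (A \<inter> D) \<omega> * f (\<theta> (?T \<omega>) \<omega>) \<partial>P x)
      = (\<integral>\<^sup>+\<omega>. indicator (A \<inter> D) \<omega> * (\<integral>\<^sup>+\<omega>'. f \<omega>' \<partial>P (X (?T \<omega>) \<omega>)) \<partial>P x)"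
    if A: "A \<in> sets (pre_sigma T)" for A
  proof -
  have "A \<inter> D \<in> sets (pre_sigma T)" using A D by (rule sets.Int)
  then have AD: "A \<inter> D \<in> sets (P x)" using sub unfolding subalgebra_def by (rule subsetD[rotated, OF _ conjunct2])
  have m: "(\<lambda>\<omega>. indicator (A \<inter> D) \<omega> * h \<omega>) \<in> borel_measurable (P x)"
      if "h \<in> borel_measurable (P x)" for h :: "'a \<Rightarrow> ennreal"
    by (intro borel_measurable_times_ennreal that borel_measurable_indicator AD)
  show ?thesis using f
  proof (induction rule: borel_measurable_induct)
    case (cong f g)
    have "(\<integral>\<^sup>+\<omega>. indicator (A \<inter> D) \<omega> * f (\<theta> (?T \<omega>) \<omega>) \<partial>P x) =
        (\<integral>\<^sup>+\<omega>. indicator (A \<inter> D) \<omega> * g (\<theta> (?T \<omega>) \<omega>) \<partial>P x)"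
      by (rule nn_integral_cong) (use cong(3) shift_in_space x in auto)
    moreover have "(\<integral>\<^sup>+\<omega>'. f \<omega>' \<partial>P (X (?T \<omega>) \<omega>)) = (\<integral>\<^sup>+\<omega>'. g \<omega>' \<partial>P (X (?T \<omega>) \<omega>))"
      if "\<omega> \<in> space (P x)" for \<omega>
      by (rule nn_integral_cong) (use cong(3) X_J[OF that] in auto)
    ultimately show ?case
      using cong(4) by (simp cong: nn_integral_cong)
  next
    case (set B)
    have "A \<inter> D \<in> sets (pre_sigma T)" using A D by auto
    from strong_markov_sets[OF x T this _ set]
    have "(\<integral>\<^sup>+\<omega>. indicator (A \<inter> D) \<omega> * indicator B (\<theta> (?T \<omega>) \<omega>) \<partial>P x)
       = (\<integral>\<^sup>+\<omega>. indicator (A \<inter> D) \<omega> * emeasure (P (X (?T \<omega>) \<omega>)) B \<partial>P x)"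
      by (auto simp: D_def)
    also have "\<dots> = (\<integral>\<^sup>+\<omega>. indicator (A \<inter> D) \<omega> * (\<integral>\<^sup>+\<omega>'. indicator B \<omega>' \<partial>P (X (?T \<omega>) \<omega>)) \<partial>P x)"
      using set by (intro nn_integral_cong) (simp add: sets_paths_P X_J)
    finally show ?case .
  next
    case (mult u c)
    have "(\<integral>\<^sup>+\<omega>. indicator (A \<inter> D) \<omega> * (c * u (\<theta> (?T \<omega>) \<omega>)) \<partial>P x) =
       c * (\<integral>\<^sup>+\<omega>. indicator (A \<inter> D) \<omega> * u (\<theta> (?T \<omega>) \<omega>) \<partial>P x)"
      by (subst nn_integral_cmult[symmetric]) (simp_all add: m[OF shiftP[OF mult(2)]] ac_simps)
    also have "\<dots> = (\<integral>\<^sup>+\<omega>. c * (indicator (A \<inter> D) \<omega> * (\<integral>\<^sup>+\<omega>'. u \<omega>' \<partial>P (X (?T \<omega>) \<omega>))) \<partial>P x)"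
      unfolding mult.IH
      by (subst nn_integral_cmult) (simp_all add: m[OF kerP[OF mult(2)]])
    also have "\<dots> = (\<integral>\<^sup>+\<omega>. indicator (A \<inter> D) \<omega> * (\<integral>\<^sup>+\<omega>'. c * u \<omega>' \<partial>P (X (?T \<omega>) \<omega>)) \<partial>P x)"
      using mult(2) X_J by (intro nn_integral_cong) (simp add: nn_integral_cmult measurable_paths_P ac_simps)
    finally show ?case .
  next
    case (add u v)
    have "(\<integral>\<^sup>+\<omega>. indicator (A \<inter> D) \<omega> * (v (\<theta> (?T \<omega>) \<omega>) + u (\<theta> (?T \<omega>) \<omega>)) \<partial>P x) =
       (\<integral>\<^sup>+\<omega>. indicator (A \<inter> D) \<omega> * v (\<theta> (?T \<omega>) \<omega>) \<partial>P x) + (\<integral>\<^sup>+\<omega>. indicator (A \<inter> D) \<omega> * u (\<theta> (?T \<omega>) \<omega>) \<partial>P x)"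
      unfolding distrib_left by (intro nn_integral_add m shiftP add)
    also have "\<dots> = (\<integral>\<^sup>+\<omega>. indicator (A \<inter> D) \<omega> * (\<integral>\<^sup>+\<omega>'. v \<omega>' \<partial>P (X (?T \<omega>) \<omega>)) +
        indicator (A \<inter> D) \<omega> * (\<integral>\<^sup>+\<omega>'. u \<omega>' \<partial>P (X (?T \<omega>) \<omega>)) \<partial>P x)"
      unfolding add.IH by (intro nn_integral_add[symmetric] m kerP add)
    also have "\<dots> = (\<integral>\<^sup>+\<omega>. indicator (A \<inter> D) \<omega> * (\<integral>\<^sup>+\<omega>'. v \<omega>' + u \<omega>' \<partial>P (X (?T \<omega>) \<omega>)) \<partial>P x)"
      using add(1,3) X_J by (intro nn_integral_cong) (simp add: nn_integral_add measurable_paths_P distrib_left)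
    finally show ?case .
  next
    case (seq U)
    have mono: "mono U" by (rule seq)
    have "(\<integral>\<^sup>+\<omega>. indicator (A \<inter> D) \<omega> * (SUP i. U i) (\<theta> (?T \<omega>) \<omega>) \<partial>P x) =
       (\<integral>\<^sup>+\<omega>. (SUP i. indicator (A \<inter> D) \<omega> * U i (\<theta> (?T \<omega>) \<omega>)) \<partial>P x)"
      by (simp add: SUP_mult_left_ennreal image_comp)
    also have "\<dots> = (SUP i. \<integral>\<^sup>+\<omega>. indicator (A \<inter> D) \<omega> * U i (\<theta> (?T \<omega>) \<omega>) \<partial>P x)"
      using mono by (intro nn_integral_monotone_convergence_SUP m shiftP seq)
        (auto simp: mono_def le_fun_def intro!: mult_left_mono)
    also have "\<dots> = (SUP i. \<integral>\<^sup>+\<omega>. indicator (A \<inter> D) \<omega> * (\<integral>\<^sup>+\<omega>'. U i \<omega>' \<partial>P (X (?T \<omega>) \<omega>)) \<partial>P x)"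
      by (simp add: seq.IH)
    also have "\<dots> = (\<integral>\<^sup>+\<omega>. (SUP i. indicator (A \<inter> D) \<omega> * (\<integral>\<^sup>+\<omega>'. U i \<omega>' \<partial>P (X (?T \<omega>) \<omega>))) \<partial>P x)"
      using mono by (intro nn_integral_monotone_convergence_SUP[symmetric] m kerP seq)
        (auto simp: mono_def le_fun_def intro!: mult_left_mono nn_integral_mono)
    also have "\<dots> = (\<integral>\<^sup>+\<omega>. indicator (A \<inter> D) \<omega> * (\<integral>\<^sup>+\<omega>'. (SUP i. U i) \<omega>' \<partial>P (X (?T \<omega>) \<omega>)) \<partial>P x)"
    proof (rule nn_integral_cong)
      fix \<omega> assume "\<omega> \<in> space (P x)"
      then have "(\<integral>\<^sup>+\<omega>'. (SUP i. U i) \<omega>' \<partial>P (X (?T \<omega>) \<omega>)) = (SUP i. \<integral>\<^sup>+\<omega>'. U i \<omega>' \<partial>P (X (?T \<omega>) \<omega>))"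
        unfolding SUP_apply
        by (intro nn_integral_monotone_convergence_SUP measurable_paths_P seq X_J)
      then show "(SUP i. indicator (A \<inter> D) \<omega> * (\<integral>\<^sup>+\<omega>'. U i \<omega>' \<partial>P (X (?T \<omega>) \<omega>))) =
          indicator (A \<inter> D) \<omega> * (\<integral>\<^sup>+\<omega>'. (SUP i. U i) \<omega>' \<partial>P (X (?T \<omega>) \<omega>))"
        by (simp add: SUP_mult_left_ennreal)
    qed
    finally show ?case .
  qed
  qed
  have mP: "h \<in> borel_measurable (P x)" if "h \<in> borel_measurable (pre_sigma T)" for h :: "'a \<Rightarrow> ennreal"
    by (rule measurable_from_subalg[OF sub that])
  have DP: "D \<in> sets (P x)" using D sub by (auto simp: subalgebra_def)
  let ?u = "\<lambda>\<omega>. indicator D \<omega> * f (\<theta> (?T \<omega>) \<omega>)"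
  let ?v = "\<lambda>\<omega>. indicator D \<omega> * (\<integral>\<^sup>+\<omega>'. f \<omega>' \<partial>P (X (?T \<omega>) \<omega>))"
  have mu: "?u \<in> borel_measurable (P x)" and mv: "?v \<in> borel_measurable (P x)"
    using DP by (auto intro!: borel_measurable_times_ennreal shiftP kerP f)
  have main: "(\<integral>\<^sup>+\<omega>. g \<omega> * ?u \<omega> \<partial>P x) = (\<integral>\<^sup>+\<omega>. g \<omega> * ?v \<omega> \<partial>P x)"
    using g
  proof (induction rule: borel_measurable_induct)
    case (cong f g)
    then show ?case
      using x by (simp add: space_pre_sigma cong: nn_integral_cong_simp)
  next
    case (set A)
    show ?case using ind[OF set] by (simp add: indicator_inter_arith mult.assoc)
  next
    case (mult h c)
    show ?case
      using mult(4) by (simp add: mult.assoc nn_integral_cmult borel_measurable_times_ennreal mP[OF mult(2)] mu mv)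
  next
    case (add h k)
    show ?case
      using add.IH by (simp add: distrib_right nn_integral_add borel_measurable_times_ennreal mP add mu mv)
  next
    case (seq U)
    have *: "(\<integral>\<^sup>+\<omega>. (SUP i. U i) \<omega> * h \<omega> \<partial>P x) = (SUP i. \<integral>\<^sup>+\<omega>. U i \<omega> * h \<omega> \<partial>P x)"
      if h: "h \<in> borel_measurable (P x)" for h
    proof -
      have "(\<integral>\<^sup>+\<omega>. (SUP i. U i) \<omega> * h \<omega> \<partial>P x) = (\<integral>\<^sup>+\<omega>. (SUP i. U i \<omega> * h \<omega>) \<partial>P x)"
        by (simp add: SUP_mult_right_ennreal image_comp)
      also have "\<dots> = (SUP i. \<integral>\<^sup>+\<omega>. U i \<omega> * h \<omega> \<partial>P x)"
        using seq(3) by (intro nn_integral_monotone_convergence_SUP borel_measurable_times_ennreal mP seq h)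
         (auto simp: mono_def le_fun_def intro!: mult_right_mono)
      finally show ?thesis .
    qed
    show ?case unfolding *[OF mu] *[OF mv] seq.IH ..
  qed
  have gD: "g \<omega> * indicator D \<omega> = g \<omega>" if "\<omega> \<in> space M" for \<omega>
    using g0[OF that] that by (cases "T \<omega> = \<infinity>") (auto simp: D_def indicator_def less_top)
  show ?thesis
    using main x by (simp add: mult.assoc[symmetric] gD cong: nn_integral_cong_simp)
qed

lemma strong_markov_hitting:
  assumes "x \<in> J" "y \<in> J" and g: "g \<in> borel_measurable (pre_sigma (hitting_time X y))"
    and g0: "\<And>\<omega>. \<omega> \<in> space M \<Longrightarrow> hitting_time X y \<omega> = \<infinity> \<Longrightarrow> g \<omega> = 0"
    and f: "f \<in> borel_measurable (path_algebra M X)"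
  shows "(\<integral>\<^sup>+\<omega>. g \<omega> * f (\<theta> (enn2real (hitting_time X y \<omega>)) \<omega>) \<partial>P x) = (\<integral>\<^sup>+\<omega>. g \<omega> \<partial>P x) * (\<integral>\<^sup>+\<omega>. f \<omega> \<partial>P y)"
proof -
  have T: "stopping_time (extended_filtration M F) (hitting_time X y)"
    by (rule stopping_time_entry_time) simp
  have "(\<integral>\<^sup>+\<omega>. g \<omega> * f (\<theta> (enn2real (hitting_time X y \<omega>)) \<omega>) \<partial>P x) =
      (\<integral>\<^sup>+\<omega>. g \<omega> * (\<integral>\<^sup>+\<omega>'. f \<omega>' \<partial>P (X (enn2real (hitting_time X y \<omega>)) \<omega>)) \<partial>P x)"
    by (rule strong_markov_nn[OF assms(1) T g g0 f])
  also have "\<dots> = (\<integral>\<^sup>+\<omega>. g \<omega> * (\<integral>\<^sup>+\<omega>'. f \<omega>' \<partial>P y) \<partial>P x)"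
  proof (rule nn_integral_cong)
    fix \<omega> assume "\<omega> \<in> space (P x)"
    then have "\<omega> \<in> space M" using assms by simp
    then show "g \<omega> * (\<integral>\<^sup>+\<omega>'. f \<omega>' \<partial>P (X (enn2real (hitting_time X y \<omega>)) \<omega>)) = g \<omega> * (\<integral>\<^sup>+\<omega>'. f \<omega>' \<partial>P y)"
      using g0[of \<omega>] at_entry_time[of \<omega> "{y}"] by (cases "hitting_time X y \<omega> = \<infinity>") (auto simp: less_top)
  qed
  also have "\<dots> = (\<integral>\<^sup>+\<omega>. g \<omega> \<partial>P x) * (\<integral>\<^sup>+\<omega>. f \<omega> \<partial>P y)"
    by (rule nn_integral_multc) (rule measurable_from_subalg[OF subalgebra_pre_sigma[OF T assms(1)] g])
  finally show ?thesis .
qed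

lemma markov_nn:
  assumes x: "x \<in> J" and t: "0 \<le> t" and g: "g \<in> borel_measurable (F t)"
    and f: "f \<in> borel_measurable (path_algebra M X)"
  shows "(\<integral>\<^sup>+\<omega>. g \<omega> * f (\<theta> t \<omega>) \<partial>P x) = (\<integral>\<^sup>+\<omega>. g \<omega> * (\<integral>\<^sup>+\<omega>'. f \<omega>' \<partial>P (X t \<omega>)) \<partial>P x)"
proof -
  let ?T = "\<lambda>_::'a. ennreal t"
  have T: "stopping_time (extended_filtration M F) ?T" by (rule stopping_time_const)
  have "sets (F t) \<subseteq> sets (pre_sigma ?T)"
  proof
    fix A assume A: "A \<in> sets (F t)"
    have At: "A \<in> sets (extended_filtration M F (ennreal t))"
      using A t by (simp add: extended_filtration_def)
    have in_ext: "A \<in> sets (extended_filtration M F u)" if "ennreal t \<le> u" for u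
      using sets_F_mono[OF that] At by blast
    have "{\<omega>\<in>A. ennreal t \<le> u} \<in> sets (extended_filtration M F u)" for u
    proof (cases "ennreal t \<le> u")
      case True
      then have "{\<omega>\<in>A. ennreal t \<le> u} = A" by blast
      then show ?thesis using in_ext[OF True] by (simp only:)
    next
      case False
      then have "{\<omega>\<in>A. ennreal t \<le> u} = {}" by blast
      then show ?thesis by (simp only: sets.empty_sets)
    qed
    then show "A \<in> sets (pre_sigma ?T)"
      by (rule sets_pre_sigmaI[OF T])
  qed
  then have "subalgebra (pre_sigma ?T) (F t)"
    using t by (simp add: subalgebra_def space_pre_sigma)
  from measurable_from_subalg[OF this g] show ?thesis
    using strong_markov_nn[OF x T _ _ f, of g] t by simp
qed

end

section \<open>Laplace transforms of hitting times\<close>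

definition discount :: "ennreal \<Rightarrow> ennreal" where
  "discount \<tau> = (if \<tau> = \<infinity> then 0 else ennreal (exp (- enn2real \<tau>)))"

lemma discount_top [simp]: "discount \<infinity> = 0" "discount top = 0"
  by (simp_all add: discount_def)

lemma discount_eq_0_iff: "discount \<tau> = 0 \<longleftrightarrow> \<tau> = \<infinity>"
  by (simp add: discount_def)

lemma discount_ennreal: "0 \<le> t \<Longrightarrow> discount (ennreal t) = ennreal (exp (- t))"
  by (simp add: discount_def)

lemma discount_le_1: "discount \<tau> \<le> 1"
  by (cases \<tau>) (auto simp: discount_def)

lemma discount_less_1: "0 < \<tau> \<Longrightarrow> discount \<tau> < 1"
  by (cases \<tau>) (auto simp: discount_def ennreal_less_one_iff)

lemma discount_pos: "\<tau> < \<infinity> \<Longrightarrow> 0 < discount \<tau>"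
  by (auto simp: discount_def)

lemma discount_add: "discount (a + b) = discount a * discount b"
  by (cases a; cases b) (auto simp: discount_def ennreal_mult'[symmetric] exp_add[symmetric] ennreal_plus[symmetric]
      simp del: ennreal_plus)

lemma discount_antimono: "a \<le> b \<Longrightarrow> discount b \<le> discount a"
  by (cases a; cases b) (auto simp: discount_def ennreal_le_iff top_unique)

lemma measurable_discount [measurable]: "discount \<in> borel_measurable borel"
  unfolding discount_def by measurable

lemma one_le_discount_plus: "1 \<le> discount \<tau> + \<tau>"
proof (cases \<tau>)
  case (real t)
  have "1 \<le> exp (- t) + t" using exp_ge_add_one_self[of "-t"] by simp
  then have "ennreal 1 \<le> ennreal (exp (- t) + t)" by (rule ennreal_leI)
  also have "\<dots> = ennreal (exp (- t)) + ennreal t" using real by (intro ennreal_plus) auto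
  finally have "ennreal 1 \<le> ennreal (exp (- t)) + ennreal t" .
  then show ?thesis using real by (simp add: discount_ennreal)
qed simp

context diffusion
begin

definition laplace :: "real \<Rightarrow> real \<Rightarrow> real set \<Rightarrow> real" where
  "laplace x b C = enn2real (\<integral>\<^sup>+\<omega>. discount (hitting_time X b \<omega>) *
     indicator {\<omega>. hitting_time X b \<omega> < entry_time X C \<omega>} \<omega> \<partial>P x)"

definition hit_prob :: "real \<Rightarrow> real \<Rightarrow> real set \<Rightarrow> real" where
  "hit_prob x b C = measure (P x) {\<omega>\<in>space M. hitting_time X b \<omega> < entry_time X C \<omega>}"

lemma measurable_entry_time [measurable (raw)]:
  "closed C \<Longrightarrow> entry_time X C \<in> borel_measurable M"
  by (rule measurable_paths_M[OF measurable_entry_time_paths])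

lemma measurable_entry_time_P:
  "x \<in> J \<Longrightarrow> closed C \<Longrightarrow> entry_time X C \<in> borel_measurable (P x)"
  by (simp add: measurable_P_iff measurable_entry_time)

lemma less_entry_sets [measurable]:
  assumes "x \<in> J" "closed C"
  shows "{\<omega>\<in>space M. hitting_time X b \<omega> < entry_time X C \<omega>} \<in> sets (P x)"
proof -
  have [measurable]: "entry_time X {b} \<in> borel_measurable (P x)" "entry_time X C \<in> borel_measurable (P x)"
    using assms by (auto intro: measurable_entry_time_P)
  have "{\<omega>\<in>space (P x). hitting_time X b \<omega> < entry_time X C \<omega>} \<in> sets (P x)" by measurable
  then show ?thesis using assms by simp
qed

lemma start_eq:
  assumes x: "x \<in> J"
  shows "AE \<omega> in P x. X 0 \<omega> = x \<and> \<omega> \<in> space M"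
  using start[OF x] AE_space by eventually_elim (use x in auto)

lemma laplace_functional_measurable:
  assumes C: "closed C"
  shows "(\<lambda>\<omega>. discount (hitting_time X b \<omega>) * indicator {\<omega>. hitting_time X b \<omega> < entry_time X C \<omega>} \<omega>)
    \<in> borel_measurable (path_algebra M X)"
proof -
  have [measurable]: "entry_time X {b} \<in> borel_measurable (path_algebra M X)"
      "entry_time X C \<in> borel_measurable (path_algebra M X)"
    using C by (auto intro: measurable_entry_time_paths)
  have "(\<lambda>\<omega>. if hitting_time X b \<omega> < entry_time X C \<omega> then discount (hitting_time X b \<omega>) else 0)
    \<in> borel_measurable (path_algebra M X)"
    by measurable
  then show ?thesis
    by (rule measurable_cong[THEN iffD1, rotated]) (auto simp: indicator_def)
qed

lemma ennreal_laplace_aux: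
  assumes x: "x \<in> J"
  shows "ennreal (laplace x b C) = (\<integral>\<^sup>+\<omega>. discount (hitting_time X b \<omega>) *
     indicator {\<omega>. hitting_time X b \<omega> < entry_time X C \<omega>} \<omega> \<partial>P x)" (is "_ = ?I")
    and "laplace x b C \<le> 1"
proof -
  interpret prob_space "P x" using prob x .
  have "?I \<le> (\<integral>\<^sup>+\<omega>. 1 \<partial>P x)"
    by (rule nn_integral_mono) (auto simp: indicator_def discount_le_1)
  then have le: "?I \<le> 1" by (simp add: emeasure_space_1)
  then show eq: "ennreal (laplace x b C) = ?I" unfolding laplace_def
    by (intro ennreal_enn2real) (auto intro: le_less_trans)
  show "laplace x b C \<le> 1" using le unfolding eq[symmetric] by (simp add: ennreal_le_1)
qed

lemmas ennreal_laplace = ennreal_laplace_aux(1)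

lemmas laplace_le_1 = ennreal_laplace_aux(2)

lemma laplace_nonneg: "0 \<le> laplace x b C"
  by (simp add: laplace_def)

lemma laplace_mono:
  assumes "x \<in> J" and "C \<subseteq> D"
  shows "laplace x b D \<le> laplace x b C"
proof -
  have "entry_time X D \<omega> \<le> entry_time X C \<omega>" for \<omega>
    unfolding entry_time_def by (rule Inf_superset_mono) (use assms in auto)
  then have "ennreal (laplace x b D) \<le> ennreal (laplace x b C)"
    unfolding ennreal_laplace[OF assms(1)]
    by (intro nn_integral_mono mult_left_mono) (auto simp: indicator_def intro: less_le_trans)
  then show ?thesis by (simp add: laplace_nonneg)
qed

lemma hitting_times_distinct:
  assumes "\<omega> \<in> space M" "a \<noteq> b" "hitting_time X a \<omega> < \<infinity>"
  shows "hitting_time X a \<omega> \<noteq> hitting_time X b \<omega>"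
proof
  assume "hitting_time X a \<omega> = hitting_time X b \<omega>"
  then show False
    using at_entry_time[OF assms(1), of "{a}"] at_entry_time[OF assms(1), of "{b}"] assms(2,3) by simp
qed

text \<open>The strong Markov property at \<open>\<tau>\<^sub>y\<close>: a path that hits \<open>b\<close> before \<open>C\<close> either does so
  before \<open>y\<close>, or starts afresh at \<open>y\<close>. All relations between the Laplace transforms come from
  this identity.\<close>

lemma laplace_decompose:
  assumes x: "x \<in> J" and y: "y \<in> J" and C: "closed C" and "y \<noteq> b"
  shows "laplace x b C = laplace x b (insert y C) + laplace x y (insert b C) * laplace y b C"
proof -
  let ?\<tau> = "\<lambda>z. hitting_time X z" and ?\<sigma> = "\<lambda>C. entry_time X C"
  let ?f = "\<lambda>b C \<omega>. discount (?\<tau> b \<omega>) * indicator {\<omega>. ?\<tau> b \<omega> < ?\<sigma> C \<omega>} \<omega>"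
  have stop: "stopping_time (extended_filtration M F) (?\<tau> y)" "stopping_time (extended_filtration M F) (?\<sigma> (insert b C))"
    using C by (auto intro: stopping_time_entry_time)
  have [measurable]: "?\<tau> y \<in> borel_measurable (pre_sigma (?\<tau> y))"
    by (rule measurable_stopping_time_pre_sigma[OF stop(1)])
  have [measurable]: "Measurable.pred (pre_sigma (?\<tau> y)) (\<lambda>\<omega>. ?\<tau> y \<omega> < ?\<sigma> (insert b C) \<omega>)"
    by (rule stopping_time_less[OF stop])
  have "(\<lambda>\<omega>. if ?\<tau> y \<omega> < ?\<sigma> (insert b C) \<omega> then discount (?\<tau> y \<omega>) else 0) \<in> borel_measurable (pre_sigma (?\<tau> y))"
    by measurable
  then have g: "?f y (insert b C) \<in> borel_measurable (pre_sigma (?\<tau> y))"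
    by (rule measurable_cong[THEN iffD1, rotated]) (auto simp: indicator_def)
  have split: "?f b C \<omega> = ?f b (insert y C) \<omega> + ?f y (insert b C) \<omega> * ?f b C (\<theta> (enn2real (?\<tau> y \<omega>)) \<omega>)"
    if \<omega>: "\<omega> \<in> space M" for \<omega>
  proof (cases "?\<tau> y \<omega> < min (?\<tau> b \<omega>) (?\<sigma> C \<omega>)")
    case True
    then obtain t where t: "?\<tau> y \<omega> = ennreal t" "0 \<le> t"
      by (cases "?\<tau> y \<omega>") auto
    have b: "?\<tau> b \<omega> = ennreal t + ?\<tau> b (\<theta> t \<omega>)"
      by (rule entry_time_shift[OF \<omega>]) (use True t in auto)
    have c: "?\<sigma> C \<omega> = ennreal t + ?\<sigma> C (\<theta> t \<omega>)"
      by (rule entry_time_shift[OF \<omega> C]) (use True t in auto)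
    have less: "?\<tau> b \<omega> < ?\<sigma> C \<omega> \<longleftrightarrow> ?\<tau> b (\<theta> t \<omega>) < ?\<sigma> C (\<theta> t \<omega>)"
      unfolding b c by (simp add: ennreal_add_left_cancel_less)
    have "?f b C \<omega> = discount (ennreal t) * ?f b C (\<theta> t \<omega>)"
      unfolding indicator_def mem_Collect_eq less by (simp add: b discount_add mult.assoc)
    moreover have "?f b (insert y C) \<omega> = 0"
      using True by (auto simp: indicator_def entry_time_insert[of X _ C])
    moreover have "?f y (insert b C) \<omega> = discount (ennreal t)"
      using True t by (auto simp: indicator_def entry_time_insert[of X _ C])
    ultimately show ?thesis using t by simp
  next
    case False
    then have "?f y (insert b C) \<omega> = 0"
      by (auto simp: indicator_def entry_time_insert[of X _ C])
    moreover have "?f b (insert y C) \<omega> = ?f b C \<omega>"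
    proof (cases "?\<tau> b \<omega> < ?\<sigma> C \<omega>")
      case True
      have "?\<tau> b \<omega> < \<infinity>" using True by (rule less_le_trans) simp
      then have "?\<tau> b \<omega> \<noteq> ?\<tau> y \<omega>"
        using hitting_times_distinct[OF \<omega>, of b y] \<open>y \<noteq> b\<close> by blast
      with True False have "?\<tau> b \<omega> < ?\<tau> y \<omega>" by auto
      then show ?thesis using True by (auto simp: indicator_def entry_time_insert[of X _ C])
    qed (auto simp: indicator_def entry_time_insert[of X _ C])
    ultimately show ?thesis by simp
  qed
  have [measurable]: "?f b (insert y C) \<in> borel_measurable (P x)"
    using C by (intro measurable_paths_P[OF x] laplace_functional_measurable) auto
  have "(\<lambda>\<omega>. ?f b C (\<theta> (enn2real (?\<tau> y \<omega>)) \<omega>)) \<in> borel_measurable M"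
    by (rule measurable_compose[OF measurable_shift_at laplace_functional_measurable[OF C]])
      (auto intro: measurable_entry_time)
  then have [measurable]: "(\<lambda>\<omega>. ?f b C (\<theta> (enn2real (?\<tau> y \<omega>)) \<omega>)) \<in> borel_measurable (P x)"
    by (simp add: measurable_P_iff x)
  have [measurable]: "?f y (insert b C) \<in> borel_measurable (P x)"
    by (rule measurable_from_subalg[OF subalgebra_pre_sigma[OF stop(1) x] g])
  have "ennreal (laplace x b C) = (\<integral>\<^sup>+\<omega>. ?f b (insert y C) \<omega> + ?f y (insert b C) \<omega> * ?f b C (\<theta> (enn2real (?\<tau> y \<omega>)) \<omega>) \<partial>P x)"
    unfolding ennreal_laplace[OF x] by (rule nn_integral_cong) (use split x in simp)
  also have "\<dots> = (\<integral>\<^sup>+\<omega>. ?f b (insert y C) \<omega> \<partial>P x) + (\<integral>\<^sup>+\<omega>. ?f y (insert b C) \<omega> * ?f b C (\<theta> (enn2real (?\<tau> y \<omega>)) \<omega>) \<partial>P x)"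
    by (rule nn_integral_add) measurable
  also have "(\<integral>\<^sup>+\<omega>. ?f y (insert b C) \<omega> * ?f b C (\<theta> (enn2real (?\<tau> y \<omega>)) \<omega>) \<partial>P x) =
      (\<integral>\<^sup>+\<omega>. ?f y (insert b C) \<omega> \<partial>P x) * (\<integral>\<^sup>+\<omega>. ?f b C \<omega> \<partial>P y)"
    by (rule strong_markov_hitting[OF x y g]) (auto intro!: laplace_functional_measurable C)
  finally have "ennreal (laplace x b C) = ennreal (laplace x b (insert y C) + laplace x y (insert b C) * laplace y b C)"
    by (simp add: ennreal_laplace[symmetric] x y ennreal_mult laplace_nonneg)
  then show ?thesis
    by (subst (asm) ennreal_inj) (auto intro!: add_nonneg_nonneg mult_nonneg_nonneg laplace_nonneg)
qed

lemma hitting_time_between: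
  assumes \<omega>: "\<omega> \<in> space M" "X 0 \<omega> = x" and between: "x \<le> y \<and> y \<le> b \<or> b \<le> y \<and> y \<le> x"
  shows "hitting_time X y \<omega> \<le> hitting_time X b \<omega>"
proof (cases "hitting_time X b \<omega> < \<infinity>")
  case True
  then obtain t where t: "hitting_time X b \<omega> = ennreal t" "0 \<le> t" "X t \<omega> = b"
    using at_entry_time[OF \<omega>(1), of "{b}"] by (cases "hitting_time X b \<omega>") auto
  have "continuous_on {0..t} (\<lambda>s. X s \<omega>)"
    by (rule continuous_on_subset[OF continuous_paths[OF \<omega>(1)]]) auto
  then obtain s where "0 \<le> s" "s \<le> t" "X s \<omega> = y"
    using IVT'[of "\<lambda>s. X s \<omega>" 0 y t] IVT2'[of "\<lambda>s. X s \<omega>" t y 0] between t \<omega>(2) by auto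
  then show ?thesis
    using entry_time_lower[of s X \<omega> "{y}"] t by (auto intro: order_trans ennreal_leI)
qed (simp add: less_top[symmetric])

lemma hitting_time_less_between:
  assumes "\<omega> \<in> space M" "X 0 \<omega> = x" and "x \<le> y \<and> y \<le> b \<or> b \<le> y \<and> y \<le> x" "y \<noteq> b"
    "hitting_time X b \<omega> < \<infinity>"
  shows "hitting_time X y \<omega> < hitting_time X b \<omega>"
  using hitting_time_between[OF assms(1-3)] hitting_times_distinct[OF assms(1), of b y] assms(4,5)
  by (metis order_le_less)

lemma laplace_drop_behind_barrier:
  assumes x: "x \<in> J" and between: "x \<le> y \<and> y \<le> c \<or> c \<le> y \<and> y \<le> x"
  shows "laplace x b (insert y (insert c C)) = laplace x b (insert y C)"
proof -
  have "ennreal (laplace x b (insert y (insert c C))) = ennreal (laplace x b (insert y C))"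
    unfolding ennreal_laplace[OF x]
  proof (rule nn_integral_cong_AE)
    show "AE \<omega> in P x. discount (hitting_time X b \<omega>) * indicator {\<omega>. hitting_time X b \<omega> < entry_time X (insert y (insert c C)) \<omega>} \<omega> =
       discount (hitting_time X b \<omega>) * indicator {\<omega>. hitting_time X b \<omega> < entry_time X (insert y C) \<omega>} \<omega>"
      using start_eq[OF x]
    proof eventually_elim
      case (elim \<omega>)
      then have "hitting_time X y \<omega> \<le> hitting_time X c \<omega>"
        using hitting_time_between[of \<omega> x y c] between by auto
      then have "entry_time X (insert y (insert c C)) \<omega> = entry_time X (insert y C) \<omega>"
        unfolding entry_time_insert[of X y "insert c C"] entry_time_insert[of X _ C]
        by (metis min.assoc min.absorb1)
      then show ?case by (simp only: indicator_def mem_Collect_eq)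
    qed
  qed
  then show ?thesis by (simp add: laplace_nonneg)
qed

lemma laplace_drop_behind_target:
  assumes x: "x \<in> J" and "y \<noteq> c" and between: "x \<le> y \<and> y \<le> c \<or> c \<le> y \<and> y \<le> x"
  shows "laplace x y (insert c C) = laplace x y C"
proof -
  have "ennreal (laplace x y (insert c C)) = ennreal (laplace x y C)"
    unfolding ennreal_laplace[OF x]
  proof (rule nn_integral_cong_AE)
    show "AE \<omega> in P x. discount (hitting_time X y \<omega>) * indicator {\<omega>. hitting_time X y \<omega> < entry_time X (insert c C) \<omega>} \<omega> =
       discount (hitting_time X y \<omega>) * indicator {\<omega>. hitting_time X y \<omega> < entry_time X C \<omega>} \<omega>"
      using start_eq[OF x]
    proof eventually_elim
      case (elim \<omega>)
      then show ?case
        using hitting_time_between[of \<omega> x y c] hitting_time_less_between[of \<omega> x y c] between \<open>y \<noteq> c\<close>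
        by (cases "hitting_time X c \<omega> = \<infinity>")
          (auto simp: indicator_def entry_time_insert[of X _ C] less_top[symmetric] discount_eq_0_iff)
    qed
  qed
  then show ?thesis by (simp add: laplace_nonneg)
qed

lemma laplace_multiplicative:
  assumes x: "x \<in> J" and y: "y \<in> J" and C: "closed C" and "y \<noteq> b"
    and between: "x \<le> y \<and> y \<le> b \<or> b \<le> y \<and> y \<le> x"
  shows "laplace x b C = laplace x y C * laplace y b C"
proof -
  have "ennreal (laplace x b (insert y C)) = (\<integral>\<^sup>+\<omega>. 0 \<partial>P x)"
    unfolding ennreal_laplace[OF x]
  proof (rule nn_integral_cong_AE)
    show "AE \<omega> in P x. discount (hitting_time X b \<omega>) * indicator {\<omega>. hitting_time X b \<omega> < entry_time X (insert y C) \<omega>} \<omega> = 0"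
      using start_eq[OF x]
    proof eventually_elim
      case (elim \<omega>)
      then show ?case using hitting_time_between[of \<omega> x y b] between
        by (auto simp: indicator_def entry_time_insert[of X _ C])
    qed
  qed
  then have "laplace x b (insert y C) = 0" by (simp add: laplace_nonneg)
  then show ?thesis
    using laplace_decompose[OF x y C \<open>y \<noteq> b\<close>] laplace_drop_behind_target[OF x \<open>y \<noteq> b\<close> between] by simp
qed

lemma laplace_le_hit_prob:
  assumes x: "x \<in> J" and C: "closed C"
  shows "laplace x b C \<le> hit_prob x b C"
proof -
  interpret prob_space "P x" using prob x .
  have "ennreal (laplace x b C) \<le> (\<integral>\<^sup>+\<omega>. indicator {\<omega>\<in>space M. hitting_time X b \<omega> < entry_time X C \<omega>} \<omega> \<partial>P x)"
    unfolding ennreal_laplace[OF x]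
    by (rule nn_integral_mono) (use x in \<open>auto simp: indicator_def discount_le_1\<close>)
  then show ?thesis
    using less_entry_sets[OF x C, of b] by (simp add: hit_prob_def emeasure_eq_measure)
qed

lemma laplace_pos:
  assumes x: "x \<in> J" and C: "closed C" and pos: "0 < hit_prob x b C"
  shows "0 < laplace x b C"
proof (rule ccontr)
  interpret prob_space "P x" using prob x .
  assume "\<not> 0 < laplace x b C"
  then have "ennreal (laplace x b C) = 0" using laplace_nonneg[of x b C] by simp
  then have "AE \<omega> in P x. discount (hitting_time X b \<omega>) * indicator {\<omega>. hitting_time X b \<omega> < entry_time X C \<omega>} \<omega> = 0"
    unfolding ennreal_laplace[OF x]
    by (subst (asm) nn_integral_0_iff_AE) (auto intro!: measurable_paths_P[OF x] laplace_functional_measurable C)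
  then have "AE \<omega> in P x. \<omega> \<notin> {\<omega>\<in>space M. hitting_time X b \<omega> < entry_time X C \<omega>}"
  proof eventually_elim
    case (elim \<omega>)
    then show ?case using discount_pos[of "hitting_time X b \<omega>"]
      by (auto simp: indicator_def split: if_splits dest: less_le_trans[OF _ top_greatest])
  qed
  then have "hit_prob x b C = 0"
    using less_entry_sets[OF x C, of b] unfolding hit_prob_def
    by (subst (asm) AE_iff_measurable[OF _ refl]) (auto simp: x measure_def)
  then show False using pos by simp
qed

lemma sets_hit_by [measurable]:
  "x \<in> J \<Longrightarrow> {\<omega>\<in>space M. hitting_time X b \<omega> \<le> u} \<in> sets (P x)"
proof -
  assume x: "x \<in> J"
  have [measurable]: "entry_time X {b} \<in> borel_measurable (P x)"
    using x by (rule measurable_entry_time_P) simp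
  have "{\<omega>\<in>space (P x). hitting_time X b \<omega> \<le> u} \<in> sets (P x)" by measurable
  then show ?thesis using x by simp
qed

text \<open>Discounting weighs late hits by at most \<open>e\<^sup>-\<^sup>t\<close> and early ones by at least \<open>e\<^sup>-\<^sup>t\<close>.\<close>

lemma laplace_le_early_plus_late:
  assumes x: "x \<in> J" and C: "closed C" and t: "0 \<le> t"
  shows "laplace x b C \<le> measure (P x) {\<omega>\<in>space M. hitting_time X b \<omega> \<le> ennreal t \<and> hitting_time X b \<omega> < entry_time X C \<omega>}
     + exp (- t) * hit_prob x b C"
proof -
  interpret prob_space "P x" using prob x .
  let ?A = "{\<omega>\<in>space M. hitting_time X b \<omega> < entry_time X C \<omega>}"
  let ?E = "{\<omega>\<in>space M. hitting_time X b \<omega> \<le> ennreal t}"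
  have [measurable]: "?A \<in> sets (P x)" "?E \<in> sets (P x)" using less_entry_sets[OF x C] sets_hit_by[OF x] by auto
  have "ennreal (laplace x b C) \<le> (\<integral>\<^sup>+\<omega>. indicator (?E \<inter> ?A) \<omega> + ennreal (exp (- t)) * indicator ?A \<omega> \<partial>P x)"
    unfolding ennreal_laplace[OF x]
  proof (rule nn_integral_mono)
    fix \<omega> assume "\<omega> \<in> space (P x)"
    then show "discount (hitting_time X b \<omega>) * indicator {\<omega>. hitting_time X b \<omega> < entry_time X C \<omega>} \<omega> \<le>
      indicator (?E \<inter> ?A) \<omega> + ennreal (exp (- t)) * indicator ?A \<omega>"
      using discount_le_1[of "hitting_time X b \<omega>"] discount_antimono[of "ennreal t" "hitting_time X b \<omega>"] x t
      by (auto simp: indicator_def discount_ennreal not_le less_imp_le intro: add_increasing2)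
  qed
  also have "\<dots> = emeasure (P x) (?E \<inter> ?A) + ennreal (exp (- t)) * emeasure (P x) ?A"
    by (subst nn_integral_add) (auto simp: nn_integral_cmult)
  also have "?E \<inter> ?A = {\<omega>\<in>space M. hitting_time X b \<omega> \<le> ennreal t \<and> hitting_time X b \<omega> < entry_time X C \<omega>}"
    by auto
  finally show ?thesis
    by (simp add: emeasure_eq_measure ennreal_mult'[symmetric] ennreal_plus[symmetric] hit_prob_def del: ennreal_plus)
qed

lemma early_le_laplace:
  assumes x: "x \<in> J" and t: "0 \<le> t"
  shows "measure (P x) {\<omega>\<in>space M. hitting_time X b \<omega> \<le> ennreal t} \<le> exp t * laplace x b {}"
proof -
  interpret prob_space "P x" using prob x .
  let ?E = "{\<omega>\<in>space M. hitting_time X b \<omega> \<le> ennreal t}"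
  have E: "?E \<in> sets (P x)" by (rule sets_hit_by[OF x])
  have "ennreal (exp (- t)) * emeasure (P x) ?E = (\<integral>\<^sup>+\<omega>. ennreal (exp (- t)) * indicator ?E \<omega> \<partial>P x)"
    using E by (simp add: nn_integral_cmult)
  also have "\<dots> \<le> ennreal (laplace x b {})"
    unfolding ennreal_laplace[OF x]
  proof (rule nn_integral_mono)
    fix \<omega> assume "\<omega> \<in> space (P x)"
    then show "ennreal (exp (- t)) * indicator ?E \<omega> \<le>
        discount (hitting_time X b \<omega>) * indicator {\<omega>. hitting_time X b \<omega> < entry_time X {} \<omega>} \<omega>"
      using discount_antimono[of "hitting_time X b \<omega>" "ennreal t"] x t
      by (auto simp: indicator_def discount_ennreal le_less_trans[OF _ ennreal_less_top])
  qed
  finally have "exp (- t) * measure (P x) ?E \<le> laplace x b {}"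
    by (simp add: emeasure_eq_measure ennreal_mult'[symmetric] laplace_nonneg)
  then show ?thesis by (simp add: exp_minus divide_simps mult.commute)
qed

text \<open>Conversely, \<open>1 - e\<^sup>-\<^sup>\<tau>\<close> is at least \<open>1 - e\<^sup>-\<^sup>t\<close> when \<open>b\<close> is not hit by time \<open>t\<close>.\<close>

lemma late_le_laplace:
  assumes x: "x \<in> J" and t: "0 \<le> t"
  shows "(1 - exp (- t)) * measure (P x) {\<omega>\<in>space M. \<not> hitting_time X b \<omega> \<le> ennreal t} \<le> 1 - laplace x b {}"
proof -
  interpret prob_space "P x" using prob x .
  let ?E = "{\<omega>\<in>space M. hitting_time X b \<omega> \<le> ennreal t}"
  have E: "?E \<in> sets (P x)" by (rule sets_hit_by[OF x])
  have eq: "{\<omega>\<in>space M. hitting_time X b \<omega> \<le> ennreal t \<and> hitting_time X b \<omega> < entry_time X {} \<omega>} = ?E"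
    by (auto intro: le_less_trans)
  have c: "{\<omega>\<in>space M. \<not> hitting_time X b \<omega> \<le> ennreal t} = space (P x) - ?E" using x by auto
  have "ennreal (laplace x b {}) \<le> (\<integral>\<^sup>+\<omega>. indicator ?E \<omega> + ennreal (exp (- t)) * indicator (space (P x) - ?E) \<omega> \<partial>P x)"
    unfolding ennreal_laplace[OF x]
  proof (rule nn_integral_mono)
    fix \<omega> assume "\<omega> \<in> space (P x)"
    then show "discount (hitting_time X b \<omega>) * indicator {\<omega>. hitting_time X b \<omega> < entry_time X {} \<omega>} \<omega> \<le>
      indicator ?E \<omega> + ennreal (exp (- t)) * indicator (space (P x) - ?E) \<omega>"
      using discount_le_1[of "hitting_time X b \<omega>"] discount_antimono[of "ennreal t" "hitting_time X b \<omega>"] x t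
      by (auto simp: indicator_def discount_ennreal not_le less_imp_le)
  qed
  also have "\<dots> = emeasure (P x) ?E + ennreal (exp (- t)) * emeasure (P x) (space (P x) - ?E)"
    using E by (subst nn_integral_add) (auto simp: nn_integral_cmult)
  finally have "laplace x b {} \<le> measure (P x) ?E + exp (- t) * measure (P x) (space (P x) - ?E)"
    by (simp add: emeasure_eq_measure ennreal_mult'[symmetric] ennreal_plus[symmetric] del: ennreal_plus)
  then show ?thesis
    unfolding c prob_compl[OF E] by (simp add: algebra_simps)
qed

lemma hitting_time_pos:
  assumes \<omega>: "\<omega> \<in> space M" and C: "closed C" "X 0 \<omega> \<notin> C"
  shows "0 < entry_time X C \<omega>"
proof (rule ccontr)
  assume "\<not> 0 < entry_time X C \<omega>"
  then show False using entry_time_le_iff[OF \<omega> C(1), of 0] C(2) by auto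
qed

lemma laplace_self:
  assumes x: "x \<in> J" and C: "closed C" "x \<notin> C"
  shows "laplace x x C = 1"
proof -
  interpret prob_space "P x" using prob x .
  have "ennreal (laplace x x C) = (\<integral>\<^sup>+\<omega>. 1 \<partial>P x)"
    unfolding ennreal_laplace[OF x]
  proof (rule nn_integral_cong_AE)
    show "AE \<omega> in P x. discount (hitting_time X x \<omega>) * indicator {\<omega>. hitting_time X x \<omega> < entry_time X C \<omega>} \<omega> = 1"
      using start_eq[OF x]
    proof eventually_elim
      case (elim \<omega>)
      then have "hitting_time X x \<omega> = 0" using entry_time_lower[of 0 X \<omega> "{x}"] by simp
      moreover have "0 < entry_time X C \<omega>" using elim C by (intro hitting_time_pos) auto
      ultimately show ?case by (simp add: discount_def)
    qed
  qed
  then show ?thesis by (simp add: emeasure_space_1 laplace_nonneg)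
qed

lemma laplace_less_1:
  assumes x: "x \<in> J" and "x \<noteq> b"
  shows "laplace x b {} < 1"
proof (rule ccontr)
  interpret prob_space "P x" using prob x .
  assume "\<not> laplace x b {} < 1"
  then have 1: "laplace x b {} = 1" using laplace_le_1[OF x, of b "{}"] by simp
  have m: "(\<lambda>\<omega>. discount (hitting_time X b \<omega>)) \<in> borel_measurable (P x)"
    using measurable_entry_time_P[OF x, of "{b}"] by simp
  have ind: "discount (hitting_time X b \<omega>) * indicator {\<omega>. hitting_time X b \<omega> < \<infinity>} \<omega> = discount (hitting_time X b \<omega>)" for \<omega>
    by (cases "hitting_time X b \<omega> = \<infinity>") (auto simp: less_top[symmetric])
  have L: "ennreal (laplace x b {}) = (\<integral>\<^sup>+\<omega>. discount (hitting_time X b \<omega>) \<partial>P x)"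
    using ennreal_laplace[OF x, of b "{}"] unfolding entry_time_empty ind .
  have "AE \<omega> in P x. discount (hitting_time X b \<omega>) < 1"
    using start_eq[OF x]
  proof eventually_elim
    case (elim \<omega>)
    then show ?case using hitting_time_pos[of \<omega> "{b}"] \<open>x \<noteq> b\<close> by (intro discount_less_1) auto
  qed
  then have le: "AE \<omega> in P x. discount (hitting_time X b \<omega>) \<le> 1" and "AE \<omega> in P x. \<not> 1 \<le> discount (hitting_time X b \<omega>)"
    by (eventually_elim, simp)+
  then have nle: "\<not> (AE \<omega> in P x. 1 \<le> discount (hitting_time X b \<omega>))"
    using AE_contr by blast
  have "(\<integral>\<^sup>+\<omega>. discount (hitting_time X b \<omega>) \<partial>P x) \<noteq> \<infinity>"
    unfolding L[symmetric] by simp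
  then have "(\<integral>\<^sup>+\<omega>. discount (hitting_time X b \<omega>) \<partial>P x) < (\<integral>\<^sup>+\<omega>. 1 \<partial>P x)"
    by (intro nn_integral_less m le nle) auto
  then show False
    unfolding L[symmetric] 1 by (simp add: emeasure_space_1)
qed

text \<open>As \<open>1 \<le> e\<^sup>-\<^sup>\<tau> + \<tau>\<close>, what discounting loses up to the exit from an interval is at most the mean exit
  time.\<close>

lemma exit_loss_le_mean_exit_time:
  assumes x: "x \<in> J" and "a \<noteq> b"
  shows "1 \<le> ennreal (laplace x b {a}) + ennreal (laplace x a {b}) +
    (\<integral>\<^sup>+\<omega>. min (hitting_time X a \<omega>) (hitting_time X b \<omega>) \<partial>P x)"
proof -
  interpret prob_space "P x" using prob x .
  let ?f = "\<lambda>b a \<omega>. discount (hitting_time X b \<omega>) * indicator {\<omega>. hitting_time X b \<omega> < hitting_time X a \<omega>} \<omega>"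
  have m: "?f b a \<in> borel_measurable (P x)" for a b
    by (intro measurable_paths_P[OF x] laplace_functional_measurable) simp
  have [measurable]: "entry_time X {c} \<in> borel_measurable (P x)" for c
    by (rule measurable_entry_time_P[OF x]) simp
  have "1 = (\<integral>\<^sup>+\<omega>. 1 \<partial>P x)" by (simp add: emeasure_space_1)
  also have "\<dots> \<le> (\<integral>\<^sup>+\<omega>. (?f b a \<omega> + ?f a b \<omega>) + min (hitting_time X a \<omega>) (hitting_time X b \<omega>) \<partial>P x)"
  proof (rule nn_integral_mono)
    fix \<omega> assume "\<omega> \<in> space (P x)"
    then have \<omega>: "\<omega> \<in> space M" using x by simp
    consider "hitting_time X a \<omega> < hitting_time X b \<omega>" | "hitting_time X b \<omega> < hitting_time X a \<omega>"
      | "hitting_time X a \<omega> = \<infinity>" "hitting_time X b \<omega> = \<infinity>"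
      using hitting_times_distinct[OF \<omega> \<open>a \<noteq> b\<close>] by (metis less_top linorder_cases infinity_ennreal_def)
    then show "1 \<le> (?f b a \<omega> + ?f a b \<omega>) + min (hitting_time X a \<omega>) (hitting_time X b \<omega>)"
      by cases (auto simp: min_def one_le_discount_plus)
  qed
  also have "\<dots> = (\<integral>\<^sup>+\<omega>. ?f b a \<omega> \<partial>P x) + (\<integral>\<^sup>+\<omega>. ?f a b \<omega> \<partial>P x) +
      (\<integral>\<^sup>+\<omega>. min (hitting_time X a \<omega>) (hitting_time X b \<omega>) \<partial>P x)"
    using m by (simp add: nn_integral_add)
  finally show ?thesis by (simp add: ennreal_laplace[OF x])
qed

end

section \<open>Two recursions\<close>

lemma one_minus_sum_le_prod:
  fixes \<gamma> :: "'i \<Rightarrow> real"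
  assumes "finite I" "\<And>i. 0 \<le> \<gamma> i" "\<And>i. \<gamma> i \<le> 1"
  shows "1 - sum \<gamma> I \<le> (\<Prod>i\<in>I. 1 - \<gamma> i)"
  using assms(1)
proof induction
  case (insert i I)
  have "(\<Prod>i\<in>I. 1 - \<gamma> i) \<le> 1" using assms(2,3) by (intro prod_le_1) auto
  then have "\<gamma> i * (\<Prod>i\<in>I. 1 - \<gamma> i) \<le> \<gamma> i * 1" using assms(2) by (rule mult_left_mono)
  then show ?case using insert by (simp add: algebra_simps)
qed simp

lemma prod_one_minus_bounded_below:
  fixes \<gamma> :: "nat \<Rightarrow> real"
  assumes \<gamma>: "\<And>k. 0 \<le> \<gamma> k" "\<And>k. \<gamma> k < 1" and sum: "summable \<gamma>"
  shows "\<exists>c>0. \<forall>n. c \<le> (\<Prod>k<n. 1 - \<gamma> k)"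
proof -
  obtain N where N: "\<And>m n. N \<le> m \<Longrightarrow> \<bar>sum \<gamma> {m..<n}\<bar> < 1 / 2"
    using sum[unfolded summable_Cauchy, rule_format, of "1/2"] by auto
  define c where "c = (\<Prod>k<N. 1 - \<gamma> k) / 2"
  have pos: "0 < (\<Prod>k<n. 1 - \<gamma> k)" for n
    using \<gamma> by (intro prod_pos) (simp add: algebra_simps)
  have "c \<le> (\<Prod>k<n. 1 - \<gamma> k)" for n
  proof (cases "N \<le> n")
    case True
    have "1 / 2 \<le> 1 - sum \<gamma> {N..<n}" using N[of N n] by linarith
    also have "\<dots> \<le> (\<Prod>k\<in>{N..<n}. 1 - \<gamma> k)"
      by (rule one_minus_sum_le_prod) (auto simp: \<gamma> less_imp_le)
    finally have "(\<Prod>k<N. 1 - \<gamma> k) * (1 / 2) \<le> (\<Prod>k<N. 1 - \<gamma> k) * (\<Prod>k\<in>{N..<n}. 1 - \<gamma> k)"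
      using pos[of N] by (intro mult_left_mono) auto
    also have "\<dots> = (\<Prod>k<n. 1 - \<gamma> k)"
      using prod.union_disjoint[of "{..<N}" "{N..<n}" "\<lambda>k. 1 - \<gamma> k"] True
      by (simp add: ivl_disj_un_one(2) ivl_disj_int_one(2))
    finally show ?thesis by (simp add: c_def)
  next
    case False
    have "(\<Prod>k<N. 1 - \<gamma> k) = (\<Prod>k<n. 1 - \<gamma> k) * (\<Prod>k\<in>{n..<N}. 1 - \<gamma> k)"
      using prod.union_disjoint[of "{..<n}" "{n..<N}" "\<lambda>k. 1 - \<gamma> k"] False
      by (simp add: ivl_disj_un_one(2) ivl_disj_int_one(2))
    also have "\<dots> \<le> (\<Prod>k<n. 1 - \<gamma> k) * 1"
      using \<gamma> pos[of n] by (intro mult_left_mono prod_le_1) (auto simp: less_imp_le)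
    finally show ?thesis using pos[of N] by (simp add: c_def)
  qed
  moreover have "0 < c" using pos[of N] by (simp add: c_def)
  ultimately show ?thesis by blast
qed

lemma summable_of_prod_one_minus_bounded_below:
  fixes \<gamma> :: "nat \<Rightarrow> real"
  assumes \<gamma>: "\<And>k. 0 \<le> \<gamma> k" "\<And>k. \<gamma> k \<le> 1" and c: "0 < c" "\<And>n. c \<le> (\<Prod>k<n. 1 - \<gamma> k)"
  shows "summable \<gamma>"
proof (rule summableI_nonneg_bounded)
  fix n
  have "c \<le> (\<Prod>k<n. 1 - \<gamma> k)" by (rule c)
  also have "\<dots> \<le> (\<Prod>k<n. exp (- \<gamma> k))"
    using \<gamma> exp_ge_add_one_self[of "- \<gamma> k" for k] by (intro prod_mono) auto
  also have "\<dots> = exp (- sum \<gamma> {..<n})" by (simp add: exp_sum[symmetric] sum_negf)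
  finally have "ln c \<le> - sum \<gamma> {..<n}" using c(1) by (subst (asm) ln_le_cancel_iff[symmetric]) auto
  then show "sum \<gamma> {..<n} \<le> - ln c" by simp
qed (use \<gamma> in auto)

text \<open>On the levels of a ladder that doubles the distance to a base point at each step, a process on
  natural scale goes up with probability one third and down with two thirds. With discounting,
  let \<open>p\<close> and \<open>q\<close> be the transforms of stepping up and down, \<open>b k\<close> that of climbing from level
  \<open>k\<close> to \<open>k + 1\<close> before the base, and \<open>a k\<close> that of descending from level \<open>k + 1\<close> to \<open>k\<close>; without
  discounting \<open>b k = 1 / 2\<close> and \<open>a k = 1\<close>. The losses \<open>1 - 2 b k\<close> and \<open>1 - a k\<close> obey linear
  recursions driven by the loss \<open>1 - p k - q k\<close> of one step, with a contraction factor one half, so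
  that the three losses are summable together.\<close>

lemma climb_bounded_below:
  fixes p q b e :: "nat \<Rightarrow> real"
  assumes b: "\<And>k. 0 < b k" "\<And>k. b k \<le> 1 / 2"
    and rec: "\<And>k. b (Suc k) = p k + q k * (b k * b (Suc k))"
    and pq: "\<And>k. 0 \<le> p k" "\<And>k. p k \<le> 1 / 3" "\<And>k. 0 \<le> q k" "\<And>k. q k \<le> 2 / 3"
    and e: "\<And>k. 1 \<le> p k + q k + e k" "summable e"
  shows "\<exists>c>0. \<forall>n. c \<le> (\<Prod>k<n. 2 * b k)"
proof -
  define \<gamma> where "\<gamma> k = 1 - 2 * b k" for k
  have \<gamma>: "0 \<le> \<gamma> k" "\<gamma> k < 1" for k using b[of k] by (auto simp: \<gamma>_def)
  have e0: "0 \<le> e k" for k using e(1)[of k] pq[of k] by linarith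
  have step: "\<gamma> (Suc k) \<le> 3 * e k + \<gamma> k / 2" for k
  proof -
    define A B where "A = q k * ((\<gamma> k + \<gamma> (Suc k)) / 4)" and "B = q k * (b k * b (Suc k))"
    have "b k * b (Suc k) = (1 - \<gamma> k) * (1 - \<gamma> (Suc k)) / 4" by (simp add: \<gamma>_def)
    moreover have "(1 - \<gamma> k - \<gamma> (Suc k)) / 4 \<le> (1 - \<gamma> k) * (1 - \<gamma> (Suc k)) / 4"
      using mult_nonneg_nonneg[OF \<gamma>(1)[of k] \<gamma>(1)[of "Suc k"]]
      by (intro divide_right_mono) (simp_all add: algebra_simps)
    ultimately have "(1 - \<gamma> k - \<gamma> (Suc k)) / 4 \<le> b k * b (Suc k)" by simp
    then have "q k * ((1 - \<gamma> k - \<gamma> (Suc k)) / 4) \<le> B"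
      unfolding B_def using pq(3) by (rule mult_left_mono)
    moreover have "q k * ((1 - \<gamma> k - \<gamma> (Suc k)) / 4) = q k / 4 - A"
      by (simp add: A_def field_simps)
    moreover have "b (Suc k) = p k + B" using rec[of k] by (simp add: B_def)
    ultimately have "p k + q k / 4 - A \<le> b (Suc k)" by linarith
    moreover have "1 / 2 - e k \<le> p k + q k / 4" using e(1)[of k] pq[of k] by simp
    moreover have "A \<le> (2 / 3) * ((\<gamma> k + \<gamma> (Suc k)) / 4)"
      unfolding A_def using pq(4)[of k] \<gamma>(1)[of k] \<gamma>(1)[of "Suc k"] by (intro mult_right_mono) auto
    moreover have "b (Suc k) = (1 - \<gamma> (Suc k)) / 2" by (simp add: \<gamma>_def)
    ultimately show ?thesis by simp
  qed
  have "summable \<gamma>"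
  proof (rule summableI_nonneg_bounded)
    fix n
    have "sum \<gamma> {..<Suc n} = \<gamma> 0 + (\<Sum>k<n. \<gamma> (Suc k))" by (rule sum.lessThan_Suc_shift)
    also have "(\<Sum>k<n. \<gamma> (Suc k)) \<le> (\<Sum>k<n. 3 * e k + \<gamma> k / 2)" by (rule sum_mono) (rule step)
    also have "\<dots> = 3 * sum e {..<n} + sum \<gamma> {..<n} / 2"
      by (simp add: sum.distrib sum_distrib_left sum_divide_distrib)
    also have "sum e {..<n} \<le> suminf e" by (rule sum_le_suminf) (use e e0 in auto)
    finally have "sum \<gamma> {..<n} / 2 \<le> \<gamma> 0 + 3 * suminf e" using \<gamma>(1)[of n] by simp
    then show "sum \<gamma> {..<n} \<le> 2 * (\<gamma> 0 + 3 * suminf e)" by simp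
  qed (rule \<gamma>)
  from prod_one_minus_bounded_below[OF \<gamma> this] show ?thesis by (simp add: \<gamma>_def)
qed

lemma descend_bounded_below:
  fixes p q b a :: "nat \<Rightarrow> real"
  assumes b: "\<And>k. 0 < b k" "\<And>k. b k \<le> 1 / 2"
    and rec: "\<And>k. b (Suc k) = p k + q k * (b k * b (Suc k))"
    and pq: "\<And>k. 0 \<le> p k" "\<And>k. p k \<le> 1 / 3" "\<And>k. 0 \<le> q k" "\<And>k. q k \<le> 2 / 3"
    and c: "0 < c" "\<And>n. c \<le> (\<Prod>k<n. 2 * b k)"
    and a: "\<And>k. 0 < a k" "\<And>k. a k \<le> 1"
    and reca: "\<And>k. a k = q k + p k * (a (Suc k) * a k)"
  shows "\<exists>d>0. \<forall>n. d \<le> (\<Prod>k<n. a k)"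
proof -
  have b2: "2 * b k \<le> 1" for k using b(2)[of k] by simp
  have "summable (\<lambda>k. 1 - 2 * b k)"
    by (rule summable_of_prod_one_minus_bounded_below[OF _ _ c(1)]) (use b c(2) less_imp_le[OF b(1)] in \<open>auto simp: mult.commute\<close>)
  then have sum: "summable (\<lambda>k. 1 - 2 * b (Suc k))" by (subst summable_Suc_iff)
  have loss: "1 - p k - q k \<le> 2 * (1 - 2 * b (Suc k))" for k
  proof -
    have "b k * b (Suc k) \<le> (1 / 2) * (1 / 2)"
      using b less_imp_le by (intro mult_mono) auto
    then have "q k * (b k * b (Suc k)) \<le> q k * (1 / 4)" using pq(3) by (intro mult_left_mono) auto
    then have "b (Suc k) \<le> p k + q k * (1 / 4)" using rec[of k] by simp
    then show ?thesis using pq(2)[of k] by simp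
  qed
  define \<delta> where "\<delta> k = 1 - a k" for k
  have \<delta>: "0 \<le> \<delta> k" "\<delta> k < 1" for k using a[of k] by (auto simp: \<delta>_def)
  define S where "S = (\<Sum>k. 1 - 2 * b (Suc k))"
  have step: "\<delta> k \<le> 3 * (1 - 2 * b (Suc k)) + \<delta> (Suc k) / 2" for k
  proof -
    define A B where "A = p k * (\<delta> k + \<delta> (Suc k))" and "B = p k * (a (Suc k) * a k)"
    have "1 - \<delta> k - \<delta> (Suc k) \<le> a (Suc k) * a k"
      using mult_nonneg_nonneg[OF \<delta>(1)[of k] \<delta>(1)[of "Suc k"]] by (simp add: \<delta>_def algebra_simps)
    then have "p k * (1 - \<delta> k - \<delta> (Suc k)) \<le> B"
      unfolding B_def using pq(1) by (rule mult_left_mono)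
    moreover have "p k * (1 - \<delta> k - \<delta> (Suc k)) = p k - A"
      by (simp add: A_def algebra_simps)
    moreover have "\<delta> k = 1 - q k - B" using reca[of k] by (simp add: B_def \<delta>_def)
    ultimately have "\<delta> k \<le> 1 - q k - p k + A" by linarith
    moreover have "A \<le> (1 / 3) * (\<delta> k + \<delta> (Suc k))"
      unfolding A_def using pq(2)[of k] \<delta>(1)[of k] \<delta>(1)[of "Suc k"] by (intro mult_right_mono) auto
    ultimately show ?thesis using loss[of k] by simp
  qed
  have "summable \<delta>"
  proof (rule summableI_nonneg_bounded)
    fix n
    have "sum \<delta> {..<n} \<le> (\<Sum>k<n. 3 * (1 - 2 * b (Suc k)) + \<delta> (Suc k) / 2)"
      by (rule sum_mono) (rule step)
    also have "\<dots> = 3 * (\<Sum>k<n. 1 - 2 * b (Suc k)) + (\<Sum>k<n. \<delta> (Suc k)) / 2"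
      by (simp only: sum.distrib sum_distrib_left sum_divide_distrib)
    also have "(\<Sum>k<n. 1 - 2 * b (Suc k)) \<le> S"
      unfolding S_def by (rule sum_le_suminf[OF sum]) (simp_all add: b2)
    also have "(\<Sum>k<n. \<delta> (Suc k)) \<le> sum \<delta> {..<n} + 1"
      using sum.lessThan_Suc_shift[of \<delta> n] \<delta>(1)[of 0] \<delta>(2)[of n] by simp
    finally show "sum \<delta> {..<n} \<le> 6 * S + 1" by (simp add: field_simps)
  qed (rule \<delta>)
  from prod_one_minus_bounded_below[OF \<delta> this] show ?thesis by (simp add: \<delta>_def)
qed

section \<open>Diffusions with scale and speed, and their reflection\<close>

lemma entry_time_uminus: "entry_time (\<lambda>t \<omega>. - X t \<omega>) C \<omega> = entry_time X (uminus ` C) \<omega>"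
proof -
  have "{t. 0 \<le> t \<and> - X t \<omega> \<in> C} = {t. 0 \<le> t \<and> X t \<omega> \<in> uminus ` C}"
    by (auto simp: image_iff) (metis minus_minus)
  then show ?thesis by (simp add: entry_time_def)
qed

lemma path_algebra_uminus: "path_algebra M (\<lambda>t \<omega>. - X t \<omega>) = path_algebra M X"
proof -
  have sub: "{(\<lambda>\<omega>. - X t \<omega>) -` B \<inter> space M |t B. 0 \<le> t \<and> B \<in> sets borel} \<subseteq>
       {X t -` B \<inter> space M |t B. 0 \<le> t \<and> B \<in> sets borel}" for X :: "real \<Rightarrow> 'a \<Rightarrow> real"
  proof safe
    fix t :: real and B :: "real set" assume t: "0 \<le> t" and B: "B \<in> sets borel"
    have "(\<lambda>\<omega>. - X t \<omega>) -` B \<inter> space M = X t -` (uminus -` B) \<inter> space M" by auto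
    moreover have "uminus -` B \<in> sets borel"
      using measurable_sets[of uminus borel borel B] B by simp
    ultimately show "\<exists>t' B'. (\<lambda>\<omega>. - X t \<omega>) -` B \<inter> space M = X t' -` B' \<inter> space M \<and> 0 \<le> t' \<and> B' \<in> sets borel"
      using t by blast
  qed
  have "{(\<lambda>\<omega>. - X t \<omega>) -` B \<inter> space M |t B. 0 \<le> t \<and> B \<in> sets borel} =
       {X t -` B \<inter> space M |t B. 0 \<le> t \<and> B \<in> sets borel}"
    using sub[of X] sub[of "\<lambda>t \<omega>. - X t \<omega>"] unfolding minus_minus by (rule antisym)
  then show ?thesis
    unfolding path_algebra_def by (rule arg_cong)
qed

lemma diffusion_reflect:
  assumes "diffusion M F J X \<theta> P"
  shows "diffusion M F (uminus ` J) (\<lambda>t \<omega>. - X t \<omega>) \<theta> (\<lambda>x. P (- x))"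
proof -
  interpret diffusion M F J X \<theta> P by fact
  show ?thesis
  proof (intro diffusion.intro diffusion_axioms.intro filtered_space_axioms, goal_cases)
    case 1
    then show ?case using interval by (auto simp: is_interval_neg_translationI)
  next
    case 2
    then show ?case using interval by auto
  next
    case (3 t \<omega>)
    then show ?case using in_state_space by auto
  next
    case (4 t)
    then show ?case using adapted by simp
  next
    case (5 \<omega>)
    then show ?case using continuous_paths by (intro continuous_on_minus) auto
  next
    case (6 t \<omega>)
    then show ?case using shift_in_space by auto
  next
    case (7 t u \<omega>)
    then show ?case using shift by auto
  next
    case (8 x)
    then have "- x \<in> J" by auto
    then show ?case by (rule prob)
  next
    case (9 x)
    then have "- x \<in> J" by auto
    then show ?case by (rule sets_P)
  next
    case (10 x)
    then have "- x \<in> J" by auto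
    then have "AE \<omega> in P (- x). X 0 \<omega> = - x" by (rule start)
    then show ?case by eventually_elim simp
  next
    case (11 B)
    then have "(\<lambda>x. measure (P x) B) \<in> borel_measurable (restrict_space borel J)"
      unfolding path_algebra_uminus by (rule kernel)
    moreover have "uminus \<in> measurable (restrict_space borel (uminus ` J)) (restrict_space borel J)"
      by (rule measurable_restrict_space3) auto
    ultimately show ?case
      by (rule measurable_compose[rotated])
  next
    case (12 x T B)
    then have "- x \<in> J" and B: "B \<in> sets (path_algebra M X)"
      unfolding path_algebra_uminus by auto
    then show ?case
      using strong_markov[OF \<open>- x \<in> J\<close> 12(2) B] by simp
  qed
qed

locale scaled_diffusion = regular_diffusion M F J X \<theta> P
  for M :: "'a measure" and F J X \<theta> P +
  fixes s :: "real \<Rightarrow> real" and m :: "real measure"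
  assumes interior_nonempty: "interior J \<noteq> {}"
    and s_cont: "continuous_on J s" and s_mono: "strict_mono_on J s"
    and exit_up: "\<And>a b x. a < x \<Longrightarrow> x < b \<Longrightarrow> {a..b} \<subseteq> interior J \<Longrightarrow>
      hit_prob x b {a} = (s x - s a) / (s b - s a)"
    and exit_down: "\<And>a b x. a < x \<Longrightarrow> x < b \<Longrightarrow> {a..b} \<subseteq> interior J \<Longrightarrow>
      hit_prob x a {b} = (s b - s x) / (s b - s a)"
    and sets_m: "sets m = sets (restrict_space borel (interior J))"
    and finite_m: "\<And>K. compact K \<Longrightarrow> K \<subseteq> interior J \<Longrightarrow> emeasure m K < \<infinity>"
    and mean_exit: "\<And>a b x. a < x \<Longrightarrow> x < b \<Longrightarrow> {a..b} \<subseteq> interior J \<Longrightarrow>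
      (\<integral>\<^sup>+\<omega>. min (hitting_time X a \<omega>) (hitting_time X b \<omega>) \<partial>P x) = (\<integral>\<^sup>+y. ennreal (green s a b x y) \<partial>m)"

lemma green_reflect: "green (\<lambda>x. - s (- x)) a b x y = green s (- b) (- a) (- x) (- y)"
proof -
  have "min (- s (- x)) (- s (- y)) = - max (s (- x)) (s (- y))"
    "max (- s (- x)) (- s (- y)) = - min (s (- x)) (s (- y))" by auto
  then show ?thesis by (auto simp: green_def algebra_simps)
qed

lemma hit_prob_reflect:
  assumes "diffusion M F J X \<theta> P"
  shows "diffusion.hit_prob M (\<lambda>t \<omega>. - X t \<omega>) (\<lambda>x. P (- x)) x b C =
    diffusion.hit_prob M X P (- x) (- b) (uminus ` C)"
  unfolding diffusion.hit_prob_def[OF assms] diffusion.hit_prob_def[OF diffusion_reflect[OF assms]]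
  by (simp add: entry_time_uminus)

lemma laplace_reflect:
  assumes "diffusion M F J X \<theta> P"
  shows "diffusion.laplace (\<lambda>t \<omega>. - X t \<omega>) (\<lambda>x. P (- x)) x b C = diffusion.laplace X P (- x) (- b) (uminus ` C)"
  unfolding diffusion.laplace_def[OF assms] diffusion.laplace_def[OF diffusion_reflect[OF assms]]
  by (simp add: entry_time_uminus)

lemma scaled_diffusion_reflect:
  assumes "scaled_diffusion M F J X \<theta> P s m"
  shows "scaled_diffusion M F (uminus ` J) (\<lambda>t \<omega>. - X t \<omega>) \<theta> (\<lambda>x. P (- x)) (\<lambda>x. - s (- x))
    (distr m (restrict_space borel (uminus ` interior J)) uminus)"
proof -
  interpret scaled_diffusion M F J X \<theta> P s m by fact
  interpret R: diffusion M F "uminus ` J" "\<lambda>t \<omega>. - X t \<omega>" \<theta> "\<lambda>x. P (- x)"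
    by (rule diffusion_reflect) unfold_locales
  have D: "diffusion M F J X \<theta> P" by unfold_locales
  have int: "interior (uminus ` J) = uminus ` interior J" by (rule interior_negations)
  have ivl: "- b < - x \<and> - x < - a \<and> {- b..- a} \<subseteq> interior J"
    if "a < x" "x < b" "{a..b} \<subseteq> uminus ` interior J" for a b x :: real
  proof -
    have "y \<in> interior J" if "y \<in> {- b..- a}" for y
    proof -
      have "- y \<in> uminus ` interior J" using that \<open>{a..b} \<subseteq> _\<close> by auto
      then show ?thesis by auto
    qed
    then show ?thesis using that by auto
  qed
  have um: "uminus \<in> measurable m (restrict_space borel (uminus ` interior J))"
    unfolding measurable_cong_sets[OF sets_m refl] by (rule measurable_restrict_space3) auto
  show ?thesis
  proof (unfold_locales, unfold int, goal_cases)
    case (1 x y)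
    then show ?case using regular[of "- x" "- y"] by (auto simp: entry_time_uminus)
  next
    case 2
    then show ?case using interior_nonempty by auto
  next
    case 3
    show ?case
      by (intro continuous_intros continuous_on_compose2[OF s_cont]) auto
  next
    case 4
    show ?case using s_mono by (auto simp: strict_mono_on_def)
  next
    case (5 a b x)
    from ivl[OF this] have i: "- b < - x" "- x < - a" "{- b..- a} \<subseteq> interior J" by auto
    show ?case unfolding hit_prob_reflect[OF D] using exit_down[OF i] by simp
  next
    case (6 a b x)
    from ivl[OF this] have i: "- b < - x" "- x < - a" "{- b..- a} \<subseteq> interior J" by auto
    show ?case unfolding hit_prob_reflect[OF D] using exit_up[OF i] by simp
  next
    case 7
    show ?case by simp
  next
    case (8 K)
    have K: "compact (uminus ` K)" by (rule compact_negations) fact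
    have "uminus ` K \<subseteq> uminus ` uminus ` interior J" using 8(2) by (rule image_mono)
    then have sub: "uminus ` K \<subseteq> interior J" by (simp add: image_image)
    have "K \<in> sets (restrict_space borel (uminus ` interior J))"
      using 8 by (auto simp: sets_restrict_space_iff compact_imp_closed open_negations[OF open_interior])
    then have "emeasure (distr m (restrict_space borel (uminus ` interior J)) uminus) K = emeasure m (uminus -` K \<inter> space m)"
      by (rule emeasure_distr[OF um])
    also have "uminus -` K \<inter> space m = uminus ` K"
    proof -
      have "space m = interior J" using sets_eq_imp_space_eq[OF sets_m] by (simp add: space_restrict_space)
      then show ?thesis using sub by (force simp: image_iff)
    qed
    finally show ?case using finite_m[OF K sub] by simp
  next
    case (9 a b x)
    from ivl[OF this] have i: "- b < - x" "- x < - a" "{- b..- a} \<subseteq> interior J" by auto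
    have "(\<lambda>x. s (- x)) \<in> borel_measurable (restrict_space borel (uminus ` interior J))"
      by (intro borel_measurable_continuous_on_restrict continuous_on_compose2[OF s_cont] continuous_intros)
        (use interior_subset[of J] in auto)
    moreover have "(\<lambda>x. x) \<in> borel_measurable (restrict_space borel (uminus ` interior J))"
      by (rule measurable_restrict_space1) simp
    ultimately have "(\<lambda>y. ennreal (green (\<lambda>x. - s (- x)) a b x y)) \<in> borel_measurable (restrict_space borel (uminus ` interior J))"
      unfolding green_def greaterThanLessThan_iff by measurable
    then have "(\<integral>\<^sup>+y. ennreal (green (\<lambda>x. - s (- x)) a b x y) \<partial>distr m (restrict_space borel (uminus ` interior J)) uminus) =
       (\<integral>\<^sup>+y. ennreal (green (\<lambda>x. - s (- x)) a b x (- y)) \<partial>m)"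
      by (intro nn_integral_distr um) simp
    also have "\<dots> = (\<integral>\<^sup>+y. ennreal (green s (- b) (- a) (- x) y) \<partial>m)"
      by (simp add: green_reflect)
    finally show ?case
      using mean_exit[OF i] by (simp add: entry_time_uminus min.commute)
  qed
qed

section \<open>Climbing to an infinite end of the scale and coming back\<close>

lemma green_quotient_le:
  fixes a b x y :: real
  assumes "a < x" "x < b" "a < y" "y < b"
  shows "2 * (min x y - a) * (b - max x y) / (b - a) \<le> 2 * (x - a)"
proof -
  have "2 * (min x y - a) * ((b - max x y) / (b - a)) \<le> (2 * (x - a)) * 1"
    using assms by (intro mult_mono) auto
  then show ?thesis by simp
qed

context scaled_diffusion
begin

lemma interior_J: "x \<in> interior J \<Longrightarrow> x \<in> J"
  using interior_subset by auto

lemma interior_between: "a \<in> interior J \<Longrightarrow> b \<in> interior J \<Longrightarrow> {a..b} \<subseteq> interior J"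
proof -
  assume ab: "a \<in> interior J" "b \<in> interior J"
  have "is_interval (interior J)"
    using interval(1) convex_interior unfolding is_interval_convex_1 by blast
  then show ?thesis using ab unfolding is_interval_1 by (meson atLeastAtMost_iff subsetI)
qed

lemma strictly_between_interior:
  assumes "a \<in> J" "b \<in> J" "a < x" "x < b"
  shows "x \<in> interior J"
proof -
  have "{a<..<b} \<subseteq> J" using assms interval(1) unfolding is_interval_1
    by (meson greaterThanLessThan_iff less_imp_le subsetI)
  then show ?thesis using assms by (intro interiorI[of "{a<..<b}"]) auto
qed

lemma s_less_iff: "x \<in> J \<Longrightarrow> y \<in> J \<Longrightarrow> s x < s y \<longleftrightarrow> x < y"
  using s_mono by (metis linorder_neqE order_less_asym' strict_mono_onD)

lemma s_le_iff: "x \<in> J \<Longrightarrow> y \<in> J \<Longrightarrow> s x \<le> s y \<longleftrightarrow> x \<le> y"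
  using s_less_iff[of y x] by (auto simp: not_less[symmetric])

lemma hit_prob_le_1: "x \<in> J \<Longrightarrow> hit_prob x b C \<le> 1"
  unfolding hit_prob_def by (intro prob_space.prob_le_1 prob)

lemma laplace_hit_pos: "x \<in> interior J \<Longrightarrow> y \<in> J \<Longrightarrow> 0 < laplace x y {}"
  by (rule laplace_pos) (use regular[of x y] in \<open>auto simp: hit_prob_def interior_J\<close>)

lemma space_m: "space m = interior J"
  using sets_eq_imp_space_eq[OF sets_m] by (simp add: space_restrict_space)

lemma sets_m_iff: "A \<in> sets m \<longleftrightarrow> A \<in> sets borel \<and> A \<subseteq> interior J"
  unfolding sets_m by (subst sets_restrict_space_iff) auto

lemma measurable_s_m [measurable]: "s \<in> borel_measurable m"
  unfolding measurable_cong_sets[OF sets_m refl]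
  by (intro borel_measurable_continuous_on_restrict continuous_on_subset[OF s_cont] interior_subset)

lemma measurable_ident_m [measurable]: "(\<lambda>x. x) \<in> borel_measurable m"
  unfolding measurable_cong_sets[OF sets_m refl] by (rule measurable_restrict_space1) simp

lemma measurable_indicator_m [measurable]:
  assumes "A \<in> sets borel"
  shows "(indicator A :: real \<Rightarrow> ennreal) \<in> borel_measurable m"
  by (rule measurable_compose[OF measurable_ident_m]) (use assms in simp)

text \<open>A ladder of levels at which the distance to \<open>c\<close>, measured in the scale, doubles.\<close>

definition ladder :: "real \<Rightarrow> (nat \<Rightarrow> real) \<Rightarrow> bool" where
  "ladder c z \<longleftrightarrow> c \<in> interior J \<and> c < z 0 \<and> (\<forall>k. z k \<in> interior J \<and> s (z k) - s c = (s (z 0) - s c) * 2 ^ k)"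

lemma ladder_exists:
  assumes c: "c \<in> interior J" "x \<in> interior J" "c < x" and unbounded: "\<And>K. \<exists>z\<in>interior J. K < s z"
  obtains z where "ladder c z" "z 0 = x"
proof -
  have J: "c \<in> J" "x \<in> J" using c by (auto intro: interior_J)
  have D: "0 < s x - s c" using s_less_iff[OF J] c by simp
  have ex: "\<exists>z\<in>interior J. s z - s c = (s x - s c) * 2 ^ k" for k
  proof -
    obtain w where w: "w \<in> interior J" "s c + (s x - s c) * 2 ^ k < s w" using unbounded by blast
    have "(s x - s c) * 1 \<le> (s x - s c) * 2 ^ k"
      by (rule mult_left_mono) (use D in auto)
    then have "s x \<le> s c + (s x - s c) * 2 ^ k" by simp
    moreover have "x \<le> w" using w(2) calculation s_le_iff[OF J(2) interior_J[OF w(1)]] by simp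
    moreover have "continuous_on {x..w} s"
      using interior_between[OF c(2) w(1)] interior_subset by (intro continuous_on_subset[OF s_cont]) auto
    ultimately obtain z where "x \<le> z" "z \<le> w" "s z = s c + (s x - s c) * 2 ^ k"
      using IVT'[of s x "s c + (s x - s c) * 2 ^ k" w] w(2) by auto
    moreover from this have "z \<in> interior J" using interior_between[OF c(2) w(1)] by auto
    ultimately show ?thesis by (intro bexI[of _ z]) auto
  qed
  define z where "z k = (if k = 0 then x else SOME z. z \<in> interior J \<and> s z - s c = (s x - s c) * 2 ^ k)" for k
  have z0: "z 0 = x" by (simp add: z_def)
  have zk: "z k \<in> interior J \<and> s (z k) - s c = (s x - s c) * 2 ^ k" for k
  proof (cases "k = 0")
    case False
    have "\<exists>z. z \<in> interior J \<and> s z - s c = (s x - s c) * 2 ^ k" using ex[of k] by blast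
    from someI_ex[OF this] show ?thesis unfolding z_def using False by (simp only: if_False)
  qed (simp add: z_def c)
  have "ladder c z" unfolding ladder_def z0 using c zk by blast
  then show thesis using z0 by (rule that)
qed

lemma ladder_facts:
  assumes "ladder c z"
  shows "c \<in> interior J" "z k \<in> interior J" "c < z k" "z k < z (Suc k)" "strict_mono z"
    "0 < s (z 0) - s c" "s (z k) - s c = (s (z 0) - s c) * 2 ^ k"
proof -
  have z: "c \<in> interior J" "c < z 0" and zk: "z k \<in> interior J"
    and eq: "s (z k) - s c = (s (z 0) - s c) * 2 ^ k" for k
    using assms unfolding ladder_def by blast+
  have J: "c \<in> J" "z k \<in> J" for k using z(1) zk by (auto intro: interior_J)
  show D: "0 < s (z 0) - s c" using z(2) s_less_iff[OF J(1) J(2)[of 0]] by simp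
  have less: "z k < z (Suc k)" for k
  proof -
    have "(s (z 0) - s c) * 2 ^ k < (s (z 0) - s c) * 2 ^ Suc k"
      using D by (intro mult_strict_left_mono) auto
    then have "s (z k) < s (z (Suc k))" unfolding eq[symmetric] by simp
    then show ?thesis using s_less_iff[OF J(2) J(2)] by blast
  qed
  show sm: "strict_mono z" unfolding strict_mono_Suc_iff using less by blast
  show "c < z k" using strict_mono_less_eq[OF sm, of 0 k] z(2) by simp
  show "c \<in> interior J" "z k \<in> interior J" "z k < z (Suc k)" "s (z k) - s c = (s (z 0) - s c) * 2 ^ k"
    by (fact z zk less eq)+
qed

lemma ladder_up:
  assumes z: "ladder c z"
  defines "p \<equiv> \<lambda>k. laplace (z (Suc k)) (z (Suc (Suc k))) {z k}"
    and "q \<equiv> \<lambda>k. laplace (z (Suc k)) (z k) {z (Suc (Suc k))}"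
    and "b \<equiv> \<lambda>k. laplace (z k) (z (Suc k)) {c}"
    and "a \<equiv> \<lambda>k. laplace (z (Suc k)) (z k) {}"
  shows "0 < b k" "b k \<le> 1 / 2" "b (Suc k) = p k + q k * (b k * b (Suc k))"
    "0 \<le> p k" "p k \<le> 1 / 3" "0 \<le> q k" "q k \<le> 2 / 3"
    "0 < a k" "a k \<le> 1" "a k = q k + p k * (a (Suc k) * a k)"
    "laplace (z 0) (z k) {c} = (\<Prod>j<k. b j)" "laplace (z k) (z 0) {} = (\<Prod>j<k. a j)"
proof -
  note l = ladder_facts[OF z]
  define D where "D = s (z 0) - s c"
  have D: "0 < D" using l(6) by (simp add: D_def)
  have s: "s (z k) = s c + D * 2 ^ k" for k using l(7)[of k, folded D_def] by (simp only: diff_eq_eq add.commute)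
  have J: "c \<in> J" "z k \<in> J" for k using l(1,2) interior_J by auto
  have less2: "z k < z (Suc (Suc k))" for k using l(4)[of k] l(4)[of "Suc k"] by simp
  have up: "hit_prob (z k) (z (Suc k)) {c} = 1 / 2" for k
  proof -
    have "hit_prob (z k) (z (Suc k)) {c} = (s (z k) - s c) / (s (z (Suc k)) - s c)"
      by (rule exit_up) (use l(3,4)[of k] interior_between[OF l(1) l(2)[of "Suc k"]] in auto)
    then show ?thesis using D by (simp add: s)
  qed
  show b_pos: "0 < b k" for k
    unfolding b_def by (rule laplace_pos) (use J up[of k] in auto)
  show "b k \<le> 1 / 2"
    unfolding b_def using laplace_le_hit_prob[of "z k" "{c}" "z (Suc k)"] up[of k] J by simp
  have sub: "{z k..z (Suc (Suc k))} \<subseteq> interior J" by (rule interior_between[OF l(2) l(2)])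
  have "hit_prob (z (Suc k)) (z (Suc (Suc k))) {z k} = (s (z (Suc k)) - s (z k)) / (s (z (Suc (Suc k))) - s (z k))"
    by (rule exit_up[OF l(4) l(4) sub])
  also have "\<dots> = (D * 2 ^ k) / (D * 2 ^ k * 3)" by (simp add: s algebra_simps)
  also have "\<dots> = 1 / 3" using D by simp
  finally show "p k \<le> 1 / 3"
    unfolding p_def using laplace_le_hit_prob[of "z (Suc k)" "{z k}" "z (Suc (Suc k))"] J by simp
  have "hit_prob (z (Suc k)) (z k) {z (Suc (Suc k))} = (s (z (Suc (Suc k))) - s (z (Suc k))) / (s (z (Suc (Suc k))) - s (z k))"
    by (rule exit_down[OF l(4) l(4) sub])
  also have "\<dots> = (D * 2 ^ k * 2) / (D * 2 ^ k * 3)" by (simp add: s algebra_simps)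
  also have "\<dots> = 2 / 3" using D by simp
  finally show "q k \<le> 2 / 3"
    unfolding q_def using laplace_le_hit_prob[of "z (Suc k)" "{z (Suc (Suc k))}" "z k"] J by simp
  show "0 \<le> p k" "0 \<le> q k" by (simp_all add: p_def q_def laplace_nonneg)
  have cz: "c < z k" "c \<noteq> z k" "z k \<noteq> c" for k using l(3)[of k] by auto
  have nz: "z k \<noteq> z (Suc (Suc k))" "z (Suc k) \<noteq> z k" "z (Suc (Suc k)) \<noteq> z k" "z (Suc k) \<noteq> z (Suc (Suc k))"
    using l(4)[of k] l(4)[of "Suc k"] by auto
  have "b (Suc k) = laplace (z (Suc k)) (z (Suc (Suc k))) {z k, c} +
      laplace (z (Suc k)) (z k) {z (Suc (Suc k)), c} * laplace (z k) (z (Suc (Suc k))) {c}"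
    unfolding b_def by (rule laplace_decompose) (use J nz in auto)
  also have "laplace (z (Suc k)) (z (Suc (Suc k))) {z k, c} = p k"
    unfolding p_def by (rule laplace_drop_behind_barrier) (use J cz(1)[of k] l(4)[of k] in auto)
  also have "laplace (z (Suc k)) (z k) {z (Suc (Suc k)), c} = q k"
    unfolding q_def insert_commute[of "z (Suc (Suc k))" c]
    by (rule laplace_drop_behind_target) (use J cz[of k] l(4)[of k] in auto)
  also have "laplace (z k) (z (Suc (Suc k))) {c} = b k * b (Suc k)"
    unfolding b_def by (rule laplace_multiplicative) (use J l(4)[of k] l(4)[of "Suc k"] in auto)
  finally show "b (Suc k) = p k + q k * (b k * b (Suc k))" .
  show "0 < a k" unfolding a_def by (rule laplace_hit_pos) (rule l(2) J)+
  show "a k \<le> 1" unfolding a_def by (rule laplace_le_1) (rule J)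
  have "a k = laplace (z (Suc k)) (z k) {z (Suc (Suc k))} +
      laplace (z (Suc k)) (z (Suc (Suc k))) {z k} * laplace (z (Suc (Suc k))) (z k) {}"
    unfolding a_def by (rule laplace_decompose) (use J nz in auto)
  also have "laplace (z (Suc (Suc k))) (z k) {} = a (Suc k) * a k"
    unfolding a_def by (rule laplace_multiplicative) (use J l(4)[of k] l(4)[of "Suc k"] in auto)
  finally show "a k = q k + p k * (a (Suc k) * a k)" by (simp add: p_def q_def)
  show "laplace (z 0) (z k) {c} = (\<Prod>j<k. b j)"
  proof (induction k)
    case 0
    then show ?case using laplace_self[of "z 0" "{c}"] J cz by simp
  next
    case (Suc k)
    have "laplace (z 0) (z (Suc k)) {c} = laplace (z 0) (z k) {c} * laplace (z k) (z (Suc k)) {c}"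
      by (rule laplace_multiplicative) (use J l(4)[of k] strict_mono_less_eq[OF l(5)] in auto)
    then show ?case using Suc by (simp add: b_def)
  qed
  show "laplace (z k) (z 0) {} = (\<Prod>j<k. a j)"
  proof (induction k)
    case 0
    then show ?case using laplace_self[of "z 0" "{}"] J by simp
  next
    case (Suc k)
    show ?case
    proof (cases "k = 0")
      case False
      then have "laplace (z (Suc k)) (z 0) {} = laplace (z (Suc k)) (z k) {} * laplace (z k) (z 0) {}"
        using strict_mono_less[OF l(5), of 0 k] l(4)[of k] by (intro laplace_multiplicative) (use J in auto)
      then show ?thesis using Suc by (simp add: a_def)
    qed (simp add: a_def)
  qed
qed

definition right_mass_finite :: "real \<Rightarrow> bool" where
  "right_mass_finite c \<longleftrightarrow> (\<exists>C. \<forall>x\<in>interior J. c < x \<longrightarrow>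
     (\<integral>\<^sup>+y\<in>{c<..x}. ennreal (s y - s c) \<partial>m) \<le> ennreal C)"

text \<open>On one step of the ladder the Green function is at most twice the distance to \<open>c\<close>. Hence the
  mean durations of the steps are summable if that distance is integrable against the speed
  measure.\<close>

lemma climb_of_mass_finite:
  assumes z: "ladder c z" and mass: "right_mass_finite c"
  shows "\<exists>d>0. \<forall>n. d \<le> 2 ^ n * laplace (z 0) (z n) {c}"
proof -
  note l = ladder_facts[OF z] and u = ladder_up[OF z]
  let ?T = "\<lambda>k. \<integral>\<^sup>+\<omega>. min (hitting_time X (z k) \<omega>) (hitting_time X (z (Suc (Suc k))) \<omega>) \<partial>P (z (Suc k))"
  let ?I = "\<lambda>a b. \<integral>\<^sup>+y\<in>{a<..b}. ennreal (s y - s c) \<partial>m"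
  have J: "c \<in> J" "z k \<in> J" for k using l(1,2) interior_J by auto
  obtain C0 where C0: "\<And>x. x \<in> interior J \<Longrightarrow> c < x \<Longrightarrow> ?I c x \<le> ennreal C0"
    using mass by (auto simp: right_mass_finite_def)
  define C where "C = max C0 0"
  have C: "?I c (z n) \<le> ennreal C" for n
    using C0[OF l(2) l(3), of n] by (auto simp: C_def intro: order_trans ennreal_leI)
  have split: "?I a b + ?I b d = ?I a d" if "a \<le> b" "b \<le> d" for a b d
    using that by (subst nn_integral_add[symmetric])
      (auto intro!: nn_integral_cong simp: indicator_def)
  have T_le: "?T k \<le> 2 * (?I (z k) (z (Suc k)) + ?I (z (Suc k)) (z (Suc (Suc k))))" for k
  proof -
    have "?T k = (\<integral>\<^sup>+y. ennreal (green s (z k) (z (Suc (Suc k))) (z (Suc k)) y) \<partial>m)"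
      by (rule mean_exit[OF l(4) l(4) interior_between[OF l(2) l(2)]])
    also have "\<dots> \<le> (\<integral>\<^sup>+y. 2 * (ennreal (s y - s c) * indicator {z k<..z (Suc (Suc k))} y) \<partial>m)"
    proof (rule nn_integral_mono)
      fix y assume "y \<in> space m"
      then have y: "y \<in> interior J" "y \<in> J" by (auto simp: space_m interior_J)
      show "ennreal (green s (z k) (z (Suc (Suc k))) (z (Suc k)) y) \<le>
          2 * (ennreal (s y - s c) * indicator {z k<..z (Suc (Suc k))} y)"
      proof (cases "z k < y \<and> y < z (Suc (Suc k))")
        case True
        let ?a = "s (z k)" and ?x = "s (z (Suc k))" and ?b = "s (z (Suc (Suc k)))"
        have a: "?a < s y" "?a < ?x" "?x < ?b" "s y < ?b" using True l(4) J y s_less_iff by auto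
        have "2 * (min ?x (s y) - ?a) * (?b - max ?x (s y)) / (?b - ?a) \<le> 2 * (?x - ?a)"
          by (rule green_quotient_le) (use a in auto)
        also have "?x - ?a = ?a - s c" using l(7)[of k] l(7)[of "Suc k"] by simp
        also have "2 * (?a - s c) \<le> 2 * (s y - s c)" using a by simp
        finally have "green s (z k) (z (Suc (Suc k))) (z (Suc k)) y \<le> 2 * (s y - s c)"
          using True l(4) by (simp add: green_def)
        moreover have "0 \<le> s y - s c" using a l(3)[of k] s_less_iff[OF J(1) J(2)[of k]] by simp
        ultimately have "ennreal (green s (z k) (z (Suc (Suc k))) (z (Suc k)) y) \<le> 2 * ennreal (s y - s c)"
          by (metis ennreal_leI ennreal_mult ennreal_numeral zero_le_numeral)
        then show ?thesis using True by simp
      qed (auto simp: green_def)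
    qed
    also have "\<dots> = 2 * ?I (z k) (z (Suc (Suc k)))" by (rule nn_integral_cmult) measurable
    finally show ?thesis unfolding split[OF less_imp_le[OF l(4)] less_imp_le[OF l(4)]] .
  qed
  have T_finite: "?T k \<noteq> \<infinity>" for k
  proof -
    have "?I (z k) (z (Suc (Suc k))) \<le> ?I c (z (Suc (Suc k)))"
      by (rule nn_integral_mono) (use l(3)[of k] in \<open>auto simp: indicator_def\<close>)
    also have "\<dots> \<le> ennreal C" by (rule C)
    finally have "2 * ?I (z k) (z (Suc (Suc k))) < \<infinity>"
      by (simp add: ennreal_mult_less_top le_less_trans)
    from le_less_trans[OF T_le[of k, unfolded split[OF less_imp_le[OF l(4)] less_imp_le[OF l(4)]]] this]
    show ?thesis by (rule less_imp_neq)
  qed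
  define e where "e k = enn2real (?T k)" for k
  have e: "ennreal (e k) = ?T k" for k
    unfolding e_def by (rule ennreal_enn2real) (use T_finite[of k] in \<open>simp add: less_top\<close>)
  have loss: "1 \<le> laplace (z (Suc k)) (z (Suc (Suc k))) {z k} + laplace (z (Suc k)) (z k) {z (Suc (Suc k))} + e k" for k
  proof -
    have "1 \<le> ennreal (laplace (z (Suc k)) (z (Suc (Suc k))) {z k}) + ennreal (laplace (z (Suc k)) (z k) {z (Suc (Suc k))}) + ennreal (e k)"
      unfolding e by (rule exit_loss_le_mean_exit_time) (use J l(4)[of k] l(4)[of "Suc k"] in auto)
    also have "\<dots> = ennreal (laplace (z (Suc k)) (z (Suc (Suc k))) {z k} + laplace (z (Suc k)) (z k) {z (Suc (Suc k))} + e k)"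
      by (simp add: laplace_nonneg e_def)
    finally show ?thesis by simp
  qed
  have sum_T: "(\<Sum>k<n. ?T k) \<le> 2 * ?I (z 0) (z n) + 2 * ?I (z 0) (z (Suc n))" for n
  proof (induction n)
    case (Suc n)
    have le: "z 0 \<le> z n" "z 0 \<le> z (Suc n)" "z n \<le> z (Suc n)" "z (Suc n) \<le> z (Suc (Suc n))"
      using strict_mono_less_eq[OF l(5)] by auto
    have "(\<Sum>k<Suc n. ?T k) \<le> (2 * ?I (z 0) (z n) + 2 * ?I (z 0) (z (Suc n))) +
        2 * (?I (z n) (z (Suc n)) + ?I (z (Suc n)) (z (Suc (Suc n))))"
      unfolding sum.lessThan_Suc by (rule add_mono[OF Suc T_le])
    also have "\<dots> = 2 * (?I (z 0) (z n) + ?I (z n) (z (Suc n))) + 2 * (?I (z 0) (z (Suc n)) + ?I (z (Suc n)) (z (Suc (Suc n))))"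
      by (simp add: distrib_left ac_simps)
    finally show ?case unfolding split[OF le(1,3)] split[OF le(2,4)] .
  qed simp
  have "summable e"
  proof (rule summableI_nonneg_bounded)
    fix n
    have sub: "?I (z 0) (z n) \<le> ennreal C" for n
      by (rule order_trans[OF nn_integral_mono C[of n]]) (use l(3)[of 0] in \<open>auto simp: indicator_def\<close>)
    have "ennreal (sum e {..<n}) = (\<Sum>k<n. ?T k)"
      unfolding e[symmetric] by (rule sum_ennreal[symmetric]) (simp add: e_def)
    also have "\<dots> \<le> 2 * ennreal C + 2 * ennreal C"
      by (rule order_trans[OF sum_T]) (intro add_mono mult_left_mono sub, auto)
    also have "\<dots> = ennreal (4 * C)"
    proof -
      have "2 * ennreal C + 2 * ennreal C = (2 + 2) * ennreal C" by (simp only: distrib_right)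
      then show ?thesis by (simp add: ennreal_mult')
    qed
    finally show "sum e {..<n} \<le> 4 * C" by (simp add: C_def)
  qed (simp add: e_def)
  from climb_bounded_below[OF u(1,2,3,4,5,6,7) loss this]
  obtain d where "0 < d" "\<And>n. d \<le> (\<Prod>k<n. 2 * laplace (z k) (z (Suc k)) {c})" by blast
  moreover have "(\<Prod>k<n. 2 * laplace (z k) (z (Suc k)) {c}) = 2 ^ n * laplace (z 0) (z n) {c}" for n
    unfolding u(11) by (simp add: prod.distrib)
  ultimately show ?thesis by auto
qed

lemma descend_of_climb:
  assumes z: "ladder c z" and d: "0 < d" "\<And>n. d \<le> 2 ^ n * laplace (z 0) (z n) {c}"
  shows "\<exists>d>0. \<forall>n. d \<le> laplace (z n) (z 0) {}"
proof -
  note u = ladder_up[OF z]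
  have "d \<le> (\<Prod>k<n. 2 * laplace (z k) (z (Suc k)) {c})" for n
    using d(2)[of n] unfolding u(11) by (simp add: prod.distrib)
  from descend_bounded_below[OF u(1,2,3,4,5,6,7) d(1) this u(8,9,10)]
  show ?thesis unfolding u(12) .
qed

end

section \<open>Coming down from an end\<close>

context scaled_diffusion
begin

definition comes_down :: "real \<Rightarrow> bool" where
  "comes_down c \<longleftrightarrow> (\<exists>\<delta>>0. \<forall>x\<in>J. c < x \<longrightarrow> \<delta> \<le> laplace x c {})"

lemma laplace_antimono_start:
  assumes "c \<in> J" "x \<in> J" "y \<in> J" "c < x" "x \<le> y"
  shows "laplace y c {} \<le> laplace x c {}"
proof -
  have "laplace y c {} = laplace y x {} * laplace x c {}"
    by (rule laplace_multiplicative) (use assms in auto)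
  also have "\<dots> \<le> 1 * laplace x c {}"
    by (rule mult_right_mono) (use assms in \<open>auto simp: laplace_nonneg laplace_le_1\<close>)
  finally show ?thesis by simp
qed

lemma comes_down_change_base:
  assumes c: "c \<in> interior J" "d \<in> interior J" and down: "comes_down c"
  shows "comes_down d"
proof -
  obtain \<delta> where \<delta>: "0 < \<delta>" "\<And>x. x \<in> J \<Longrightarrow> c < x \<Longrightarrow> \<delta> \<le> laplace x c {}"
    using down by (auto simp: comes_down_def)
  have J: "c \<in> J" "d \<in> J" using c by (auto intro: interior_J)
  have pos: "0 < laplace c d {}" by (rule laplace_hit_pos[OF c(1) J(2)])
  show ?thesis
  proof (cases "c \<le> d")
    case True
    have "\<delta> \<le> laplace x d {}" if x: "x \<in> J" "d < x" for x
    proof (cases "c = d")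
      case False
      have "\<delta> \<le> laplace x c {}" using \<delta>(2)[OF x(1)] True x by simp
      also have "\<dots> = laplace x d {} * laplace d c {}"
        by (rule laplace_multiplicative) (use x J True False in auto)
      also have "\<dots> \<le> laplace x d {} * 1"
        by (rule mult_left_mono) (use J in \<open>auto simp: laplace_nonneg laplace_le_1\<close>)
      finally show ?thesis by simp
    qed (use \<delta>(2)[OF x(1)] x in simp)
    then show ?thesis using \<delta>(1) by (auto simp: comes_down_def)
  next
    case False
    define \<eta> where "\<eta> = min 1 \<delta> * laplace c d {}"
    have "\<eta> \<le> laplace x d {}" if x: "x \<in> J" "d < x" for x
    proof (cases "c < x")
      case True
      have "\<eta> \<le> laplace x c {} * laplace c d {}"
        unfolding \<eta>_def using \<delta>(2)[OF x(1) True] pos by (intro mult_right_mono) auto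
      also have "\<dots> = laplace x d {}"
        by (rule laplace_multiplicative[symmetric]) (use x J True False in auto)
      finally show ?thesis .
    next
      case xc: False
      have "\<eta> \<le> 1 * laplace c d {}" unfolding \<eta>_def using pos by (intro mult_right_mono) auto
      also have "\<dots> \<le> laplace x d {}"
        using laplace_antimono_start[of d x c] x J xc by simp
      finally show ?thesis .
    qed
    moreover have "0 < \<eta>" using \<delta>(1) pos by (simp add: \<eta>_def)
    ultimately show ?thesis by (auto simp: comes_down_def)
  qed
qed

text \<open>If \<open>c\<close> is hit by time \<open>t\<close> with probability at least \<open>\<delta> / 2\<close> from everywhere above, the mean
  time \<open>S\<close> to leave \<open>(c, b)\<close> satisfies \<open>S \<le> t + (1 - \<delta> / 2) S\<close>, so that it is bounded
  independently of \<open>b\<close>. The Green formula turns this into a bound on the speed measure.\<close>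

lemma mean_exit_bounded_of_comes_down:
  assumes c: "c \<in> interior J" and b: "b \<in> interior J" "c < b"
    and \<delta>: "0 < \<delta>" "\<delta> \<le> 1" "\<And>x. x \<in> J \<Longrightarrow> c < x \<Longrightarrow> \<delta> \<le> laplace x c {}"
    and x: "c < x" "x < b"
  shows "(\<integral>\<^sup>+\<omega>. min (hitting_time X c \<omega>) (hitting_time X b \<omega>) \<partial>P x) \<le> ennreal (2 * ln (2 / \<delta>) / \<delta>)"
proof -
  define t where "t = ln (2 / \<delta>)"
  have t: "0 \<le> t" "exp (- t) = \<delta> / 2" using \<delta> by (simp_all add: t_def exp_minus)
  let ?\<sigma> = "\<lambda>\<omega>. min (hitting_time X c \<omega>) (hitting_time X b \<omega>)"
  let ?E = "\<lambda>x. \<integral>\<^sup>+\<omega>. ?\<sigma> \<omega> \<partial>P x"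
  define S where "S = (SUP x\<in>{c<..<b}. ?E x)"
  have sub: "{c..b} \<subseteq> interior J" by (rule interior_between[OF c b(1)])
  have J: "y \<in> J" if "y \<in> {c..b}" for y using sub that interior_J by auto
  have S_finite: "S < \<infinity>"
  proof -
    have "?E y \<le> 2 * ennreal (s b - s c) * emeasure m {c..b}" if y: "y \<in> {c<..<b}" for y
    proof -
      have "?E y = (\<integral>\<^sup>+z. ennreal (green s c b y z) \<partial>m)" by (rule mean_exit) (use y sub in auto)
      also have "\<dots> \<le> (\<integral>\<^sup>+z. ennreal (2 * (s b - s c)) * indicator {c..b} z \<partial>m)"
      proof (rule nn_integral_mono)
        fix z assume "z \<in> space m"
        show "ennreal (green s c b y z) \<le> ennreal (2 * (s b - s c)) * indicator {c..b} z"
        proof (cases "c < z \<and> z < b")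
          case True
          have "s c < s y" "s y < s b" "s c < s z" "s z < s b"
            using True y J by (simp_all add: s_less_iff)
          from green_quotient_le[OF this] this have "green s c b y z \<le> 2 * (s b - s c)"
            using True y by (simp add: green_def)
          then show ?thesis using True by (simp add: ennreal_leI)
        qed (use y in \<open>auto simp: green_def\<close>)
      qed
      also have "\<dots> = ennreal (2 * (s b - s c)) * emeasure m {c..b}"
        using sub by (intro nn_integral_cmult_indicator) (simp add: sets_m_iff)
      also have "ennreal (2 * (s b - s c)) = 2 * ennreal (s b - s c)" by (subst ennreal_mult') simp_all
      finally show ?thesis .
    qed
    then have "S \<le> 2 * ennreal (s b - s c) * emeasure m {c..b}"
      unfolding S_def by (rule SUP_least)
    also have "\<dots> < \<infinity>"
      using finite_m[OF _ sub] by (simp add: ennreal_mult_less_top)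
    finally show ?thesis .
  qed
  have step: "?E y \<le> ennreal t + ennreal (1 - \<delta> / 2) * S" if y: "y \<in> {c<..<b}" for y
  proof -
    have yJ: "y \<in> J" using J[of y] y by auto
    interpret prob_space "P y" using prob yJ .
    let ?A = "{\<omega>\<in>space M. \<not> ?\<sigma> \<omega> \<le> ennreal t}"
    have \<sigma>_paths: "?\<sigma> \<in> borel_measurable (path_algebra M X)"
      using measurable_entry_time_paths[of "{c}"] measurable_entry_time_paths[of "{b}"]
      by (intro borel_measurable_min) auto
    have A_F: "?A \<in> sets (F t)"
    proof -
      have X: "X v \<in> borel_measurable (F t)" if "0 \<le> v" "v \<le> t" for v
      proof (rule measurable_from_subalg)
        show "subalgebra (F t) (F v)" unfolding subalgebra_def using that F_mono[of v t] by simp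
      qed (rule adapted, fact)
      have "{\<omega>\<in>space M. hitting_time X a \<omega> \<le> ennreal t} \<in> sets (F t)" for a
        by (rule entry_time_measurable_upto[OF space_Ft[OF t(1)] X closed_singleton t(1)])
      then have "space (F t) - ({\<omega>\<in>space M. hitting_time X c \<omega> \<le> ennreal t} \<union> {\<omega>\<in>space M. hitting_time X b \<omega> \<le> ennreal t}) \<in> sets (F t)"
        by (intro sets.compl_sets sets.Un)
      also have "space (F t) - ({\<omega>\<in>space M. hitting_time X c \<omega> \<le> ennreal t} \<union> {\<omega>\<in>space M. hitting_time X b \<omega> \<le> ennreal t}) = ?A"
        using t(1) by (auto simp: min_le_iff_disj)
      finally show ?thesis .
    qed
    then have A_P: "?A \<in> sets (P y)"
      using subalgebra_F[OF t(1)] sets_P[OF yJ] by (auto simp: subalgebra_def)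
    have A_le: "measure (P y) ?A \<le> 1 - \<delta> / 2"
    proof -
      have "\<delta> \<le> laplace y c {}" using \<delta>(3)[OF yJ] y by simp
      also have "\<dots> \<le> measure (P y) {\<omega>\<in>space M. hitting_time X c \<omega> \<le> ennreal t \<and> hitting_time X c \<omega> < entry_time X {} \<omega>}
          + exp (- t) * hit_prob y c {}"
        by (rule laplace_le_early_plus_late[OF yJ _ t(1)]) simp
      also have "measure (P y) {\<omega>\<in>space M. hitting_time X c \<omega> \<le> ennreal t \<and> hitting_time X c \<omega> < entry_time X {} \<omega>}
          \<le> measure (P y) (space (P y) - ?A)"
      proof (rule finite_measure_mono)
        show "space (P y) - ?A \<in> sets (P y)" using A_P by (rule sets.compl_sets)
        show "{\<omega>\<in>space M. hitting_time X c \<omega> \<le> ennreal t \<and> hitting_time X c \<omega> < entry_time X {} \<omega>} \<subseteq> space (P y) - ?A"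
          using yJ by (auto simp: min_le_iff_disj)
      qed
      also have "\<dots> = 1 - measure (P y) ?A" by (rule prob_compl[OF A_P])
      also have "exp (- t) * hit_prob y c {} \<le> (\<delta> / 2) * 1"
        unfolding t(2) using \<delta>(1) hit_prob_le_1[OF yJ] by (intro mult_left_mono) auto
      finally show ?thesis by simp
    qed
    have "?E y \<le> (\<integral>\<^sup>+\<omega>. ennreal t + indicator ?A \<omega> * ?\<sigma> (\<theta> t \<omega>) \<partial>P y)"
    proof (rule nn_integral_mono)
      fix \<omega> assume "\<omega> \<in> space (P y)"
      then have \<omega>: "\<omega> \<in> space M" using yJ by simp
      show "?\<sigma> \<omega> \<le> ennreal t + indicator ?A \<omega> * ?\<sigma> (\<theta> t \<omega>)"
      proof (cases "?\<sigma> \<omega> \<le> ennreal t")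
        case True
        then show ?thesis by (simp add: add_increasing2)
      next
        case False
        have "\<omega> \<in> ?A" using False \<omega> by blast
        moreover have "hitting_time X c \<omega> = ennreal t + hitting_time X c (\<theta> t \<omega>)"
          "hitting_time X b \<omega> = ennreal t + hitting_time X b (\<theta> t \<omega>)"
          using False t(1) by (auto intro!: entry_time_shift[OF \<omega>] simp: min_le_iff_disj not_le)
        moreover have "min (ennreal t + u) (ennreal t + v) = ennreal t + min u v" for u v
          by (simp add: min_def)
        ultimately show ?thesis by simp
      qed
    qed
    also have "\<dots> = (\<integral>\<^sup>+\<omega>. ennreal t \<partial>P y) + (\<integral>\<^sup>+\<omega>. indicator ?A \<omega> * ?\<sigma> (\<theta> t \<omega>) \<partial>P y)"
    proof (rule nn_integral_add)
      have "(\<lambda>\<omega>. ?\<sigma> (\<theta> t \<omega>)) \<in> borel_measurable M"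
        using measurable_compose[OF measurable_shift_at[of "\<lambda>_. ennreal t"] \<sigma>_paths] t(1) by simp
      then show "(\<lambda>\<omega>. indicator ?A \<omega> * ?\<sigma> (\<theta> t \<omega>)) \<in> borel_measurable (P y)"
        using A_P by (intro borel_measurable_times_ennreal) (simp_all add: measurable_P_iff[OF yJ])
    qed simp
    also have "(\<integral>\<^sup>+\<omega>. indicator ?A \<omega> * ?\<sigma> (\<theta> t \<omega>) \<partial>P y) = (\<integral>\<^sup>+\<omega>. indicator ?A \<omega> * ?E (X t \<omega>) \<partial>P y)"
      by (rule markov_nn[OF yJ t(1) _ \<sigma>_paths]) (use A_F in simp)
    also have "\<dots> \<le> (\<integral>\<^sup>+\<omega>. S * indicator ?A \<omega> \<partial>P y)"
    proof (rule nn_integral_mono_AE)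
      show "AE \<omega> in P y. indicator ?A \<omega> * ?E (X t \<omega>) \<le> S * indicator ?A \<omega>"
        using start_eq[OF yJ]
      proof eventually_elim
        case (elim \<omega>)
        show ?case
        proof (cases "\<omega> \<in> ?A")
          case True
          have late: "ennreal t < hitting_time X c \<omega>" "ennreal t < hitting_time X b \<omega>"
            using True by (auto simp: not_le)
          have nc: "X u \<omega> \<noteq> c \<and> X u \<omega> \<noteq> b" if "0 \<le> u" "u \<le> t" for u
          proof -
            have "ennreal u \<le> ennreal t" using that by (simp add: ennreal_leI)
            then have "ennreal u < hitting_time X c \<omega>" "ennreal u < hitting_time X b \<omega>"
              using late by (auto intro: le_less_trans)
            then show ?thesis
              using not_in_before_entry_time[of u X "{c}" \<omega>] not_in_before_entry_time[of u X "{b}" \<omega>] that by blast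
          qed
          have cont: "continuous_on {0..t} (\<lambda>u. X u \<omega>)"
            by (rule continuous_on_subset[OF continuous_paths]) (use elim in auto)
          have "c < X t \<omega>"
          proof (rule ccontr)
            assume "\<not> c < X t \<omega>"
            then obtain u where "0 \<le> u" "u \<le> t" "X u \<omega> = c"
              using IVT2'[of "\<lambda>u. X u \<omega>" t c 0] t(1) cont elim y by auto
            then show False using nc by blast
          qed
          moreover have "X t \<omega> < b"
          proof (rule ccontr)
            assume "\<not> X t \<omega> < b"
            then obtain u where "0 \<le> u" "u \<le> t" "X u \<omega> = b"
              using IVT'[of "\<lambda>u. X u \<omega>" 0 b t] t(1) cont elim y by auto
            then show False using nc by blast
          qed
          ultimately have "?E (X t \<omega>) \<le> S" unfolding S_def by (intro SUP_upper) simp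
          then show ?thesis by (subst mult.commute) (rule mult_right_mono, simp_all)
        qed simp
      qed
    qed
    also have "\<dots> = S * ennreal (measure (P y) ?A)"
      using A_P by (simp add: nn_integral_cmult_indicator emeasure_eq_measure)
    also have "\<dots> \<le> S * ennreal (1 - \<delta> / 2)"
      by (intro mult_left_mono ennreal_leI A_le) simp
    also have "(\<integral>\<^sup>+\<omega>. ennreal t \<partial>P y) = ennreal t" by (simp add: emeasure_space_1)
    finally show ?thesis by (simp add: mult.commute)
  qed
  have "S \<le> ennreal t + ennreal (1 - \<delta> / 2) * S"
    unfolding S_def by (rule SUP_least) (rule step[unfolded S_def])
  moreover obtain r where r: "S = ennreal r" "0 \<le> r" using S_finite by (cases S) auto
  ultimately have "ennreal r \<le> ennreal (t + (1 - \<delta> / 2) * r)"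
    using t(1) \<delta>(1,2) by (simp add: ennreal_mult)
  then have "r \<le> t + (1 - \<delta> / 2) * r"
    using t(1) \<delta>(1,2) r by (subst (asm) ennreal_le_iff) auto
  then have "r \<le> 2 * t / \<delta>" using \<delta>(1) by (simp add: field_simps)
  then have "S \<le> ennreal (2 * t / \<delta>)" using r by (simp add: ennreal_leI)
  moreover have "?E x \<le> S" unfolding S_def by (rule SUP_upper) (use x in auto)
  ultimately show ?thesis by (simp add: t_def)
qed

lemma mass_finite_of_comes_down:
  assumes c: "c \<in> interior J" and unbounded: "\<And>K. \<exists>z\<in>interior J. K < s z" and down: "comes_down c"
  shows "right_mass_finite c"
proof -
  obtain \<delta>0 where \<delta>0: "0 < \<delta>0" "\<And>x. x \<in> J \<Longrightarrow> c < x \<Longrightarrow> \<delta>0 \<le> laplace x c {}"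
    using down by (auto simp: comes_down_def)
  define \<delta> where "\<delta> = min 1 \<delta>0"
  have \<delta>: "0 < \<delta>" "\<delta> \<le> 1" using \<delta>0(1) by (auto simp: \<delta>_def)
  have \<delta>L: "\<delta> \<le> laplace x c {}" if "x \<in> J" "c < x" for x
    using \<delta>0(2)[OF that] by (simp add: \<delta>_def)
  have "(\<integral>\<^sup>+y\<in>{c<..x}. ennreal (s y - s c) \<partial>m) \<le> ennreal (2 * ln (2 / \<delta>) / \<delta>)"
    if x: "x \<in> interior J" "c < x" for x
  proof -
    obtain b where b: "b \<in> interior J" "max (s x) (2 * s x - s c) < s b" using unbounded by blast
    have J: "c \<in> J" "x \<in> J" "b \<in> J" using c x b by (auto intro: interior_J)
    have xb: "x < b" using b(2) s_less_iff[OF J(2,3)] by simp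
    have "(\<integral>\<^sup>+y\<in>{c<..x}. ennreal (s y - s c) \<partial>m) \<le> (\<integral>\<^sup>+y. ennreal (green s c b x y) \<partial>m)"
    proof (rule nn_integral_mono)
      fix y assume "y \<in> space m"
      then have y: "y \<in> J" by (auto simp: space_m interior_J)
      show "ennreal (s y - s c) * indicator {c<..x} y \<le> ennreal (green s c b x y)"
      proof (cases "y \<in> {c<..x}")
        case True
        have le: "s c < s y" "s y \<le> s x" "s x < s b" "s c < s b"
          using True y J xb x by (simp_all add: s_less_iff s_le_iff)
        have "(s y - s c) * (s b - s c) \<le> (s y - s c) * (2 * (s b - s x))"
          using le b(2) by (intro mult_left_mono) auto
        then have "s y - s c \<le> (s y - s c) * (2 * (s b - s x)) / (s b - s c)"
          using le by (subst pos_le_divide_eq) auto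
        also have "\<dots> = green s c b x y"
          using True le xb x by (simp add: green_def min_absorb2 max_absorb1, simp add: algebra_simps)
        finally show ?thesis using True by (simp add: ennreal_leI)
      qed simp
    qed
    also have "\<dots> = (\<integral>\<^sup>+\<omega>. min (hitting_time X c \<omega>) (hitting_time X b \<omega>) \<partial>P x)"
      by (rule mean_exit[symmetric]) (use x xb interior_between[OF c b(1)] in auto)
    also have "\<dots> \<le> ennreal (2 * ln (2 / \<delta>) / \<delta>)"
      by (rule mean_exit_bounded_of_comes_down[OF c b(1) _ \<delta> \<delta>L]) (use x xb in auto)
    finally show ?thesis .
  qed
  then show ?thesis unfolding right_mass_finite_def by blast
qed

lemma cofinal_sequence:
  obtains b :: "nat \<Rightarrow> real" where "incseq b" "\<And>n. b n \<in> interior J" "\<And>y. y \<in> interior J \<Longrightarrow> \<exists>n. y < b n"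
proof -
  let ?Q = "\<rat> \<inter> interior J"
  have above: "\<exists>q\<in>?Q. y < q" if yI: "y \<in> interior J" for y
  proof -
    obtain e where e: "0 < e" "ball y e \<subseteq> interior J"
      by (rule openE[OF open_interior yI]) blast
    obtain q where "q \<in> \<rat>" "y < q" "q < y + e" using Rats_dense_in_real[of y "y + e"] e(1) by auto
    then show ?thesis using e(2) by (intro bexI[of _ q]) (auto simp: dist_real_def subset_iff)
  qed
  then have ne: "?Q \<noteq> {}" using interior_nonempty by blast
  have "countable ?Q" by (auto intro: countable_rat countable_Int1)
  then obtain f :: "nat \<Rightarrow> real" where f: "?Q = range f"
    using range_from_nat_into[OF ne] by metis
  define b where "b n = Max (f ` {..n})" for n
  have "incseq b" unfolding b_def by (intro monoI Max_mono) auto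
  moreover have "b n \<in> interior J" for n
  proof -
    have "b n \<in> f ` {..n}" unfolding b_def by (rule Max_in) auto
    then show ?thesis using f by auto
  qed
  moreover have "\<exists>n. y < b n" if y: "y \<in> interior J" for y
  proof -
    obtain q where "q \<in> ?Q" "y < q" using above[OF y] by blast
    then obtain n where "y < f n" using f by auto
    also have "f n \<le> b n" unfolding b_def by (rule Max_ge) auto
    finally show ?thesis ..
  qed
  ultimately show thesis by (rule that)
qed

text \<open>At an end where the scale is finite and that is not in the state space, a path started close to
  the end converges to it with probability close to one.\<close>

lemma scale_unbounded_of_comes_down:
  assumes c: "c \<in> interior J" and no_max: "\<And>x. x \<in> J \<Longrightarrow> \<exists>y\<in>J. x < y" and down: "comes_down c"
  shows "\<exists>z\<in>interior J. K < s z"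
proof (rule ccontr)
  assume "\<not> (\<exists>z\<in>interior J. K < s z)"
  then have K: "s z \<le> K" if "z \<in> interior J" for z using that by (auto simp: not_less)
  have bdd: "bdd_above (s ` interior J)" using K by (auto intro!: bdd_aboveI2)
  define L where "L = (SUP z\<in>interior J. s z)"
  have L: "s z \<le> L" if "z \<in> interior J" for z unfolding L_def by (rule cSUP_upper[OF that bdd])
  have above: "\<exists>y\<in>interior J. x < y" if xJ: "x \<in> J" for x
  proof -
    obtain y where y: "y \<in> J" "x < y" using no_max[OF xJ] by blast
    then obtain w where "x < w" "w < y" using dense by blast
    then show ?thesis using strictly_between_interior[OF xJ y(1)] by blast
  qed
  obtain d where d: "d \<in> interior J" "c < d" using above[of c] c interior_J by auto
  have J: "c \<in> J" "d \<in> J" using c d by (auto intro: interior_J)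
  have Lc: "s c < L" using L[OF d(1)] s_less_iff[OF J] d(2) by simp
  obtain b where b: "incseq b" "\<And>n. b n \<in> interior J" "\<And>y. y \<in> interior J \<Longrightarrow> \<exists>n. y < b n"
    by (rule cofinal_sequence) blast
  have hp: "hit_prob x c {} \<le> (L - s x) / (L - s c)" if x: "x \<in> interior J" "c < x" for x
  proof -
    have xJ: "x \<in> J" using x interior_J by auto
    interpret prob_space "P x" using prob xJ .
    obtain n0 where n0: "x < b n0" using b(3)[OF x(1)] by blast
    let ?A = "\<lambda>n. {\<omega>\<in>space M. hitting_time X c \<omega> < hitting_time X (b (n0 + n)) \<omega> \<and> X 0 \<omega> = x}"
    have A_sets: "?A n \<in> sets (P x)" for n
    proof -
      have "{\<omega>\<in>space (P x). X 0 \<omega> = x} \<in> sets (P x)"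
        using measurable_X[of 0] by (simp add: measurable_P_iff[OF xJ, symmetric])
      then have "{\<omega>\<in>space M. hitting_time X c \<omega> < hitting_time X (b (n0 + n)) \<omega>} \<inter> {\<omega>\<in>space (P x). X 0 \<omega> = x} \<in> sets (P x)"
        by (intro sets.Int less_entry_sets xJ) simp_all
      moreover have "{\<omega>\<in>space M. hitting_time X c \<omega> < hitting_time X (b (n0 + n)) \<omega>} \<inter> {\<omega>\<in>space (P x). X 0 \<omega> = x} = ?A n"
        using xJ by auto
      ultimately show ?thesis by (simp only:)
    qed
    have bn: "x < b (n0 + n)" for n using n0 incseqD[OF b(1), of n0 "n0 + n"] by simp
    have "incseq ?A"
    proof (rule incseq_SucI, safe)
      fix n \<omega> assume \<omega>: "\<omega> \<in> space M" and l: "hitting_time X c \<omega> < hitting_time X (b (n0 + n)) \<omega>" "x = X 0 \<omega>"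
      have "hitting_time X (b (n0 + n)) \<omega> \<le> hitting_time X (b (n0 + Suc n)) \<omega>"
        by (rule hitting_time_between[OF \<omega> refl]) (use bn[of n] l(2) incseqD[OF b(1)] in auto)
      with l(1) show "hitting_time X c \<omega> < hitting_time X (b (n0 + Suc n)) \<omega>" by (rule less_le_trans)
    qed
    moreover have "range ?A \<subseteq> sets (P x)" using A_sets by blast
    ultimately have lim: "(\<lambda>n. measure (P x) (?A n)) \<longlonglongrightarrow> measure (P x) (\<Union>n. ?A n)"
      by (intro finite_Lim_measure_incseq)
    have "measure (P x) (?A n) \<le> (L - s x) / (L - s c)" for n
    proof -
      have bJ: "b (n0 + n) \<in> J" using b(2) interior_J by blast
      have le: "s c < s x" "s x < s (b (n0 + n))" using x bn s_less_iff[OF J(1) xJ] s_less_iff[OF xJ bJ] by auto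
      have "measure (P x) (?A n) \<le> hit_prob x c {b (n0 + n)}"
        unfolding hit_prob_def using less_entry_sets[OF xJ, of "{b (n0 + n)}" c] by (intro finite_measure_mono) auto
      also have "\<dots> = (s (b (n0 + n)) - s x) / (s (b (n0 + n)) - s c)"
        by (rule exit_down) (use x bn interior_between[OF c b(2)] in auto)
      also have "\<dots> = 1 - (s x - s c) / (s (b (n0 + n)) - s c)" using le by (simp add: field_simps)
      also have "\<dots> \<le> 1 - (s x - s c) / (L - s c)"
        using le Lc L[OF b(2)] by (intro diff_left_mono divide_left_mono mult_pos_pos) auto
      also have "\<dots> = (L - s x) / (L - s c)" using Lc by (simp add: field_simps)
      finally show ?thesis .
    qed
    then have "measure (P x) (\<Union>n. ?A n) \<le> (L - s x) / (L - s c)"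
      by (intro LIMSEQ_le_const2[OF lim]) auto
    moreover have "hit_prob x c {} \<le> measure (P x) (\<Union>n. ?A n)"
      unfolding hit_prob_def
    proof (rule finite_measure_mono_AE)
      show "AE \<omega> in P x. \<omega> \<in> {\<omega>\<in>space M. hitting_time X c \<omega> < entry_time X {} \<omega>} \<longrightarrow> \<omega> \<in> (\<Union>n. ?A n)"
        using start_eq[OF xJ]
      proof eventually_elim
        case (elim \<omega>)
        show ?case
        proof
          assume "\<omega> \<in> {\<omega>\<in>space M. hitting_time X c \<omega> < entry_time X {} \<omega>}"
          then have fin: "hitting_time X c \<omega> < \<infinity>" by simp
          then obtain t where t: "hitting_time X c \<omega> = ennreal t" "0 \<le> t"
            by (cases "hitting_time X c \<omega>") auto
          \<comment> \<open>The path up to the hit is compact, so it stays below some \<open>b n\<close>.\<close>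
          have cont: "continuous_on {0..t} (\<lambda>u. X u \<omega>)"
            by (rule continuous_on_subset[OF continuous_paths]) (use elim in auto)
          obtain v where v: "v \<in> {0..t}" "\<And>u. u \<in> {0..t} \<Longrightarrow> X u \<omega> \<le> X v \<omega>"
            using continuous_attains_sup[OF _ _ cont] t(2) by auto
          obtain y where y: "y \<in> interior J" "X v \<omega> < y" using above[of "X v \<omega>"] X_in_J[of v \<omega>] v(1) elim by auto
          obtain n where n: "y < b n" using b(3)[OF y(1)] by blast
          have "b n \<le> b (n0 + n)" by (rule incseqD[OF b(1)]) simp
          then have no: "X u \<omega> \<noteq> b (n0 + n)" if "u \<in> {0..t}" for u using v(2)[OF that] y n by simp
          have "\<not> hitting_time X (b (n0 + n)) \<omega> \<le> ennreal t"
            using entry_time_le_iff[of \<omega> "{b (n0 + n)}" t] elim t(2) no by auto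
          then have "hitting_time X c \<omega> < hitting_time X (b (n0 + n)) \<omega>" using t by simp
          then show "\<omega> \<in> (\<Union>n. ?A n)" using elim by blast
        qed
      qed
      show "(\<Union>n. ?A n) \<in> sets (P x)" using A_sets by (intro sets.countable_UN) blast
    qed
    ultimately show ?thesis by simp
  qed
  obtain \<delta> where \<delta>: "0 < \<delta>" "\<And>x. x \<in> J \<Longrightarrow> c < x \<Longrightarrow> \<delta> \<le> laplace x c {}"
    using down by (auto simp: comes_down_def)
  have "L - \<delta> * (L - s c) < L" using \<delta>(1) Lc by simp
  then obtain z where z: "z \<in> interior J" "L - \<delta> * (L - s c) < s z"
    using less_cSUP_iff[OF interior_nonempty bdd] unfolding L_def by blast
  define x where "x = max z d"
  have x: "x \<in> interior J" "c < x" using z d by (auto simp: x_def max_def)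
  have "s z \<le> s x" using z(1) x(1) s_le_iff interior_J by (simp add: x_def)
  then have "L - s x < \<delta> * (L - s c)" using z(2) by simp
  then have "(L - s x) / (L - s c) < \<delta>" using Lc by (simp add: pos_divide_less_eq)
  moreover have "\<delta> \<le> laplace x c {}" using \<delta>(2)[OF interior_J[OF x(1)] x(2)] .
  moreover have "laplace x c {} \<le> hit_prob x c {}"
    by (rule laplace_le_hit_prob[OF interior_J[OF x(1)]]) simp
  ultimately show False using hp[OF x] by linarith
qed

text \<open>At an infinite end of the scale, hitting far levels is rare enough for the scale to be
  negligible against the inverse of the Laplace transform, unless the process comes down.\<close>

lemma scale_times_laplace_vanishes:
  assumes x: "x \<in> interior J" and unbounded: "\<And>K. \<exists>z\<in>interior J. K < s z" and not_down: "\<not> comes_down x"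
    and \<epsilon>: "0 < \<epsilon>"
  shows "\<exists>K. \<forall>z\<in>interior J. K < s z \<longrightarrow> s z * laplace x z {} \<le> \<epsilon>"
proof -
  obtain e where e: "0 < e" "ball x e \<subseteq> interior J"
    by (rule openE[OF open_interior x]) blast
  define c where "c = x - e / 2"
  have c: "c \<in> interior J" "c < x" using e by (auto simp: c_def dist_real_def subset_iff)
  obtain z where z: "ladder c z" "z 0 = x" by (rule ladder_exists[OF c(1) x c(2) unbounded])
  note l = ladder_facts[OF z(1)]
  have J: "c \<in> J" "x \<in> J" "z n \<in> J" for n using c x l(2) by (auto intro: interior_J)
  define D where "D = s x - s c"
  have D: "0 < D" using s_less_iff[OF J(1,2)] c(2) by (simp add: D_def)
  have sz: "s (z n) - s c = D * 2 ^ n" for n using l(7)[of n] z(2) by (simp add: D_def)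
  define \<rho> where "\<rho> = laplace x c {}"
  have \<rho>: "\<rho> < 1" unfolding \<rho>_def by (rule laplace_less_1) (use J c in auto)
  define \<eta> where "\<eta> = \<epsilon> * (1 - \<rho>) / (2 * D)"
  have \<eta>: "0 < \<eta>" using \<epsilon> D \<rho> by (simp add: \<eta>_def)
  have "\<exists>n. 2 ^ n * laplace x (z n) {c} < \<eta>"
  proof (rule ccontr)
    assume "\<not> ?thesis"
    then have "\<And>n. \<eta> \<le> 2 ^ n * laplace (z 0) (z n) {c}" using z(2) by (auto simp: not_less)
    from descend_of_climb[OF z(1) \<eta> this] obtain d where d: "0 < d" "\<And>n. d \<le> laplace (z n) x {}"
      unfolding z(2) by blast
    have "d \<le> laplace w x {}" if w: "w \<in> J" "x < w" for w
    proof -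
      obtain n where n: "(s w - s c) / D < 2 ^ n" using real_arch_pow[of 2 "(s w - s c) / D"] by auto
      then have "s w - s c < D * 2 ^ n" using D by (simp add: pos_divide_less_eq mult.commute)
      then have "w < z n" using sz[of n] s_less_iff[OF w(1) J(3)[of n]] by simp
      then have "laplace (z n) x {} \<le> laplace w x {}"
        by (intro laplace_antimono_start) (use w J in auto)
      then show ?thesis using d(2)[of n] by simp
    qed
    then have "comes_down x" using d(1) by (auto simp: comes_down_def)
    then show False using not_down by simp
  qed
  then obtain n where n: "2 ^ n * laplace x (z n) {c} < \<eta>" by blast
  have "s w * laplace x w {} \<le> \<epsilon>" if w: "w \<in> interior J" and large: "max (s (z n)) (max 0 (2 * s c)) < s w" for w
  proof -
    have wJ: "w \<in> J" using w interior_J by blast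
    have zw: "z n < w" using large s_less_iff[OF J(3)[of n] wJ] by simp
    have xz: "x \<le> z n" using strict_mono_less_eq[OF l(5), of 0 n] z(2) by simp
    have cz: "c < z n" using xz c by simp
    have scw: "0 < s w - s c" using s_less_iff[OF J(1) wJ] cz zw by simp
    have "laplace x w {c} = laplace x (z n) {c} * laplace (z n) w {c}"
      by (rule laplace_multiplicative) (use J zw xz in auto)
    also have "\<dots> \<le> laplace x (z n) {c} * ((s (z n) - s c) / (s w - s c))"
    proof (rule mult_left_mono)
      have "laplace (z n) w {c} \<le> hit_prob (z n) w {c}" by (rule laplace_le_hit_prob) (use J in auto)
      also have "\<dots> = (s (z n) - s c) / (s w - s c)"
        by (rule exit_up[OF cz zw interior_between[OF c(1) w]])
      finally show "laplace (z n) w {c} \<le> (s (z n) - s c) / (s w - s c)" .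
    qed (rule laplace_nonneg)
    also have "\<dots> = D * (2 ^ n * laplace x (z n) {c}) / (s w - s c)" by (simp add: sz)
    also have "\<dots> \<le> D * \<eta> / (s w - s c)"
      using D n scw by (intro divide_right_mono mult_left_mono) auto
    finally have 1: "laplace x w {c} \<le> D * \<eta> / (s w - s c)" .
    have "laplace x w {} = laplace x w {c} + laplace x c {w} * laplace c w {}"
      by (rule laplace_decompose) (use J cz zw in auto)
    also have "laplace c w {} = laplace c x {} * laplace x w {}"
      by (rule laplace_multiplicative) (use J c xz zw in auto)
    also have "laplace x c {w} * (laplace c x {} * laplace x w {}) \<le> \<rho> * (1 * laplace x w {})"
      unfolding \<rho>_def using J
      by (intro mult_mono laplace_mono laplace_le_1 mult_nonneg_nonneg laplace_nonneg) auto
    finally have "laplace x w {} * (1 - \<rho>) \<le> laplace x w {c}" by (simp add: algebra_simps)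
    also note 1
    finally have "laplace x w {} \<le> (D * \<eta> / (s w - s c)) / (1 - \<rho>)"
      using \<rho> by (subst pos_le_divide_eq) simp_all
    also have "\<dots> = \<epsilon> / (2 * (s w - s c))" using D \<rho> by (simp add: \<eta>_def)
    finally have "s w * laplace x w {} \<le> s w * (\<epsilon> / (2 * (s w - s c)))"
      using large by (intro mult_left_mono) auto
    also have "\<dots> = \<epsilon> * (s w / (2 * (s w - s c)))" by simp
    also have "\<dots> \<le> \<epsilon> * 1"
      using large scw \<epsilon> by (intro mult_left_mono) (auto simp: divide_le_eq_1)
    finally show ?thesis by simp
  qed
  then show ?thesis by blast
qed

end

section \<open>Functions vanishing at infinity\<close>

lemma C0_small_outside:
  assumes "f \<in> C0 J" "0 < \<epsilon>"
  obtains K where "K \<subseteq> J" "compact K" "\<And>x. x \<in> J - K \<Longrightarrow> \<bar>f x\<bar> < \<epsilon>"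
proof -
  have "\<forall>\<epsilon>>0. \<exists>K\<subseteq>J. compact K \<and> (\<forall>x\<in>J - K. \<bar>f x\<bar> < \<epsilon>)"
    using assms(1) by (simp add: C0_def)
  from this[THEN spec[of _ \<epsilon>]] assms(2)
  obtain K where "K \<subseteq> J" "compact K" "\<forall>x\<in>J - K. \<bar>f x\<bar> < \<epsilon>" by auto
  then show thesis by (intro that[of K]) auto
qed

lemma C0_bounded:
  assumes "f \<in> C0 J"
  obtains B where "0 < B" "\<And>x. x \<in> J \<Longrightarrow> \<bar>f x\<bar> \<le> B"
proof -
  obtain K where K: "K \<subseteq> J" "compact K" "\<And>x. x \<in> J - K \<Longrightarrow> \<bar>f x\<bar> < 1"
    by (rule C0_small_outside[OF assms zero_less_one]) blast
  have "continuous_on K f" using assms K(1) by (auto simp: C0_def intro: continuous_on_subset)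
  then have "bounded (f ` K)" using K(2) compact_continuous_image compact_imp_bounded by blast
  then obtain b where b: "\<And>x. x \<in> K \<Longrightarrow> \<bar>f x\<bar> \<le> b" by (auto simp: bounded_real)
  have "\<bar>f x\<bar> \<le> max b 1" if "x \<in> J" for x
    using b[of x] K(3)[of x] that by (cases "x \<in> K") auto
  then show thesis by (intro that[of "max b 1"]) auto
qed

lemma C0_uniformly_continuous_near_compact:
  fixes f :: "real \<Rightarrow> real"
  assumes cont: "continuous_on J f" and K: "K \<subseteq> J" "compact K" and \<epsilon>: "0 < \<epsilon>"
  obtains \<delta> where "0 < \<delta>" "\<And>x y. x \<in> K \<Longrightarrow> y \<in> J \<Longrightarrow> \<bar>x - y\<bar> < \<delta> \<Longrightarrow> \<bar>f x - f y\<bar> < (\<epsilon>::real)"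
proof -
  define G where "G = {U :: real set. open U \<and> (\<forall>a\<in>U \<inter> J. \<forall>b\<in>U \<inter> J. \<bar>f a - f b\<bar> < \<epsilon>)}"
  have cover: "K \<subseteq> \<Union>G"
  proof
    fix x assume "x \<in> K"
    then have x: "x \<in> J" using K by auto
    obtain d where d: "0 < d" "\<And>y. y \<in> J \<Longrightarrow> dist y x < d \<Longrightarrow> dist (f y) (f x) < \<epsilon> / 2"
      using cont[unfolded continuous_on_iff, rule_format, OF x, of "\<epsilon> / 2"] \<epsilon> by auto
    have "\<bar>f a - f b\<bar> < \<epsilon>" if a: "a \<in> ball x d \<inter> J" and b: "b \<in> ball x d \<inter> J" for a b
    proof -
      have "dist (f a) (f x) < \<epsilon> / 2" "dist (f b) (f x) < \<epsilon> / 2"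
        using a b d(2)[of a] d(2)[of b] by (auto simp: dist_commute)
      then show ?thesis unfolding dist_real_def by linarith
    qed
    then have "ball x d \<in> G" unfolding G_def by simp
    moreover have "x \<in> ball x d" using d(1) by simp
    ultimately show "x \<in> \<Union>G" by blast
  qed
  obtain e where e: "0 < e" "\<And>x. x \<in> K \<Longrightarrow> \<exists>U\<in>G. ball x e \<subseteq> U"
    using Heine_Borel_lemma[OF K(2) cover] unfolding G_def by auto
  have "\<bar>f x - f y\<bar> < \<epsilon>" if x: "x \<in> K" and y: "y \<in> J" "\<bar>x - y\<bar> < e" for x y
  proof -
    obtain U where U: "U \<in> G" "ball x e \<subseteq> U" using e(2)[OF x] by blast
    have "x \<in> U" "y \<in> U" using U(2) e(1) y(2) by (auto simp: dist_real_def subset_iff)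
    then show ?thesis using U(1) x y(1) K(1) unfolding G_def by blast
  qed
  with e(1) show thesis by (rule that)
qed

text \<open>A function in \<open>C0\<close> oscillates by more than \<open>\<epsilon>\<close> only across some two points of a finite set.\<close>

lemma C0_finite_separating_set:
  assumes f: "f \<in> C0 J" and J: "is_interval J" and \<epsilon>: "0 < \<epsilon>"
  obtains Z where "finite Z" "Z \<subseteq> J"
    "\<And>w w'. w \<in> J \<Longrightarrow> w' \<in> J \<Longrightarrow> w < w' \<Longrightarrow> \<epsilon> < \<bar>f w - f w'\<bar> \<Longrightarrow> \<exists>z\<in>Z. \<exists>z'\<in>Z. w \<le> z \<and> z < z' \<and> z' \<le> w'"
proof -
  have "0 < \<epsilon> / 2" using \<epsilon> by simp
  then obtain K where K: "K \<subseteq> J" "compact K" "\<And>x. x \<in> J - K \<Longrightarrow> \<bar>f x\<bar> < \<epsilon> / 2"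
    by (rule C0_small_outside[OF f]) blast
  have cont: "continuous_on J f" using f by (simp add: C0_def)
  obtain \<delta> where \<delta>: "0 < \<delta>" "\<And>x y. x \<in> K \<Longrightarrow> y \<in> J \<Longrightarrow> \<bar>x - y\<bar> < \<delta> \<Longrightarrow> \<bar>f x - f y\<bar> < \<epsilon>"
    by (rule C0_uniformly_continuous_near_compact[OF cont K(1,2) \<epsilon>]) blast
  obtain R where R: "\<And>x. x \<in> K \<Longrightarrow> \<bar>x\<bar> \<le> R" "0 \<le> R"
  proof -
    obtain b where "\<And>x. x \<in> K \<Longrightarrow> \<bar>x\<bar> \<le> b"
      using compact_imp_bounded[OF K(2)] by (auto simp: bounded_real)
    then show thesis by (intro that[of "max b 0"]) (auto simp: le_max_iff_disj)
  qed
  define g where "g = \<delta> / 3"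
  have g: "0 < g" using \<delta> by (simp add: g_def)
  define N where "N = \<lceil>(R + \<delta>) / g\<rceil>"
  define Z where "Z = (\<lambda>i::int. of_int i * g) ` {- N..N} \<inter> J"
  have inZ: "of_int i * g \<in> Z" if "of_int i * g \<in> J" "\<bar>of_int i * g\<bar> \<le> R + \<delta>" for i :: int
  proof -
    have "\<bar>of_int i\<bar> * g \<le> R + \<delta>" using that(2) g by (simp add: abs_mult)
    then have "\<bar>of_int i\<bar> \<le> (R + \<delta>) / g" using g by (subst pos_le_divide_eq)
    then have "of_int \<bar>i\<bar> \<le> (R + \<delta>) / g" by simp
    then have "of_int \<bar>i\<bar> \<le> (of_int N :: real)" unfolding N_def by (rule order_trans[OF _ le_of_int_ceiling])
    then have "\<bar>i\<bar> \<le> N" by (simp only: of_int_le_iff)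
    then have "i \<in> {- N..N}" by auto
    then show ?thesis using that(1) unfolding Z_def by blast
  qed
  have "\<exists>z\<in>Z. \<exists>z'\<in>Z. w \<le> z \<and> z < z' \<and> z' \<le> w'"
    if w: "w \<in> J" "w' \<in> J" "w < w'" and large: "\<epsilon> < \<bar>f w - f w'\<bar>" for w w'
  proof -
    have long: "\<delta> \<le> w' - w"
    proof (rule ccontr)
      assume "\<not> \<delta> \<le> w' - w"
      then have close: "\<bar>w - w'\<bar> < \<delta>" "\<bar>w' - w\<bar> < \<delta>" using w(3) by auto
      consider "w \<in> K" | "w' \<in> K" | "w \<notin> K" "w' \<notin> K" by blast
      then show False
      proof cases
        case 1
        then show False using \<delta>(2)[OF 1 w(2) close(1)] large by simp
      next
        case 2
        then show False using \<delta>(2)[OF 2 w(1) close(2)] large by simp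
      next
        case 3
        then have "\<bar>f w\<bar> < \<epsilon> / 2" "\<bar>f w'\<bar> < \<epsilon> / 2" using K(3) w by auto
        then show False using large by linarith
      qed
    qed
    have "w \<in> K \<or> w' \<in> K"
    proof (rule ccontr)
      assume "\<not> (w \<in> K \<or> w' \<in> K)"
      then have "\<bar>f w\<bar> < \<epsilon> / 2" "\<bar>f w'\<bar> < \<epsilon> / 2" using K(3) w by auto
      then show False using large by linarith
    qed
    then obtain p where p: "w \<le> p" "p \<le> w'" "\<bar>p\<bar> \<le> R" using R(1) w(3) by (meson less_imp_le order_refl)
    define a where "a = max w (p - \<delta>)"
    have a: "w \<le> a" "a + \<delta> \<le> w'" "p - \<delta> \<le> a" "a + \<delta> \<le> p + \<delta>" using p long \<delta>(1) by (auto simp: a_def)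
    define i where "i = \<lceil>a / g\<rceil>"
    have "a / g \<le> of_int i" "of_int i < a / g + 1" unfolding i_def by linarith+
    then have i: "a \<le> of_int i * g" "of_int i * g < a + g" using g by (simp_all add: field_simps)
    have i1: "of_int (i + 1) * g = of_int i * g + g" by (simp add: algebra_simps)
    have 3: "3 * g = \<delta>" by (simp add: g_def)
    have rng: "of_int i * g \<in> {w..w'}" "of_int (i + 1) * g \<in> {w..w'}"
      "\<bar>of_int i * g\<bar> \<le> R + \<delta>" "\<bar>of_int (i + 1) * g\<bar> \<le> R + \<delta>"
      using i i1 3 a p g by (auto simp: abs_le_iff)
    have "{w..w'} \<subseteq> J" using J w unfolding is_interval_1 by (meson atLeastAtMost_iff subsetI)
    then have "of_int i * g \<in> Z" "of_int (i + 1) * g \<in> Z" using inZ rng by blast+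
    moreover have "of_int i * g < of_int (i + 1) * g" using i1 g by simp
    ultimately show ?thesis using rng by (meson atLeastAtMost_iff)
  qed
  moreover have "finite Z" "Z \<subseteq> J" unfolding Z_def by auto
  ultimately show thesis by (rule that[rotated 2])
qed

context scaled_diffusion
begin

lemma measurable_C0_X:
  fixes f :: "real \<Rightarrow> real"
  assumes f: "continuous_on J f" and t: "0 \<le> t"
  shows "(\<lambda>\<omega>. f (X t \<omega>)) \<in> borel_measurable (path_algebra M X)"
proof (rule measurable_compose[of "X t" _ "restrict_space borel J"])
  show "X t \<in> measurable (path_algebra M X) (restrict_space borel J)"
    by (rule measurable_restrict_space2[OF _ measurable_X_paths[OF t]]) (use X_in_J[OF t] in auto)
  show "f \<in> borel_measurable (restrict_space borel J)"
    by (rule borel_measurable_continuous_on_restrict[OF f])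
qed

lemma integrable_C0_X:
  fixes f :: "real \<Rightarrow> real"
  assumes f: "continuous_on J f" and B: "\<And>x. x \<in> J \<Longrightarrow> \<bar>f x\<bar> \<le> B" and t: "0 \<le> t" and x: "x \<in> J"
  shows "integrable (P x) (\<lambda>\<omega>. f (X t \<omega>))"
proof -
  interpret prob_space "P x" using prob x .
  show ?thesis
    by (rule integrable_const_bound[where B=B])
      (use B X_in_J[OF t] x measurable_paths_P[OF x measurable_C0_X[OF f t]] in auto)
qed

lemma abs_transition_le:
  fixes f :: "real \<Rightarrow> real"
  assumes f: "continuous_on J f" and B: "\<And>x. x \<in> J \<Longrightarrow> \<bar>f x\<bar> \<le> B" and t: "0 \<le> t" and x: "x \<in> J"
  shows "\<bar>transition_semigroup X P t f x\<bar> \<le> B"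
proof -
  interpret prob_space "P x" using prob x .
  have "\<bar>transition_semigroup X P t f x\<bar> \<le> (\<integral>\<omega>. \<bar>f (X t \<omega>)\<bar> \<partial>P x)"
    unfolding transition_semigroup_def by (rule integral_abs_bound)
  also have "\<dots> \<le> (\<integral>\<omega>. B \<partial>P x)"
    by (rule integral_mono) (use integrable_C0_X[OF f B t x] B X_in_J[OF t] x in auto)
  finally show ?thesis by (simp add: prob_space)
qed

text \<open>Shifting a bounded function to a nonnegative one makes its transition function a nonnegative
  integral, to which the Markov property applies directly.\<close>

lemma ennreal_transition_shifted:
  fixes f :: "real \<Rightarrow> real"
  assumes f: "continuous_on J f" and B: "\<And>x. x \<in> J \<Longrightarrow> \<bar>f x\<bar> \<le> B" and t: "0 \<le> t" and x: "x \<in> J"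
  shows "(\<integral>\<^sup>+\<omega>. ennreal (f (X t \<omega>) + B) \<partial>P x) = ennreal (transition_semigroup X P t f x + B)"
proof -
  interpret prob_space "P x" using prob x .
  have int: "integrable (P x) (\<lambda>\<omega>. f (X t \<omega>))" by (rule integrable_C0_X[OF assms])
  have "(\<integral>\<^sup>+\<omega>. ennreal (f (X t \<omega>) + B) \<partial>P x) = ennreal (\<integral>\<omega>. f (X t \<omega>) + B \<partial>P x)"
  proof (rule nn_integral_eq_integral)
    show "AE \<omega> in P x. 0 \<le> f (X t \<omega>) + B"
    proof (rule AE_I2)
      fix \<omega> assume "\<omega> \<in> space (P x)"
      then have "\<bar>f (X t \<omega>)\<bar> \<le> B" using B X_in_J[OF t] x by simp
      then show "0 \<le> f (X t \<omega>) + B" by linarith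
    qed
  qed (use int in simp)
  also have "(\<integral>\<omega>. f (X t \<omega>) + B \<partial>P x) = transition_semigroup X P t f x + B"
    using int by (simp add: transition_semigroup_def prob_space)
  finally show ?thesis .
qed

lemma quick_entry_unlikely:
  assumes x: "x \<in> J" and C: "closed C" "x \<notin> C" and \<epsilon>: "0 < \<epsilon>"
  shows "\<exists>h>0. measure (P x) {\<omega>\<in>space M. entry_time X C \<omega> \<le> ennreal h} \<le> \<epsilon>"
proof -
  interpret prob_space "P x" using prob x .
  let ?A = "\<lambda>n. {\<omega>\<in>space M. entry_time X C \<omega> \<le> ennreal (1 / Suc n)}"
  have [measurable]: "entry_time X C \<in> borel_measurable (P x)" by (rule measurable_entry_time_P[OF x C(1)])
  have A: "?A n \<in> sets (P x)" for n
  proof -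
    have "{\<omega>\<in>space (P x). entry_time X C \<omega> \<le> ennreal (1 / Suc n)} \<in> sets (P x)" by measurable
    then show ?thesis using x by simp
  qed
  have "decseq ?A"
  proof (rule decseq_SucI)
    fix n
    have "ennreal (1 / Suc (Suc n)) \<le> ennreal (1 / Suc n)" by (intro ennreal_leI frac_le) auto
    then show "?A (Suc n) \<subseteq> ?A n" by (auto intro: order_trans)
  qed
  moreover have "range ?A \<subseteq> sets (P x)" using A by blast
  ultimately have lim: "(\<lambda>n. measure (P x) (?A n)) \<longlonglongrightarrow> measure (P x) (\<Inter>n. ?A n)"
    by (intro finite_Lim_measure_decseq)
  have "AE \<omega> in P x. \<omega> \<notin> (\<Inter>n. ?A n)"
    using start_eq[OF x]
  proof eventually_elim
    case (elim \<omega>)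
    have pos: "0 < entry_time X C \<omega>" by (rule hitting_time_pos) (use elim C in auto)
    show ?case
    proof
      assume in_all: "\<omega> \<in> (\<Inter>n. ?A n)"
      then have "entry_time X C \<omega> \<le> ennreal (1 / Suc 0)" by blast
      then have "entry_time X C \<omega> < \<infinity>" by (rule le_less_trans) simp
      then obtain r where r: "entry_time X C \<omega> = ennreal r" "0 < r"
        using pos by (cases "entry_time X C \<omega>") auto
      obtain n where "1 / Suc n < r" using r(2) nat_approx_posE by blast
      moreover have "entry_time X C \<omega> \<le> ennreal (1 / Suc n)" using in_all by blast
      ultimately show False using r by (simp add: ennreal_le_iff)
    qed
  qed
  moreover have "(\<Inter>n. ?A n) \<in> sets (P x)"
    by (rule sets.countable_INT) (use A in auto)
  ultimately have "measure (P x) (\<Inter>n. ?A n) = 0"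
    by (subst prob_eq_0)
  then have "(\<lambda>n. measure (P x) (?A n)) \<longlonglongrightarrow> 0" using lim by simp
  from order_tendstoD(2)[OF this \<epsilon>] obtain n where "measure (P x) (?A n) < \<epsilon>"
    unfolding eventually_sequentially by blast
  then show ?thesis by (intro exI[of _ "1 / Suc n"]) (simp add: less_imp_le)
qed

section \<open>The semigroup on functions vanishing at infinity\<close>

definition oscillates :: "(real \<Rightarrow> real) \<Rightarrow> real \<Rightarrow> real \<Rightarrow> 'a set" where
  "oscillates f \<epsilon> \<eta> = {\<omega>\<in>space M. \<exists>u\<in>\<rat> \<inter> {0..\<eta>}. \<epsilon> < \<bar>f (X u \<omega>) - f (X 0 \<omega>)\<bar>}"

lemma oscillates_sets:
  assumes f: "continuous_on J f"
  shows "oscillates f \<epsilon> \<eta> \<in> sets (path_algebra M X)"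
proof -
  have "{\<omega>\<in>space (path_algebra M X). \<epsilon> < \<bar>f (X u \<omega>) - f (X 0 \<omega>)\<bar>} \<in> sets (path_algebra M X)" if "u \<in> \<rat> \<inter> {0..\<eta>}" for u
  proof -
    have [measurable]: "(\<lambda>\<omega>. f (X u \<omega>)) \<in> borel_measurable (path_algebra M X)"
      "(\<lambda>\<omega>. f (X 0 \<omega>)) \<in> borel_measurable (path_algebra M X)"
      using that by (auto intro!: measurable_C0_X[OF f])
    show ?thesis by measurable
  qed
  then have "(\<Union>u\<in>\<rat> \<inter> {0..\<eta>}. {\<omega>\<in>space M. \<epsilon> < \<bar>f (X u \<omega>) - f (X 0 \<omega>)\<bar>}) \<in> sets (path_algebra M X)"
    by (intro sets.countable_UN' countable_Int1 countable_rat) auto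
  also have "(\<Union>u\<in>\<rat> \<inter> {0..\<eta>}. {\<omega>\<in>space M. \<epsilon> < \<bar>f (X u \<omega>) - f (X 0 \<omega>)\<bar>}) = oscillates f \<epsilon> \<eta>"
    by (auto simp: oscillates_def)
  finally show ?thesis .
qed

lemma not_oscillates:
  assumes f: "continuous_on J f" and \<omega>: "\<omega> \<in> space M" "\<omega> \<notin> oscillates f \<epsilon> \<eta>" and u: "0 \<le> u" "u \<le> \<eta>" and "0 < \<eta>"
  shows "\<bar>f (X u \<omega>) - f (X 0 \<omega>)\<bar> \<le> \<epsilon>"
proof -
  let ?S = "{v\<in>{0..\<eta>}. \<bar>f (X v \<omega>) - f (X 0 \<omega>)\<bar> \<le> \<epsilon>}"
  have "continuous_on {0..\<eta>} (\<lambda>v. f (X v \<omega>))"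
    by (rule continuous_on_compose2[OF f continuous_on_subset[OF continuous_paths[OF \<omega>(1)]]])
      (use X_in_J \<omega>(1) in auto)
  then have "continuous_on {0..\<eta>} (\<lambda>v. \<bar>f (X v \<omega>) - f (X 0 \<omega>)\<bar>)" by (intro continuous_intros)
  then have "closed ({0..\<eta>} \<inter> (\<lambda>v. \<bar>f (X v \<omega>) - f (X 0 \<omega>)\<bar>) -` {..\<epsilon>})"
    by (rule continuous_closed_preimage) auto
  moreover have "{0..\<eta>} \<inter> (\<lambda>v. \<bar>f (X v \<omega>) - f (X 0 \<omega>)\<bar>) -` {..\<epsilon>} = ?S" by auto
  ultimately have cl: "closed ?S" by (simp only:)
  have "{0<..<\<eta>} \<inter> \<rat> \<subseteq> ?S"
    using \<omega> by (auto simp: oscillates_def not_less)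
  then have "closure ({0<..<\<eta>} \<inter> \<rat>) \<subseteq> ?S" using cl by (rule closure_minimal)
  moreover have "closure ({0<..<\<eta>} \<inter> \<rat>) = {0..\<eta>}"
    using closure_open_Int_superset[of "{0<..<\<eta>}" \<rat>] \<open>0 < \<eta>\<close> by (simp add: Rats_closure_real)
  ultimately show ?thesis using u by auto
qed

text \<open>To oscillate, the path must cross a gap between two of finitely many points, starting from one
  of them; this gives a bound that does not depend on the starting point.\<close>

lemma oscillation_unlikely:
  assumes f: "f \<in> C0 J" and \<epsilon>: "0 < \<epsilon>"
  shows "\<exists>\<eta>>0. \<forall>w\<in>J. measure (P w) (oscillates f \<epsilon> \<eta>) \<le> \<epsilon>"
proof -
  have cont: "continuous_on J f" using f by (simp add: C0_def)
  obtain Z where Z: "finite Z" "Z \<subseteq> J" "\<And>w w'. w \<in> J \<Longrightarrow> w' \<in> J \<Longrightarrow> w < w' \<Longrightarrow> \<epsilon> < \<bar>f w - f w'\<bar> \<Longrightarrow>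
      \<exists>z\<in>Z. \<exists>z'\<in>Z. w \<le> z \<and> z < z' \<and> z' \<le> w'"
    by (rule C0_finite_separating_set[OF f interval(1) \<epsilon>]) blast
  let ?I = "{p\<in>Z \<times> Z. fst p \<noteq> snd p}"
  have fin: "finite ?I" using Z(1) by simp
  define \<epsilon>' where "\<epsilon>' = \<epsilon> / (card ?I + 1)"
  have \<epsilon>': "0 < \<epsilon>'" using \<epsilon> by (simp add: \<epsilon>'_def)
  have "\<exists>h>0. measure (P (fst p)) {\<omega>\<in>space M. hitting_time X (snd p) \<omega> \<le> ennreal h} \<le> \<epsilon>'" if "p \<in> ?I" for p
    by (rule quick_entry_unlikely[OF _ _ _ \<epsilon>']) (use that Z(2) in \<open>auto simp: mem_Times_iff\<close>)
  then have "\<forall>p\<in>?I. \<exists>h. 0 < h \<and> measure (P (fst p)) {\<omega>\<in>space M. hitting_time X (snd p) \<omega> \<le> ennreal h} \<le> \<epsilon>'"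
    by blast
  from bchoice[OF this] obtain h where
    "\<forall>p\<in>?I. 0 < h p \<and> measure (P (fst p)) {\<omega>\<in>space M. hitting_time X (snd p) \<omega> \<le> ennreal (h p)} \<le> \<epsilon>'"
    by (elim exE) (rule that)
  then have h: "0 < h p"
    "measure (P (fst p)) {\<omega>\<in>space M. hitting_time X (snd p) \<omega> \<le> ennreal (h p)} \<le> \<epsilon>'" if "p \<in> ?I" for p
    using that by blast+
  define \<eta> where "\<eta> = Min (insert 1 (h ` ?I))"
  have \<eta>: "0 < \<eta>" unfolding \<eta>_def using fin h(1) by (subst Min_gr_iff) auto
  have \<eta>h: "\<eta> \<le> h p" if "p \<in> ?I" for p unfolding \<eta>_def using fin that by (intro Min_le) auto
  have "measure (P w) (oscillates f \<epsilon> \<eta>) \<le> \<epsilon>" if w: "w \<in> J" for w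
  proof -
    interpret prob_space "P w" using prob w .
    let ?g = "\<lambda>z \<omega>. indicator {\<omega>. hitting_time X z \<omega> < \<infinity>} \<omega> :: ennreal"
    let ?E = "\<lambda>z'. {\<omega>\<in>space M. hitting_time X z' \<omega> \<le> ennreal \<eta>}"
    let ?\<theta> = "\<lambda>z \<omega>. \<theta> (enn2real (hitting_time X z \<omega>)) \<omega>"
    have E_paths: "?E z' \<in> sets (path_algebra M X)" for z'
      by (rule entry_time_measurable_upto) (use \<eta> in \<open>auto intro: measurable_X_paths\<close>)
    have g_meas: "?g z \<in> borel_measurable (pre_sigma (hitting_time X z))" for z
    proof -
      have [measurable]: "hitting_time X z \<in> borel_measurable (pre_sigma (hitting_time X z))"
        by (rule measurable_stopping_time_pre_sigma) (rule stopping_time_entry_time, simp)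
      have "(\<lambda>\<omega>. if hitting_time X z \<omega> < \<infinity> then 1 else 0 :: ennreal) \<in> borel_measurable (pre_sigma (hitting_time X z))"
        by measurable
      then show ?thesis by (rule measurable_cong[THEN iffD1, rotated]) (auto simp: indicator_def)
    qed
    have m: "(\<lambda>\<omega>. ?g z \<omega> * indicator (?E z') (?\<theta> z \<omega>)) \<in> borel_measurable (P w)" for z z'
    proof -
      have "?g z \<in> borel_measurable (P w)"
        by (rule measurable_from_subalg[OF subalgebra_pre_sigma[OF stopping_time_entry_time w] g_meas]) simp
      moreover have "(\<lambda>\<omega>. indicator (?E z') (?\<theta> z \<omega>) :: ennreal) \<in> borel_measurable (P w)"
        unfolding measurable_P_iff[OF w]
        by (rule measurable_compose[OF measurable_shift_at borel_measurable_indicator[OF E_paths]])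
          (rule measurable_entry_time, simp)
      ultimately show ?thesis by (rule borel_measurable_times_ennreal)
    qed
    have "emeasure (P w) (oscillates f \<epsilon> \<eta>) = (\<integral>\<^sup>+\<omega>. indicator (oscillates f \<epsilon> \<eta>) \<omega> \<partial>P w)"
      using sets_paths_P[OF w oscillates_sets[OF cont]] by simp
    also have "\<dots> \<le> (\<integral>\<^sup>+\<omega>. (\<Sum>p\<in>?I. ?g (fst p) \<omega> * indicator (?E (snd p)) (?\<theta> (fst p) \<omega>)) \<partial>P w)"
    proof (rule nn_integral_mono_AE)
      show "AE \<omega> in P w. indicator (oscillates f \<epsilon> \<eta>) \<omega> \<le>
          (\<Sum>p\<in>?I. ?g (fst p) \<omega> * indicator (?E (snd p)) (?\<theta> (fst p) \<omega>))"
        using start_eq[OF w]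
      proof eventually_elim
        case (elim \<omega>)
        show ?case
        proof (cases "\<omega> \<in> oscillates f \<epsilon> \<eta>")
          case True
          then obtain u where u: "0 \<le> u" "u \<le> \<eta>" "\<epsilon> < \<bar>f (X u \<omega>) - f w\<bar>"
            using elim by (auto simp: oscillates_def)
          have uJ: "X u \<omega> \<in> J" using X_in_J[OF u(1)] elim by blast
          have "\<exists>z z'. z \<in> Z \<and> z' \<in> Z \<and> z \<noteq> z' \<and>
              (w \<le> z \<and> z \<le> z' \<and> z' \<le> X u \<omega> \<or> X u \<omega> \<le> z' \<and> z' \<le> z \<and> z \<le> w)"
          proof (cases "w < X u \<omega>")
            case True
            have "\<epsilon> < \<bar>f w - f (X u \<omega>)\<bar>" using u(3) by (simp add: abs_minus_commute)
            from Z(3)[OF w uJ True this] show ?thesis by (metis less_imp_le less_irrefl)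
          next
            case False
            have "w \<noteq> X u \<omega>" using u(3) \<epsilon> by auto
            then have lt: "X u \<omega> < w" using False by simp
            have "\<epsilon> < \<bar>f (X u \<omega>) - f w\<bar>" by (rule u(3))
            from Z(3)[OF uJ w lt this] show ?thesis by (metis less_imp_le less_irrefl)
          qed
          then obtain z z' where z: "z \<in> Z" "z' \<in> Z" "z \<noteq> z'"
            "w \<le> z \<and> z \<le> z' \<and> z' \<le> X u \<omega> \<or> X u \<omega> \<le> z' \<and> z' \<le> z \<and> z \<le> w" by blast
          have "hitting_time X (X u \<omega>) \<omega> \<le> ennreal u" by (rule entry_time_lower) (use u in auto)
          moreover have "hitting_time X z' \<omega> \<le> hitting_time X (X u \<omega>) \<omega>"
            by (rule hitting_time_between[of \<omega> w]) (use elim z(4) in auto)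
          ultimately have zu: "hitting_time X z' \<omega> \<le> ennreal u" by (rule order_trans[rotated])
          have zz: "hitting_time X z \<omega> \<le> hitting_time X z' \<omega>"
            by (rule hitting_time_between[of \<omega> w]) (use elim z(4) in auto)
          have fin_z: "hitting_time X z \<omega> < \<infinity>" by (rule le_less_trans[OF order_trans[OF zz zu]]) simp
          then obtain r where r: "hitting_time X z \<omega> = ennreal r" "0 \<le> r" by (cases "hitting_time X z \<omega>") auto
          have "hitting_time X z' \<omega> = ennreal r + hitting_time X z' (\<theta> r \<omega>)"
            by (rule entry_time_shift) (use elim r zz in auto)
          then have "hitting_time X z' (\<theta> r \<omega>) \<le> hitting_time X z' \<omega>" by simp
          also note zu
          also have "ennreal u \<le> ennreal \<eta>" using u(2) by (rule ennreal_leI)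
          finally have "\<theta> r \<omega> \<in> ?E z'" using shift_in_space[OF r(2)] elim by simp
          then have "1 \<le> ?g (fst (z, z')) \<omega> * indicator (?E (snd (z, z'))) (?\<theta> (fst (z, z')) \<omega>)"
            using fin_z r by simp
          also have "\<dots> \<le> (\<Sum>p\<in>?I. ?g (fst p) \<omega> * indicator (?E (snd p)) (?\<theta> (fst p) \<omega>))"
            by (rule member_le_sum) (use z fin in auto)
          finally show ?thesis using True by simp
        qed simp
      qed
    qed
    also have "\<dots> = (\<Sum>p\<in>?I. \<integral>\<^sup>+\<omega>. ?g (fst p) \<omega> * indicator (?E (snd p)) (?\<theta> (fst p) \<omega>) \<partial>P w)"
      by (rule nn_integral_sum) (rule m)
    also have "\<dots> \<le> (\<Sum>p\<in>?I. ennreal \<epsilon>')"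
    proof (rule sum_mono)
      fix p assume p: "p \<in> ?I"
      then have J: "fst p \<in> J" using Z(2) by auto
      interpret Q: prob_space "P (fst p)" using prob J .
      have "(\<integral>\<^sup>+\<omega>. ?g (fst p) \<omega> * indicator (?E (snd p)) (?\<theta> (fst p) \<omega>) \<partial>P w) =
          (\<integral>\<^sup>+\<omega>. ?g (fst p) \<omega> \<partial>P w) * (\<integral>\<^sup>+\<omega>. indicator (?E (snd p)) \<omega> \<partial>P (fst p))"
        by (rule strong_markov_hitting[OF w J g_meas]) (use E_paths in auto)
      also have "\<dots> \<le> 1 * ennreal \<epsilon>'"
      proof (rule mult_mono)
        have "(\<integral>\<^sup>+\<omega>. ?g (fst p) \<omega> \<partial>P w) \<le> (\<integral>\<^sup>+\<omega>. 1 \<partial>P w)" by (rule nn_integral_mono) (simp add: indicator_def)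
        then show "(\<integral>\<^sup>+\<omega>. ?g (fst p) \<omega> \<partial>P w) \<le> 1" by (simp add: emeasure_space_1)
        have "ennreal \<eta> \<le> ennreal (h p)" using \<eta>h[OF p] by (rule ennreal_leI)
        then have "measure (P (fst p)) (?E (snd p)) \<le> measure (P (fst p)) {\<omega>\<in>space M. hitting_time X (snd p) \<omega> \<le> ennreal (h p)}"
          by (intro Q.finite_measure_mono sets_hit_by[OF J]) (auto intro: order_trans)
        also have "\<dots> \<le> \<epsilon>'" by (rule h(2)[OF p])
        finally show "(\<integral>\<^sup>+\<omega>. indicator (?E (snd p)) \<omega> \<partial>P (fst p)) \<le> ennreal \<epsilon>'"
          using sets_paths_P[OF J E_paths] by (simp add: Q.emeasure_eq_measure ennreal_leI)
      qed auto
      finally show "(\<integral>\<^sup>+\<omega>. ?g (fst p) \<omega> * indicator (?E (snd p)) (?\<theta> (fst p) \<omega>) \<partial>P w) \<le> ennreal \<epsilon>'" by simp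
    qed
    also have "(\<Sum>p\<in>?I. ennreal \<epsilon>') = ennreal (card ?I * \<epsilon>')"
      using \<epsilon>' by (simp add: ennreal_mult' ennreal_of_nat_eq_real_of_nat)
    also have "card ?I * \<epsilon>' \<le> \<epsilon>" unfolding \<epsilon>'_def using \<epsilon> by (simp add: field_simps)
    finally have "emeasure (P w) (oscillates f \<epsilon> \<eta>) \<le> ennreal \<epsilon>" by (simp add: ennreal_leI)
    then show ?thesis using \<epsilon> by (simp add: emeasure_eq_measure)
  qed
  then show ?thesis using \<eta> by blast
qed

end

lemma le_discountI:
  assumes "0 < \<tau>" "\<And>u. 0 \<le> u \<Longrightarrow> ennreal u < \<tau> \<Longrightarrow> L \<le> ennreal (exp (- u))"
  shows "L \<le> discount \<tau>"
proof (cases \<tau>)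
  case (real t)
  then have t: "0 < t" using assms(1) by simp
  have "((\<lambda>u. ennreal (exp (- u))) \<longlongrightarrow> ennreal (exp (- t))) (at_left t)"
    by (intro tendsto_intros tendsto_ennrealI)
  moreover have "eventually (\<lambda>u. L \<le> ennreal (exp (- u))) (at_left t)"
    unfolding eventually_at_left[OF t] using t assms(2) real
    by (intro exI[of _ 0]) (auto simp: ennreal_less_iff)
  ultimately have "L \<le> ennreal (exp (- t))"
    by (rule tendsto_lowerbound) simp
  then show ?thesis using real by (simp add: discount_ennreal)
next
  case top
  have "((\<lambda>u::real. exp (- u)) \<longlongrightarrow> 0) at_top"
    by (rule filterlim_compose[OF exp_at_bot filterlim_uminus_at_bot_at_top])
  then have "((\<lambda>u. ennreal (exp (- u))) \<longlongrightarrow> ennreal 0) at_top" by (rule tendsto_ennrealI)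
  moreover have "eventually (\<lambda>u. L \<le> ennreal (exp (- u))) at_top"
    unfolding eventually_at_top_linorder using assms(2) top by (intro exI[of _ 0]) auto
  ultimately have "L \<le> ennreal 0" by (rule tendsto_lowerbound) simp
  then show ?thesis by simp
qed

context scaled_diffusion
begin

definition left_comes_down :: "real \<Rightarrow> bool" where
  "left_comes_down c \<longleftrightarrow> (\<exists>\<delta>>0. \<forall>x\<in>J. x < c \<longrightarrow> \<delta> \<le> laplace x c {})"

lemma ennreal_laplace_empty:
  assumes x: "x \<in> J"
  shows "ennreal (laplace x b {}) = (\<integral>\<^sup>+\<omega>. discount (hitting_time X b \<omega>) \<partial>P x)"
  unfolding ennreal_laplace[OF x] entry_time_empty
proof (rule nn_integral_cong)
  fix \<omega>
  show "discount (hitting_time X b \<omega>) * indicator {\<omega>. hitting_time X b \<omega> < \<infinity>} \<omega> = discount (hitting_time X b \<omega>)"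
    by (cases "hitting_time X b \<omega> = \<infinity>") (auto simp: less_top[symmetric])
qed

lemma above_compact:
  assumes "K \<subseteq> J" "compact K" and no_max: "\<And>x. x \<in> J \<Longrightarrow> \<exists>y\<in>J. x < y"
  shows "\<exists>y\<in>interior J. \<forall>k\<in>K. k < y"
proof (cases "K = {}")
  case False
  then obtain k where k: "k \<in> K" "\<And>l. l \<in> K \<Longrightarrow> l \<le> k" using compact_attains_sup[OF assms(2)] by blast
  then have kJ: "k \<in> J" using assms(1) by auto
  obtain y where y: "y \<in> J" "k < y" using no_max[OF kJ] by blast
  obtain w where "k < w" "w < y" using dense[OF y(2)] by blast
  moreover from this have "w \<in> interior J" by (rule strictly_between_interior[OF kJ y(1)])
  ultimately show ?thesis using k(2) by (intro bexI[of _ w]) (auto intro: le_less_trans)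
qed (use interior_nonempty in auto)

text \<open>From \<open>d\<close>, the hitting times of points \<open>x\<close> descending to \<open>z\<close> increase to that of \<open>z\<close>. By the
  factorization of the transform from \<open>d\<close> to \<open>z\<close> at \<open>x\<close>, the transform from \<open>x\<close> to \<open>z\<close> tends to one:
  nearby points are hit quickly. Only accessibility enters.\<close>

lemma laplace_near_target:
  assumes z: "z \<in> J" and d: "d \<in> interior J" "z < d" and \<epsilon>: "0 < \<epsilon>"
  shows "\<exists>x0. z < x0 \<and> x0 \<le> d \<and> (\<forall>x. z < x \<longrightarrow> x \<le> x0 \<longrightarrow> 1 - \<epsilon> \<le> laplace x z {})"
proof -
  have dJ: "d \<in> J" using d interior_J by blast
  interpret prob_space "P d" using prob dJ .
  define L where "L = laplace d z {}"
  have L: "0 < L" unfolding L_def by (rule laplace_hit_pos[OF d(1) z])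
  define x where "x n = z + (d - z) / Suc n" for n
  have x: "z < x n" "x n \<le> d" for n
  proof -
    show "z < x n" using d(2) by (simp add: x_def)
    have "(d - z) / Suc n \<le> (d - z) / 1" using d(2) by (intro divide_left_mono) auto
    then show "x n \<le> d" by (simp add: x_def)
  qed
  have betw: "w \<in> J" if "z < w" "w \<le> d" for w
    using interval(1) z dJ that unfolding is_interval_1 by (meson less_imp_le)
  have x_dec: "x (Suc n) \<le> x n" for n
    unfolding x_def using d(2) by (intro add_left_mono divide_left_mono) auto
  have m: "(\<lambda>\<omega>. discount (hitting_time X b \<omega>)) \<in> borel_measurable (P d)" for b
    using measurable_entry_time_P[OF dJ, of "{b}"] by simp
  have "(INF n. ennreal (laplace d (x n) {})) = (INF n. \<integral>\<^sup>+\<omega>. discount (hitting_time X (x n) \<omega>) \<partial>P d)"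
    by (simp add: ennreal_laplace_empty[OF dJ])
  also have "\<dots> = (\<integral>\<^sup>+\<omega>. (INF n. discount (hitting_time X (x n) \<omega>)) \<partial>P d)"
  proof (rule nn_integral_monotone_convergence_INF_AE[symmetric])
    fix n
    show "AE \<omega> in P d. discount (hitting_time X (x (Suc n)) \<omega>) \<le> discount (hitting_time X (x n) \<omega>)"
      using start_eq[OF dJ]
    proof eventually_elim
      case (elim \<omega>)
      have "hitting_time X (x n) \<omega> \<le> hitting_time X (x (Suc n)) \<omega>"
        by (rule hitting_time_between[of \<omega> d]) (use elim x x_dec in auto)
      then show ?case by (rule discount_antimono)
    qed
    show "(\<lambda>\<omega>. discount (hitting_time X (x n) \<omega>)) \<in> borel_measurable (P d)" by (rule m)
  next
    show "(\<integral>\<^sup>+\<omega>. discount (hitting_time X (x 0) \<omega>) \<partial>P d) < \<infinity>"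
      unfolding ennreal_laplace_empty[OF dJ, symmetric] by simp
  qed
  also have "\<dots> \<le> (\<integral>\<^sup>+\<omega>. discount (hitting_time X z \<omega>) \<partial>P d)"
  proof (rule nn_integral_mono_AE)
    show "AE \<omega> in P d. (INF n. discount (hitting_time X (x n) \<omega>)) \<le> discount (hitting_time X z \<omega>)"
      using start_eq[OF dJ]
    proof eventually_elim
      case (elim \<omega>)
      then have \<omega>: "\<omega> \<in> space M" "X 0 \<omega> = d" by auto
      show ?case
      proof (rule le_discountI)
        show "0 < hitting_time X z \<omega>" by (rule hitting_time_pos[OF \<omega>(1)]) (use \<omega> d in auto)
        fix u :: real assume u: "0 \<le> u" "ennreal u < hitting_time X z \<omega>"
        \<comment> \<open>The path on \<open>[0, u]\<close> stays above \<open>z\<close>, hence above some \<open>x n\<close>.\<close>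
        have cont: "continuous_on {0..u} (\<lambda>v. X v \<omega>)"
          by (rule continuous_on_subset[OF continuous_paths[OF \<omega>(1)]]) auto
        obtain v where v: "v \<in> {0..u}" "\<And>w. w \<in> {0..u} \<Longrightarrow> X v \<omega> \<le> X w \<omega>"
          using continuous_attains_inf[OF _ _ cont] u(1) by auto
        have "z < X v \<omega>"
        proof (rule ccontr)
          assume "\<not> z < X v \<omega>"
          moreover have "continuous_on {0..v} (\<lambda>v. X v \<omega>)" by (rule continuous_on_subset[OF cont]) (use v(1) in auto)
          ultimately obtain w where w: "0 \<le> w" "w \<le> v" "X w \<omega> = z"
            using IVT2'[of "\<lambda>v. X v \<omega>" v z 0] v(1) \<omega>(2) d(2) by auto
          have "hitting_time X z \<omega> \<le> ennreal w" by (rule entry_time_lower) (use w in auto)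
          also have "\<dots> \<le> ennreal u" using w v(1) by (intro ennreal_leI) auto
          finally show False using u(2) by simp
        qed
        then have "0 < (X v \<omega> - z) / (d - z)" using d(2) by simp
        then obtain n where n: "1 / Suc n < (X v \<omega> - z) / (d - z)" using nat_approx_posE by blast
        then have "1 / Suc n * (d - z) < X v \<omega> - z" using d(2) by (simp only: pos_less_divide_eq diff_gt_0_iff_gt)
        then have "x n < X v \<omega>" by (simp add: x_def)
        then have no: "X w \<omega> \<noteq> x n" if "w \<in> {0..u}" for w using v(2)[OF that] by auto
        have "\<not> hitting_time X (x n) \<omega> \<le> ennreal u"
          using entry_time_le_iff[OF \<omega>(1), of "{x n}" u] u(1) no by auto
        then have "discount (hitting_time X (x n) \<omega>) \<le> discount (ennreal u)"
          by (intro discount_antimono) auto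
        then show "(INF n. discount (hitting_time X (x n) \<omega>)) \<le> ennreal (exp (- u))"
          using u(1) by (intro INF_lower2[of n]) (auto simp: discount_ennreal)
      qed
    qed
  qed
  also have "\<dots> = ennreal L" by (simp add: L_def ennreal_laplace_empty[OF dJ])
  also have "\<dots> < ennreal (L + \<epsilon> * L)" using L \<epsilon> by (intro ennreal_lessI) (auto intro: add_pos_pos mult_pos_pos)
  finally obtain n where n: "ennreal (laplace d (x n) {}) < ennreal (L + \<epsilon> * L)"
    unfolding INF_less_iff by blast
  then have n: "laplace d (x n) {} < L + \<epsilon> * L" by (subst (asm) ennreal_less_iff) (rule laplace_nonneg)
  have xJ: "x n \<in> J" using betw x by blast
  have "L = laplace d (x n) {} * laplace (x n) z {}"
    unfolding L_def by (rule laplace_multiplicative) (use dJ xJ x[of n] in auto)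
  also have "\<dots> \<le> (L + \<epsilon> * L) * laplace (x n) z {}"
    using n by (intro mult_right_mono laplace_nonneg) auto
  finally have "L * 1 \<le> L * ((1 + \<epsilon>) * laplace (x n) z {})" by (simp add: algebra_simps)
  then have one: "1 \<le> (1 + \<epsilon>) * laplace (x n) z {}" using L by (simp only: mult_le_cancel_left_pos)
  have "\<epsilon> * laplace (x n) z {} \<le> \<epsilon> * 1"
    using \<epsilon> laplace_le_1[OF xJ] by (intro mult_left_mono) auto
  then have "1 - \<epsilon> \<le> laplace (x n) z {}" using one by (simp add: algebra_simps)
  moreover have "laplace (x n) z {} \<le> laplace w z {}" if "z < w" "w \<le> x n" for w
    by (rule laplace_antimono_start) (use that z xJ betw[of w] x(2)[of n] in auto)
  ultimately show ?thesis using x[of n] by (intro exI[of _ "x n"]) (auto intro: order_trans)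
qed

text \<open>Started near \<open>z\<close>, the process hits \<open>z\<close> quickly and from there on evolves as started from
  \<open>z\<close>, up to a small shift of time, which the bound on oscillations absorbs.\<close>

lemma transition_right_continuous:
  assumes f: "f \<in> C0 J" and t: "0 \<le> t" and z: "z \<in> J" and d: "d \<in> interior J" "z < d" and \<epsilon>: "0 < \<epsilon>"
  shows "\<exists>x0. z < x0 \<and> (\<forall>x\<in>J. z < x \<longrightarrow> x \<le> x0 \<longrightarrow> \<bar>transition_semigroup X P t f x - transition_semigroup X P t f z\<bar> \<le> \<epsilon>)"
proof -
  let ?T = "transition_semigroup X P t f"
  have cont: "continuous_on J f" using f by (simp add: C0_def)
  obtain B where B: "0 < B" "\<And>x. x \<in> J \<Longrightarrow> \<bar>f x\<bar> \<le> B" by (rule C0_bounded[OF f]) blast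
  define e where "e = \<epsilon> / (1 + 6 * B)"
  have e: "0 < e" "e * (1 + 6 * B) = \<epsilon>" using \<epsilon> B by (simp_all add: e_def)
  obtain \<eta> where \<eta>: "0 < \<eta>" "\<And>w. w \<in> J \<Longrightarrow> measure (P w) (oscillates f e \<eta>) \<le> e"
    using oscillation_unlikely[OF f e(1)] by blast
  have e\<eta>: "0 < 1 - exp (- \<eta>)" using \<eta>(1) by simp
  then have "0 < e * (1 - exp (- \<eta>))" using e(1) by simp
  from laplace_near_target[OF z d this] obtain x0 where x0: "z < x0" "x0 \<le> d"
    "\<And>x. z < x \<Longrightarrow> x \<le> x0 \<Longrightarrow> 1 - e * (1 - exp (- \<eta>)) \<le> laplace x z {}" by blast
  have "\<bar>?T x - ?T z\<bar> \<le> \<epsilon>" if x: "x \<in> J" "z < x" "x \<le> x0" for x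
  proof -
    interpret prob_space "P x" using prob x(1) .
    let ?\<tau> = "hitting_time X z"
    let ?H = "{\<omega>\<in>space M. ?\<tau> \<omega> \<le> ennreal \<eta>}"
    let ?O = "{\<omega>\<in>space M. \<theta> t \<omega> \<in> oscillates f e \<eta>}"
    let ?bad = "(space M - ?H) \<union> ?O"
    let ?F = "\<lambda>\<omega>. ennreal (f (X t \<omega>) + B)"
    let ?S = "\<lambda>\<omega>. indicator ?H \<omega> * ?F (\<theta> (enn2real (?\<tau> \<omega>)) \<omega>)"
    have stop: "stopping_time (extended_filtration M F) ?\<tau>" by (rule stopping_time_entry_time) simp
    have H: "?H \<in> sets (P x)" by (rule sets_hit_by[OF x(1)])
    have H_pre: "?H \<in> sets (pre_sigma ?\<tau>)"
    proof -
      have [measurable]: "?\<tau> \<in> borel_measurable (pre_sigma ?\<tau>)" by (rule measurable_stopping_time_pre_sigma[OF stop])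
      have "{\<omega>\<in>space (pre_sigma ?\<tau>). ?\<tau> \<omega> \<le> ennreal \<eta>} \<in> sets (pre_sigma ?\<tau>)" by measurable
      then show ?thesis by (simp add: space_pre_sigma)
    qed
    have \<theta>t: "\<theta> t \<in> measurable M (path_algebra M X)"
      using measurable_shift_at[of "\<lambda>_. ennreal t"] t by simp
    have O: "?O \<in> sets (P x)"
    proof -
      have "\<theta> t -` oscillates f e \<eta> \<inter> space M \<in> sets M"
        by (rule measurable_sets[OF \<theta>t oscillates_sets[OF cont]])
      also have "\<theta> t -` oscillates f e \<eta> \<inter> space M = ?O" by auto
      finally show ?thesis using x(1) by (simp add: sets_P)
    qed
    have bad: "?bad \<in> sets (P x)"
      using H O sets.compl_sets[OF H] x(1) by (intro sets.Un) auto
    have F_paths: "?F \<in> borel_measurable (path_algebra M X)"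
      using measurable_C0_X[OF cont t] by measurable
    have F_P: "?F \<in> borel_measurable (P x)" by (rule measurable_paths_P[OF x(1) F_paths])
    have S_P: "?S \<in> borel_measurable (P x)"
    proof -
      have "(\<lambda>\<omega>. ?F (\<theta> (enn2real (?\<tau> \<omega>)) \<omega>)) \<in> borel_measurable M"
        by (rule measurable_compose[OF measurable_shift_at F_paths]) (rule measurable_entry_time, simp)
      then show ?thesis using H by (intro borel_measurable_times_ennreal) (simp_all add: measurable_P_iff[OF x(1)])
    qed
    have F_EX: "(\<integral>\<^sup>+\<omega>. ?F \<omega> \<partial>P y) = ennreal (?T y + B)" if "y \<in> J" for y
      by (rule ennreal_transition_shifted[OF cont B(2) t that])
    have T0: "0 \<le> ?T y + B" if "y \<in> J" for y
      using abs_transition_le[OF cont B(2) t that] by linarith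
    define p where "p = measure (P x) ?H"
    define r where "r = measure (P x) ?bad"
    have S_EX: "(\<integral>\<^sup>+\<omega>. ?S \<omega> \<partial>P x) = ennreal (p * (?T z + B))"
    proof -
      have "(\<integral>\<^sup>+\<omega>. ?S \<omega> \<partial>P x) = (\<integral>\<^sup>+\<omega>. indicator ?H \<omega> \<partial>P x) * (\<integral>\<^sup>+\<omega>. ?F \<omega> \<partial>P z)"
        by (rule strong_markov_hitting[OF x(1) z _ _ F_paths])
          (use H_pre in \<open>auto simp: top_unique\<close>)
      then show ?thesis using H F_EX[OF z] T0[OF z] by (simp add: emeasure_eq_measure p_def ennreal_mult)
    qed
    have close: "\<bar>f (X t (\<theta> (enn2real (?\<tau> \<omega>)) \<omega>)) - f (X t \<omega>)\<bar> \<le> e"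
      if \<omega>: "\<omega> \<in> space M" "\<omega> \<notin> ?bad" for \<omega>
    proof -
      let ?u = "enn2real (?\<tau> \<omega>)"
      have h: "?\<tau> \<omega> \<le> ennreal \<eta>" and no: "\<theta> t \<omega> \<notin> oscillates f e \<eta>" using \<omega> by auto
      have u: "0 \<le> ?u" "?u \<le> \<eta>" using h \<eta>(1) by (auto intro: enn2real_leI)
      have "\<bar>f (X ?u (\<theta> t \<omega>)) - f (X 0 (\<theta> t \<omega>))\<bar> \<le> e"
        by (rule not_oscillates[OF cont _ no u \<eta>(1)]) (rule shift_in_space[OF t \<omega>(1)])
      then show ?thesis using u t \<omega>(1) by (simp add: shift add.commute)
    qed
    have fB: "0 \<le> f (X v \<omega>) + B" "f (X v \<omega>) + B \<le> 2 * B" if "0 \<le> v" "\<omega> \<in> space M" for v \<omega>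
      using B(2)[OF X_in_J[OF that]] by (auto simp: abs_le_iff)
    have int_rhs: "(\<integral>\<^sup>+\<omega>. g \<omega> + (ennreal e + ennreal (2 * B) * indicator ?bad \<omega>) \<partial>P x) =
        (\<integral>\<^sup>+\<omega>. g \<omega> \<partial>P x) + ennreal (e + 2 * B * r)" if g: "g \<in> borel_measurable (P x)" for g
    proof -
      have "(\<integral>\<^sup>+\<omega>. g \<omega> + (ennreal e + ennreal (2 * B) * indicator ?bad \<omega>) \<partial>P x) =
         (\<integral>\<^sup>+\<omega>. g \<omega> \<partial>P x) + (ennreal e + ennreal (2 * B) * emeasure (P x) ?bad)"
        using g bad by (subst nn_integral_add)
          (auto simp: nn_integral_add nn_integral_cmult_indicator emeasure_space_1 simp del: sets.Un)
      also have "ennreal e + ennreal (2 * B) * emeasure (P x) ?bad = ennreal (e + 2 * B * r)"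
        using e(1) B(1) by (simp add: emeasure_eq_measure r_def ennreal_mult)
      finally show ?thesis .
    qed
    have "(\<integral>\<^sup>+\<omega>. ?F \<omega> \<partial>P x) \<le> (\<integral>\<^sup>+\<omega>. ?S \<omega> + (ennreal e + ennreal (2 * B) * indicator ?bad \<omega>) \<partial>P x)"
    proof (rule nn_integral_mono)
      fix \<omega> assume "\<omega> \<in> space (P x)"
      then have \<omega>: "\<omega> \<in> space M" using x(1) by simp
      show "?F \<omega> \<le> ?S \<omega> + (ennreal e + ennreal (2 * B) * indicator ?bad \<omega>)"
      proof (cases "\<omega> \<in> ?bad")
        case True
        have "?F \<omega> \<le> ennreal (2 * B)" using fB(2)[OF t \<omega>] by (rule ennreal_leI)
        then show ?thesis using True by (simp add: add_increasing)
      next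
        case False
        let ?v = "f (X t (\<theta> (enn2real (?\<tau> \<omega>)) \<omega>)) + B"
        have "f (X t \<omega>) + B \<le> ?v + e" using close[OF \<omega> False] by (simp add: abs_le_iff)
        then have "?F \<omega> \<le> ennreal (?v + e)" by (rule ennreal_leI)
        also have "\<dots> = ennreal ?v + ennreal e"
          using fB(1)[OF t shift_in_space[OF enn2real_nonneg \<omega>]] e(1) by (intro ennreal_plus) auto
        finally show ?thesis using False \<omega> by simp
      qed
    qed
    then have "ennreal (?T x + B) \<le> ennreal (p * (?T z + B) + (e + 2 * B * r))"
      unfolding F_EX[OF x(1)] int_rhs[OF S_P] S_EX
      using T0[OF z] e(1) B(1) by (subst ennreal_plus) (auto simp: p_def r_def)
    then have I: "?T x + B \<le> p * (?T z + B) + (e + 2 * B * r)"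
      using T0[OF z] e(1) B(1) by (subst (asm) ennreal_le_iff) (auto simp: p_def r_def)
    have "(\<integral>\<^sup>+\<omega>. ?S \<omega> \<partial>P x) \<le> (\<integral>\<^sup>+\<omega>. ?F \<omega> + (ennreal e + ennreal (2 * B) * indicator ?bad \<omega>) \<partial>P x)"
    proof (rule nn_integral_mono)
      fix \<omega> assume "\<omega> \<in> space (P x)"
      then have \<omega>: "\<omega> \<in> space M" using x(1) by simp
      let ?v = "f (X t (\<theta> (enn2real (?\<tau> \<omega>)) \<omega>)) + B"
      have v: "?v \<le> 2 * B" by (rule fB(2)[OF t shift_in_space[OF enn2real_nonneg \<omega>]])
      have S_le: "?S \<omega> \<le> ennreal ?v" by (simp add: indicator_def)
      show "?S \<omega> \<le> ?F \<omega> + (ennreal e + ennreal (2 * B) * indicator ?bad \<omega>)"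
      proof (cases "\<omega> \<in> ?bad")
        case True
        have "ennreal ?v \<le> ennreal (2 * B)" using v by (rule ennreal_leI)
        then have "?S \<omega> \<le> ennreal (2 * B)" using S_le by (rule order_trans[rotated])
        then show ?thesis using True by (simp add: add_increasing)
      next
        case False
        have "?v \<le> (f (X t \<omega>) + B) + e" using close[OF \<omega> False] by (simp add: abs_le_iff)
        then have "ennreal ?v \<le> ennreal ((f (X t \<omega>) + B) + e)" by (rule ennreal_leI)
        also have "\<dots> = ?F \<omega> + ennreal e"
          using fB(1)[OF t \<omega>] e(1) by (intro ennreal_plus) auto
        finally have "?S \<omega> \<le> ?F \<omega> + ennreal e" using S_le by (rule order_trans[rotated])
        then show ?thesis using False by simp
      qed
    qed
    then have "ennreal (p * (?T z + B)) \<le> ennreal ((?T x + B) + (e + 2 * B * r))"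
      unfolding int_rhs[OF F_P] F_EX[OF x(1)] S_EX
      using T0[OF x(1)] e(1) B(1) by (subst ennreal_plus) (auto simp: r_def)
    then have II: "p * (?T z + B) \<le> (?T x + B) + (e + 2 * B * r)"
      using T0[OF x(1)] e(1) B(1) by (subst (asm) ennreal_le_iff) (auto simp: r_def)
    have p: "p \<le> 1" by (simp add: p_def)
    have late: "1 - p \<le> e"
    proof -
      have "(1 - exp (- \<eta>)) * measure (P x) {\<omega>\<in>space M. \<not> ?\<tau> \<omega> \<le> ennreal \<eta>} \<le> 1 - laplace x z {}"
        by (rule late_le_laplace[OF x(1)]) (use \<eta>(1) in simp)
      also have "\<dots> \<le> (1 - exp (- \<eta>)) * e" using x0(3)[OF x(2,3)] by (simp add: mult.commute)
      finally have "measure (P x) {\<omega>\<in>space M. \<not> ?\<tau> \<omega> \<le> ennreal \<eta>} \<le> e"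
        using e\<eta> by (simp only: mult_le_cancel_left_pos)
      moreover have "{\<omega>\<in>space M. \<not> ?\<tau> \<omega> \<le> ennreal \<eta>} = space (P x) - ?H" using x(1) by auto
      ultimately show ?thesis using prob_compl[OF H] by (simp add: p_def)
    qed
    have r: "r \<le> 2 * e"
    proof -
      have "measure (P x) ?O \<le> e"
      proof -
        have "emeasure (P x) ?O = (\<integral>\<^sup>+\<omega>. indicator ?O \<omega> \<partial>P x)" using O by simp
        also have "\<dots> = (\<integral>\<^sup>+\<omega>. 1 * indicator (oscillates f e \<eta>) (\<theta> t \<omega>) \<partial>P x)"
          by (rule nn_integral_cong) (use x(1) in \<open>simp add: indicator_def\<close>)
        also have "\<dots> = (\<integral>\<^sup>+\<omega>. 1 * (\<integral>\<^sup>+\<omega>'. indicator (oscillates f e \<eta>) \<omega>' \<partial>P (X t \<omega>)) \<partial>P x)"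
          by (rule markov_nn[OF x(1) t]) (use oscillates_sets[OF cont] in auto)
        also have "\<dots> \<le> (\<integral>\<^sup>+\<omega>. ennreal e \<partial>P x)"
        proof (rule nn_integral_mono)
          fix \<omega> assume "\<omega> \<in> space (P x)"
          then have J: "X t \<omega> \<in> J" using X_in_J[OF t] x(1) by simp
          interpret Q: prob_space "P (X t \<omega>)" using prob J .
          show "1 * (\<integral>\<^sup>+\<omega>'. indicator (oscillates f e \<eta>) \<omega>' \<partial>P (X t \<omega>)) \<le> ennreal e"
            using sets_paths_P[OF J oscillates_sets[OF cont]] \<eta>(2)[OF J]
            by (simp add: Q.emeasure_eq_measure ennreal_leI)
        qed
        finally show ?thesis using e(1) by (simp add: emeasure_eq_measure prob_space)
      qed
      moreover have "measure (P x) (space M - ?H) \<le> e" using prob_compl[OF H] late x(1) by (simp add: p_def)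
      moreover have "r \<le> measure (P x) (space M - ?H) + measure (P x) ?O"
        unfolding r_def using sets.compl_sets[OF H] O x(1) by (intro measure_Un_le) auto
      ultimately show ?thesis by simp
    qed
    have Tz2: "?T z + B \<le> 2 * B" using abs_transition_le[OF cont B(2) t z] by (simp add: abs_le_iff)
    have "B * r \<le> B * (2 * e)" using r B(1) by (intro mult_left_mono) auto
    then have Br: "2 * B * r \<le> 4 * (e * B)" by (simp add: algebra_simps)
    have pT: "p * (?T z + B) \<le> 1 * (?T z + B)" using p T0[OF z] by (rule mult_right_mono)
    have "?T x + B \<le> 1 * (?T z + B) + (e + 4 * (e * B))"
      by (rule order_trans[OF I add_mono[OF pT add_left_mono[OF Br]]])
    then have 1: "?T x - ?T z \<le> e + 4 * (e * B)" by (simp add: algebra_simps)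
    have "(1 - p) * (?T z + B) \<le> e * (2 * B)"
      using late p Tz2 T0[OF z] e(1) by (intro mult_mono) auto
    then have "?T z + B \<le> p * (?T z + B) + 2 * (e * B)" by (simp add: algebra_simps)
    also have "\<dots> \<le> ((?T x + B) + (e + 4 * (e * B))) + 2 * (e * B)"
      by (rule add_right_mono[OF order_trans[OF II add_left_mono[OF add_left_mono[OF Br]]]])
    finally have 2: "?T z - ?T x \<le> e + 6 * (e * B)" by (simp add: algebra_simps)
    have "0 \<le> e * B" using e(1) B(1) by simp
    moreover have "e + 6 * (e * B) = \<epsilon>" using e(2) by (simp add: algebra_simps)
    ultimately show ?thesis using 1 2 by (simp add: abs_le_iff)
  qed
  then show ?thesis using x0(1) by blast
qed

end

context scaled_diffusion
begin

lemma above_after_late_hit: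
  assumes \<omega>: "\<omega> \<in> space M" "y < X 0 \<omega>" and t: "0 \<le> t" and late: "\<not> hitting_time X y \<omega> \<le> ennreal t"
  shows "y < X t \<omega>"
proof (rule ccontr)
  assume "\<not> y < X t \<omega>"
  moreover have "continuous_on {0..t} (\<lambda>u. X u \<omega>)"
    by (rule continuous_on_subset[OF continuous_paths[OF \<omega>(1)]]) auto
  ultimately obtain u where u: "0 \<le> u" "u \<le> t" "X u \<omega> = y"
    using IVT2'[of "\<lambda>u. X u \<omega>" t y 0] t \<omega>(2) by auto
  have "hitting_time X y \<omega> \<le> ennreal u" by (rule entry_time_lower) (use u in auto)
  also have "\<dots> \<le> ennreal t" using u by (intro ennreal_leI) auto
  finally show False using late by simp
qed

lemma transition_vanishes_right:
  assumes f: "f \<in> C0 J" and t: "0 \<le> t" and no_max: "\<And>x. x \<in> J \<Longrightarrow> \<exists>y\<in>J. x < y"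
    and c: "c \<in> interior J" and not_down: "\<not> comes_down c" and \<epsilon>: "0 < \<epsilon>"
  shows "\<exists>q\<in>J. \<forall>x\<in>J. q < x \<longrightarrow> \<bar>transition_semigroup X P t f x\<bar> \<le> \<epsilon>"
proof -
  have cont: "continuous_on J f" using f by (simp add: C0_def)
  obtain B where B: "0 < B" "\<And>x. x \<in> J \<Longrightarrow> \<bar>f x\<bar> \<le> B" by (rule C0_bounded[OF f]) blast
  have "0 < \<epsilon> / 2" using \<epsilon> by simp
  then obtain K where K: "K \<subseteq> J" "compact K" "\<And>x. x \<in> J - K \<Longrightarrow> \<bar>f x\<bar> < \<epsilon> / 2"
    by (rule C0_small_outside[OF f]) blast
  obtain y where y: "y \<in> interior J" "\<And>k. k \<in> K \<Longrightarrow> k < y"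
    using above_compact[OF K(1,2) no_max] by blast
  have yJ: "y \<in> J" using y(1) interior_J by blast
  have not_down_y: "\<not> comes_down y" using comes_down_change_base[OF y(1) c] not_down by blast
  define \<delta> where "\<delta> = \<epsilon> / (2 * B * exp t)"
  have \<delta>: "0 < \<delta>" using \<epsilon> B(1) by (simp add: \<delta>_def)
  have "\<not> (\<forall>x\<in>J. y < x \<longrightarrow> \<delta> \<le> laplace x y {})"
    using not_down_y \<delta> unfolding comes_down_def by blast
  then obtain q where q: "q \<in> J" "y < q" "laplace q y {} < \<delta>" by (auto simp: not_le)
  have "\<bar>transition_semigroup X P t f x\<bar> \<le> \<epsilon>" if x: "x \<in> J" "q < x" for x
  proof -
    interpret prob_space "P x" using prob x(1) .
    let ?H = "{\<omega>\<in>space M. hitting_time X y \<omega> \<le> ennreal t}"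
    have H: "?H \<in> sets (P x)" by (rule sets_hit_by[OF x(1)])
    have intH: "integrable (P x) (indicat_real ?H)"
      by (rule integrable_real_indicator[OF H]) (simp add: emeasure_eq_measure)
    have int: "integrable (P x) (\<lambda>\<omega>. f (X t \<omega>))" by (rule integrable_C0_X[OF cont B(2) t x(1)])
    have "\<bar>transition_semigroup X P t f x\<bar> \<le> (\<integral>\<omega>. \<bar>f (X t \<omega>)\<bar> \<partial>P x)"
      unfolding transition_semigroup_def by (rule integral_abs_bound)
    also have "\<dots> \<le> (\<integral>\<omega>. \<epsilon> / 2 + B * indicator ?H \<omega> \<partial>P x)"
    proof (rule integral_mono_AE)
      show "AE \<omega> in P x. \<bar>f (X t \<omega>)\<bar> \<le> \<epsilon> / 2 + B * indicator ?H \<omega>"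
        using start_eq[OF x(1)]
      proof eventually_elim
        case (elim \<omega>)
        then have XJ: "X t \<omega> \<in> J" using X_in_J[OF t] by blast
        show ?case
        proof (cases "\<omega> \<in> ?H")
          case True
          then have i: "indicator ?H \<omega> = (1::real)" by (rule indicator_simps(1))
          show ?thesis unfolding i using B(2)[OF XJ] \<epsilon> by simp
        next
          case False
          then have i: "indicator ?H \<omega> = (0::real)" by (rule indicator_simps(2))
          have late: "\<not> hitting_time X y \<omega> \<le> ennreal t" using False elim by blast
          have "y < X t \<omega>"
            by (rule above_after_late_hit[OF _ _ t late]) (use elim x(2) q(2) in auto)
          then have "X t \<omega> \<notin> K" using y(2)[of "X t \<omega>"] by (meson less_asym)
          then have "\<bar>f (X t \<omega>)\<bar> < \<epsilon> / 2" using K(3) XJ by blast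
          then show ?thesis unfolding i by simp
        qed
      qed
    qed (use int intH in auto)
    also have "\<dots> = \<epsilon> / 2 + B * measure (P x) ?H"
      using H intH by (simp add: prob_space)
    also have "B * measure (P x) ?H \<le> B * (exp t * \<delta>)"
    proof (rule mult_left_mono)
      have "measure (P x) ?H \<le> exp t * laplace x y {}" by (rule early_le_laplace[OF x(1) t])
      also have "\<dots> \<le> exp t * \<delta>"
        using laplace_antimono_start[OF yJ q(1) x(1) q(2)] x(2) q(3) by (intro mult_left_mono) auto
      finally show "measure (P x) ?H \<le> exp t * \<delta>" .
    qed (use B in simp)
    also have "B * (exp t * \<delta>) = \<epsilon> / 2" using B(1) by (simp add: \<delta>_def)
    finally show ?thesis by simp
  qed
  then show ?thesis using q(1) by blast
qed

text \<open>If the process comes down from the end, a bump function near \<open>y\<close> is charged at one of finitely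
  many times with a probability that does not depend on how far away the process starts.\<close>

lemma not_comes_down_of_invariant:
  assumes inv: "\<And>t f. 0 \<le> t \<Longrightarrow> f \<in> C0 J \<Longrightarrow> transition_semigroup X P t f \<in> C0 J"
    and no_max: "\<And>x. x \<in> J \<Longrightarrow> \<exists>y\<in>J. x < y" and y: "y \<in> interior J"
  shows "\<not> comes_down y"
proof
  assume "comes_down y"
  then obtain \<delta>0 where \<delta>0: "0 < \<delta>0" "\<And>x. x \<in> J \<Longrightarrow> y < x \<Longrightarrow> \<delta>0 \<le> laplace x y {}"
    by (auto simp: comes_down_def)
  define \<delta> where "\<delta> = min 1 \<delta>0"
  have \<delta>: "0 < \<delta>" "\<delta> \<le> 1" "\<And>x. x \<in> J \<Longrightarrow> y < x \<Longrightarrow> \<delta> \<le> laplace x y {}"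
    using \<delta>0 by (auto simp: \<delta>_def min_le_iff_disj)
  define t where "t = ln (2 / \<delta>)"
  have t: "0 \<le> t" "exp (- t) = \<delta> / 2" using \<delta> by (simp_all add: t_def exp_minus)
  have yJ: "y \<in> J" using y interior_J by blast
  obtain e where e: "0 < e" "ball y e \<subseteq> interior J" by (rule openE[OF open_interior y]) blast
  define \<rho> where "\<rho> = e / 2"
  have \<rho>: "0 < \<rho>" "{y - \<rho>..y + \<rho>} \<subseteq> J"
    using e interior_subset[of J] by (auto simp: \<rho>_def dist_real_def subset_iff)
  define f where "f z = max 0 (1 - \<bar>z - y\<bar> / \<rho>)" for z
  have f01: "0 \<le> f z" "f z \<le> 1" for z using \<rho>(1) by (auto simp: f_def)
  have f0: "f z = 0" if "z \<notin> {y - \<rho>..y + \<rho>}" for z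
    using that \<rho>(1) by (auto simp: f_def max_def divide_simps abs_if split: if_splits)
  have cont: "continuous_on J f" unfolding f_def using \<rho>(1) by (intro continuous_intros) auto
  have f: "f \<in> C0 J"
    unfolding C0_def
  proof (intro CollectI conjI cont allI impI)
    fix \<epsilon> :: real assume "0 < \<epsilon>"
    then show "\<exists>K\<subseteq>J. compact K \<and> (\<forall>x\<in>J - K. \<bar>f x\<bar> < \<epsilon>)"
      using \<rho>(2) f0 by (intro exI[of _ "{y - \<rho>..y + \<rho>}"]) auto
  qed
  have f_half: "1 / 2 \<le> f z" if "y - \<rho> / 2 < z" "z < y + \<rho> / 2" for z
  proof -
    have "\<bar>z - y\<bar> \<le> \<rho> / 2" using that by (auto simp: abs_if field_simps)
    then have "\<bar>z - y\<bar> / \<rho> \<le> 1 / 2" using \<rho>(1) by (simp add: divide_simps)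
    then have "1 / 2 \<le> 1 - \<bar>z - y\<bar> / \<rho>" by simp
    also have "\<dots> \<le> f z" unfolding f_def by (rule max.cobounded2)
    finally show ?thesis .
  qed
  define C where "C = {..y - \<rho> / 2} \<union> {y + \<rho> / 2..}"
  have C: "closed C" "y \<notin> C" using \<rho>(1) by (auto simp: C_def)
  obtain h where h: "0 < h" "measure (P y) {\<omega>\<in>space M. entry_time X C \<omega> \<le> ennreal h} \<le> 1 / 2"
    using quick_entry_unlikely[OF yJ C, of "1/2"] by auto
  let ?Q = "{\<omega>\<in>space M. entry_time X C \<omega> \<le> ennreal h}"
  have Q_paths: "?Q \<in> sets (path_algebra M X)"
    by (rule entry_time_measurable_upto) (use h(1) C in \<open>auto intro: measurable_X_paths\<close>)
  let ?B = "space M - ?Q"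
  have B_paths: "?B \<in> sets (path_algebra M X)" using sets.compl_sets[OF Q_paths] by simp
  have PB: "1 / 2 \<le> measure (P y) ?B"
  proof -
    interpret prob_space "P y" using prob yJ .
    show ?thesis using prob_compl[OF sets_paths_P[OF yJ Q_paths]] h(2) yJ by simp
  qed
  define n where "n = nat \<lceil>t / h\<rceil>"
  have n: "t \<le> real n * h"
  proof -
    have "t / h \<le> real n" unfolding n_def by linarith
    then show ?thesis using h(1) by (simp add: pos_divide_le_eq)
  qed
  let ?T = "\<lambda>k. transition_semigroup X P (real (Suc k) * h) f"
  have low: "\<delta> / 8 \<le> (\<Sum>k\<le>n. ?T k x)" if x: "x \<in> J" "y < x" for x
  proof -
    interpret prob_space "P x" using prob x(1) .
    let ?\<tau> = "hitting_time X y"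
    let ?A = "\<lambda>k. {\<omega>\<in>space M. ennreal (real k * h) \<le> ?\<tau> \<omega> \<and> ?\<tau> \<omega> < ennreal (real (Suc k) * h)}"
    have stop: "stopping_time (extended_filtration M F) ?\<tau>" by (rule stopping_time_entry_time) simp
    have A_pre: "?A k \<in> sets (pre_sigma ?\<tau>)" for k
    proof -
      have [measurable]: "?\<tau> \<in> borel_measurable (pre_sigma ?\<tau>)" by (rule measurable_stopping_time_pre_sigma[OF stop])
      have "{\<omega>\<in>space (pre_sigma ?\<tau>). ennreal (real k * h) \<le> ?\<tau> \<omega> \<and> ?\<tau> \<omega> < ennreal (real (Suc k) * h)} \<in> sets (pre_sigma ?\<tau>)"
        by measurable
      then show ?thesis by (simp only: space_pre_sigma)
    qed
    have A_P: "?A k \<in> sets (P x)" for k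
      using A_pre[of k] subalgebra_pre_sigma[OF stop x(1)] unfolding subalgebra_def by blast
    have T_ge: "measure (P x) (?A k) * (1 / 4) \<le> ?T k x" for k
    proof -
      let ?s = "real (Suc k) * h"
      have s0: "0 \<le> ?s" using h(1) by simp
      have "ennreal (measure (P x) (?A k)) * ennreal (measure (P y) ?B) =
          (\<integral>\<^sup>+\<omega>. indicator (?A k) \<omega> \<partial>P x) * (\<integral>\<^sup>+\<omega>. indicator ?B \<omega> \<partial>P y)"
      proof -
        interpret Qy: prob_space "P y" using prob yJ .
        show ?thesis
          using A_P[of k] sets_paths_P[OF yJ B_paths] by (simp only: nn_integral_indicator emeasure_eq_measure Qy.emeasure_eq_measure)
      qed
      also have "\<dots> = (\<integral>\<^sup>+\<omega>. indicator (?A k) \<omega> * indicator ?B (\<theta> (enn2real (?\<tau> \<omega>)) \<omega>) \<partial>P x)"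
      proof (rule strong_markov_hitting[symmetric, OF x(1) yJ])
        show "indicator (?A k) \<in> borel_measurable (pre_sigma ?\<tau>)" using A_pre by (rule borel_measurable_indicator)
        show "indicator ?B \<in> borel_measurable (path_algebra M X)" using B_paths by (rule borel_measurable_indicator)
      qed (simp add: indicator_def)
      also have "\<dots> \<le> (\<integral>\<^sup>+\<omega>. ennreal (2 * f (X ?s \<omega>)) \<partial>P x)"
      proof (rule nn_integral_mono)
        fix \<omega> assume "\<omega> \<in> space (P x)"
        then have \<omega>: "\<omega> \<in> space M" using x(1) by simp
        show "indicator (?A k) \<omega> * indicator ?B (\<theta> (enn2real (?\<tau> \<omega>)) \<omega>) \<le> ennreal (2 * f (X ?s \<omega>))"
        proof (cases "\<omega> \<in> ?A k \<and> \<theta> (enn2real (?\<tau> \<omega>)) \<omega> \<in> ?B")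
          case True
          then have A: "ennreal (real k * h) \<le> ?\<tau> \<omega>" "?\<tau> \<omega> < ennreal ?s"
            and Bm: "\<not> entry_time X C (\<theta> (enn2real (?\<tau> \<omega>)) \<omega>) \<le> ennreal h" using shift_in_space \<omega> by auto
          obtain r where r: "?\<tau> \<omega> = ennreal r" "0 \<le> r" using A(2) by (cases "?\<tau> \<omega>") auto
          have rk: "real k * h \<le> r" "r < ?s" using A r s0 h(1) by (auto simp: ennreal_less_iff)
          define u where "u = ?s - r"
          have u: "0 \<le> u" "u \<le> h" using rk by (auto simp: u_def algebra_simps)
          have "ennreal u < entry_time X C (\<theta> r \<omega>)"
            using Bm r u(2) by (auto simp: not_le intro: le_less_trans ennreal_leI)
          then have "X u (\<theta> r \<omega>) \<notin> C" by (rule not_in_before_entry_time[OF _ u(1)])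
          then have "X ?s \<omega> \<notin> C" using shift[OF r(2) u(1) \<omega>] by (simp add: u_def)
          then have "1 / 2 \<le> f (X ?s \<omega>)" by (intro f_half) (auto simp: C_def)
          then have "ennreal 1 \<le> ennreal (2 * f (X ?s \<omega>))" by (intro ennreal_leI) simp
          then show ?thesis using True by simp
        next
          case False
          then have "indicator (?A k) \<omega> * indicator ?B (\<theta> (enn2real (?\<tau> \<omega>)) \<omega>) = (0::ennreal)"
            unfolding indicator_def by (simp only: de_Morgan_conj) (auto split: if_splits)
          then show ?thesis by (simp only: zero_le)
        qed
      qed
      also have "\<dots> = ennreal (2 * ?T k x)"
      proof -
        have int: "integrable (P x) (\<lambda>\<omega>. f (X ?s \<omega>))"
          by (rule integrable_C0_X[OF cont _ s0 x(1), of 1]) (use f01 in auto)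
        have "(\<integral>\<^sup>+\<omega>. ennreal (2 * f (X ?s \<omega>)) \<partial>P x) = ennreal (\<integral>\<omega>. 2 * f (X ?s \<omega>) \<partial>P x)"
          by (rule nn_integral_eq_integral) (use int f01 in auto)
        then show ?thesis by (simp add: transition_semigroup_def)
      qed
      finally have "ennreal (measure (P x) (?A k) * measure (P y) ?B) \<le> ennreal (2 * ?T k x)"
        by (simp only: ennreal_mult measure_nonneg)
      moreover have "0 \<le> ?T k x" unfolding transition_semigroup_def using f01(1) by (rule Bochner_Integration.integral_nonneg)
      ultimately have "measure (P x) (?A k) * measure (P y) ?B \<le> 2 * ?T k x"
        by (subst (asm) ennreal_le_iff) auto
      moreover have "measure (P x) (?A k) * (1 / 2) \<le> measure (P x) (?A k) * measure (P y) ?B"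
        using PB by (rule mult_left_mono) simp
      ultimately show ?thesis by simp
    qed
    have "\<delta> \<le> laplace x y {}" by (rule \<delta>(3)[OF x])
    also have "\<dots> \<le> measure (P x) {\<omega>\<in>space M. ?\<tau> \<omega> \<le> ennreal t \<and> ?\<tau> \<omega> < entry_time X {} \<omega>} + exp (- t) * hit_prob x y {}"
      by (rule laplace_le_early_plus_late[OF x(1) _ t(1)]) simp
    also have "exp (- t) * hit_prob x y {} \<le> (\<delta> / 2) * 1"
      unfolding t(2) using \<delta>(1) hit_prob_le_1[OF x(1)] by (intro mult_left_mono) auto
    also have "measure (P x) {\<omega>\<in>space M. ?\<tau> \<omega> \<le> ennreal t \<and> ?\<tau> \<omega> < entry_time X {} \<omega>} \<le> measure (P x) (\<Union>k\<in>{..n}. ?A k)"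
    proof (rule finite_measure_mono)
      show "(\<Union>k\<in>{..n}. ?A k) \<in> sets (P x)" using A_P by (intro sets.finite_UN) auto
      show "{\<omega>\<in>space M. ?\<tau> \<omega> \<le> ennreal t \<and> ?\<tau> \<omega> < entry_time X {} \<omega>} \<subseteq> (\<Union>k\<in>{..n}. ?A k)"
      proof
        fix \<omega> assume "\<omega> \<in> {\<omega>\<in>space M. ?\<tau> \<omega> \<le> ennreal t \<and> ?\<tau> \<omega> < entry_time X {} \<omega>}"
        then have \<omega>: "\<omega> \<in> space M" "?\<tau> \<omega> \<le> ennreal t" by auto
        then obtain r where r: "?\<tau> \<omega> = ennreal r" "0 \<le> r" by (cases "?\<tau> \<omega>") (auto simp: top_unique)
        have rt: "r \<le> t" using \<omega>(2) r t(1) by simp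
        define k where "k = nat \<lfloor>r / h\<rfloor>"
        have rh: "0 \<le> r / h" using r(2) h(1) by simp
        then have "real k \<le> r / h" "r / h < real k + 1" unfolding k_def by linarith+
        then have kr: "real k * h \<le> r" "r < real (Suc k) * h" using h(1)
          by (auto simp: pos_le_divide_eq pos_divide_less_eq algebra_simps)
        have "real k * h \<le> real n * h" using kr(1) rt n by linarith
        then have "k \<le> n" using h(1) by simp
        moreover have "\<omega> \<in> ?A k" using \<omega>(1) r kr by (auto intro: ennreal_leI ennreal_lessI simp: ennreal_less_iff)
        ultimately show "\<omega> \<in> (\<Union>k\<in>{..n}. ?A k)" by blast
      qed
    qed
    also have "\<dots> \<le> (\<Sum>k\<le>n. measure (P x) (?A k))"
      by (rule finite_measure_subadditive_finite) (use A_P in auto)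
    finally have "\<delta> / 2 \<le> (\<Sum>k\<le>n. measure (P x) (?A k))" by simp
    then have "\<delta> / 8 \<le> (\<Sum>k\<le>n. measure (P x) (?A k) * (1 / 4))"
      unfolding sum_distrib_right[symmetric] by simp
    also have "\<dots> \<le> (\<Sum>k\<le>n. ?T k x)" by (rule sum_mono) (rule T_ge)
    finally show ?thesis .
  qed
  define \<eta> where "\<eta> = \<delta> / (16 * (n + 1))"
  have \<eta>: "0 < \<eta>" using \<delta>(1) by (simp add: \<eta>_def)
  have "\<forall>k. \<exists>K. K \<subseteq> J \<and> compact K \<and> (\<forall>x\<in>J - K. \<bar>?T k x\<bar> < \<eta>)"
  proof
    fix k
    have "?T k \<in> C0 J" by (rule inv[OF _ f]) (use h(1) in simp)
    then obtain K where "K \<subseteq> J" "compact K" "\<And>x. x \<in> J - K \<Longrightarrow> \<bar>?T k x\<bar> < \<eta>"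
      by (rule C0_small_outside[OF _ \<eta>]) blast
    then show "\<exists>K. K \<subseteq> J \<and> compact K \<and> (\<forall>x\<in>J - K. \<bar>?T k x\<bar> < \<eta>)" by (intro exI[of _ K]) simp
  qed
  from choice[OF this] obtain K where Kall: "\<forall>k. K k \<subseteq> J \<and> compact (K k) \<and> (\<forall>x\<in>J - K k. \<bar>?T k x\<bar> < \<eta>)"
    by (elim exE) (rule that)
  have K: "K k \<subseteq> J" "compact (K k)" for k using Kall by blast+
  have K_small: "\<bar>?T k x\<bar> < \<eta>" if "x \<in> J" "x \<notin> K k" for k x using Kall that by blast
  have "compact (\<Union>k\<in>{..n}. K k)" using K(2) by (intro compact_UN) auto
  then have comp: "compact (insert y (\<Union>k\<in>{..n}. K k))" by (rule compact_insert)
  have sub: "insert y (\<Union>k\<in>{..n}. K k) \<subseteq> J" using K(1) yJ by blast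
  have "\<exists>x\<in>interior J. \<forall>k\<in>insert y (\<Union>k\<in>{..n}. K k). k < x"
    by (rule above_compact[OF sub comp no_max])
  then obtain x where x1: "x \<in> interior J"
    and x2: "\<forall>k\<in>insert y (\<Union>k\<in>{..n}. K k). k < x" by (elim bexE) (rule that)
  have x: "x \<in> interior J" "k \<in> insert y (\<Union>k\<in>{..n}. K k) \<Longrightarrow> k < x" for k
    using x1 x2 by blast+
  have xJ: "x \<in> J" using x(1) interior_J by blast
  have "\<delta> / 8 \<le> (\<Sum>k\<le>n. ?T k x)" by (rule low[OF xJ]) (use x(2) in blast)
  also have "\<dots> \<le> (\<Sum>k\<le>n. \<eta>)"
  proof (rule sum_mono)
    fix k assume "k \<in> {..n}"
    then have "x \<in> K k \<Longrightarrow> x < x" using x(2)[of x] by blast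
    then have "x \<notin> K k" by (metis less_irrefl)
    then show "?T k x \<le> \<eta>" using K_small[OF xJ, of k] by (simp only: abs_less_iff) simp
  qed
  also have "\<dots> = real (n + 1) * \<eta>" by simp
  also have "\<dots> = \<delta> / 16" unfolding \<eta>_def by (simp add: field_simps)
  finally show False using \<delta>(1) by simp
qed

end

lemma C0_reflect: "f \<in> C0 (uminus ` J) \<longleftrightarrow> (\<lambda>x. f (- x)) \<in> C0 J"
proof -
  have imp: "(\<lambda>x. f (- x)) \<in> C0 (uminus ` J)" if f: "f \<in> C0 J" for f :: "real \<Rightarrow> real" and J
    unfolding C0_def
  proof (intro CollectI conjI allI impI)
    show "continuous_on (uminus ` J) (\<lambda>x. f (- x))"
      by (rule continuous_on_compose2[of J f]) (use f in \<open>auto simp: C0_def intro!: continuous_intros\<close>)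
    fix \<epsilon> :: real assume "0 < \<epsilon>"
    then obtain K where K: "K \<subseteq> J" "compact K" "\<And>x. x \<in> J - K \<Longrightarrow> \<bar>f x\<bar> < \<epsilon>"
      by (rule C0_small_outside[OF f]) blast
    show "\<exists>K\<subseteq>uminus ` J. compact K \<and> (\<forall>x\<in>uminus ` J - K. \<bar>f (- x)\<bar> < \<epsilon>)"
    proof (intro exI[of _ "uminus ` K"] conjI ballI)
      show "uminus ` K \<subseteq> uminus ` J" using K(1) by (rule image_mono)
      show "compact (uminus ` K)" using K(2) by (rule compact_negations)
      fix x assume x: "x \<in> uminus ` J - uminus ` K"
      then have "- x \<in> J" by auto
      moreover have "- x \<notin> K" using x by (metis DiffD2 imageI minus_minus)
      ultimately show "\<bar>f (- x)\<bar> < \<epsilon>" by (intro K(3)) simp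
    qed
  qed
  show ?thesis
    using imp[of f "uminus ` J"] imp[of "\<lambda>x. f (- x)" J] by (auto simp: image_image)
qed

lemma transition_reflect:
  "transition_semigroup (\<lambda>t \<omega>. - X t \<omega>) (\<lambda>x. P (- x)) t f x = transition_semigroup X P t (\<lambda>x. f (- x)) (- x)"
  by (simp add: transition_semigroup_def)

lemma left_comes_down_reflect:
  assumes "scaled_diffusion M F J X \<theta> P s m"
  shows "scaled_diffusion.comes_down (uminus ` J) (\<lambda>t \<omega>. - X t \<omega>) (\<lambda>x. P (- x)) (- c) \<longleftrightarrow>
    scaled_diffusion.left_comes_down J X P c"
proof -
  interpret scaled_diffusion M F J X \<theta> P s m by fact
  interpret R: scaled_diffusion M F "uminus ` J" "\<lambda>t \<omega>. - X t \<omega>" \<theta> "\<lambda>x. P (- x)" "\<lambda>x. - s (- x)"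
    "distr m (restrict_space borel (uminus ` interior J)) uminus"
    by (rule scaled_diffusion_reflect) fact
  have D: "diffusion M F J X \<theta> P" by unfold_locales
  show ?thesis
    unfolding R.comes_down_def left_comes_down_def laplace_reflect[OF D]
    by (simp add: ball_simps)
qed

context scaled_diffusion
begin

lemma transition_preserves_C0:
  assumes c: "c \<in> interior J"
    and right: "(\<forall>x\<in>J. \<exists>y\<in>J. x < y) \<Longrightarrow> \<not> comes_down c"
    and left: "(\<forall>x\<in>J. \<exists>y\<in>J. y < x) \<Longrightarrow> \<not> left_comes_down c"
    and f: "f \<in> C0 J" and t: "0 \<le> t"
  shows "transition_semigroup X P t f \<in> C0 J"
proof -
  interpret R: scaled_diffusion M F "uminus ` J" "\<lambda>t \<omega>. - X t \<omega>" \<theta> "\<lambda>x. P (- x)" "\<lambda>x. - s (- x)"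
    "distr m (restrict_space borel (uminus ` interior J)) uminus"
    by (rule scaled_diffusion_reflect) unfold_locales
  have SD: "scaled_diffusion M F J X \<theta> P s m" by unfold_locales
  let ?T = "transition_semigroup X P t f"
  have fR: "(\<lambda>x. f (- x)) \<in> C0 (uminus ` J)" unfolding C0_reflect using f by simp
  have TR: "transition_semigroup (\<lambda>t \<omega>. - X t \<omega>) (\<lambda>x. P (- x)) t (\<lambda>x. f (- x)) x = ?T (- x)" for x
    unfolding transition_reflect by simp
  have intR: "interior (uminus ` J) = uminus ` interior J" by (rule interior_negations)
  have "continuous_on J ?T"
    unfolding continuous_on_iff
  proof (intro ballI allI impI)
    fix z e :: real assume z: "z \<in> J" and "0 < e"
    then have e2: "0 < e / 2" by simp
    have "\<exists>r>0. \<forall>x\<in>J. z < x \<longrightarrow> x \<le> z + r \<longrightarrow> \<bar>?T x - ?T z\<bar> \<le> e / 2"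
    proof (cases "\<exists>d\<in>interior J. z < d")
      case True
      then obtain d where "d \<in> interior J" "z < d" by blast
      from transition_right_continuous[OF f t z this e2] obtain x0 where
        "z < x0" "\<forall>x\<in>J. z < x \<longrightarrow> x \<le> x0 \<longrightarrow> \<bar>?T x - ?T z\<bar> \<le> e / 2" by blast
      then show ?thesis by (intro exI[of _ "x0 - z"]) auto
    next
      case False
      have "\<not> z < x" if "x \<in> J" for x
      proof
        assume "z < x"
        then obtain w where "z < w" "w < x" using dense by blast
        then show False using strictly_between_interior[OF z that] False by blast
      qed
      then show ?thesis by (intro exI[of _ 1]) auto
    qed
    then obtain r where r: "0 < r" "\<And>x. x \<in> J \<Longrightarrow> z < x \<Longrightarrow> x \<le> z + r \<Longrightarrow> \<bar>?T x - ?T z\<bar> \<le> e / 2" by blast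
    have "\<exists>l>0. \<forall>x\<in>J. x < z \<longrightarrow> z - l \<le> x \<longrightarrow> \<bar>?T x - ?T z\<bar> \<le> e / 2"
    proof (cases "\<exists>d\<in>interior J. d < z")
      case True
      then obtain d where d: "- d \<in> interior (uminus ` J)" "- z < - d" unfolding intR by auto
      have "- z \<in> uminus ` J" using z by simp
      from R.transition_right_continuous[OF fR t this d e2, unfolded TR] obtain x0 where
        x0: "- z < x0" "\<forall>x\<in>uminus ` J. - z < x \<longrightarrow> x \<le> x0 \<longrightarrow> \<bar>?T (- x) - ?T z\<bar> \<le> e / 2" by auto
      have "\<bar>?T x - ?T z\<bar> \<le> e / 2" if "x \<in> J" "x < z" "z - (x0 + z) \<le> x" for x
        using x0(2)[rule_format, of "- x"] that by simp
      then show ?thesis using x0(1) by (intro exI[of _ "x0 + z"]) auto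
    next
      case False
      have "\<not> x < z" if "x \<in> J" for x
      proof
        assume "x < z"
        then obtain w where "x < w" "w < z" using dense by blast
        then show False using strictly_between_interior[OF that z] False by blast
      qed
      then show ?thesis by (intro exI[of _ 1]) auto
    qed
    then obtain l where l: "0 < l" "\<And>x. x \<in> J \<Longrightarrow> x < z \<Longrightarrow> z - l \<le> x \<Longrightarrow> \<bar>?T x - ?T z\<bar> \<le> e / 2" by blast
    have "dist (?T x) (?T z) < e" if "x \<in> J" "dist x z < min l r" for x
    proof -
      have "\<bar>x - z\<bar> < min l r" using that(2) by (simp add: dist_real_def)
      then have "\<bar>?T x - ?T z\<bar> \<le> e / 2"
        using r(2)[OF that(1)] l(2)[OF that(1)] e2 by (cases x z rule: linorder_cases) auto
      then show ?thesis using e2 by (simp add: dist_real_def)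
    qed
    then show "\<exists>d>0. \<forall>x\<in>J. dist x z < d \<longrightarrow> dist (?T x) (?T z) < e"
      using l(1) r(1) by (intro exI[of _ "min l r"]) auto
  qed
  moreover have "\<exists>K\<subseteq>J. compact K \<and> (\<forall>x\<in>J - K. \<bar>?T x\<bar> < \<epsilon>)" if \<epsilon>: "0 < \<epsilon>" for \<epsilon>
  proof -
    have \<epsilon>2: "0 < \<epsilon> / 2" using \<epsilon> by simp
    have "\<exists>q\<in>J. \<forall>x\<in>J. q < x \<longrightarrow> \<bar>?T x\<bar> \<le> \<epsilon> / 2"
    proof (cases "\<forall>x\<in>J. \<exists>y\<in>J. x < y")
      case True
      then show ?thesis using transition_vanishes_right[OF f t _ c right[OF True] \<epsilon>2] by blast
    next
      case False
      then show ?thesis by blast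
    qed
    then obtain q where q: "q \<in> J" "\<And>x. x \<in> J \<Longrightarrow> q < x \<Longrightarrow> \<bar>?T x\<bar> \<le> \<epsilon> / 2" by blast
    have "\<exists>p\<in>J. \<forall>x\<in>J. x < p \<longrightarrow> \<bar>?T x\<bar> \<le> \<epsilon> / 2"
    proof (cases "\<forall>x\<in>J. \<exists>y\<in>J. y < x")
      case True
      have not_down: "\<not> R.comes_down (- c)" using left[OF True] left_comes_down_reflect[OF SD] by simp
      have cR: "- c \<in> interior (uminus ` J)" unfolding intR using c by simp
      have "\<exists>y\<in>uminus ` J. x < y" if x: "x \<in> uminus ` J" for x
      proof -
        have "- x \<in> J" using x by auto
        then obtain y where "y \<in> J" "y < - x" using True by blast
        then show ?thesis by (intro bexI[of _ "- y"]) auto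
      qed
      from R.transition_vanishes_right[OF fR t this cR not_down \<epsilon>2]
      have "\<exists>q\<in>uminus ` J. \<forall>x\<in>uminus ` J. q < x \<longrightarrow> \<bar>?T (- x)\<bar> \<le> \<epsilon> / 2" unfolding TR by simp
      then obtain q where q: "q \<in> uminus ` J" "\<forall>x\<in>uminus ` J. q < x \<longrightarrow> \<bar>?T (- x)\<bar> \<le> \<epsilon> / 2"
        by (elim bexE) (rule that)
      have "\<bar>?T x\<bar> \<le> \<epsilon> / 2" if "x \<in> J" "x < - q" for x
        using q(2)[rule_format, of "- x"] that by simp
      then show ?thesis using q(1) by (intro bexI[of _ "- q"]) auto
    next
      case False
      then show ?thesis by blast
    qed
    then obtain p where p: "p \<in> J" "\<And>x. x \<in> J \<Longrightarrow> x < p \<Longrightarrow> \<bar>?T x\<bar> \<le> \<epsilon> / 2" by blast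
    have "{p..q} \<subseteq> J" using interval(1) p(1) q(1) unfolding is_interval_1 by (meson atLeastAtMost_iff subsetI)
    moreover have "\<bar>?T x\<bar> < \<epsilon>" if "x \<in> J - {p..q}" for x
      using p(2)[of x] q(2)[of x] that \<epsilon> by force
    ultimately show ?thesis by (intro exI[of _ "{p..q}"]) auto
  qed
  ultimately show ?thesis by (simp add: C0_def)
qed

lemma transition_uniformly_close:
  assumes f: "f \<in> C0 J" and \<epsilon>: "0 < \<epsilon>"
  shows "\<exists>\<eta>>0. \<forall>t. 0 \<le> t \<longrightarrow> t \<le> \<eta> \<longrightarrow> (\<forall>x\<in>J. \<bar>transition_semigroup X P t f x - f x\<bar> \<le> \<epsilon>)"
proof -
  have cont: "continuous_on J f" using f by (simp add: C0_def)
  obtain B where B: "0 < B" "\<And>x. x \<in> J \<Longrightarrow> \<bar>f x\<bar> \<le> B" by (rule C0_bounded[OF f]) blast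
  define e where "e = \<epsilon> / (1 + 2 * B)"
  have e: "0 < e" "e * (1 + 2 * B) = \<epsilon>" using \<epsilon> B by (simp_all add: e_def)
  obtain \<eta> where \<eta>: "0 < \<eta>" "\<And>w. w \<in> J \<Longrightarrow> measure (P w) (oscillates f e \<eta>) \<le> e"
    using oscillation_unlikely[OF f e(1)] by blast
  have "\<bar>transition_semigroup X P t f x - f x\<bar> \<le> \<epsilon>" if t: "0 \<le> t" "t \<le> \<eta>" and x: "x \<in> J" for t x
  proof -
    interpret prob_space "P x" using prob x .
    have int: "integrable (P x) (\<lambda>\<omega>. f (X t \<omega>))" by (rule integrable_C0_X[OF cont B(2) t(1) x])
    have O: "oscillates f e \<eta> \<in> sets (P x)" by (rule sets_paths_P[OF x oscillates_sets[OF cont]])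
    have intO: "integrable (P x) (indicat_real (oscillates f e \<eta>))"
      by (rule integrable_real_indicator[OF O]) (simp add: emeasure_eq_measure)
    have "transition_semigroup X P t f x - f x = (\<integral>\<omega>. f (X t \<omega>) - f x \<partial>P x)"
      using int by (simp add: transition_semigroup_def prob_space)
    then have "\<bar>transition_semigroup X P t f x - f x\<bar> \<le> (\<integral>\<omega>. \<bar>f (X t \<omega>) - f x\<bar> \<partial>P x)"
      by (simp only: integral_abs_bound)
    also have "\<dots> \<le> (\<integral>\<omega>. e + 2 * B * indicator (oscillates f e \<eta>) \<omega> \<partial>P x)"
    proof (rule integral_mono_AE)
      show "AE \<omega> in P x. \<bar>f (X t \<omega>) - f x\<bar> \<le> e + 2 * B * indicator (oscillates f e \<eta>) \<omega>"
        using start_eq[OF x]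
      proof eventually_elim
        case (elim \<omega>)
        show ?case
        proof (cases "\<omega> \<in> oscillates f e \<eta>")
          case True
          have "\<bar>f (X t \<omega>)\<bar> \<le> B" "\<bar>f x\<bar> \<le> B" using B(2) X_in_J[OF t(1)] elim x by auto
          then show ?thesis using True e(1) by (simp add: abs_le_iff)
        next
          case False
          then show ?thesis using not_oscillates[OF cont _ False t \<eta>(1)] elim by simp
        qed
      qed
    qed (use int intO in auto)
    also have "\<dots> = e + 2 * B * measure (P x) (oscillates f e \<eta>)" using O intO by (simp add: prob_space)
    also have "\<dots> \<le> e + 2 * B * e" using \<eta>(2)[OF x] B(1) by (intro add_left_mono mult_left_mono) auto
    also have "\<dots> = \<epsilon>" using e(2) by (simp add: algebra_simps)
    finally show ?thesis .
  qed
  then show ?thesis using \<eta>(1) by blast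
qed

lemma transition_semigroup_add:
  assumes f: "f \<in> C0 J" and t: "0 \<le> t" "0 \<le> u" and x: "x \<in> J"
    and Tf: "continuous_on J (transition_semigroup X P u f)"
  shows "transition_semigroup X P (t + u) f x = transition_semigroup X P t (transition_semigroup X P u f) x"
proof -
  let ?T = "transition_semigroup X P"
  have cont: "continuous_on J f" using f by (simp add: C0_def)
  obtain B where B: "0 < B" "\<And>x. x \<in> J \<Longrightarrow> \<bar>f x\<bar> \<le> B" by (rule C0_bounded[OF f]) blast
  have tu: "0 \<le> t + u" using t by simp
  have TB: "\<bar>?T u f x\<bar> \<le> B" if "x \<in> J" for x by (rule abs_transition_le[OF cont B(2) t(2) that])
  have F_paths: "(\<lambda>\<omega>. ennreal (f (X u \<omega>) + B)) \<in> borel_measurable (path_algebra M X)"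
    using measurable_C0_X[OF cont t(2)] by measurable
  have "ennreal (?T (t + u) f x + B) = (\<integral>\<^sup>+\<omega>. ennreal (f (X (t + u) \<omega>) + B) \<partial>P x)"
    by (rule ennreal_transition_shifted[OF cont B(2) tu x, symmetric])
  also have "\<dots> = (\<integral>\<^sup>+\<omega>. 1 * ennreal (f (X u (\<theta> t \<omega>)) + B) \<partial>P x)"
    by (rule nn_integral_cong) (use x t in \<open>simp add: shift add.commute\<close>)
  also have "\<dots> = (\<integral>\<^sup>+\<omega>. 1 * (\<integral>\<^sup>+\<omega>'. ennreal (f (X u \<omega>') + B) \<partial>P (X t \<omega>)) \<partial>P x)"
    by (rule markov_nn[OF x t(1) _ F_paths]) simp
  also have "\<dots> = (\<integral>\<^sup>+\<omega>. ennreal (?T u f (X t \<omega>) + B) \<partial>P x)"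
  proof (rule nn_integral_cong)
    fix \<omega> assume "\<omega> \<in> space (P x)"
    then have "X t \<omega> \<in> J" using X_in_J[OF t(1)] x by simp
    then show "1 * (\<integral>\<^sup>+\<omega>'. ennreal (f (X u \<omega>') + B) \<partial>P (X t \<omega>)) = ennreal (?T u f (X t \<omega>) + B)"
      using ennreal_transition_shifted[OF cont B(2) t(2)] by simp
  qed
  also have "\<dots> = ennreal (?T t (?T u f) x + B)"
    by (rule ennreal_transition_shifted[OF Tf TB t(1) x])
  finally have eq: "ennreal (?T (t + u) f x + B) = ennreal (?T t (?T u f) x + B)" .
  have "0 \<le> ?T (t + u) f x + B" using abs_transition_le[OF cont B(2) tu x] by (simp add: abs_le_iff)
  moreover have "0 \<le> ?T t (?T u f) x + B" using abs_transition_le[OF Tf TB t(1) x] by (simp add: abs_le_iff)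
  ultimately show ?thesis using eq by simp
qed

theorem FD_process_iff:
  assumes c: "c \<in> interior J"
  shows "FD_process J X P \<longleftrightarrow>
    ((\<forall>x\<in>J. \<exists>y\<in>J. x < y) \<longrightarrow> \<not> comes_down c) \<and> ((\<forall>x\<in>J. \<exists>y\<in>J. y < x) \<longrightarrow> \<not> left_comes_down c)"
    (is "_ \<longleftrightarrow> ?R \<and> ?L")
proof
  interpret R: scaled_diffusion M F "uminus ` J" "\<lambda>t \<omega>. - X t \<omega>" \<theta> "\<lambda>x. P (- x)" "\<lambda>x. - s (- x)"
    "distr m (restrict_space borel (uminus ` interior J)) uminus"
    by (rule scaled_diffusion_reflect) unfold_locales
  have SD: "scaled_diffusion M F J X \<theta> P s m" by unfold_locales
  assume "FD_process J X P"
  then have inv: "transition_semigroup X P t f \<in> C0 J" if "0 \<le> t" "f \<in> C0 J" for t f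
    using that by (simp add: FD_process_def strongly_continuous_semigroup_def)
  have ?R using not_comes_down_of_invariant[OF inv _ c] by blast
  moreover have ?L
  proof
    assume no_min: "\<forall>x\<in>J. \<exists>y\<in>J. y < x"
    have "\<not> R.comes_down (- c)"
    proof (rule R.not_comes_down_of_invariant)
      show "- c \<in> interior (uminus ` J)" unfolding interior_negations using c by simp
    next
      fix x assume "x \<in> uminus ` J"
      then have "- x \<in> J" by auto
      then obtain y where "y \<in> J" "y < - x" using no_min by blast
      then show "\<exists>y\<in>uminus ` J. x < y" by (intro bexI[of _ "- y"]) auto
    next
      fix t :: real and f assume "0 \<le> t" "f \<in> C0 (uminus ` J)"
      then show "transition_semigroup (\<lambda>t \<omega>. - X t \<omega>) (\<lambda>x. P (- x)) t f \<in> C0 (uminus ` J)"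
        unfolding C0_reflect transition_reflect using inv by simp
    qed
    then show "\<not> left_comes_down c" using left_comes_down_reflect[OF SD] by simp
  qed
  ultimately show "?R \<and> ?L" ..
next
  assume RL: "?R \<and> ?L"
  let ?T = "transition_semigroup X P"
  have inv: "?T t f \<in> C0 J" if "0 \<le> t" "f \<in> C0 J" for t f
    by (rule transition_preserves_C0[OF c _ _ that(2,1)]) (use RL in blast)+
  have ne: "J \<noteq> {}" by (rule interval(2))
  have C0_cont: "continuous_on J f" if "f \<in> C0 J" for f using that by (simp add: C0_def)
  have sup_upper: "\<bar>f x\<bar> \<le> sup_norm_on J f" if f: "f \<in> C0 J" and x: "x \<in> J" for f x
  proof -
    obtain B where "\<And>x. x \<in> J \<Longrightarrow> \<bar>f x\<bar> \<le> B" by (rule C0_bounded[OF f]) blast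
    then show ?thesis unfolding sup_norm_on_def using x by (intro cSUP_upper bdd_aboveI2)
  qed
  have lin: "?T t (\<lambda>y. \<alpha> * f y + \<beta> * g y) x = \<alpha> * ?T t f x + \<beta> * ?T t g x"
    if "0 \<le> t" "f \<in> C0 J" "g \<in> C0 J" "x \<in> J" for t f g \<alpha> \<beta> x
  proof -
    have "integrable (P x) (\<lambda>\<omega>. f (X t \<omega>))"
      by (rule integrable_C0_X[OF C0_cont[OF that(2)] sup_upper[OF that(2)] that(1,4)])
    moreover have "integrable (P x) (\<lambda>\<omega>. g (X t \<omega>))"
      by (rule integrable_C0_X[OF C0_cont[OF that(3)] sup_upper[OF that(3)] that(1,4)])
    ultimately show ?thesis by (simp add: transition_semigroup_def)
  qed
  have contr: "sup_norm_on J (?T t f) \<le> 1 * sup_norm_on J f" if "0 \<le> t" "f \<in> C0 J" for t f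
    unfolding sup_norm_on_def[of J "?T t f"]
    by (rule cSUP_least[OF ne]) (use abs_transition_le[OF C0_cont[OF that(2)] sup_upper[OF that(2)] that(1)] in simp)
  have start0: "?T 0 f x = f x" if f: "f \<in> C0 J" and x: "x \<in> J" for f x
  proof -
    interpret prob_space "P x" using prob x .
    have "?T 0 f x = (\<integral>\<omega>. f x \<partial>P x)"
      unfolding transition_semigroup_def
    proof (rule integral_cong_AE)
      show "(\<lambda>\<omega>. f (X 0 \<omega>)) \<in> borel_measurable (P x)"
        by (rule measurable_paths_P[OF x measurable_C0_X[OF C0_cont[OF f]]]) simp
      show "AE \<omega> in P x. f (X 0 \<omega>) = f x" using start_eq[OF x] by eventually_elim simp
    qed simp
    then show ?thesis by (simp add: prob_space)
  qed
  have strong: "((\<lambda>t. sup_norm_on J (\<lambda>x. ?T t f x - f x)) \<longlongrightarrow> 0) (at_right 0)" if f: "f \<in> C0 J" for f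
  proof (rule tendstoI)
    fix \<epsilon> :: real assume "0 < \<epsilon>"
    then have "0 < \<epsilon> / 2" by simp
    from transition_uniformly_close[OF f this] obtain \<eta> where \<eta>: "0 < \<eta>"
      "\<And>t x. 0 \<le> t \<Longrightarrow> t \<le> \<eta> \<Longrightarrow> x \<in> J \<Longrightarrow> \<bar>?T t f x - f x\<bar> \<le> \<epsilon> / 2" by blast
    have "dist (sup_norm_on J (\<lambda>x. ?T t f x - f x)) 0 < \<epsilon>" if t: "0 < t" "t < \<eta>" for t
    proof -
      have "sup_norm_on J (\<lambda>x. ?T t f x - f x) \<le> \<epsilon> / 2"
        unfolding sup_norm_on_def by (intro cSUP_least ne) (use \<eta>(2) t in auto)
      moreover have "0 \<le> sup_norm_on J (\<lambda>x. ?T t f x - f x)"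
      proof -
        obtain x where x: "x \<in> J" using ne by blast
        have "0 \<le> \<bar>?T t f x - f x\<bar>" by simp
        also have "\<dots> \<le> sup_norm_on J (\<lambda>x. ?T t f x - f x)"
          unfolding sup_norm_on_def using x \<eta>(2) t by (intro cSUP_upper bdd_aboveI2[where M="\<epsilon> / 2"]) auto
        finally show ?thesis .
      qed
      ultimately show ?thesis using \<open>0 < \<epsilon> / 2\<close> by (simp add: dist_real_def)
    qed
    then show "eventually (\<lambda>t. dist (sup_norm_on J (\<lambda>x. ?T t f x - f x)) 0 < \<epsilon>) (at_right 0)"
      unfolding eventually_at_right_field using \<eta>(1) by blast
  qed
  have add: "?T (t + u) f x = ?T t (?T u f) x" if "0 \<le> t" "0 \<le> u" "f \<in> C0 J" "x \<in> J" for t u f x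
    by (rule transition_semigroup_add[OF that(3,1,2,4) C0_cont[OF inv[OF that(2,3)]]])
  show "FD_process J X P"
    unfolding FD_process_def strongly_continuous_semigroup_def
  proof (intro conjI allI ballI impI)
    show "\<exists>C. \<forall>f\<in>C0 J. sup_norm_on J (?T t f) \<le> C * sup_norm_on J f" if "0 \<le> t" for t
      using contr[OF that] by (intro exI[of _ 1]) blast
  qed (fact inv lin start0 add strong)+
qed

end

section \<open>Two facts on expectations\<close>

lemma integral_of_limit:
  fixes Z :: "nat \<Rightarrow> 'a \<Rightarrow> real"
  assumes "prob_space Q" and Z: "\<And>n. integrable Q (Z n)" "\<And>n. (\<integral>\<omega>. Z n \<omega> \<partial>Q) = \<mu>"
    and Y: "Y \<in> borel_measurable Q" and lim: "AE \<omega> in Q. (\<lambda>n. Z n \<omega>) \<longlonglongrightarrow> Y \<omega>"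
    and up: "\<And>\<epsilon>. 0 < \<epsilon> \<Longrightarrow> \<exists>K. \<forall>n. (\<integral>\<^sup>+\<omega>. ennreal (Z n \<omega> - K) \<partial>Q) \<le> ennreal \<epsilon>"
    and down: "\<And>\<epsilon>. 0 < \<epsilon> \<Longrightarrow> \<exists>K. \<forall>n. (\<integral>\<^sup>+\<omega>. ennreal (- Z n \<omega> - K) \<partial>Q) \<le> ennreal \<epsilon>"
  shows "integrable Q Y" "(\<integral>\<omega>. Y \<omega> \<partial>Q) = \<mu>"
proof -
  interpret prob_space Q by fact
  have Zm [measurable]: "Z n \<in> borel_measurable Q" for n using Z(1) by blast
  note Y [measurable]
  have main: "integrable Q Y \<and> \<bar>(\<integral>\<omega>. Y \<omega> \<partial>Q) - \<mu>\<bar> \<le> 5 * \<epsilon>" if \<epsilon>: "0 < \<epsilon>" for \<epsilon>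
  proof -
    obtain K1 where K1: "\<And>n. (\<integral>\<^sup>+\<omega>. ennreal (Z n \<omega> - K1) \<partial>Q) \<le> ennreal \<epsilon>" using up[OF \<epsilon>] by blast
    obtain K2 where K2: "\<And>n. (\<integral>\<^sup>+\<omega>. ennreal (- Z n \<omega> - K2) \<partial>Q) \<le> ennreal \<epsilon>" using down[OF \<epsilon>] by blast
    define K where "K = max 0 (max K1 K2)"
    define C where "C z = max (- K) (min K z)" for z :: real
    have Cm [measurable]: "C \<in> borel_measurable borel" unfolding C_def by measurable
    have C_bound: "\<bar>C z\<bar> \<le> K" for z by (auto simp: C_def K_def)
    have C_diff: "ennreal \<bar>z - C z\<bar> \<le> ennreal (z - K1) + ennreal (- z - K2)" for z
    proof -
      consider "K < z" | "z < - K" | "- K \<le> z" "z \<le> K" by linarith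
      then show ?thesis
      proof cases
        case 1
        then have "\<bar>z - C z\<bar> \<le> z - K1" by (auto simp: C_def K_def)
        then show ?thesis by (intro add_increasing2 ennreal_leI) auto
      next
        case 2
        then have "\<bar>z - C z\<bar> \<le> - z - K2" by (auto simp: C_def K_def)
        then show ?thesis by (intro add_increasing ennreal_leI) auto
      next
        case 3
        then have "C z = z" by (auto simp: C_def)
        then show ?thesis by simp
      qed
    qed
    have Zd: "(\<integral>\<^sup>+\<omega>. ennreal \<bar>Z n \<omega> - C (Z n \<omega>)\<bar> \<partial>Q) \<le> ennreal (2 * \<epsilon>)" for n
    proof -
      have "(\<integral>\<^sup>+\<omega>. ennreal \<bar>Z n \<omega> - C (Z n \<omega>)\<bar> \<partial>Q) \<le> (\<integral>\<^sup>+\<omega>. ennreal (Z n \<omega> - K1) + ennreal (- Z n \<omega> - K2) \<partial>Q)"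
        by (rule nn_integral_mono) (rule C_diff)
      also have "\<dots> = (\<integral>\<^sup>+\<omega>. ennreal (Z n \<omega> - K1) \<partial>Q) + (\<integral>\<^sup>+\<omega>. ennreal (- Z n \<omega> - K2) \<partial>Q)"
        by (rule nn_integral_add) measurable
      also have "\<dots> \<le> ennreal \<epsilon> + ennreal \<epsilon>" by (rule add_mono[OF K1 K2])
      also have "\<dots> = ennreal (2 * \<epsilon>)" using \<epsilon> by (subst ennreal_plus[symmetric]) auto
      finally show ?thesis .
    qed
    have C_cont: "continuous_on UNIV C" unfolding C_def by (intro continuous_intros)
    have C_lim: "(\<lambda>n. C (z n)) \<longlonglongrightarrow> C y" if "z \<longlonglongrightarrow> y" for z y
      by (rule continuous_on_tendsto_compose[OF C_cont that]) auto
    have Yd: "(\<integral>\<^sup>+\<omega>. ennreal \<bar>Y \<omega> - C (Y \<omega>)\<bar> \<partial>Q) \<le> ennreal (2 * \<epsilon>)"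
    proof -
      have "(\<integral>\<^sup>+\<omega>. ennreal \<bar>Y \<omega> - C (Y \<omega>)\<bar> \<partial>Q) = (\<integral>\<^sup>+\<omega>. liminf (\<lambda>n. ennreal \<bar>Z n \<omega> - C (Z n \<omega>)\<bar>) \<partial>Q)"
      proof (rule nn_integral_cong_AE)
        show "AE \<omega> in Q. ennreal \<bar>Y \<omega> - C (Y \<omega>)\<bar> = liminf (\<lambda>n. ennreal \<bar>Z n \<omega> - C (Z n \<omega>)\<bar>)"
          using lim
        proof eventually_elim
          case (elim \<omega>)
          have "(\<lambda>n. ennreal \<bar>Z n \<omega> - C (Z n \<omega>)\<bar>) \<longlonglongrightarrow> ennreal \<bar>Y \<omega> - C (Y \<omega>)\<bar>"
            by (intro tendsto_ennrealI tendsto_rabs tendsto_diff elim C_lim)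
          then show ?case using lim_imp_Liminf[OF sequentially_bot] by metis
        qed
      qed
      also have "\<dots> \<le> liminf (\<lambda>n. \<integral>\<^sup>+\<omega>. ennreal \<bar>Z n \<omega> - C (Z n \<omega>)\<bar> \<partial>Q)"
        by (rule nn_integral_liminf) measurable
      also have "\<dots> \<le> liminf (\<lambda>n::nat. ennreal (2 * \<epsilon>))"
        by (rule Liminf_mono) (simp only: Zd always_eventually simp_thms)
      finally show ?thesis by (simp add: Liminf_const)
    qed
    have intC: "integrable Q (\<lambda>\<omega>. C (g \<omega>))" if [measurable]: "g \<in> borel_measurable Q" for g
      by (rule integrable_const_bound[where B=K]) (use C_bound in auto)
    have intYd: "integrable Q (\<lambda>\<omega>. Y \<omega> - C (Y \<omega>))"
    proof (rule integrableI_bounded)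
      show "(\<integral>\<^sup>+\<omega>. ennreal (norm (Y \<omega> - C (Y \<omega>))) \<partial>Q) < \<infinity>"
        unfolding real_norm_def by (rule le_less_trans[OF Yd]) simp
    qed measurable
    have intY: "integrable Q Y"
      using Bochner_Integration.integrable_add[OF intYd intC[OF Y]] by simp
    have dist_le: "\<bar>(\<integral>\<omega>. g \<omega> \<partial>Q) - (\<integral>\<omega>. C (g \<omega>) \<partial>Q)\<bar> \<le> 2 * \<epsilon>"
      if g: "integrable Q g" and d: "(\<integral>\<^sup>+\<omega>. ennreal \<bar>g \<omega> - C (g \<omega>)\<bar> \<partial>Q) \<le> ennreal (2 * \<epsilon>)" for g
    proof -
      have gm: "g \<in> borel_measurable Q" using g by blast
      have int: "integrable Q (\<lambda>\<omega>. g \<omega> - C (g \<omega>))" by (rule Bochner_Integration.integrable_diff[OF g intC[OF gm]])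
      have "\<bar>(\<integral>\<omega>. g \<omega> \<partial>Q) - (\<integral>\<omega>. C (g \<omega>) \<partial>Q)\<bar> = \<bar>\<integral>\<omega>. g \<omega> - C (g \<omega>) \<partial>Q\<bar>"
        by (subst Bochner_Integration.integral_diff[OF g intC[OF gm]]) simp
      also have "\<dots> \<le> (\<integral>\<omega>. \<bar>g \<omega> - C (g \<omega>)\<bar> \<partial>Q)" by (rule integral_abs_bound)
      also have "(\<integral>\<omega>. \<bar>g \<omega> - C (g \<omega>)\<bar> \<partial>Q) \<le> 2 * \<epsilon>"
      proof -
        have "ennreal (\<integral>\<omega>. \<bar>g \<omega> - C (g \<omega>)\<bar> \<partial>Q) = (\<integral>\<^sup>+\<omega>. ennreal \<bar>g \<omega> - C (g \<omega>)\<bar> \<partial>Q)"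
          by (rule nn_integral_eq_integral[symmetric]) (use int in auto)
        then have "ennreal (\<integral>\<omega>. \<bar>g \<omega> - C (g \<omega>)\<bar> \<partial>Q) \<le> ennreal (2 * \<epsilon>)" using d by (rule ord_eq_le_trans)
        then show ?thesis using \<epsilon> by (subst (asm) ennreal_le_iff) simp_all
      qed
      finally show ?thesis .
    qed
    have "(\<lambda>n. \<integral>\<omega>. C (Z n \<omega>) \<partial>Q) \<longlonglongrightarrow> (\<integral>\<omega>. C (Y \<omega>) \<partial>Q)"
    proof (rule integral_dominated_convergence[where w="\<lambda>_. K"])
      show "AE \<omega> in Q. (\<lambda>n. C (Z n \<omega>)) \<longlonglongrightarrow> C (Y \<omega>)"
        using lim by eventually_elim (rule C_lim)
      show "AE \<omega> in Q. norm (C (Z n \<omega>)) \<le> K" for n by (simp add: C_bound)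
    qed simp_all
    then obtain n where n: "\<bar>(\<integral>\<omega>. C (Z n \<omega>) \<partial>Q) - (\<integral>\<omega>. C (Y \<omega>) \<partial>Q)\<bar> < \<epsilon>"
      using \<epsilon> unfolding LIMSEQ_iff real_norm_def by blast
    have "\<bar>(\<integral>\<omega>. Y \<omega> \<partial>Q) - \<mu>\<bar> \<le> 5 * \<epsilon>"
      using dist_le[OF intY Yd] dist_le[OF Z(1)[of n] Zd[of n]] n unfolding Z(2) abs_le_iff abs_less_iff by simp
    then show ?thesis using intY by blast
  qed
  show "integrable Q Y" using main[of 1] by simp
  show "(\<integral>\<omega>. Y \<omega> \<partial>Q) = \<mu>"
  proof (rule ccontr)
    assume "(\<integral>\<omega>. Y \<omega> \<partial>Q) \<noteq> \<mu>"
    then have "0 < \<bar>(\<integral>\<omega>. Y \<omega> \<partial>Q) - \<mu>\<bar> / 10" by simp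
    from main[OF this] \<open>(\<integral>\<omega>. Y \<omega> \<partial>Q) \<noteq> \<mu>\<close> show False by simp
  qed
qed

text \<open>Doob's inequality for \<open>(Y - K)\<^sup>+\<close>: decompose by the first time in \<open>D\<close> at which \<open>Y\<close> exceeds
  \<open>L\<close>.\<close>

lemma martingale_maximal_inequality:
  assumes "prob_space Q" and sub: "\<And>t. 0 \<le> t \<Longrightarrow> subalgebra Q (F t)"
    and mono: "\<And>t u. 0 \<le> t \<Longrightarrow> t \<le> u \<Longrightarrow> sets (F t) \<subseteq> sets (F u)"
    and Y: "martingale Q F Y" and D: "finite D" "D \<subseteq> {0..t}" and K: "K < L"
  shows "(L - K) * measure Q {\<omega>\<in>space Q. \<exists>u\<in>D. L < Y u \<omega>} \<le> (\<integral>\<omega>. max 0 (Y t \<omega> - K) \<partial>Q)"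
proof (cases "D = {}")
  case True
  then show ?thesis by (auto intro: integral_nonneg_AE)
next
  case False
  interpret prob_space Q by fact
  have t: "0 \<le> t" using False D(2) by force
  have Yint: "integrable Q (Y u)" and Ymeas: "Y u \<in> borel_measurable (F u)" if "0 \<le> u" for u
    using Y that by (auto simp: martingale_def)
  let ?A = "\<lambda>u. {\<omega>\<in>space Q. L < Y u \<omega> \<and> (\<forall>v\<in>D. v < u \<longrightarrow> \<not> L < Y v \<omega>)}"
  have A_F: "?A u \<in> sets (F u)" if u: "u \<in> D" for u
  proof -
    have u0: "0 \<le> u" using u D(2) by auto
    have sp: "space (F u) = space Q" using sub[OF u0] by (simp add: subalgebra_def)
    have lev: "{\<omega>\<in>space Q. L < Y v \<omega>} \<in> sets (F u)" if v: "v \<in> D" "v \<le> u" for v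
    proof -
      have v0: "0 \<le> v" using v D(2) by auto
      have "{\<omega>\<in>space (F v). L < Y v \<omega>} \<in> sets (F v)" using Ymeas[OF v0] by measurable
      moreover have "space (F v) = space Q" using sub[OF v0] by (simp add: subalgebra_def)
      ultimately show ?thesis using mono[OF v0 v(2)] by auto
    qed
    have "?A u = {\<omega>\<in>space Q. L < Y u \<omega>} - (\<Union>v\<in>{v\<in>D. v < u}. {\<omega>\<in>space Q. L < Y v \<omega>})" by auto
    also have "\<dots> \<in> sets (F u)"
      using D(1) lev u by (intro sets.Diff sets.finite_UN) auto
    finally show ?thesis .
  qed
  have A_Q: "?A u \<in> sets Q" if "u \<in> D" for u
  proof -
    have "0 \<le> u" using that D(2) by auto
    then show ?thesis using A_F[OF that] sub[of u] unfolding subalgebra_def by blast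
  qed
  have union: "{\<omega>\<in>space Q. \<exists>u\<in>D. L < Y u \<omega>} = (\<Union>u\<in>D. ?A u)"
  proof (intro equalityI subsetI)
    fix \<omega> assume \<omega>: "\<omega> \<in> {\<omega>\<in>space Q. \<exists>u\<in>D. L < Y u \<omega>}"
    let ?D = "{u\<in>D. L < Y u \<omega>}"
    have ne: "finite ?D" "?D \<noteq> {}" using \<omega> D(1) by auto
    have m: "Min ?D \<in> ?D" by (rule Min_in[OF ne])
    have "\<not> L < Y v \<omega>" if "v \<in> D" "v < Min ?D" for v
      using Min_le[OF ne(1), of v] that by auto
    then have "\<omega> \<in> ?A (Min ?D)" using m \<omega> by blast
    then show "\<omega> \<in> (\<Union>u\<in>D. ?A u)" using m by blast
  qed auto
  have disj: "disjoint_family_on ?A D"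
    unfolding disjoint_family_on_def
  proof (intro ballI impI)
    fix u v assume "u \<in> D" "v \<in> D" "u \<noteq> v"
    then show "?A u \<inter> ?A v = {}" by (cases u v rule: linorder_cases) auto
  qed
  have int_pos: "integrable Q (\<lambda>\<omega>. max 0 (Y t \<omega> - K))" using Yint[OF t] by auto
  have step: "(L - K) * measure Q (?A u) \<le> (\<integral>\<omega>. indicator (?A u) \<omega> * max 0 (Y t \<omega> - K) \<partial>Q)" if u: "u \<in> D" for u
  proof -
    have ut: "0 \<le> u" "u \<le> t" using u D(2) by auto
    interpret finite_measure_subalgebra Q "F u" by unfold_locales (rule sub[OF ut(1)])
    have indY: "integrable Q (\<lambda>\<omega>. indicator (?A u) \<omega> * Y v \<omega>)" if "0 \<le> v" for v
      using integrable_mult_indicator[OF A_Q[OF u] Yint[OF that]] by simp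
    have ind1: "integrable Q (\<lambda>\<omega>. indicator (?A u) \<omega> * c)" for c :: real
      using integrable_mult_indicator[OF A_Q[OF u], of "\<lambda>_. c"] by simp
    have "(L - K) * measure Q (?A u) = (\<integral>\<omega>. indicator (?A u) \<omega> * (L - K) \<partial>Q)"
      using A_Q[OF u] by simp
    also have "\<dots> \<le> (\<integral>\<omega>. indicator (?A u) \<omega> * (Y u \<omega> - K) \<partial>Q)"
    proof (rule integral_mono[OF ind1])
      show "integrable Q (\<lambda>\<omega>. indicator (?A u) \<omega> * (Y u \<omega> - K))"
        unfolding right_diff_distrib by (intro Bochner_Integration.integrable_diff indY ind1 ut)
    qed (auto simp: indicator_def)
    also have "\<dots> = (\<integral>\<omega>. indicator (?A u) \<omega> * Y u \<omega> \<partial>Q) - (\<integral>\<omega>. indicator (?A u) \<omega> * K \<partial>Q)"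
      unfolding right_diff_distrib by (rule Bochner_Integration.integral_diff[OF indY[OF ut(1)] ind1])
    also have "(\<integral>\<omega>. indicator (?A u) \<omega> * Y u \<omega> \<partial>Q) = (\<integral>\<omega>. indicator (?A u) \<omega> * Y t \<omega> \<partial>Q)"
    proof -
      have "(\<integral>\<omega>. indicator (?A u) \<omega> * Y t \<omega> \<partial>Q) = (\<integral>\<omega>. indicator (?A u) \<omega> * real_cond_exp Q (F u) (Y t) \<omega> \<partial>Q)"
        by (rule real_cond_exp_intg(2)[symmetric, OF indY[OF t]]) (use A_F[OF u] Yint[OF t] in auto)
      also have "\<dots> = (\<integral>\<omega>. indicator (?A u) \<omega> * Y u \<omega> \<partial>Q)"
      proof (rule integral_cong_AE)
        have "AE \<omega> in Q. real_cond_exp Q (F u) (Y t) \<omega> = Y u \<omega>" using Y ut by (simp add: martingale_def)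
        then show "AE \<omega> in Q. indicator (?A u) \<omega> * real_cond_exp Q (F u) (Y t) \<omega> = indicator (?A u) \<omega> * Y u \<omega>"
          by eventually_elim simp
      qed (use A_Q[OF u] Yint[OF ut(1)] in \<open>auto intro!: borel_measurable_times\<close>)
      finally show ?thesis by (rule sym)
    qed
    also have "(\<integral>\<omega>. indicator (?A u) \<omega> * Y t \<omega> \<partial>Q) - (\<integral>\<omega>. indicator (?A u) \<omega> * K \<partial>Q) = (\<integral>\<omega>. indicator (?A u) \<omega> * (Y t \<omega> - K) \<partial>Q)"
      unfolding right_diff_distrib by (rule Bochner_Integration.integral_diff[OF indY[OF t] ind1, symmetric])
    also have "\<dots> \<le> (\<integral>\<omega>. indicator (?A u) \<omega> * max 0 (Y t \<omega> - K) \<partial>Q)"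
    proof (rule integral_mono)
      show "integrable Q (\<lambda>\<omega>. indicator (?A u) \<omega> * (Y t \<omega> - K))"
        unfolding right_diff_distrib by (intro Bochner_Integration.integrable_diff indY ind1 t)
      show "integrable Q (\<lambda>\<omega>. indicator (?A u) \<omega> * max 0 (Y t \<omega> - K))"
        using integrable_mult_indicator[OF A_Q[OF u] int_pos] by simp
    qed (auto simp: indicator_def)
    finally show ?thesis .
  qed
  have "(L - K) * measure Q {\<omega>\<in>space Q. \<exists>u\<in>D. L < Y u \<omega>} = (\<Sum>u\<in>D. (L - K) * measure Q (?A u))"
    unfolding union sum_distrib_left[symmetric]
    by (subst finite_measure_finite_Union[OF D(1) _ disj]) (use A_Q in auto)
  also have "\<dots> \<le> (\<Sum>u\<in>D. \<integral>\<omega>. indicator (?A u) \<omega> * max 0 (Y t \<omega> - K) \<partial>Q)"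
    by (rule sum_mono) (rule step)
  also have "\<dots> = (\<integral>\<omega>. (\<Sum>u\<in>D. indicator (?A u) \<omega> * max 0 (Y t \<omega> - K)) \<partial>Q)"
    by (rule Bochner_Integration.integral_sum[symmetric])
      (use integrable_mult_indicator[OF A_Q int_pos] in simp)
  also have "\<dots> \<le> (\<integral>\<omega>. max 0 (Y t \<omega> - K) \<partial>Q)"
  proof (rule integral_mono[OF _ int_pos])
    show "integrable Q (\<lambda>\<omega>. \<Sum>u\<in>D. indicator (?A u) \<omega> * max 0 (Y t \<omega> - K))"
      by (rule Bochner_Integration.integrable_sum) (use integrable_mult_indicator[OF A_Q int_pos] in simp)
    fix \<omega> assume "\<omega> \<in> space Q"
    have "(\<Sum>u\<in>D. indicator (?A u) \<omega> :: real) = indicator (\<Union>u\<in>D. ?A u) \<omega>"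
      using disj D(1) by (simp only: indicator_UN_disjoint)
    also have "\<dots> \<le> 1" by (rule indicator_le_1)
    finally have "(\<Sum>u\<in>D. indicator (?A u) \<omega>) * max 0 (Y t \<omega> - K) \<le> 1 * max 0 (Y t \<omega> - K)"
      by (rule mult_right_mono) simp
    then show "(\<Sum>u\<in>D. indicator (?A u) \<omega> * max 0 (Y t \<omega> - K)) \<le> max 0 (Y t \<omega> - K)"
      unfolding sum_distrib_right by simp
  qed
  finally show ?thesis .
qed

section \<open>When the stopped process on natural scale is a martingale\<close>

context scaled_diffusion
begin

abbreviation "exit_time \<equiv> entry_time X (- interior J)"

lemma closed_exterior: "closed (- interior J)"
  by (simp add: closed_Compl)

lemma stopped_scaled_eq:
  "stopped_scaled J X s t \<omega> = s (X (enn2real (min (ennreal t) (exit_time \<omega>))) \<omega>)"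
  by (simp add: stopped_scaled_def)

lemma stopped_before_exit:
  assumes "0 \<le> t" "ennreal t \<le> exit_time \<omega>"
  shows "stopped_scaled J X s t \<omega> = s (X t \<omega>)"
  using assms by (simp add: stopped_scaled_eq min_absorb1)

lemma stopped_continuous:
  assumes \<omega>: "\<omega> \<in> space M"
  shows "continuous_on {0..} (\<lambda>t. stopped_scaled J X s t \<omega>)"
proof (cases "exit_time \<omega> = \<infinity>")
  case True
  have cont: "continuous_on {0..} (\<lambda>t. s (X t \<omega>))"
    by (rule continuous_on_compose2[OF s_cont continuous_paths[OF \<omega>]]) (use X_in_J \<omega> in auto)
  have "stopped_scaled J X s t \<omega> = s (X t \<omega>)" if "t \<in> {0..}" for t
    by (rule stopped_before_exit) (use that True in auto)
  from continuous_on_eq[OF cont this[symmetric]] show ?thesis by simp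
next
  case False
  then obtain r where r: "exit_time \<omega> = ennreal r" "0 \<le> r" by (cases "exit_time \<omega>") auto
  have "continuous_on {0..} (\<lambda>t. X (min t r) \<omega>)"
    by (rule continuous_on_compose2[OF continuous_paths[OF \<omega>]]) (use r in \<open>auto intro!: continuous_intros\<close>)
  then have cont: "continuous_on {0..} (\<lambda>t. s (X (min t r) \<omega>))"
    by (rule continuous_on_compose2[OF s_cont]) (use r X_in_J \<omega> in auto)
  have "stopped_scaled J X s t \<omega> = s (X (min t r) \<omega>)" if "t \<in> {0..}" for t
  proof -
    have "min (ennreal t) (ennreal r) = ennreal (min t r)"
      using that r(2) by (auto simp: min_def ennreal_le_iff)
    then show ?thesis using that r by (simp add: stopped_scaled_eq)
  qed
  from continuous_on_eq[OF cont this[symmetric]] show ?thesis by simp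
qed

lemma stopped_measurable:
  assumes N: "space N = space M" and t: "0 \<le> t" and X: "\<And>v. 0 \<le> v \<Longrightarrow> v \<le> t \<Longrightarrow> X v \<in> borel_measurable N"
  shows "stopped_scaled J X s t \<in> borel_measurable N"
proof -
  let ?Z = "\<lambda>\<omega>. enn2real (min (ennreal t) (exit_time \<omega>))"
  have Zt: "0 \<le> ?Z \<omega>" "?Z \<omega> \<le> t" for \<omega> using t by (auto intro: enn2real_leI)
  have Z: "?Z \<in> borel_measurable N"
  proof (rule borel_measurableI_le)
    fix a :: real
    consider "a < 0" | "0 \<le> a" "a < t" | "t \<le> a" by linarith
    then show "{\<omega>\<in>space N. ?Z \<omega> \<le> a} \<in> sets N"
    proof cases
      case 1
      then have "{\<omega>\<in>space N. ?Z \<omega> \<le> a} = {}" using Zt(1) by (auto simp: not_le intro: less_le_trans)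
      then show ?thesis by (simp only: sets.empty_sets)
    next
      case 2
      have "?Z \<omega> \<le> a \<longleftrightarrow> exit_time \<omega> \<le> ennreal a" for \<omega>
      proof (cases "exit_time \<omega>")
        case (real r)
        have "min (ennreal t) (ennreal r) = ennreal (min t r)"
          using t real(1) by (auto simp: min_def ennreal_le_iff)
        then show ?thesis using real 2 t by (auto simp: ennreal_le_iff)
      qed (use 2 t in \<open>simp add: top_unique\<close>)
      then have "{\<omega>\<in>space N. ?Z \<omega> \<le> a} = {\<omega>\<in>space M. exit_time \<omega> \<le> ennreal a}" using N by simp
      also have "\<dots> \<in> sets N"
        by (rule entry_time_measurable_upto[OF N X closed_exterior 2(1)]) (use 2 in auto)
      finally show ?thesis .
    next
      case 3
      then have "{\<omega>\<in>space N. ?Z \<omega> \<le> a} = space N" using Zt(2) by (auto intro: order_trans)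
      then show ?thesis by (simp only: sets.top)
    qed
  qed
  have "(\<lambda>\<omega>. X (?Z \<omega>) \<omega>) \<in> borel_measurable N"
    by (rule measurable_at_random_time[OF N Z Zt(1)]) (use X Zt(2) in \<open>blast intro: order_trans\<close>)
  then have "(\<lambda>\<omega>. X (?Z \<omega>) \<omega>) \<in> measurable N (restrict_space borel J)"
    by (rule measurable_restrict_space2[rotated]) (use N X_in_J in auto)
  from measurable_compose[OF this borel_measurable_continuous_on_restrict[OF s_cont]]
  show ?thesis by (simp add: stopped_scaled_def[abs_def])
qed

lemma measurable_X_F:
  assumes "0 \<le> v" "v \<le> t"
  shows "X v \<in> borel_measurable (F t)"
proof (rule measurable_from_subalg)
  show "subalgebra (F t) (F v)" unfolding subalgebra_def using assms F_mono[of v t] by simp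
  show "X v \<in> borel_measurable (F v)" by (rule adapted) fact
qed

lemmas stopped_measurable_F = stopped_measurable[OF space_Ft _ measurable_X_F]

lemma stopped_measurable_paths: "0 \<le> t \<Longrightarrow> stopped_scaled J X s t \<in> borel_measurable (path_algebra M X)"
  by (rule stopped_measurable) (auto intro: measurable_X_paths)

lemma subalgebra_P_F: "x \<in> J \<Longrightarrow> 0 \<le> t \<Longrightarrow> subalgebra (P x) (F t)"
  using subalgebra_F[of t] by (simp add: subalgebra_def sets_P)

text \<open>If the process comes down from an infinite end of the scale, then by the ladder estimate far
  levels \<open>z n\<close> are reached by a fixed time with a probability comparable to \<open>2\<^sup>-\<^sup>n\<close>, that is, to
  the inverse of the scale. Doob's inequality forbids this for a martingale.\<close>

lemma not_mass_finite_of_martingale: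
  assumes c: "c \<in> interior J" and unbounded: "\<And>K. \<exists>z\<in>interior J. K < s z"
    and mart: "\<And>x. x \<in> interior J \<Longrightarrow> martingale (P x) F (stopped_scaled J X s)"
  shows "\<not> right_mass_finite c"
proof
  assume mass: "right_mass_finite c"
  let ?Y = "stopped_scaled J X s"
  have cJ: "c \<in> J" using c interior_J by blast
  obtain x where x: "x \<in> interior J" "s c < s x" using unbounded by blast
  have xJ: "x \<in> J" using x interior_J by blast
  have cx: "c < x" using s_less_iff[OF cJ xJ] x by simp
  obtain z where z: "ladder c z" "z 0 = x" by (rule ladder_exists[OF c x(1) cx unbounded])
  note l = ladder_facts[OF z(1)]
  have J: "z n \<in> J" for n using l(2) by (auto intro: interior_J)
  define D where "D = s x - s c"
  have D: "0 < D" using x(2) by (simp add: D_def)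
  have sz: "s (z n) = s c + D * 2 ^ n" for n using l(7)[of n] unfolding z(2) D_def[symmetric] by (simp only: diff_eq_eq add.commute)
  obtain d where d: "0 < d" "\<And>n. d \<le> 2 ^ n * laplace x (z n) {c}"
    using climb_of_mass_finite[OF z(1) mass] unfolding z(2) by blast
  interpret prob_space "P x" using prob xJ .
  define t where "t = max 0 (ln (2 / d))"
  have t0: "0 \<le> t" by (simp add: t_def)
  have "exp (- t) \<le> exp (- ln (2 / d))" by (simp add: t_def)
  also have "\<dots> = d / 2" using d(1) by (simp add: exp_minus)
  finally have et: "exp (- t) \<le> d / 2" .
  let ?E = "\<lambda>n. {\<omega>\<in>space M. hitting_time X (z n) \<omega> \<le> ennreal t \<and> hitting_time X (z n) \<omega> < entry_time X {c} \<omega>}"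
  have E_low: "d / 2 \<le> 2 ^ n * measure (P x) (?E n)" if n: "1 \<le> n" for n
  proof -
    have xz: "x < z n" using strict_mono_less[OF l(5), of 0 n] n z(2) by simp
    have hp: "hit_prob x (z n) {c} = (s x - s c) / (s (z n) - s c)"
      by (rule exit_up[OF cx xz interior_between[OF c l(2)]])
    have "2 ^ n * hit_prob x (z n) {c} = 1"
      unfolding hp D_def[symmetric] sz using D by simp
    moreover have "2 ^ n * laplace x (z n) {c} \<le> 2 ^ n * (measure (P x) (?E n) + exp (- t) * hit_prob x (z n) {c})"
      by (rule mult_left_mono[OF laplace_le_early_plus_late[OF xJ _ t0]]) auto
    moreover have "2 ^ n * (measure (P x) (?E n) + exp (- t) * hit_prob x (z n) {c}) =
        2 ^ n * measure (P x) (?E n) + exp (- t) * (2 ^ n * hit_prob x (z n) {c})"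
      by (simp add: algebra_simps)
    ultimately have "d \<le> 2 ^ n * measure (P x) (?E n) + exp (- t)" using d(2)[of n] by simp
    then show ?thesis using et by simp
  qed
  define T where "T = t + 1"
  have T: "0 \<le> T" "t < T" using t0 by (auto simp: T_def)
  have Yint: "integrable (P x) (?Y T)" using mart[OF x(1)] T by (simp add: martingale_def)
  have "(\<lambda>k. \<integral>\<omega>. max 0 (?Y T \<omega> - real k) \<partial>P x) \<longlonglongrightarrow> (\<integral>\<omega>. 0 \<partial>P x)"
  proof (rule integral_dominated_convergence[where w="\<lambda>\<omega>. \<bar>?Y T \<omega>\<bar>"])
    show "AE \<omega> in P x. (\<lambda>k. max 0 (?Y T \<omega> - real k)) \<longlonglongrightarrow> 0"
    proof (rule AE_I2)
      fix \<omega>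
      obtain k0 where "?Y T \<omega> \<le> real k0" using real_arch_simple by blast
      then have "eventually (\<lambda>k. max 0 (?Y T \<omega> - real k) = 0) sequentially"
        unfolding eventually_sequentially by (intro exI[of _ k0]) auto
      then show "(\<lambda>k. max 0 (?Y T \<omega> - real k)) \<longlonglongrightarrow> 0" by (rule tendsto_eventually)
    qed
    show "AE \<omega> in P x. norm (max 0 (?Y T \<omega> - real k)) \<le> \<bar>?Y T \<omega>\<bar>" for k by auto
  qed (use Yint in auto)
  then have "(\<lambda>k. \<integral>\<omega>. max 0 (?Y T \<omega> - real k) \<partial>P x) \<longlonglongrightarrow> 0" by simp
  then have "eventually (\<lambda>k. (\<integral>\<omega>. max 0 (?Y T \<omega> - real k) \<partial>P x) < D * d / 8) sequentially"
    by (rule order_tendstoD(2)) (use D d(1) in simp)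
  then obtain k where k: "(\<integral>\<omega>. max 0 (?Y T \<omega> - real k) \<partial>P x) < D * d / 8"
    unfolding eventually_sequentially by blast
  have far: "(L - real k) * measure (P x) (?E n) \<le> D * d / 8" if L: "real k < L" "L < s (z n)" and n: "1 \<le> n" for L n
  proof -
    have "countable (\<rat> \<inter> {0..T})" by (intro countable_Int1 countable_rat)
    moreover have "0 \<in> \<rat> \<inter> {0..T}" using T by simp
    ultimately obtain q :: "nat \<Rightarrow> real" where q: "\<rat> \<inter> {0..T} = range q"
      using range_from_nat_into[of "\<rat> \<inter> {0..T}"] by (metis empty_iff)
    let ?G = "\<lambda>m. {\<omega>\<in>space (P x). \<exists>u\<in>q ` {..m}. L < ?Y u \<omega>}"
    have qT: "q ` {..m} \<subseteq> {0..T}" for m using q by auto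
    have G_sets: "?G m \<in> sets (P x)" for m
    proof -
      have "?G m = (\<Union>u\<in>q ` {..m}. {\<omega>\<in>space (P x). L < ?Y u \<omega>})" by auto
      also have "\<dots> \<in> sets (P x)"
      proof (rule sets.finite_UN)
        fix u assume "u \<in> q ` {..m}"
        then have "u \<in> {0..T}" using qT[of m] by blast
        then have "0 \<le> u" by simp
        then have "?Y u \<in> borel_measurable (P x)" by (intro measurable_paths_P[OF xJ] stopped_measurable_paths)
        then show "{\<omega>\<in>space (P x). L < ?Y u \<omega>} \<in> sets (P x)" by measurable
      qed simp
      finally show ?thesis .
    qed
    have G_le: "(L - real k) * measure (P x) (?G m) \<le> D * d / 8" for m
    proof -
      have "(L - real k) * measure (P x) (?G m) \<le> (\<integral>\<omega>. max 0 (?Y T \<omega> - real k) \<partial>P x)"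
        by (rule martingale_maximal_inequality[where F=F and Y="?Y", OF prob[OF xJ] subalgebra_P_F[OF xJ] F_mono mart[OF x(1)] _ qT L(1)])
          simp_all
      then show ?thesis using k by simp
    qed
    have "incseq ?G" by (rule incseq_SucI) (force simp: atMost_Suc)
    moreover have "range ?G \<subseteq> sets (P x)" using G_sets by blast
    ultimately have "(\<lambda>m. measure (P x) (?G m)) \<longlonglongrightarrow> measure (P x) (\<Union>m. ?G m)"
      by (intro finite_Lim_measure_incseq)
    then have "(\<lambda>m. (L - real k) * measure (P x) (?G m)) \<longlonglongrightarrow> (L - real k) * measure (P x) (\<Union>m. ?G m)"
      by (intro tendsto_intros)
    then have *: "(L - real k) * measure (P x) (\<Union>m. ?G m) \<le> D * d / 8"
      by (rule LIMSEQ_le_const2) (use G_le in blast)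
    have "measure (P x) (?E n) \<le> measure (P x) (\<Union>m. ?G m)"
    proof (rule finite_measure_mono_AE)
      show "(\<Union>m. ?G m) \<in> sets (P x)" by (rule sets.countable_UN) (use G_sets in blast)
      show "AE \<omega> in P x. \<omega> \<in> ?E n \<longrightarrow> \<omega> \<in> (\<Union>m. ?G m)"
        using start_eq[OF xJ]
      proof eventually_elim
        case (elim \<omega>)
        then have \<omega>: "\<omega> \<in> space M" "X 0 \<omega> = x" by auto
        show ?case
        proof
          assume "\<omega> \<in> ?E n"
          then have E: "hitting_time X (z n) \<omega> \<le> ennreal t" "hitting_time X (z n) \<omega> < hitting_time X c \<omega>" by auto
          then obtain r where r: "hitting_time X (z n) \<omega> = ennreal r" "0 \<le> r"
            by (cases "hitting_time X (z n) \<omega>") (auto simp: top_unique)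
          have rt: "r \<le> t" using E(1) r t0 by simp
          have Xr: "X r \<omega> = z n" using at_entry_time[OF \<omega>(1), of "{z n}"] r by simp
          \<comment> \<open>Up to the hit the path stays in \<open>(c, z n]\<close>, so the process has not been stopped.\<close>
          have inside: "X v \<omega> \<in> interior J" if v: "0 \<le> v" "v \<le> r" for v
          proof -
            have "ennreal v \<le> ennreal r" using v by (intro ennreal_leI)
            then have "ennreal v < hitting_time X c \<omega>" using E(2) unfolding r(1) by (rule le_less_trans)
            then have "\<not> hitting_time X c \<omega> \<le> ennreal v" by (simp only: not_le)
            then have cv: "c < X v \<omega>" by (intro above_after_late_hit[OF \<omega>(1) _ v(1)]) (use \<omega>(2) cx in auto)
            have "X v \<omega> \<le> z n"
            proof (rule ccontr)
              assume "\<not> X v \<omega> \<le> z n"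
              moreover have "continuous_on {0..v} (\<lambda>u. X u \<omega>)"
                by (rule continuous_on_subset[OF continuous_paths[OF \<omega>(1)]]) auto
              moreover have "x \<le> z n" using strict_mono_less_eq[OF l(5), of 0 n] z(2) by simp
              ultimately obtain w where w: "0 \<le> w" "w \<le> v" "X w \<omega> = z n"
                using IVT'[of "\<lambda>u. X u \<omega>" 0 "z n" v] v(1) \<omega>(2) by auto
              have "hitting_time X (z n) \<omega> \<le> ennreal w" by (rule entry_time_lower) (use w in auto)
              then have "r \<le> w" using r w(1) by simp
              then have "w = v" "v = r" using w v by auto
              then show False using Xr \<open>\<not> X v \<omega> \<le> z n\<close> by simp
            qed
            then show ?thesis using cv interior_between[OF c l(2)[of n]] by auto
          qed
          have late: "\<not> exit_time \<omega> \<le> ennreal r"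
            unfolding entry_time_le_iff[OF \<omega>(1) closed_exterior r(2)] using inside by auto
          then have Yr: "?Y r \<omega> = s (z n)" using stopped_before_exit[OF r(2), of \<omega>] Xr by simp
          have "continuous_on {0..T} (\<lambda>u. ?Y u \<omega>)"
            by (rule continuous_on_subset[OF stopped_continuous[OF \<omega>(1)]]) auto
          moreover have "r \<in> {0..T}" "0 < s (z n) - L" using r rt T L by auto
          ultimately obtain e where e: "0 < e" "\<And>u. u \<in> {0..T} \<Longrightarrow> dist u r < e \<Longrightarrow> dist (?Y u \<omega>) (?Y r \<omega>) < s (z n) - L"
            unfolding continuous_on_iff by blast
          have "r < min T (r + e)" using rt T e(1) by simp
          then obtain u where u: "u \<in> \<rat>" "r < u" "u < min T (r + e)" using Rats_dense_in_real by blast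
          have uT: "u \<in> {0..T}" using u r by auto
          have "dist (?Y u \<omega>) (s (z n)) < s (z n) - L"
            using e(2)[OF uT] u Yr by (simp add: dist_real_def)
          then have "L < ?Y u \<omega>" by (simp add: dist_real_def abs_less_iff)
          moreover obtain m where "u = q m" using uT u(1) q by blast
          ultimately have "\<omega> \<in> ?G m" using \<omega>(1) xJ by auto
          then show "\<omega> \<in> (\<Union>m. ?G m)" by blast
        qed
      qed
    qed
    then have "(L - real k) * measure (P x) (?E n) \<le> (L - real k) * measure (P x) (\<Union>m. ?G m)"
      using L(1) by (intro mult_left_mono) auto
    then show ?thesis using * by simp
  qed
  obtain n0 where n0: "(2 * (real k + 1 - s c)) / D < 2 ^ n0" using real_arch_pow[of 2 "(2 * (real k + 1 - s c)) / D"] by auto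
  define n where "n = Suc n0"
  have "(2 * (real k + 1 - s c)) / D < 2 ^ n"
    by (rule less_le_trans[OF n0]) (simp add: n_def)
  then have big: "2 * (real k + 1 - s c) < D * 2 ^ n" using D by (simp only: pos_divide_less_eq mult.commute)
  define L where "L = s (z n) - 1"
  have "real k + 1 - s c < D * 2 ^ n"
  proof (cases "real k + 1 - s c \<le> 0")
    case True
    also have "0 < D * 2 ^ n" using D by simp
    finally show ?thesis .
  next
    case False
    then show ?thesis using big by simp
  qed
  then have kL: "real k < L" by (simp add: L_def sz)
  have "D * 2 ^ n / 2 \<le> L - real k" using big by (simp add: L_def sz field_simps)
  then have "(D * 2 ^ n / 2) * measure (P x) (?E n) \<le> (L - real k) * measure (P x) (?E n)"
    by (rule mult_right_mono) simp
  also have "\<dots> \<le> D * d / 8" by (rule far[OF kL]) (simp_all add: L_def n_def)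
  finally have "D * (2 ^ n * measure (P x) (?E n)) \<le> D * (d / 4)" by simp
  then have "2 ^ n * measure (P x) (?E n) \<le> d / 4" using D by (simp only: mult_le_cancel_left_pos)
  moreover have "d / 2 \<le> 2 ^ n * measure (P x) (?E n)" by (rule E_low) (simp add: n_def)
  ultimately show False using d(1) by simp
qed

end

context scaled_diffusion
begin

abbreviation stop_at :: "real \<Rightarrow> real \<Rightarrow> real \<Rightarrow> 'a \<Rightarrow> ennreal" where
  "stop_at t a b \<omega> \<equiv> min (ennreal t) (min (hitting_time X a \<omega>) (hitting_time X b \<omega>))"

lemma stop_at_finite: "stop_at t a b \<omega> < \<infinity>"
  by (rule le_less_trans[OF min.cobounded1]) simp

lemma ennreal_stop_at: "ennreal (enn2real (stop_at t a b \<omega>)) = stop_at t a b \<omega>"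
  by (rule ennreal_enn2real) (use stop_at_finite in simp)

lemma stop_at_stopping: "stopping_time (extended_filtration M F) (stop_at t a b)"
  by (intro stopping_time_min stopping_time_const stopping_time_entry_time) auto

lemma inside_until_stop:
  assumes \<omega>: "\<omega> \<in> space M" "a < X 0 \<omega>" "X 0 \<omega> < b" and v: "0 \<le> v" "ennreal v \<le> min (hitting_time X a \<omega>) (hitting_time X b \<omega>)"
  shows "X v \<omega> \<in> {a..b}"
proof -
  have cont: "continuous_on {0..v} (\<lambda>u. X u \<omega>)"
    by (rule continuous_on_subset[OF continuous_paths[OF \<omega>(1)]]) auto
  have no: "v \<le> u" if "0 \<le> u" "X u \<omega> = a \<or> X u \<omega> = b" for u
  proof -
    have "min (hitting_time X a \<omega>) (hitting_time X b \<omega>) \<le> ennreal u"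
      using that entry_time_lower[of u X \<omega> "{a}"] entry_time_lower[of u X \<omega> "{b}"] by (auto simp: min_le_iff_disj)
    then have "ennreal v \<le> ennreal u" using v(2) by (rule order_trans[rotated])
    then show ?thesis using that(1) by (simp add: ennreal_le_iff)
  qed
  have "a \<le> X v \<omega>"
  proof (rule ccontr)
    assume "\<not> a \<le> X v \<omega>"
    then obtain u where u: "0 \<le> u" "u \<le> v" "X u \<omega> = a"
      using IVT2'[of "\<lambda>u. X u \<omega>" v a 0] cont v(1) \<omega> by auto
    then have "u = v" using no[of u] by simp
    then show False using u \<open>\<not> a \<le> X v \<omega>\<close> by simp
  qed
  moreover have "X v \<omega> \<le> b"
  proof (rule ccontr)
    assume "\<not> X v \<omega> \<le> b"
    then obtain u where u: "0 \<le> u" "u \<le> v" "X u \<omega> = b"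
      using IVT'[of "\<lambda>u. X u \<omega>" 0 b v] cont v(1) \<omega> by auto
    then have "u = v" using no[of u] by simp
    then show False using u \<open>\<not> X v \<omega> \<le> b\<close> by simp
  qed
  ultimately show ?thesis by simp
qed

lemma stop_at_inside:
  assumes \<omega>: "\<omega> \<in> space M" "a < X 0 \<omega>" "X 0 \<omega> < b"
  shows "X (enn2real (stop_at t a b \<omega>)) \<omega> \<in> {a..b}"
  by (rule inside_until_stop[OF \<omega> enn2real_nonneg]) (simp only: ennreal_stop_at min.cobounded2)

lemma shift_at_stop:
  assumes \<omega>: "\<omega> \<in> space M"
  shows "hitting_time X a \<omega> = stop_at t a b \<omega> + hitting_time X a (\<theta> (enn2real (stop_at t a b \<omega>)) \<omega>)"
    "hitting_time X b \<omega> = stop_at t a b \<omega> + hitting_time X b (\<theta> (enn2real (stop_at t a b \<omega>)) \<omega>)"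
proof -
  define u where "u = enn2real (stop_at t a b \<omega>)"
  have "ennreal u \<le> hitting_time X a \<omega>" "ennreal u \<le> hitting_time X b \<omega>"
    unfolding u_def ennreal_stop_at by (auto simp: min_le_iff_disj)
  then have "hitting_time X a \<omega> = ennreal u + hitting_time X a (\<theta> u \<omega>)"
      "hitting_time X b \<omega> = ennreal u + hitting_time X b (\<theta> u \<omega>)"
    by (auto intro!: entry_time_shift[OF \<omega>] simp: u_def)
  then show "hitting_time X a \<omega> = stop_at t a b \<omega> + hitting_time X a (\<theta> (enn2real (stop_at t a b \<omega>)) \<omega>)"
    "hitting_time X b \<omega> = stop_at t a b \<omega> + hitting_time X b (\<theta> (enn2real (stop_at t a b \<omega>)) \<omega>)"
    unfolding u_def ennreal_stop_at by auto
qed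

lemma measurable_s_stop:
  assumes x: "x \<in> J"
  shows "(\<lambda>\<omega>. s (X (enn2real (stop_at t a b \<omega>)) \<omega>)) \<in> borel_measurable (P x)"
proof -
  have "(\<lambda>\<omega>. X (enn2real (stop_at t a b \<omega>)) \<omega>) \<in> borel_measurable M"
    by (rule measurable_X_at[OF measurable_stopping_time_M[OF stop_at_stopping]])
  then have "(\<lambda>\<omega>. X (enn2real (stop_at t a b \<omega>)) \<omega>) \<in> measurable M (restrict_space borel J)"
    by (rule measurable_restrict_space2[rotated]) (use X_in_J in auto)
  from measurable_compose[OF this borel_measurable_continuous_on_restrict[OF s_cont]]
  show ?thesis by (simp add: measurable_P_iff[OF x])
qed

text \<open>The hitting probabilities make \<open>s (X)\<close> a martingale up to the exit from a compact interval.\<close>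

lemma expectation_at_stop:
  assumes I: "a \<in> interior J" "b \<in> interior J" and x: "a < x" "x < b"
  shows "integrable (P x) (\<lambda>\<omega>. s (X (enn2real (stop_at t a b \<omega>)) \<omega>))"
    "(\<integral>\<omega>. s (X (enn2real (stop_at t a b \<omega>)) \<omega>) \<partial>P x) = s x"
proof -
  have sub: "{a..b} \<subseteq> interior J" by (rule interior_between[OF I])
  have J: "y \<in> J" if "y \<in> {a..b}" for y using sub that interior_J by auto
  have xJ: "x \<in> J" and aJ: "a \<in> J" and bJ: "b \<in> J" using x by (auto intro: J)
  interpret prob_space "P x" using prob xJ .
  let ?T = "stop_at t a b" and ?S = "\<lambda>\<omega>. s (X (enn2real (stop_at t a b \<omega>)) \<omega>)"
  have inside: "AE \<omega> in P x. \<omega> \<in> space M \<and> X (enn2real (?T \<omega>)) \<omega> \<in> {a..b}"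
    using start_eq[OF xJ] by eventually_elim (use x stop_at_inside in auto)
  have S_bounds: "AE \<omega> in P x. s a \<le> ?S \<omega> \<and> ?S \<omega> \<le> s b"
    using inside
  proof eventually_elim
    case (elim \<omega>)
    then show ?case using s_le_iff[OF aJ J] s_le_iff[OF J bJ] by auto
  qed
  show int: "integrable (P x) ?S"
  proof (rule integrable_const_bound[where B="max \<bar>s a\<bar> \<bar>s b\<bar>"])
    show "AE \<omega> in P x. norm (?S \<omega>) \<le> max \<bar>s a\<bar> \<bar>s b\<bar>"
      using S_bounds by eventually_elim (simp only: real_norm_def, arith)
  qed (rule measurable_s_stop[OF xJ])
  define H where "H = {\<omega>\<in>space M. hitting_time X b \<omega> < entry_time X {a} \<omega>}"
  have H_paths: "H \<in> sets (path_algebra M X)"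
  proof -
    have [measurable]: "entry_time X {a} \<in> borel_measurable (path_algebra M X)" "entry_time X {b} \<in> borel_measurable (path_algebra M X)"
      by (auto intro: measurable_entry_time_paths)
    have "{\<omega>\<in>space (path_algebra M X). hitting_time X b \<omega> < entry_time X {a} \<omega>} \<in> sets (path_algebra M X)" by measurable
    then show ?thesis by (simp add: H_def)
  qed
  have sab: "0 < s b - s a" using s_less_iff[OF aJ bJ] x by simp
  have PH: "measure (P y) H = (s y - s a) / (s b - s a)" if y: "y \<in> {a..b}" for y
  proof -
    have yJ: "y \<in> J" by (rule J[OF y])
    interpret Q: prob_space "P y" using prob yJ .
    consider "y = a" | "y = b" | "a < y" "y < b" using y by (auto simp: order_le_less)
    then show ?thesis
    proof cases
      case 1
      have "AE \<omega> in P y. \<omega> \<notin> H"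
        using start_eq[OF yJ]
      proof eventually_elim
        case (elim \<omega>)
        then have "hitting_time X a \<omega> \<le> ennreal 0" by (intro entry_time_lower) (auto simp: 1)
        then show ?case by (simp add: H_def)
      qed
      then show ?thesis using Q.prob_eq_0 sets_paths_P[OF yJ H_paths] 1 by simp
    next
      case 2
      have "AE \<omega> in P y. \<omega> \<in> H"
        using start_eq[OF yJ]
      proof eventually_elim
        case (elim \<omega>)
        then have "hitting_time X b \<omega> \<le> ennreal 0" by (intro entry_time_lower) (auto simp: 2)
        moreover have "0 < entry_time X {a} \<omega>" by (rule hitting_time_pos) (use elim 2 x in auto)
        ultimately show ?case using elim by (simp add: H_def)
      qed
      then show ?thesis using Q.prob_eq_1[OF sets_paths_P[OF yJ H_paths]] 2 sab by simp
    next
      case 3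
      then show ?thesis using exit_up[OF 3 sub] by (simp add: hit_prob_def H_def)
    qed
  qed
  have "emeasure (P x) H = (\<integral>\<^sup>+\<omega>. indicator H \<omega> \<partial>P x)"
    using sets_paths_P[OF xJ H_paths] by simp
  also have "\<dots> = (\<integral>\<^sup>+\<omega>. 1 * indicator H (\<theta> (enn2real (?T \<omega>)) \<omega>) \<partial>P x)"
  proof (rule nn_integral_cong)
    fix \<omega> assume "\<omega> \<in> space (P x)"
    then have \<omega>: "\<omega> \<in> space M" using xJ by simp
    have "hitting_time X b \<omega> < hitting_time X a \<omega> \<longleftrightarrow>
        ?T \<omega> + hitting_time X b (\<theta> (enn2real (?T \<omega>)) \<omega>) < ?T \<omega> + hitting_time X a (\<theta> (enn2real (?T \<omega>)) \<omega>)"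
      by (rule arg_cong2[where f="(<)", OF shift_at_stop(2)[OF \<omega>, of b t a] shift_at_stop(1)[OF \<omega>, of a t b]])
    moreover have "?T \<omega> \<noteq> \<infinity>" using stop_at_finite[of t a \<omega> b] by (rule less_imp_neq)
    ultimately have "hitting_time X b \<omega> < hitting_time X a \<omega> \<longleftrightarrow>
        hitting_time X b (\<theta> (enn2real (?T \<omega>)) \<omega>) < hitting_time X a (\<theta> (enn2real (?T \<omega>)) \<omega>)"
      by (simp only: ennreal_add_left_cancel_less simp_thms)
    then have "\<omega> \<in> H \<longleftrightarrow> \<theta> (enn2real (?T \<omega>)) \<omega> \<in> H"
      using \<omega> shift_in_space[OF enn2real_nonneg \<omega>] unfolding H_def mem_Collect_eq by (simp only: simp_thms)
    then show "indicator H \<omega> = (1::ennreal) * indicator H (\<theta> (enn2real (?T \<omega>)) \<omega>)" by (simp add: indicator_def)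
  qed
  also have "\<dots> = (\<integral>\<^sup>+\<omega>. 1 * (\<integral>\<^sup>+\<omega>'. indicator H \<omega>' \<partial>P (X (enn2real (?T \<omega>)) \<omega>)) \<partial>P x)"
  proof (rule strong_markov_nn[OF xJ stop_at_stopping])
    show "indicator H \<in> borel_measurable (path_algebra M X)" using H_paths by simp
  qed (use stop_at_finite in \<open>auto simp: less_top[symmetric]\<close>)
  also have "\<dots> = (\<integral>\<^sup>+\<omega>. ennreal ((?S \<omega> - s a) / (s b - s a)) \<partial>P x)"
  proof (rule nn_integral_cong_AE)
    show "AE \<omega> in P x. 1 * (\<integral>\<^sup>+\<omega>'. indicator H \<omega>' \<partial>P (X (enn2real (?T \<omega>)) \<omega>)) = ennreal ((?S \<omega> - s a) / (s b - s a))"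
      using inside
    proof eventually_elim
      case (elim \<omega>)
      then have yJ: "X (enn2real (?T \<omega>)) \<omega> \<in> J" using J by blast
      interpret Q: prob_space "P (X (enn2real (?T \<omega>)) \<omega>)" using prob yJ .
      have "(\<integral>\<^sup>+\<omega>'. indicator H \<omega>' \<partial>P (X (enn2real (?T \<omega>)) \<omega>)) = ennreal (measure (P (X (enn2real (?T \<omega>)) \<omega>)) H)"
        using sets_paths_P[OF yJ H_paths] by (simp add: Q.emeasure_eq_measure)
      then show ?case using PH elim by simp
    qed
  qed
  also have "\<dots> = ennreal (\<integral>\<omega>. (?S \<omega> - s a) / (s b - s a) \<partial>P x)"
  proof (rule nn_integral_eq_integral)
    show "integrable (P x) (\<lambda>\<omega>. (?S \<omega> - s a) / (s b - s a))" using int by simp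
    show "AE \<omega> in P x. 0 \<le> (?S \<omega> - s a) / (s b - s a)" using S_bounds by eventually_elim (use sab in simp)
  qed
  also have "(\<integral>\<omega>. (?S \<omega> - s a) / (s b - s a) \<partial>P x) = ((\<integral>\<omega>. ?S \<omega> \<partial>P x) - s a) / (s b - s a)"
    using int by (simp add: prob_space)
  finally have eq: "ennreal ((s x - s a) / (s b - s a)) = ennreal (((\<integral>\<omega>. ?S \<omega> \<partial>P x) - s a) / (s b - s a))"
    using PH[of x] x by (simp add: emeasure_eq_measure)
  have "s a = (\<integral>\<omega>. s a \<partial>P x)" by (simp add: prob_space)
  also have "\<dots> \<le> (\<integral>\<omega>. ?S \<omega> \<partial>P x)"
    by (rule integral_mono_AE) (use int S_bounds in auto)
  finally have "0 \<le> ((\<integral>\<omega>. ?S \<omega> \<partial>P x) - s a) / (s b - s a)" using sab by simp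
  moreover have "0 \<le> (s x - s a) / (s b - s a)" using s_less_iff[OF aJ xJ] x sab by simp
  ultimately have "(s x - s a) / (s b - s a) = ((\<integral>\<omega>. ?S \<omega> \<partial>P x) - s a) / (s b - s a)"
    using eq by (simp only: ennreal_inj)
  then show "(\<integral>\<omega>. ?S \<omega> \<partial>P x) = s x" using sab by (simp add: divide_cancel_right)
qed

text \<open>The inverse \<open>1 / laplace x z\<close> of the transform, as a function of \<open>z\<close> above \<open>x\<close>, has discounted
  expectation at most one at any of the stopping times; as the scale is negligible against it, the
  variables \<open>s (X)\<close> at these times are uniformly integrable.\<close>

lemma scale_uniformly_integrable_above:
  assumes x: "x \<in> interior J" and t: "0 \<le> t" and \<epsilon>: "0 < \<epsilon>"
    and right: "(\<And>K. \<exists>z\<in>interior J. K < s z) \<Longrightarrow> \<not> comes_down x"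
  shows "\<exists>K. \<forall>a\<in>interior J. \<forall>b\<in>interior J. a < x \<longrightarrow> x < b \<longrightarrow>
    (\<integral>\<^sup>+\<omega>. ennreal (s (X (enn2real (stop_at t a b \<omega>)) \<omega>) - K) \<partial>P x) \<le> ennreal \<epsilon>"
proof -
  have xJ: "x \<in> J" using x interior_J by blast
  interpret prob_space "P x" using prob xJ .
  have inside: "AE \<omega> in P x. \<omega> \<in> space M \<and> X (enn2real (stop_at t a b \<omega>)) \<omega> \<in> {a..b}" if "a < x" "x < b" for a b
    using start_eq[OF xJ] by eventually_elim (use that stop_at_inside in auto)
  show ?thesis
  proof (cases "\<forall>K. \<exists>z\<in>interior J. K < s z")
    case False
    then obtain K where K: "\<And>z. z \<in> interior J \<Longrightarrow> s z \<le> K" by (auto simp: not_less)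
    have "(\<integral>\<^sup>+\<omega>. ennreal (s (X (enn2real (stop_at t a b \<omega>)) \<omega>) - K) \<partial>P x) \<le> ennreal \<epsilon>"
      if I: "a \<in> interior J" "b \<in> interior J" and ab: "a < x" "x < b" for a b
    proof -
      have "(\<integral>\<^sup>+\<omega>. ennreal (s (X (enn2real (stop_at t a b \<omega>)) \<omega>) - K) \<partial>P x) = (\<integral>\<^sup>+\<omega>. 0 \<partial>P x)"
      proof (rule nn_integral_cong_AE)
        show "AE \<omega> in P x. ennreal (s (X (enn2real (stop_at t a b \<omega>)) \<omega>) - K) = 0"
          using inside[OF ab]
        proof eventually_elim
          case (elim \<omega>)
          then have "X (enn2real (stop_at t a b \<omega>)) \<omega> \<in> interior J" using interior_between[OF I] by blast
          then show ?case using K by (simp add: ennreal_eq_0_iff)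
        qed
      qed
      then show ?thesis by simp
    qed
    then show ?thesis by blast
  next
    case True
    then have unb: "\<And>K. \<exists>z\<in>interior J. K < s z" by blast
    define e where "e = \<epsilon> / exp t"
    have e: "0 < e" using \<epsilon> by (simp add: e_def)
    obtain K0 where K0: "\<And>z. z \<in> interior J \<Longrightarrow> K0 < s z \<Longrightarrow> s z * laplace x z {} \<le> e"
      using scale_times_laplace_vanishes[OF x unb right[OF unb] e] by blast
    define K where "K = max 0 (max K0 (s x))"
    have "(\<integral>\<^sup>+\<omega>. ennreal (s (X (enn2real (stop_at t a b \<omega>)) \<omega>) - K) \<partial>P x) \<le> ennreal \<epsilon>"
      if I: "a \<in> interior J" "b \<in> interior J" and ab: "a < x" "x < b" for a b
    proof -
      let ?T = "stop_at t a b" and ?Z = "\<lambda>\<omega>. X (enn2real (stop_at t a b \<omega>)) \<omega>"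
      have bJ: "b \<in> J" using I(2) interior_J by blast
      define l where "l = laplace x b {}"
      have l: "0 < l" unfolding l_def by (rule laplace_hit_pos[OF x bJ])
      have bound: "ennreal (s z - K) \<le> ennreal (e / l) * ennreal (laplace z b {})" if z: "z \<in> {a..b}" for z
      proof (cases "K < s z")
        case True
        have zI: "z \<in> interior J" using z interior_between[OF I] by blast
        have zJ: "z \<in> J" using zI interior_J by blast
        have xz: "x < z" using True s_less_iff[OF xJ zJ] by (simp add: K_def)
        have small: "s z * laplace x z {} \<le> e" by (rule K0[OF zI]) (use True in \<open>simp add: K_def\<close>)
        have fac: "l = laplace x z {} * laplace z b {}"
        proof (cases "z = b")
          case True
          then show ?thesis using laplace_self[OF bJ, of "{}"] by (simp add: l_def)
        next
          case False
          then show ?thesis unfolding l_def by (intro laplace_multiplicative) (use xJ zJ xz z in auto)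
        qed
        have "s z * l = (s z * laplace x z {}) * laplace z b {}" by (simp add: fac)
        also have "\<dots> \<le> e * laplace z b {}" using small by (rule mult_right_mono) (rule laplace_nonneg)
        finally have "s z \<le> e * laplace z b {} / l" using l by (simp only: pos_le_divide_eq)
        moreover have "s z - K \<le> s z" by (simp add: K_def)
        ultimately have "s z - K \<le> (e / l) * laplace z b {}" by simp
        then have "ennreal (s z - K) \<le> ennreal ((e / l) * laplace z b {})" by (rule ennreal_leI)
        also have "\<dots> = ennreal (e / l) * ennreal (laplace z b {})"
          using e l by (intro ennreal_mult laplace_nonneg) auto
        finally show ?thesis .
      next
        case False
        then have "ennreal (s z - K) = 0" by (simp add: ennreal_eq_0_iff)
        then show ?thesis by simp
      qed
      have d_paths: "(\<lambda>\<omega>. discount (hitting_time X b \<omega>)) \<in> borel_measurable (path_algebra M X)"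
        using measurable_entry_time_paths[of "{b}"] by simp
      have "ennreal (exp (- t)) * (\<integral>\<^sup>+\<omega>. ennreal (laplace (?Z \<omega>) b {}) \<partial>P x) =
          (\<integral>\<^sup>+\<omega>. ennreal (exp (- t)) * ennreal (laplace (?Z \<omega>) b {}) \<partial>P x)"
      proof (rule nn_integral_cmult[symmetric])
        have "(\<lambda>\<omega>. \<integral>\<^sup>+\<omega>'. discount (hitting_time X b \<omega>') \<partial>P (?Z \<omega>)) \<in> borel_measurable M"
          by (rule measurable_kernel_at[OF d_paths measurable_stopping_time_M[OF stop_at_stopping]])
        then have "(\<lambda>\<omega>. \<integral>\<^sup>+\<omega>'. discount (hitting_time X b \<omega>') \<partial>P (?Z \<omega>)) \<in> borel_measurable (P x)"
          by (simp add: measurable_P_iff[OF xJ])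
        then show "(\<lambda>\<omega>. ennreal (laplace (?Z \<omega>) b {})) \<in> borel_measurable (P x)"
          by (rule measurable_cong[THEN iffD1, rotated]) (use xJ X_in_J in \<open>simp add: ennreal_laplace_empty\<close>)
      qed
      also have "\<dots> \<le> (\<integral>\<^sup>+\<omega>. discount (?T \<omega>) * (\<integral>\<^sup>+\<omega>'. discount (hitting_time X b \<omega>') \<partial>P (?Z \<omega>)) \<partial>P x)"
      proof (rule nn_integral_mono)
        fix \<omega> assume "\<omega> \<in> space (P x)"
        then have "?Z \<omega> \<in> J" using X_in_J xJ by simp
        moreover have "ennreal (exp (- t)) \<le> discount (?T \<omega>)"
          using discount_antimono[of "?T \<omega>" "ennreal t"] t by (simp add: discount_ennreal)
        ultimately show "ennreal (exp (- t)) * ennreal (laplace (?Z \<omega>) b {}) \<le>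
            discount (?T \<omega>) * (\<integral>\<^sup>+\<omega>'. discount (hitting_time X b \<omega>') \<partial>P (?Z \<omega>))"
          by (simp only: ennreal_laplace_empty) (rule mult_right_mono, simp_all)
      qed
      also have "\<dots> = (\<integral>\<^sup>+\<omega>. discount (?T \<omega>) * discount (hitting_time X b (\<theta> (enn2real (?T \<omega>)) \<omega>)) \<partial>P x)"
      proof (rule strong_markov_nn[OF xJ stop_at_stopping _ _ d_paths, symmetric])
        show "(\<lambda>\<omega>. discount (?T \<omega>)) \<in> borel_measurable (pre_sigma ?T)"
          by (rule measurable_compose[OF measurable_stopping_time_pre_sigma[OF stop_at_stopping] measurable_discount])
        show "discount (?T \<omega>) = 0" if "?T \<omega> = \<infinity>" for \<omega> unfolding that by simp
      qed
      also have "\<dots> = (\<integral>\<^sup>+\<omega>. discount (hitting_time X b \<omega>) \<partial>P x)"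
      proof (rule nn_integral_cong)
        fix \<omega> assume "\<omega> \<in> space (P x)"
        then have \<omega>: "\<omega> \<in> space M" using xJ by simp
        from arg_cong[OF shift_at_stop(2)[OF \<omega>, of b t a], of discount]
        show "discount (?T \<omega>) * discount (hitting_time X b (\<theta> (enn2real (?T \<omega>)) \<omega>)) = discount (hitting_time X b \<omega>)"
          unfolding discount_add by (rule sym)
      qed
      also have "\<dots> = ennreal l" by (simp add: l_def ennreal_laplace_empty[OF xJ])
      finally have mass: "ennreal (exp (- t)) * (\<integral>\<^sup>+\<omega>. ennreal (laplace (?Z \<omega>) b {}) \<partial>P x) \<le> ennreal l" .
      have "(\<integral>\<^sup>+\<omega>. ennreal (s (?Z \<omega>) - K) \<partial>P x) \<le> (\<integral>\<^sup>+\<omega>. ennreal (e / l) * ennreal (laplace (?Z \<omega>) b {}) \<partial>P x)"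
        by (rule nn_integral_mono_AE) (use inside[OF ab] in \<open>eventually_elim, use bound in blast\<close>)
      also have "\<dots> \<le> ennreal (e / l * exp t) * (ennreal (exp (- t)) * (\<integral>\<^sup>+\<omega>. ennreal (laplace (?Z \<omega>) b {}) \<partial>P x))"
      proof -
        have c: "ennreal (e / l * exp t) * ennreal (exp (- t)) = ennreal (e / l)"
          using e l by (subst ennreal_mult[symmetric]) (auto simp: exp_minus)
        have "(\<integral>\<^sup>+\<omega>. ennreal (e / l) * ennreal (laplace (?Z \<omega>) b {}) \<partial>P x) \<le> ennreal (e / l) * (\<integral>\<^sup>+\<omega>. ennreal (laplace (?Z \<omega>) b {}) \<partial>P x)"
        proof (subst nn_integral_cmult)
          have "(\<lambda>\<omega>. \<integral>\<^sup>+\<omega>'. discount (hitting_time X b \<omega>') \<partial>P (?Z \<omega>)) \<in> borel_measurable M"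
            by (rule measurable_kernel_at[OF d_paths measurable_stopping_time_M[OF stop_at_stopping]])
          then have "(\<lambda>\<omega>. \<integral>\<^sup>+\<omega>'. discount (hitting_time X b \<omega>') \<partial>P (?Z \<omega>)) \<in> borel_measurable (P x)"
            by (simp add: measurable_P_iff[OF xJ])
          then show "(\<lambda>\<omega>. ennreal (laplace (?Z \<omega>) b {})) \<in> borel_measurable (P x)"
            by (rule measurable_cong[THEN iffD1, rotated]) (use xJ X_in_J in \<open>simp add: ennreal_laplace_empty\<close>)
        qed simp
        then show ?thesis unfolding mult.assoc[symmetric] c .
      qed
      also have "\<dots> \<le> ennreal (e / l * exp t) * ennreal l" using mass by (rule mult_left_mono) simp
      also have "\<dots> = ennreal \<epsilon>"
        using \<epsilon> e l by (subst ennreal_mult[symmetric]) (auto simp: e_def)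
      finally show ?thesis .
    qed
    then show ?thesis by blast
  qed
qed

lemma scale_uniformly_integrable_below:
  assumes x: "x \<in> interior J" and t: "0 \<le> t" and \<epsilon>: "0 < \<epsilon>"
    and left: "(\<And>K. \<exists>z\<in>interior J. s z < K) \<Longrightarrow> \<not> left_comes_down x"
  shows "\<exists>K. \<forall>a\<in>interior J. \<forall>b\<in>interior J. a < x \<longrightarrow> x < b \<longrightarrow>
    (\<integral>\<^sup>+\<omega>. ennreal (- s (X (enn2real (stop_at t a b \<omega>)) \<omega>) - K) \<partial>P x) \<le> ennreal \<epsilon>"
proof -
  interpret R: scaled_diffusion M F "uminus ` J" "\<lambda>t \<omega>. - X t \<omega>" \<theta> "\<lambda>x. P (- x)" "\<lambda>x. - s (- x)"
    "distr m (restrict_space borel (uminus ` interior J)) uminus"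
    by (rule scaled_diffusion_reflect) unfold_locales
  have SD: "scaled_diffusion M F J X \<theta> P s m" by unfold_locales
  have intR: "interior (uminus ` J) = uminus ` interior J" by (rule interior_negations)
  have xR: "- x \<in> interior (uminus ` J)" unfolding intR using x by simp
  have "\<not> R.comes_down (- x)" if unb: "\<And>K. \<exists>z\<in>interior (uminus ` J). K < - s (- z)"
  proof -
    have "\<exists>z\<in>interior J. s z < K" for K
    proof -
      obtain z where "z \<in> uminus ` interior J" "- K < - s (- z)" using unb[of "- K"] unfolding intR by blast
      then show ?thesis by (intro bexI[of _ "- z"]) auto
    qed
    then show ?thesis using left left_comes_down_reflect[OF SD] by blast
  qed
  from R.scale_uniformly_integrable_above[OF xR t \<epsilon> this] obtain K where K:
    "\<And>a b. a \<in> interior (uminus ` J) \<Longrightarrow> b \<in> interior (uminus ` J) \<Longrightarrow> a < - x \<Longrightarrow> - x < b \<Longrightarrow>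
    (\<integral>\<^sup>+\<omega>. ennreal (- s (- (- X (enn2real (R.stop_at t a b \<omega>)) \<omega>)) - K) \<partial>P (- (- x))) \<le> ennreal \<epsilon>" by blast
  have "(\<integral>\<^sup>+\<omega>. ennreal (- s (X (enn2real (stop_at t a b \<omega>)) \<omega>) - K) \<partial>P x) \<le> ennreal \<epsilon>"
    if I: "a \<in> interior J" "b \<in> interior J" and ab: "a < x" "x < b" for a b
  proof -
    have "- b \<in> interior (uminus ` J)" "- a \<in> interior (uminus ` J)" unfolding intR using I by auto
    from K[OF this] have "(\<integral>\<^sup>+\<omega>. ennreal (- s (X (enn2real (R.stop_at t (- b) (- a) \<omega>)) \<omega>) - K) \<partial>P x) \<le> ennreal \<epsilon>"
      using ab by simp
    moreover have "R.stop_at t (- b) (- a) \<omega> = stop_at t a b \<omega>" for \<omega>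
      by (simp add: entry_time_uminus min.commute)
    ultimately show ?thesis by simp
  qed
  then show ?thesis by blast
qed

end

context scaled_diffusion
begin

lemma sequence_above:
  assumes x: "x \<in> interior J"
  obtains b :: "nat \<Rightarrow> real" where "\<And>n. b n \<in> interior J" "\<And>n. x < b n"
    "\<And>y. y \<in> interior J \<Longrightarrow> eventually (\<lambda>n. y < b n) sequentially"
proof -
  obtain b' :: "nat \<Rightarrow> real" where b': "incseq b'" "\<And>n. b' n \<in> interior J" "\<And>y. y \<in> interior J \<Longrightarrow> \<exists>n. y < b' n"
    by (rule cofinal_sequence) blast
  obtain n0 where n0: "x < b' n0" using b'(3)[OF x] by blast
  have 1: "x < b' (n + n0)" for n
    by (rule less_le_trans[OF n0 incseqD[OF b'(1)]]) simp
  have 2: "eventually (\<lambda>n. y < b' (n + n0)) sequentially" if y: "y \<in> interior J" for y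
  proof -
    obtain k where k: "y < b' k" using b'(3)[OF y] by blast
    have "y < b' (n + n0)" if "k \<le> n" for n
      by (rule less_le_trans[OF k incseqD[OF b'(1)]]) (use that in simp)
    then show ?thesis unfolding eventually_sequentially by blast
  qed
  show thesis by (rule that[of "\<lambda>n. b' (n + n0)"]) (use b'(2) 1 2 in blast)+
qed

lemma sequence_below:
  assumes x: "x \<in> interior J"
  obtains a :: "nat \<Rightarrow> real" where "\<And>n. a n \<in> interior J" "\<And>n. a n < x"
    "\<And>y. y \<in> interior J \<Longrightarrow> eventually (\<lambda>n. a n < y) sequentially"
proof -
  interpret R: scaled_diffusion M F "uminus ` J" "\<lambda>t \<omega>. - X t \<omega>" \<theta> "\<lambda>x. P (- x)" "\<lambda>x. - s (- x)"
    "distr m (restrict_space borel (uminus ` interior J)) uminus"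
    by (rule scaled_diffusion_reflect) unfold_locales
  have intR: "interior (uminus ` J) = uminus ` interior J" by (rule interior_negations)
  have "- x \<in> interior (uminus ` J)" unfolding intR using x by simp
  then obtain b :: "nat \<Rightarrow> real" where b: "\<And>n. b n \<in> interior (uminus ` J)" "\<And>n. - x < b n"
    "\<And>y. y \<in> interior (uminus ` J) \<Longrightarrow> eventually (\<lambda>n. y < b n) sequentially"
    by (rule R.sequence_above) blast
  have 1: "- b n \<in> interior J" for n using b(1)[of n] unfolding intR by auto
  have 2: "- b n < x" for n using b(2)[of n] by simp
  have 3: "eventually (\<lambda>n. - b n < y) sequentially" if "y \<in> interior J" for y
  proof -
    have "- y \<in> interior (uminus ` J)" unfolding intR using that by simp
    from b(3)[OF this] show ?thesis by eventually_elim simp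
  qed
  show thesis by (rule that[of "\<lambda>n. - b n"]) (use 1 2 3 in blast)+
qed

lemma stop_at_converges:
  assumes \<omega>: "\<omega> \<in> space M" "X 0 \<omega> = x" and t: "0 \<le> t"
    and a: "\<And>n. a n \<in> interior J" "\<And>n. a n < x" "\<And>y. y \<in> interior J \<Longrightarrow> eventually (\<lambda>n. a n < y) sequentially"
    and b: "\<And>n. b n \<in> interior J" "\<And>n. x < b n" "\<And>y. y \<in> interior J \<Longrightarrow> eventually (\<lambda>n. y < b n) sequentially"
  shows "(\<lambda>n. s (X (enn2real (stop_at t (a n) (b n) \<omega>)) \<omega>)) \<longlonglongrightarrow> stopped_scaled J X s t \<omega>"
proof -
  let ?r = "\<lambda>n. enn2real (stop_at t (a n) (b n) \<omega>)" and ?R = "enn2real (min (ennreal t) (exit_time \<omega>))"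
  have fin: "min (ennreal t) (exit_time \<omega>) < \<infinity>" by (rule le_less_trans[OF min.cobounded1]) simp
  have eR: "ennreal ?R = min (ennreal t) (exit_time \<omega>)" by (rule ennreal_enn2real) (use fin in simp)
  have X0: "a n < X 0 \<omega>" "X 0 \<omega> < b n" for n using a(2) b(2) \<omega>(2) by auto
  have up: "?r n \<le> ?R" for n
  proof (rule enn2real_mono)
    have "min (hitting_time X (a n) \<omega>) (hitting_time X (b n) \<omega>) \<le> exit_time \<omega>"
    proof (rule ccontr)
      assume neg: "\<not> min (hitting_time X (a n) \<omega>) (hitting_time X (b n) \<omega>) \<le> exit_time \<omega>"
      then have lt: "exit_time \<omega> < min (hitting_time X (a n) \<omega>) (hitting_time X (b n) \<omega>)" by (simp only: not_le)
      then have "exit_time \<omega> < \<infinity>" by (rule less_le_trans) simp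
      note out = at_entry_time[OF \<omega>(1) closed_exterior this]
      have e: "ennreal (enn2real (exit_time \<omega>)) = exit_time \<omega>"
        by (rule ennreal_enn2real) (use \<open>exit_time \<omega> < \<infinity>\<close> in simp)
      have "X (enn2real (exit_time \<omega>)) \<omega> \<in> {a n..b n}"
        by (rule inside_until_stop[OF \<omega>(1) X0 enn2real_nonneg]) (unfold e, rule less_imp_le[OF lt])
      then show False using out interior_between[OF a(1) b(1)] by blast
    qed
    then show "stop_at t (a n) (b n) \<omega> \<le> min (ennreal t) (exit_time \<omega>)"
      by (rule min.mono[OF order_refl])
  qed (use fin in simp)
  have low: "eventually (\<lambda>n. u < ?r n) sequentially" if u: "0 \<le> u" "u < ?R" for u
  proof -
    have "ennreal u < ennreal ?R" using u by (simp add: ennreal_less_iff)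
    then have ut: "ennreal u < ennreal t" and ue: "\<not> exit_time \<omega> \<le> ennreal u" unfolding eR by auto
    have in_int: "X w \<omega> \<in> interior J" if "w \<in> {0..u}" for w
      using ue entry_time_le_iff[OF \<omega>(1) closed_exterior u(1)] that by auto
    have cont: "continuous_on {0..u} (\<lambda>w. X w \<omega>)"
      by (rule continuous_on_subset[OF continuous_paths[OF \<omega>(1)]]) auto
    have ne: "{0..u} \<noteq> {}" using u(1) by simp
    obtain p where p: "p \<in> {0..u}" "\<And>w. w \<in> {0..u} \<Longrightarrow> X p \<omega> \<le> X w \<omega>"
      using continuous_attains_inf[OF compact_Icc ne cont] by blast
    obtain q where q: "q \<in> {0..u}" "\<And>w. w \<in> {0..u} \<Longrightarrow> X w \<omega> \<le> X q \<omega>"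
      using continuous_attains_sup[OF compact_Icc ne cont] by blast
    from a(3)[OF in_int[OF p(1)]] b(3)[OF in_int[OF q(1)]] show ?thesis
    proof eventually_elim
      case (elim n)
      have "\<not> hitting_time X (a n) \<omega> \<le> ennreal u"
        unfolding entry_time_le_iff[OF \<omega>(1) closed_singleton u(1)] using p(2) elim(1) by fastforce
      moreover have "\<not> hitting_time X (b n) \<omega> \<le> ennreal u"
        unfolding entry_time_le_iff[OF \<omega>(1) closed_singleton u(1)] using q(2) elim(2) by fastforce
      ultimately have "ennreal u < stop_at t (a n) (b n) \<omega>" using ut by (simp add: not_le)
      then have "ennreal u < ennreal (?r n)" by (simp only: ennreal_stop_at)
      then show ?case by (simp only: ennreal_less_iff[OF u(1)])
    qed
  qed
  have "?r \<longlonglongrightarrow> ?R"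
  proof (rule order_tendstoI)
    fix y assume y: "y < ?R"
    show "eventually (\<lambda>n. y < ?r n) sequentially"
    proof (cases "0 \<le> y")
      case True
      then show ?thesis by (rule low[OF _ y])
    next
      case False
      have "y < ?r n" for n by (rule less_le_trans[OF _ enn2real_nonneg]) (use False in simp)
      then show ?thesis by (intro always_eventually allI)
    qed
  next
    fix y assume y: "?R < y"
    show "eventually (\<lambda>n. ?r n < y) sequentially"
      by (intro always_eventually allI le_less_trans[OF up y])
  qed
  moreover have "continuous_on {0..} (\<lambda>t. s (X t \<omega>))"
    by (rule continuous_on_compose2[OF s_cont continuous_paths[OF \<omega>(1)]]) (use X_in_J \<omega> in auto)
  ultimately show ?thesis
    unfolding stopped_scaled_eq by (intro continuous_on_tendsto_compose[of "{0..}" "\<lambda>t. s (X t \<omega>)"]) auto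
qed

text \<open>As the interval grows, the optional stopping identity passes to the limit by uniform
  integrability.\<close>

lemma expectation_stopped:
  assumes x: "x \<in> interior J" and t: "0 \<le> t"
    and right: "(\<And>K. \<exists>z\<in>interior J. K < s z) \<Longrightarrow> \<not> comes_down x"
    and left: "(\<And>K. \<exists>z\<in>interior J. s z < K) \<Longrightarrow> \<not> left_comes_down x"
  shows "integrable (P x) (stopped_scaled J X s t)" "(\<integral>\<omega>. stopped_scaled J X s t \<omega> \<partial>P x) = s x"
proof -
  have xJ: "x \<in> J" using x interior_J by blast
  obtain b :: "nat \<Rightarrow> real" where b: "\<And>n. b n \<in> interior J" "\<And>n. x < b n"
    "\<And>y. y \<in> interior J \<Longrightarrow> eventually (\<lambda>n. y < b n) sequentially"
    by (rule sequence_above[OF x]) blast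
  obtain a :: "nat \<Rightarrow> real" where a: "\<And>n. a n \<in> interior J" "\<And>n. a n < x"
    "\<And>y. y \<in> interior J \<Longrightarrow> eventually (\<lambda>n. a n < y) sequentially"
    by (rule sequence_below[OF x]) blast
  let ?Z = "\<lambda>n \<omega>. s (X (enn2real (stop_at t (a n) (b n) \<omega>)) \<omega>)"
  have Z: "integrable (P x) (?Z n)" "(\<integral>\<omega>. ?Z n \<omega> \<partial>P x) = s x" for n
    by (rule expectation_at_stop[OF a(1) b(1) a(2) b(2)])+
  have Y: "stopped_scaled J X s t \<in> borel_measurable (P x)"
    by (rule measurable_paths_P[OF xJ stopped_measurable_paths[OF t]])
  have lim: "AE \<omega> in P x. (\<lambda>n. ?Z n \<omega>) \<longlonglongrightarrow> stopped_scaled J X s t \<omega>"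
    using start_eq[OF xJ]
  proof eventually_elim
    case (elim \<omega>)
    show ?case by (rule stop_at_converges[OF _ _ t a b]) (use elim in simp_all)
  qed
  have up: "\<exists>K. \<forall>n. (\<integral>\<^sup>+\<omega>. ennreal (?Z n \<omega> - K) \<partial>P x) \<le> ennreal \<epsilon>" if "0 < \<epsilon>" for \<epsilon>
    using scale_uniformly_integrable_above[OF x t that right] a(1,2) b(1,2) by blast
  have down: "\<exists>K. \<forall>n. (\<integral>\<^sup>+\<omega>. ennreal (- ?Z n \<omega> - K) \<partial>P x) \<le> ennreal \<epsilon>" if "0 < \<epsilon>" for \<epsilon>
    using scale_uniformly_integrable_below[OF x t that left] a(1,2) b(1,2) by blast
  show "integrable (P x) (stopped_scaled J X s t)"
    by (rule integral_of_limit(1)[OF prob[OF xJ] Z Y lim up down])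
  show "(\<integral>\<omega>. stopped_scaled J X s t \<omega> \<partial>P x) = s x"
    by (rule integral_of_limit(2)[OF prob[OF xJ] Z Y lim up down])
qed

lemma martingale_of_not_comes_down:
  assumes x: "x \<in> interior J"
    and right: "\<And>y. y \<in> interior J \<Longrightarrow> (\<And>K. \<exists>z\<in>interior J. K < s z) \<Longrightarrow> \<not> comes_down y"
    and left: "\<And>y. y \<in> interior J \<Longrightarrow> (\<And>K. \<exists>z\<in>interior J. s z < K) \<Longrightarrow> \<not> left_comes_down y"
  shows "martingale (P x) F (stopped_scaled J X s)"
proof -
  define Y where "Y = stopped_scaled J X s"
  have xJ: "x \<in> J" using x interior_J by blast
  interpret prob_space "P x" using prob xJ .
  have int: "integrable (P y) (Y t)" and mean: "(\<integral>\<omega>. Y t \<omega> \<partial>P y) = s y" if "y \<in> interior J" "0 \<le> t" for y t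
    unfolding Y_def using expectation_stopped[OF that right[OF that(1)] left[OF that(1)]] by auto
  have meas: "Y t \<in> borel_measurable (F t)" if "0 \<le> t" for t
    unfolding Y_def by (rule stopped_measurable[OF space_Ft[OF that] that measurable_X_F])
  have "AE \<omega> in P x. real_cond_exp (P x) (F r) (Y t) \<omega> = Y r \<omega>" if rt: "0 \<le> r" "r \<le> t" for r t
  proof -
    have t: "0 \<le> t" "0 \<le> t - r" using rt by auto
    interpret finite_measure_subalgebra "P x" "F r" by unfold_locales (rule subalgebra_P_F[OF xJ rt(1)])
    show ?thesis
    proof (rule real_cond_exp_charact[OF _ int[OF x t(1)] int[OF x rt(1)] meas[OF rt(1)]])
      fix A assume A: "A \<in> sets (F r)"
      define G where "G = A - {\<omega>\<in>space M. exit_time \<omega> \<le> ennreal r}"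
      have "{\<omega>\<in>space M. exit_time \<omega> \<le> ennreal r} \<in> sets (F r)"
        by (rule entry_time_measurable_upto[OF space_Ft[OF rt(1)] _ closed_exterior rt(1)]) (rule measurable_X_F)
      then have G: "G \<in> sets (F r)" unfolding G_def by (rule sets.Diff[OF A])
      have GM: "\<omega> \<in> space M" if "\<omega> \<in> G" for \<omega>
        using sets.sets_into_space[OF G] that rt(1) by auto
      have GP: "G \<in> sets (P x)" using G subalgebra_P_F[OF xJ rt(1)] by (auto simp: subalgebra_def)
      \<comment> \<open>Outside of \<open>G\<close> the process has been stopped before time \<open>r\<close>, on \<open>G\<close> it starts afresh at \<open>X r\<close>.\<close>
      have stopped: "Y t \<omega> = Y r \<omega>" if "exit_time \<omega> \<le> ennreal r" for \<omega>
      proof -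
        have "exit_time \<omega> \<le> ennreal t" by (rule order_trans[OF that ennreal_leI[OF rt(2)]])
        then show ?thesis using that by (simp add: Y_def stopped_scaled_eq min_absorb2)
      qed
      have fresh: "X r \<omega> \<in> interior J" "Y r \<omega> = s (X r \<omega>)" "Y t \<omega> = Y (t - r) (\<theta> r \<omega>)" if g: "\<omega> \<in> G" for \<omega>
      proof -
        have \<omega>: "\<omega> \<in> space M" by (rule GM[OF g])
        have late: "\<not> exit_time \<omega> \<le> ennreal r" using g \<omega> by (auto simp: G_def)
        then show "X r \<omega> \<in> interior J"
          using entry_time_le_iff[OF \<omega> closed_exterior rt(1)] rt(1) by auto
        have le: "ennreal r \<le> exit_time \<omega>" using late by simp
        then show "Y r \<omega> = s (X r \<omega>)" unfolding Y_def by (rule stopped_before_exit[OF rt(1)])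
        let ?e = "exit_time (\<theta> r \<omega>)"
        have shift_exit: "exit_time \<omega> = ennreal r + ?e" by (rule entry_time_shift[OF \<omega> closed_exterior rt(1) le])
        have tr: "ennreal t = ennreal r + ennreal (t - r)" using rt by (simp add: ennreal_plus[symmetric] del: ennreal_plus)
        have "min (ennreal t) (exit_time \<omega>) = ennreal r + min (ennreal (t - r)) ?e"
        proof (cases "ennreal (t - r) \<le> ?e")
          case True
          then show ?thesis unfolding shift_exit tr min_absorb1[OF True] by (intro min_absorb1 add_left_mono)
        next
          case False
          then have le: "?e \<le> ennreal (t - r)" by simp
          then show ?thesis unfolding shift_exit tr min_absorb2[OF le] by (intro min_absorb2 add_left_mono)
        qed
        moreover have fin: "min (ennreal (t - r)) ?e < top" by (rule le_less_trans[OF min.cobounded1]) simp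
        ultimately have "enn2real (min (ennreal t) (exit_time \<omega>)) = enn2real (min (ennreal (t - r)) ?e) + r"
          using rt(1) by (simp add: enn2real_plus)
        then show "Y t \<omega> = Y (t - r) (\<theta> r \<omega>)"
          unfolding Y_def stopped_scaled_eq using shift[OF rt(1) enn2real_nonneg \<omega>] by simp
      qed
      define h where "h \<sigma> y = (\<integral>\<^sup>+\<omega>. ennreal (\<sigma> * Y (t - r) \<omega>) \<partial>P y)" for \<sigma> y :: real
      have h_fin: "h \<sigma> y \<noteq> \<infinity>" if "y \<in> interior J" for \<sigma> y
        using integrable_mult_right[OF int[OF that t(2)], of \<sigma>] unfolding h_def real_integrable_def by simp
      have h_diff: "enn2real (h 1 y) - enn2real (h (- 1) y) = s y" if "y \<in> interior J" for y
        using real_lebesgue_integral_def[OF int[OF that t(2)]] mean[OF that t(2)] by (simp add: h_def)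
      have f_meas: "(\<lambda>\<omega>. ennreal (\<sigma> * Y (t - r) \<omega>)) \<in> borel_measurable (path_algebra M X)" for \<sigma>
        using stopped_measurable_paths[OF t(2)] unfolding Y_def by measurable
      have key: "(\<integral>\<^sup>+\<omega>. ennreal (\<sigma> * (indicator G \<omega> * Y t \<omega>)) \<partial>P x) = (\<integral>\<^sup>+\<omega>. indicator G \<omega> * h \<sigma> (X r \<omega>) \<partial>P x)" for \<sigma>
      proof -
        have "(\<integral>\<^sup>+\<omega>. ennreal (\<sigma> * (indicator G \<omega> * Y t \<omega>)) \<partial>P x) = (\<integral>\<^sup>+\<omega>. indicator G \<omega> * ennreal (\<sigma> * Y (t - r) (\<theta> r \<omega>)) \<partial>P x)"
          by (rule nn_integral_cong) (use fresh(3) in \<open>simp add: indicator_def\<close>)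
        also have "\<dots> = (\<integral>\<^sup>+\<omega>. indicator G \<omega> * (\<integral>\<^sup>+\<omega>'. ennreal (\<sigma> * Y (t - r) \<omega>') \<partial>P (X r \<omega>)) \<partial>P x)"
          by (rule markov_nn[OF xJ rt(1) borel_measurable_indicator[OF G] f_meas])
        finally show ?thesis by (simp add: h_def)
      qed
      define p where "p \<sigma> \<omega> = enn2real (indicator G \<omega> * h \<sigma> (X r \<omega>))" for \<sigma> \<omega>
      have p_eq: "ennreal (p \<sigma> \<omega>) = indicator G \<omega> * h \<sigma> (X r \<omega>)" for \<sigma> \<omega>
        unfolding p_def
      proof (rule ennreal_enn2real)
        show "indicator G \<omega> * h \<sigma> (X r \<omega>) < top"
        proof (cases "\<omega> \<in> G")
          case True
          then show ?thesis using h_fin[OF fresh(1)[OF True]] by (simp add: less_top)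
        qed simp
      qed
      have hm: "(\<lambda>\<omega>. h \<sigma> (X r \<omega>)) \<in> borel_measurable (P x)" for \<sigma>
      proof -
        have "(\<lambda>\<omega>. h \<sigma> (X (enn2real (ennreal r)) \<omega>)) \<in> borel_measurable M"
          unfolding h_def by (rule measurable_kernel_at[OF f_meas]) simp
        then show ?thesis using rt(1) by (simp add: measurable_P_iff[OF xJ])
      qed
      have pm: "p \<sigma> \<in> borel_measurable (P x)" for \<sigma>
        unfolding p_def using hm[of \<sigma>] GP by measurable
      have GY: "integrable (P x) (\<lambda>\<omega>. indicator G \<omega> * Y t \<omega>)"
        using integrable_mult_indicator[OF GP int[OF x t(1)]] by simp
      have GYr: "integrable (P x) (\<lambda>\<omega>. indicator G \<omega> * Y r \<omega>)"
        using integrable_mult_indicator[OF GP int[OF x rt(1)]] by simp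
      have fin: "(\<integral>\<^sup>+\<omega>. ennreal (p \<sigma> \<omega>) \<partial>P x) \<noteq> \<infinity>" for \<sigma>
        unfolding p_eq key[symmetric] using integrable_mult_right[OF GY, of \<sigma>] unfolding real_integrable_def by simp
      have p_int: "integrable (P x) (p \<sigma>)" for \<sigma>
        by (rule integrableI_nonneg[OF pm]) (use fin[of \<sigma>] in \<open>auto simp: p_def less_top\<close>)
      have p_val: "(\<integral>\<omega>. p \<sigma> \<omega> \<partial>P x) = enn2real (\<integral>\<^sup>+\<omega>. ennreal (\<sigma> * (indicator G \<omega> * Y t \<omega>)) \<partial>P x)" for \<sigma>
        unfolding key p_eq[symmetric] by (rule integral_eq_nn_integral[OF pm]) (simp add: p_def)
      have "(\<integral>\<omega>. indicator G \<omega> * Y t \<omega> \<partial>P x) = (\<integral>\<omega>. p 1 \<omega> \<partial>P x) - (\<integral>\<omega>. p (- 1) \<omega> \<partial>P x)"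
        unfolding p_val real_lebesgue_integral_def[OF GY] by simp
      also have "\<dots> = (\<integral>\<omega>. p 1 \<omega> - p (- 1) \<omega> \<partial>P x)"
        by (rule Bochner_Integration.integral_diff[symmetric]) (rule p_int)+
      also have "\<dots> = (\<integral>\<omega>. indicator G \<omega> * Y r \<omega> \<partial>P x)"
      proof (rule Bochner_Integration.integral_cong[OF refl])
        fix \<omega>
        show "p 1 \<omega> - p (- 1) \<omega> = indicator G \<omega> * Y r \<omega>"
        proof (cases "\<omega> \<in> G")
          case True
          then show ?thesis using h_diff[OF fresh(1)[OF True]] fresh(2)[OF True] by (simp add: p_def)
        qed (simp add: p_def)
      qed
      finally have on_G: "(\<integral>\<omega>. indicator G \<omega> * Y t \<omega> \<partial>P x) = (\<integral>\<omega>. indicator G \<omega> * Y r \<omega> \<partial>P x)" .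
      have AP: "A \<in> sets (P x)" using A subalgebra_P_F[OF xJ rt(1)] by (auto simp: subalgebra_def)
      have AY: "integrable (P x) (\<lambda>\<omega>. indicator A \<omega> * Y t \<omega>)"
        using integrable_mult_indicator[OF AP int[OF x t(1)]] by simp
      have AYr: "integrable (P x) (\<lambda>\<omega>. indicator A \<omega> * Y r \<omega>)"
        using integrable_mult_indicator[OF AP int[OF x rt(1)]] by simp
      have "(\<integral>\<omega>. indicator A \<omega> * Y t \<omega> \<partial>P x) - (\<integral>\<omega>. indicator A \<omega> * Y r \<omega> \<partial>P x) =
          (\<integral>\<omega>. indicator A \<omega> * Y t \<omega> - indicator A \<omega> * Y r \<omega> \<partial>P x)"
        by (rule Bochner_Integration.integral_diff[OF AY AYr, symmetric])
      also have "\<dots> = (\<integral>\<omega>. indicator G \<omega> * Y t \<omega> - indicator G \<omega> * Y r \<omega> \<partial>P x)"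
      proof (rule Bochner_Integration.integral_cong[OF refl])
        fix \<omega> assume "\<omega> \<in> space (P x)"
        then show "indicator A \<omega> * Y t \<omega> - indicator A \<omega> * Y r \<omega> = indicator G \<omega> * Y t \<omega> - indicator G \<omega> * Y r \<omega>"
          using stopped[of \<omega>] xJ by (cases "exit_time \<omega> \<le> ennreal r") (auto simp: G_def indicator_def)
      qed
      also have "\<dots> = (\<integral>\<omega>. indicator G \<omega> * Y t \<omega> \<partial>P x) - (\<integral>\<omega>. indicator G \<omega> * Y r \<omega> \<partial>P x)"
        by (rule Bochner_Integration.integral_diff[OF GY GYr])
      finally show "(\<integral>\<omega>\<in>A. Y t \<omega> \<partial>P x) = (\<integral>\<omega>\<in>A. Y r \<omega> \<partial>P x)"
        using on_G by (simp add: set_lebesgue_integral_def)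
    qed
  qed
  then show ?thesis unfolding martingale_def Y_def[symmetric] using meas int[OF x] by blast
qed

lemma stopped_scaled_reflect:
  "stopped_scaled (uminus ` J) (\<lambda>t \<omega>. - X t \<omega>) (\<lambda>x. - s (- x)) t \<omega> = - stopped_scaled J X s t \<omega>"
proof -
  have "- interior (uminus ` J) = uminus ` (- interior J)"
  proof -
    have mem: "x \<in> uminus ` A \<longleftrightarrow> - x \<in> A" for x :: real and A
      by (auto intro: image_eqI[of x uminus "- x"])
    show ?thesis by (rule set_eqI) (simp only: interior_negations Compl_iff mem)
  qed
  then have "entry_time (\<lambda>t \<omega>. - X t \<omega>) (- interior (uminus ` J)) \<omega> = exit_time \<omega>"
    by (simp add: entry_time_uminus image_image)
  then show ?thesis by (simp add: stopped_scaled_def)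
qed

lemma martingale_uminus:
  assumes x: "x \<in> J" and Y: "martingale (P x) F Y"
  shows "martingale (P x) F (\<lambda>t \<omega>. - Y t \<omega>)"
proof -
  interpret prob_space "P x" using prob x .
  have Ym: "Y t \<in> borel_measurable (F t)" and Yi: "integrable (P x) (Y t)" if "0 \<le> t" for t
    using Y that by (auto simp: martingale_def)
  have "AE \<omega> in P x. real_cond_exp (P x) (F r) (\<lambda>\<omega>. - Y t \<omega>) \<omega> = - Y r \<omega>" if rt: "0 \<le> r" "r \<le> t" for r t
  proof -
    interpret finite_measure_subalgebra "P x" "F r" by unfold_locales (rule subalgebra_P_F[OF x rt(1)])
    have "0 \<le> t" using rt by simp
    from real_cond_exp_cmult[OF Yi[OF this], of "- 1"]
    have "AE \<omega> in P x. real_cond_exp (P x) (F r) (\<lambda>\<omega>. - Y t \<omega>) \<omega> = - real_cond_exp (P x) (F r) (Y t) \<omega>" by simp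
    moreover have "AE \<omega> in P x. real_cond_exp (P x) (F r) (Y t) \<omega> = Y r \<omega>"
      using Y rt by (auto simp: martingale_def)
    ultimately show ?thesis by eventually_elim simp
  qed
  then show ?thesis unfolding martingale_def using Ym Yi by auto
qed

definition left_mass_finite :: "real \<Rightarrow> bool" where
  "left_mass_finite c \<longleftrightarrow> (\<exists>C. \<forall>x\<in>interior J. x < c \<longrightarrow>
     (\<integral>\<^sup>+y\<in>{x<..c}. ennreal (s c - s y) \<partial>m) \<le> ennreal C)"

end

text \<open>Reflection turns \<open>{x<..c}\<close> into a half-open interval of the other kind. The end point \<open>c\<close> has
  weight zero in the integral, and \<open>x\<close> may be moved.\<close>

lemma left_mass_finite_reflect:
  assumes "scaled_diffusion M F J X \<theta> P s m" and c: "c \<in> interior J"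
  shows "scaled_diffusion.right_mass_finite (uminus ` J) (\<lambda>x. - s (- x))
      (distr m (restrict_space borel (uminus ` interior J)) uminus) (- c) \<longleftrightarrow>
    scaled_diffusion.left_mass_finite J s m c"
proof -
  interpret scaled_diffusion M F J X \<theta> P s m by fact
  interpret R: scaled_diffusion M F "uminus ` J" "\<lambda>t \<omega>. - X t \<omega>" \<theta> "\<lambda>x. P (- x)" "\<lambda>x. - s (- x)"
    "distr m (restrict_space borel (uminus ` interior J)) uminus"
    by (rule scaled_diffusion_reflect) fact
  have um: "uminus \<in> measurable m (restrict_space borel (uminus ` interior J))"
    unfolding measurable_cong_sets[OF sets_m refl] by (rule measurable_restrict_space3) auto
  have cJ: "c \<in> J" using c interior_J by blast
  have int: "(\<integral>\<^sup>+y\<in>{- c<..- x}. ennreal (- s (- y) - - s (- (- c))) \<partial>distr m (restrict_space borel (uminus ` interior J)) uminus)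
      = (\<integral>\<^sup>+y\<in>{x..<c}. ennreal (s c - s y) \<partial>m)" for x
  proof -
    have "(\<lambda>y. ennreal (- s (- y) - - s (- (- c)))) \<in> borel_measurable (distr m (restrict_space borel (uminus ` interior J)) uminus)"
      using R.measurable_s_m by (intro measurable_compose[OF _ measurable_ennreal] borel_measurable_diff borel_measurable_const)
    then have "(\<lambda>y. ennreal (- s (- y) - - s (- (- c))) * indicator {- c<..- x} y) \<in> borel_measurable (distr m (restrict_space borel (uminus ` interior J)) uminus)"
      by (intro borel_measurable_times_ennreal R.measurable_indicator_m) auto
    from nn_integral_distr[OF um this] show ?thesis
      by (rule trans) (auto intro!: nn_integral_cong simp: indicator_def)
  qed
  have le1: "(\<integral>\<^sup>+y\<in>{x<..c}. ennreal (s c - s y) \<partial>m) \<le> (\<integral>\<^sup>+y\<in>{x..<c}. ennreal (s c - s y) \<partial>m)" for x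
    by (rule nn_integral_mono) (auto simp: indicator_def)
  have le2: "(\<integral>\<^sup>+y\<in>{x..<c}. ennreal (s c - s y) \<partial>m) \<le> (\<integral>\<^sup>+y\<in>{x'<..c}. ennreal (s c - s y) \<partial>m)" if "x' < x" for x x'
    by (rule nn_integral_mono) (use that in \<open>auto simp: indicator_def\<close>)
  have all: "(\<forall>x\<in>interior (uminus ` J). - c < x \<longrightarrow> Q x) \<longleftrightarrow> (\<forall>x\<in>interior J. x < c \<longrightarrow> Q (- x))" for Q :: "real \<Rightarrow> bool"
    unfolding interior_negations by (simp add: ball_simps)
  show ?thesis
    unfolding R.right_mass_finite_def left_mass_finite_def all int
  proof (rule arg_cong[where f=Ex], rule ext, rule iffI)
    fix C assume "\<forall>x\<in>interior J. x < c \<longrightarrow> (\<integral>\<^sup>+y\<in>{x..<c}. ennreal (s c - s y) \<partial>m) \<le> ennreal C"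
    then show "\<forall>x\<in>interior J. x < c \<longrightarrow> (\<integral>\<^sup>+y\<in>{x<..c}. ennreal (s c - s y) \<partial>m) \<le> ennreal C"
      using le1 order_trans by blast
  next
    fix C assume C: "\<forall>x\<in>interior J. x < c \<longrightarrow> (\<integral>\<^sup>+y\<in>{x<..c}. ennreal (s c - s y) \<partial>m) \<le> ennreal C"
    show "\<forall>x\<in>interior J. x < c \<longrightarrow> (\<integral>\<^sup>+y\<in>{x..<c}. ennreal (s c - s y) \<partial>m) \<le> ennreal C"
    proof (intro ballI impI)
      fix x assume x: "x \<in> interior J" "x < c"
      obtain e where e: "0 < e" "ball x e \<subseteq> interior J" by (rule openE[OF open_interior x(1)]) blast
      have "x - e / 2 \<in> interior J" "x - e / 2 < c" "x - e / 2 < x" using e x by (auto simp: dist_real_def subset_iff)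
      then show "(\<integral>\<^sup>+y\<in>{x..<c}. ennreal (s c - s y) \<partial>m) \<le> ennreal C"
        using C le2[of "x - e / 2" x] order_trans by blast
    qed
  qed
qed

context scaled_diffusion
begin

lemma not_left_mass_finite_of_martingale:
  assumes c: "c \<in> interior J" and unbounded: "\<And>K. \<exists>z\<in>interior J. s z < K"
    and mart: "\<And>x. x \<in> interior J \<Longrightarrow> martingale (P x) F (stopped_scaled J X s)"
  shows "\<not> left_mass_finite c"
proof -
  interpret R: scaled_diffusion M F "uminus ` J" "\<lambda>t \<omega>. - X t \<omega>" \<theta> "\<lambda>x. P (- x)" "\<lambda>x. - s (- x)"
    "distr m (restrict_space borel (uminus ` interior J)) uminus"
    by (rule scaled_diffusion_reflect) unfold_locales
  have SD: "scaled_diffusion M F J X \<theta> P s m" by unfold_locales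
  have "\<not> R.right_mass_finite (- c)"
  proof (rule R.not_mass_finite_of_martingale)
    show "- c \<in> interior (uminus ` J)" unfolding interior_negations using c by simp
  next
    fix K
    obtain z where "z \<in> interior J" "s z < - K" using unbounded by blast
    then show "\<exists>z\<in>interior (uminus ` J). K < - s (- z)"
      unfolding interior_negations by (intro bexI[of _ "- z"]) auto
  next
    fix x assume "x \<in> interior (uminus ` J)"
    then have x: "- x \<in> interior J" unfolding interior_negations by auto
    have "stopped_scaled (uminus ` J) (\<lambda>t \<omega>. - X t \<omega>) (\<lambda>x. - s (- x)) = (\<lambda>t \<omega>. - stopped_scaled J X s t \<omega>)"
      by (intro ext stopped_scaled_reflect)
    then show "martingale (P (- x)) F (stopped_scaled (uminus ` J) (\<lambda>t \<omega>. - X t \<omega>) (\<lambda>x. - s (- x)))"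
      using martingale_uminus[OF interior_J[OF x] mart[OF x]] by simp
  qed
  then show ?thesis using left_mass_finite_reflect[OF SD c] by simp
qed

lemma left_comes_down_facts:
  assumes c: "c \<in> interior J"
  shows "(\<And>x. x \<in> J \<Longrightarrow> \<exists>y\<in>J. y < x) \<Longrightarrow> left_comes_down c \<Longrightarrow> (\<forall>K. \<exists>z\<in>interior J. s z < K) \<and> left_mass_finite c"
    and "d \<in> interior J \<Longrightarrow> left_comes_down c \<Longrightarrow> left_comes_down d"
proof -
  interpret R: scaled_diffusion M F "uminus ` J" "\<lambda>t \<omega>. - X t \<omega>" \<theta> "\<lambda>x. P (- x)" "\<lambda>x. - s (- x)"
    "distr m (restrict_space borel (uminus ` interior J)) uminus"
    by (rule scaled_diffusion_reflect) unfold_locales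
  have SD: "scaled_diffusion M F J X \<theta> P s m" by unfold_locales
  have intR: "- x \<in> interior (uminus ` J)" if "x \<in> interior J" for x
    unfolding interior_negations using that by simp
  show "left_comes_down d" if d: "d \<in> interior J" and down: "left_comes_down c"
    using R.comes_down_change_base[OF intR[OF c] intR[OF d]] down by (simp only: left_comes_down_reflect[OF SD])
  assume no_min: "\<And>x. x \<in> J \<Longrightarrow> \<exists>y\<in>J. y < x" and down: "left_comes_down c"
  have Rdown: "R.comes_down (- c)" using down by (simp only: left_comes_down_reflect[OF SD])
  have no_max: "\<exists>y\<in>uminus ` J. x < y" if "x \<in> uminus ` J" for x
  proof -
    have "- x \<in> J" using that by auto
    then obtain y where "y \<in> J" "y < - x" using no_min by blast
    then show ?thesis by (intro bexI[of _ "- y"]) auto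
  qed
  have unb: "\<exists>z\<in>interior (uminus ` J). K < - s (- z)" for K
    by (rule R.scale_unbounded_of_comes_down[OF intR[OF c] no_max Rdown])
  have "left_mass_finite c"
    using R.mass_finite_of_comes_down[OF intR[OF c] unb Rdown] left_mass_finite_reflect[OF SD c] by simp
  moreover have "\<exists>z\<in>interior J. s z < K" for K
  proof -
    obtain z where "z \<in> uminus ` interior J" "- K < - s (- z)" using unb[of "- K"] unfolding interior_negations by blast
    then show ?thesis by (intro bexI[of _ "- z"]) auto
  qed
  ultimately show "(\<forall>K. \<exists>z\<in>interior J. s z < K) \<and> left_mass_finite c" by blast
qed

end

section \<open>Entrance boundaries\<close>

lemma boundary_value_monotone:
  fixes f :: "real \<Rightarrow> ennreal"
  assumes b: "b \<in> boundary J" and D: "D \<subseteq> interior J"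
    and near: "\<And>z. z \<in> D \<Longrightarrow> \<exists>U. open U \<and> b \<in> U \<and> (\<forall>x\<in>interior J. ereal x \<in> U \<longrightarrow> x \<in> D \<and> f z \<le> f x)"
    and D_ne: "D \<noteq> {}" and closure: "b \<in> closure (ereal ` interior J)"
  shows "boundary_value J f b = (SUP x\<in>D. f x)"
  unfolding boundary_value_def
proof (rule tendsto_Lim)
  have "b \<notin> ereal ` interior J" using b by (simp add: boundary_def)
  then have "b islimpt ereal ` interior J" using closure by (simp add: closure_def)
  then show "at b within ereal ` interior J \<noteq> bot" by (simp add: trivial_limit_within)
  have eventually_nbhd: "eventually (\<lambda>x. Q x) (at b within ereal ` interior J)"
    if "open U" "b \<in> U" "\<And>x. x \<in> interior J \<Longrightarrow> ereal x \<in> U \<Longrightarrow> Q (ereal x)" for U Q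
    unfolding eventually_at_topological using that by blast
  show "((\<lambda>x. f (real_of_ereal x)) \<longlongrightarrow> (SUP x\<in>D. f x)) (at b within ereal ` interior J)"
  proof (rule order_tendstoI)
    fix y assume "y < (SUP x\<in>D. f x)"
    then obtain z where z: "z \<in> D" "y < f z" by (auto simp: less_SUP_iff)
    obtain U where U: "open U" "b \<in> U" "\<And>x. x \<in> interior J \<Longrightarrow> ereal x \<in> U \<Longrightarrow> f z \<le> f x"
      using near[OF z(1)] by blast
    show "eventually (\<lambda>x. y < f (real_of_ereal x)) (at b within ereal ` interior J)"
      by (rule eventually_nbhd[OF U(1,2)]) (use U(3) z(2) in \<open>auto intro: less_le_trans\<close>)
  next
    fix y assume y: "(SUP x\<in>D. f x) < y"
    obtain z where z: "z \<in> D" using D_ne by blast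
    obtain U where U: "open U" "b \<in> U" "\<And>x. x \<in> interior J \<Longrightarrow> ereal x \<in> U \<Longrightarrow> x \<in> D"
      using near[OF z] by blast
    have "f x < y" if "x \<in> D" for x by (rule le_less_trans[OF SUP_upper[OF that] y])
    then show "eventually (\<lambda>x. f (real_of_ereal x) < y) (at b within ereal ` interior J)"
      by (intro eventually_nbhd[OF U(1,2)]) (use U(3) in auto)
  qed
qed

lemma emeasure_stieltjes:
  assumes s: "continuous_on {a..b} s" "mono_on {a..b} s" and ab: "a \<le> a'" "a' \<le> b'" "b' \<le> b"
  shows "emeasure (stieltjes s a b) {a'<..b'} = ennreal (s b' - s a')"
proof -
  let ?F = "\<lambda>z. s (max a (min b z))"
  have le: "a \<le> b" using ab by simp
  have "emeasure (interval_measure ?F) {a'<..b'} = ennreal (?F b' - ?F a')"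
  proof (rule emeasure_interval_measure_Ioc[OF ab(2)])
    show "?F x \<le> ?F y" if "x \<le> y" for x y
      by (rule mono_onD[OF s(2)]) (use le that in \<open>auto simp: max_def min_def\<close>)
    have "continuous_on UNIV ?F"
      by (rule continuous_on_compose2[OF s(1)]) (use le in \<open>auto intro!: continuous_intros\<close>)
    then show "continuous (at_right x) ?F" for x
      by (simp add: continuous_on_eq_continuous_at continuous_at_imp_continuous_at_within)
  qed
  moreover have "min b b' = b'" "min b a' = a'" "max a b' = b'" "max a a' = a'" using ab by auto
  ultimately show ?thesis by (simp add: stieltjes_def)
qed

lemma sets_stieltjes: "sets (stieltjes s a b) = sets borel"
  by (simp add: stieltjes_def)

lemma density_stieltjes:
  assumes s: "continuous_on {a..b} s" "mono_on {a..b} s" and ab: "a \<le> a'" "a' \<le> b'" "b' \<le> b"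
  shows "density (stieltjes s a' b') (indicator {a'<..b'}) = density (stieltjes s a b) (indicator {a'<..b'})"
    (is "?M = ?N")
proof (rule measure_eqI_generator_eq[where E="range (\<lambda>(p, q). {p<..q::real})" and \<Omega>=UNIV and A="\<lambda>n. {- real n<..real n}"])
  have s': "continuous_on {a'..b'} s" "mono_on {a'..b'} s"
    using continuous_on_subset[OF s(1), of "{a'..b'}"] mono_on_subset[OF s(2), of "{a'..b'}"] ab by auto
  have eq: "emeasure (stieltjes s a' b') ({a'<..b'} \<inter> {p<..q}) = emeasure (stieltjes s a b) ({a'<..b'} \<inter> {p<..q})" for p q
  proof (cases "max a' p \<le> min b' q")
    case True
    show ?thesis
      unfolding Int_greaterThanAtMost
      by (subst emeasure_stieltjes[OF s' _ True], simp, simp, subst emeasure_stieltjes[OF s _ True]) (use ab in auto)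
  next
    case False
    then have "{a'<..b'} \<inter> {p<..q} = {}" by auto
    then show ?thesis by (simp only: emeasure_empty)
  qed
  have dens: "emeasure (density (stieltjes s u v) (indicator {a'<..b'})) {p<..q} = emeasure (stieltjes s u v) ({a'<..b'} \<inter> {p<..q})" for u v p q
    by (subst emeasure_density) (simp_all add: sets_stieltjes indicator_inter_arith[symmetric] borel_measurable_indicator)
  show "emeasure ?M X = emeasure ?N X" if "X \<in> range (\<lambda>(p, q). {p<..q::real})" for X
    using that eq dens by auto
  show "Int_stable (range (\<lambda>(p, q). {p<..q::real}))"
  proof (rule Int_stableI)
    fix A B assume "A \<in> range (\<lambda>(p, q). {p<..q::real})" "B \<in> range (\<lambda>(p, q). {p<..q::real})"
    then obtain p q p' q' where "A = {p<..q}" "B = {p'<..q'}" by auto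
    then have "A \<inter> B = (\<lambda>(p, q). {p<..q}) (max p p', min q q')" by simp
    then show "A \<inter> B \<in> range (\<lambda>(p, q). {p<..q})" by (rule range_eqI)
  qed
  show "sets ?M = sigma_sets UNIV (range (\<lambda>(p, q). {p<..q::real}))" "sets ?N = sigma_sets UNIV (range (\<lambda>(p, q). {p<..q::real}))"
    by (simp_all add: sets_stieltjes borel_sigma_sets_Ioc)
  show "(\<Union>i. {- real i<..real i}) = UNIV"
  proof (rule set_eqI)
    fix y :: real
    obtain n where "\<bar>y\<bar> < real n" using reals_Archimedean2 by blast
    then have "y \<in> {- real n<..real n}" by auto
    then show "y \<in> (\<Union>i. {- real i<..real i}) \<longleftrightarrow> y \<in> UNIV" by blast
  qed
  show "emeasure ?M {- real i<..real i} \<noteq> \<infinity>" for i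
  proof -
    have "emeasure ?M {- real i<..real i} \<le> emeasure (stieltjes s a' b') {a'<..b'}"
      unfolding dens by (rule emeasure_mono) (auto simp: sets_stieltjes)
    also have "\<dots> = ennreal (s b' - s a')" by (rule emeasure_stieltjes[OF s' order_refl ab(2) order_refl])
    finally show ?thesis by (auto simp: top_unique)
  qed
qed auto

lemma nn_integral_stieltjes_extend:
  assumes s: "continuous_on {a..b} s" "mono_on {a..b} s" and ab: "a \<le> a'" "a' \<le> b'" "b' \<le> b"
  shows "(\<integral>\<^sup>+z\<in>{a'<..b'}. f z \<partial>stieltjes s a' b') \<le> (\<integral>\<^sup>+z\<in>{a'<..b'}. f z \<partial>stieltjes s a b)"
proof -
  let ?S = "stieltjes s a' b'" and ?T = "stieltjes s a b" and ?I = "{a'<..b'}"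
  have "integral\<^sup>S ?S g \<le> (\<integral>\<^sup>+z\<in>?I. f z \<partial>?T)" if g: "simple_function ?S g" and le: "g \<le> (\<lambda>z. f z * indicator ?I z)" for g
  proof -
    have gm: "g \<in> borel_measurable ?S" using g by (rule borel_measurable_simple_function)
    then have gmT: "g \<in> borel_measurable ?T" by (simp add: measurable_cong_sets[OF sets_stieltjes refl])
    have supp: "indicator ?I z * g z = g z" for z
      using le_funD[OF le, of z] by (cases "z \<in> ?I") auto
    have "integral\<^sup>S ?S g = (\<integral>\<^sup>+z. indicator ?I z * g z \<partial>?S)"
      unfolding supp by (rule nn_integral_eq_simple_integral[OF g, symmetric])
    also have "\<dots> = (\<integral>\<^sup>+z. g z \<partial>density ?S (indicator ?I))"
      by (rule nn_integral_density[symmetric]) (use gm in \<open>auto simp: sets_stieltjes intro!: borel_measurable_indicator\<close>)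
    also have "\<dots> = (\<integral>\<^sup>+z. g z \<partial>density ?T (indicator ?I))"
      by (simp only: density_stieltjes[OF s ab])
    also have "\<dots> = (\<integral>\<^sup>+z. indicator ?I z * g z \<partial>?T)"
      by (rule nn_integral_density) (use gmT in \<open>auto simp: sets_stieltjes intro!: borel_measurable_indicator\<close>)
    also have "\<dots> \<le> (\<integral>\<^sup>+z\<in>?I. f z \<partial>?T)"
      unfolding supp by (rule nn_integral_mono) (use le in \<open>auto dest: le_funD\<close>)
    finally show ?thesis .
  qed
  then show ?thesis unfolding nn_integral_def[of ?S] by (intro SUP_least) auto
qed

context scaled_diffusion
begin

lemma s_mono_on_between: "a \<in> J \<Longrightarrow> b \<in> J \<Longrightarrow> {a..b} \<subseteq> J \<Longrightarrow> mono_on {a..b} s"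
  by (rule mono_onI) (auto simp: s_le_iff subset_iff)

lemma emeasure_stieltjes_scale:
  assumes "a \<in> interior J" "b \<in> interior J" "a \<le> a'" "a' \<le> b'" "b' \<le> b"
  shows "emeasure (stieltjes s a b) {a'<..b'} = ennreal (s b' - s a')"
proof -
  have sub: "{a..b} \<subseteq> J" using interior_between[OF assms(1,2)] interior_J by blast
  show ?thesis
    by (rule emeasure_stieltjes[OF continuous_on_subset[OF s_cont sub] s_mono_on_between[OF _ _ sub] assms(3-5)])
      (use assms interior_J in auto)
qed

lemma sets_m_Ioc: "a \<in> interior J \<Longrightarrow> b \<in> interior J \<Longrightarrow> {a<..b} \<in> sets m"
  using interior_between[of a b] by (auto simp: sets_m_iff)

lemma mass_Ioc_finite:
  assumes "a \<in> interior J" "b \<in> interior J"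
  shows "emeasure m {a<..b} < \<infinity>"
proof -
  have "emeasure m {a<..b} \<le> emeasure m {a..b}"
    by (rule emeasure_mono) (use interior_between[OF assms] in \<open>auto simp: sets_m_iff\<close>)
  also have "\<dots> < \<infinity>" by (rule finite_m[OF compact_Icc interior_between[OF assms]])
  finally show ?thesis .
qed

text \<open>An interval without mass would be left at once.\<close>

lemma mass_Ioc_pos:
  assumes I: "a \<in> interior J" "b \<in> interior J" and ab: "a < b"
  shows "0 < emeasure m {a<..b}"
proof (rule ccontr)
  assume "\<not> 0 < emeasure m {a<..b}"
  then have zero: "emeasure m {a<..b} = 0" by (simp add: not_gr_zero)
  have sub: "{a..b} \<subseteq> interior J" by (rule interior_between[OF I])
  obtain x where x: "a < x" "x < b" using dense[OF ab] by blast
  then have "x \<in> interior J" using sub by auto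
  then have xJ: "x \<in> J" by (rule interior_J)
  interpret prob_space "P x" using prob xJ .
  let ?\<tau> = "\<lambda>\<omega>. min (hitting_time X a \<omega>) (hitting_time X b \<omega>)"
  have "{a<..b} \<in> null_sets m" using zero sets_m_Ioc[OF I] by auto
  then have "AE y in m. y \<notin> {a<..b}" by (rule AE_not_in)
  then have "AE y in m. ennreal (green s a b x y) = 0"
    by eventually_elim (auto simp: green_def)
  then have "(\<integral>\<^sup>+y. ennreal (green s a b x y) \<partial>m) = (\<integral>\<^sup>+y. 0 \<partial>m)" by (rule nn_integral_cong_AE)
  then have int0: "(\<integral>\<^sup>+\<omega>. ?\<tau> \<omega> \<partial>P x) = 0" using mean_exit[OF x sub] by simp
  have [measurable]: "hitting_time X a \<in> borel_measurable (P x)" "hitting_time X b \<in> borel_measurable (P x)"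
    by (auto intro!: measurable_paths_P[OF xJ] measurable_entry_time_paths)
  have "?\<tau> \<in> borel_measurable (P x)" by measurable
  from nn_integral_0_iff_AE[OF this] int0 have "AE \<omega> in P x. ?\<tau> \<omega> = 0" by simp
  then have "AE \<omega> in P x. False"
    using start_eq[OF xJ]
  proof eventually_elim
    case (elim \<omega>)
    have "0 < hitting_time X a \<omega>" by (rule hitting_time_pos) (use elim x in auto)
    moreover have "0 < hitting_time X b \<omega>" by (rule hitting_time_pos) (use elim x in auto)
    ultimately show False using elim(1) by (simp add: min_def split: if_splits)
  qed
  then show False by simp
qed

lemma interior_neighbours:
  assumes "c \<in> interior J"
  shows "\<exists>d\<in>interior J. c < d" "\<exists>d\<in>interior J. d < c"
proof -
  obtain e where e: "0 < e" "ball c e \<subseteq> interior J" by (rule openE[OF open_interior assms]) blast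
  then have "c + e / 2 \<in> interior J" "c - e / 2 \<in> interior J" by (auto simp: dist_real_def subset_iff)
  then show "\<exists>d\<in>interior J. c < d" "\<exists>d\<in>interior J. d < c" using e(1) by (intro bexI[of _ "c + e / 2"] bexI[of _ "c - e / 2"]; simp)+
qed

lemma markov_bound:
  assumes A: "A \<in> sets m" and r: "0 < r" and f: "\<And>y. y \<in> A \<Longrightarrow> r \<le> f y"
    and int: "(\<integral>\<^sup>+y\<in>B. ennreal (f y) \<partial>m) \<le> ennreal C" and sub: "A \<subseteq> B"
  shows "emeasure m A \<le> ennreal (C / r)"
proof -
  have "ennreal r * emeasure m A = (\<integral>\<^sup>+y. ennreal r * indicator A y \<partial>m)"
    using A by (simp add: nn_integral_cmult_indicator)
  also have "\<dots> \<le> (\<integral>\<^sup>+y\<in>B. ennreal (f y) \<partial>m)"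
    by (rule nn_integral_mono) (use f sub in \<open>auto simp: indicator_def intro!: ennreal_leI\<close>)
  also note int
  finally have "ennreal r * emeasure m A \<le> ennreal C" .
  then have "ennreal (1 / r) * (ennreal r * emeasure m A) \<le> ennreal (1 / r) * ennreal C"
    by (rule mult_left_mono) simp
  moreover have "ennreal (1 / r) * (ennreal r * emeasure m A) = emeasure m A"
    using r by (simp add: mult.assoc[symmetric] ennreal_mult[symmetric])
  moreover have "ennreal (1 / r) * ennreal C = ennreal (C / r)"
    using r by (subst ennreal_mult'[symmetric]) auto
  ultimately show ?thesis by simp
qed

lemma bdry_u_right_bounded:
  assumes c: "c \<in> interior J" and mass: "right_mass_finite c" and K: "\<And>z. z \<in> interior J \<Longrightarrow> s z \<le> K"
  shows "\<exists>C<\<infinity>. \<forall>x\<in>interior J. c \<le> x \<longrightarrow> bdry_u s m c x \<le> C"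
proof -
  obtain d where d: "d \<in> interior J" "c < d" using interior_neighbours(1)[OF c] by blast
  obtain C where C: "\<And>x. x \<in> interior J \<Longrightarrow> c < x \<Longrightarrow> (\<integral>\<^sup>+y\<in>{c<..x}. ennreal (s y - s c) \<partial>m) \<le> ennreal C"
    using mass by (auto simp: right_mass_finite_def)
  have cJ: "c \<in> J" and dJ: "d \<in> J" using c d interior_J by auto
  let ?r = "s d - s c"
  have r: "0 < ?r" using s_less_iff[OF cJ dJ] d by simp
  let ?B = "emeasure m {c<..d} + ennreal (C / ?r)"
  have B: "emeasure m {c<..x} \<le> ?B" if x: "x \<in> interior J" for x
  proof (cases "x \<le> d")
    case True
    have "emeasure m {c<..x} \<le> emeasure m {c<..d}"
      by (rule emeasure_mono) (use True sets_m_Ioc[OF c d(1)] in auto)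
    also have "\<dots> \<le> ?B" by simp
    finally show ?thesis .
  next
    case False
    have J: "y \<in> J" if "y \<in> {d<..x}" for y
      by (rule interior_J, rule subsetD[OF interior_between[OF d(1) x]]) (use that in auto)
    have "emeasure m {d<..x} \<le> ennreal (C / ?r)"
    proof (rule markov_bound[OF sets_m_Ioc[OF d(1) x] r _ C[OF x]])
      show "?r \<le> s y - s c" if "y \<in> {d<..x}" for y using s_le_iff[OF dJ J[OF that]] that by simp
    qed (use d False in auto)
    moreover have "{c<..x} = {c<..d} \<union> {d<..x}" using d False by auto
    ultimately show ?thesis
      using emeasure_subadditive[OF sets_m_Ioc[OF c d(1)] sets_m_Ioc[OF d(1) x]] by (simp add: add_left_mono order_trans)
  qed
  have "bdry_u s m c x \<le> ?B * ennreal (K - s c)" if x: "x \<in> interior J" "c \<le> x" for x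
  proof -
    have "bdry_u s m c x \<le> (\<integral>\<^sup>+z. ?B * indicator {c<..x} z \<partial>stieltjes s c x)"
      unfolding bdry_u_def if_P[OF x(2)]
    proof (rule nn_integral_mono)
      fix z show "emeasure m {c<..z} * indicator {c<..x} z \<le> ?B * indicator {c<..x} z"
      proof (cases "z \<in> {c<..x}")
        case True
        have "z \<in> interior J" by (rule subsetD[OF interior_between[OF c x(1)]]) (use True in auto)
        from B[OF this] True show ?thesis by simp
      qed simp
    qed
    also have "\<dots> = ?B * emeasure (stieltjes s c x) {c<..x}"
      by (rule nn_integral_cmult_indicator) (simp add: sets_stieltjes)
    also have "emeasure (stieltjes s c x) {c<..x} = ennreal (s x - s c)"
      by (rule emeasure_stieltjes_scale[OF c x(1)]) (use x in auto)
    also have "?B * \<dots> \<le> ?B * ennreal (K - s c)"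
      by (intro mult_left_mono ennreal_leI) (use K[OF x(1)] in auto)
    finally show ?thesis .
  qed
  moreover have "?B * ennreal (K - s c) < \<infinity>"
    using mass_Ioc_finite[OF c d(1)] by (simp add: ennreal_mult_less_top)
  ultimately show ?thesis by blast
qed

lemma bdry_u_left_bounded:
  assumes c: "c \<in> interior J" and mass: "left_mass_finite c" and K: "\<And>z. z \<in> interior J \<Longrightarrow> K \<le> s z"
  shows "\<exists>C<\<infinity>. \<forall>x\<in>interior J. x < c \<longrightarrow> bdry_u s m c x \<le> C"
proof -
  obtain d where d: "d \<in> interior J" "d < c" using interior_neighbours(2)[OF c] by blast
  obtain C where C: "\<And>x. x \<in> interior J \<Longrightarrow> x < c \<Longrightarrow> (\<integral>\<^sup>+y\<in>{x<..c}. ennreal (s c - s y) \<partial>m) \<le> ennreal C"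
    using mass by (auto simp: left_mass_finite_def)
  have cJ: "c \<in> J" and dJ: "d \<in> J" using c d interior_J by auto
  let ?r = "s c - s d"
  have r: "0 < ?r" using s_less_iff[OF dJ cJ] d by simp
  let ?B = "ennreal (C / ?r) + emeasure m {d<..c}"
  have B: "emeasure m {x<..c} \<le> ?B" if x: "x \<in> interior J" for x
  proof (cases "d \<le> x")
    case True
    have "emeasure m {x<..c} \<le> emeasure m {d<..c}"
      by (rule emeasure_mono) (use True sets_m_Ioc[OF d(1) c] in auto)
    also have "\<dots> \<le> ?B" by simp
    finally show ?thesis .
  next
    case False
    have J: "y \<in> J" if "y \<in> {x<..d}" for y
      by (rule interior_J, rule subsetD[OF interior_between[OF x d(1)]]) (use that in auto)
    have "emeasure m {x<..d} \<le> ennreal (C / ?r)"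
    proof (rule markov_bound[OF sets_m_Ioc[OF x d(1)] r _ C[OF x]])
      show "?r \<le> s c - s y" if "y \<in> {x<..d}" for y using s_le_iff[OF J[OF that] dJ] that by simp
    qed (use d False in auto)
    moreover have "{x<..c} = {x<..d} \<union> {d<..c}" using d False by auto
    ultimately show ?thesis
      using emeasure_subadditive[OF sets_m_Ioc[OF x d(1)] sets_m_Ioc[OF d(1) c]] by (simp add: add_right_mono order_trans)
  qed
  have "bdry_u s m c x \<le> ?B * ennreal (s c - K)" if x: "x \<in> interior J" "x < c" for x
  proof -
    have nx: "\<not> c \<le> x" using x(2) by simp
    have "bdry_u s m c x \<le> (\<integral>\<^sup>+z. ?B * indicator {x<..c} z \<partial>stieltjes s x c)"
      unfolding bdry_u_def if_not_P[OF nx]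
    proof (rule nn_integral_mono)
      fix z show "emeasure m {z<..c} * indicator {x<..c} z \<le> ?B * indicator {x<..c} z"
      proof (cases "z \<in> {x<..c}")
        case True
        have "z \<in> interior J" by (rule subsetD[OF interior_between[OF x(1) c]]) (use True in auto)
        from B[OF this] True show ?thesis by simp
      qed simp
    qed
    also have "\<dots> = ?B * emeasure (stieltjes s x c) {x<..c}"
      by (rule nn_integral_cmult_indicator) (simp add: sets_stieltjes)
    also have "emeasure (stieltjes s x c) {x<..c} = ennreal (s c - s x)"
      by (rule emeasure_stieltjes_scale[OF x(1) c]) (use x in auto)
    also have "?B * \<dots> \<le> ?B * ennreal (s c - K)"
      by (intro mult_left_mono ennreal_leI) (use K[OF x(1)] in auto)
    finally show ?thesis .
  qed
  moreover have "?B * ennreal (s c - K) < \<infinity>"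
    using mass_Ioc_finite[OF d(1) c] by (simp add: ennreal_mult_less_top)
  ultimately show ?thesis by blast
qed

lemma SUP_scale_top:
  fixes \<mu> :: ennreal
  assumes \<mu>: "0 < \<mu>" and unb: "\<And>K. \<exists>x\<in>A. K < g x" and f: "\<And>x. x \<in> A \<Longrightarrow> 0 < g x \<Longrightarrow> \<mu> * ennreal (g x) \<le> f x"
  shows "(SUP x\<in>A. f x) = (\<infinity>::ennreal)"
proof (rule ccontr)
  assume "(SUP x\<in>A. f x) \<noteq> \<infinity>"
  then obtain R where R: "(SUP x\<in>A. f x) = ennreal R" "0 \<le> R" by (cases "SUP x\<in>A. f x") auto
  obtain q where q: "0 < q" "ennreal q \<le> \<mu>"
  proof (cases \<mu>)
    case (real r)
    then show ?thesis using \<mu> that[of r] by auto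
  next
    case top
    then show ?thesis using that[of 1] by simp
  qed
  obtain x where x: "x \<in> A" "(R + 1) / q < g x" using unb by blast
  have gx: "0 < g x" by (rule le_less_trans[OF _ x(2)]) (use R q in simp)
  have "R + 1 < q * g x" using x(2) q(1) by (simp add: pos_divide_less_eq mult.commute)
  then have "ennreal (R + 1) \<le> ennreal (q * g x)" by (intro ennreal_leI) simp
  also have "\<dots> = ennreal q * ennreal (g x)" using q gx by (intro ennreal_mult) auto
  also have "\<dots> \<le> \<mu> * ennreal (g x)" using q(2) by (rule mult_right_mono) simp
  also have "\<dots> \<le> f x" by (rule f[OF x(1) gx])
  also have "\<dots> \<le> ennreal R" unfolding R(1)[symmetric] by (rule SUP_upper[OF x(1)])
  finally have "R + 1 \<le> R" using R(2) by (simp only: ennreal_le_iff)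
  then show False by simp
qed

lemma bdry_u_right_unbounded:
  assumes c: "c \<in> interior J" and unb: "\<And>K. \<exists>z\<in>interior J. K < s z"
  shows "(SUP x\<in>{x\<in>interior J. c \<le> x}. bdry_u s m c x) = \<infinity>"
proof -
  obtain d where d: "d \<in> interior J" "c < d" using interior_neighbours(1)[OF c] by blast
  have cJ: "c \<in> J" and dJ: "d \<in> J" using c d interior_J by auto
  show ?thesis
  proof (rule SUP_scale_top[OF mass_Ioc_pos[OF c d], where g="\<lambda>x. s x - s d"])
    fix K
    obtain z where z: "z \<in> interior J" "max (K + s d) (s c) < s z" using unb by blast
    then have "c < z" using s_less_iff[OF cJ interior_J[OF z(1)]] by simp
    then show "\<exists>x\<in>{x\<in>interior J. c \<le> x}. K < s x - s d" using z by (intro bexI[of _ z]) auto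
  next
    fix x assume "x \<in> {x\<in>interior J. c \<le> x}" "0 < s x - s d"
    then have x: "x \<in> interior J" "c \<le> x" "d < x" using s_less_iff[OF dJ interior_J] by auto
    have "emeasure m {c<..d} * ennreal (s x - s d) = emeasure m {c<..d} * emeasure (stieltjes s c x) {d<..x}"
      by (subst emeasure_stieltjes_scale[OF c x(1)]) (use x d in auto)
    also have "\<dots> = (\<integral>\<^sup>+z. emeasure m {c<..d} * indicator {d<..x} z \<partial>stieltjes s c x)"
      by (rule nn_integral_cmult_indicator[symmetric]) (simp add: sets_stieltjes)
    also have "\<dots> \<le> bdry_u s m c x"
      unfolding bdry_u_def if_P[OF x(2)]
    proof (rule nn_integral_mono)
      fix z
      show "emeasure m {c<..d} * indicator {d<..x} z \<le> emeasure m {c<..z} * indicator {c<..x} z"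
      proof (cases "z \<in> {d<..x}")
        case True
        then have "z \<in> interior J" using interior_between[OF d(1) x(1)] by auto
        then have "emeasure m {c<..d} \<le> emeasure m {c<..z}"
          by (intro emeasure_mono sets_m_Ioc c) (use True in auto)
        then show ?thesis using True d by simp
      qed simp
    qed
    finally show "emeasure m {c<..d} * ennreal (s x - s d) \<le> bdry_u s m c x" .
  qed
qed

lemma bdry_u_left_unbounded:
  assumes c: "c \<in> interior J" and unb: "\<And>K. \<exists>z\<in>interior J. s z < K"
  shows "(SUP x\<in>{x\<in>interior J. x < c}. bdry_u s m c x) = \<infinity>"
proof -
  obtain d where d: "d \<in> interior J" "d < c" using interior_neighbours(2)[OF c] by blast
  have cJ: "c \<in> J" and dJ: "d \<in> J" using c d interior_J by auto
  show ?thesis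
  proof (rule SUP_scale_top[OF mass_Ioc_pos[OF d(1) c d(2)], where g="\<lambda>x. s d - s x"])
    fix K
    obtain z where z: "z \<in> interior J" "s z < min (s d - K) (s c)" using unb by blast
    then have "z < c" using s_less_iff[OF interior_J[OF z(1)] cJ] by simp
    then show "\<exists>x\<in>{x\<in>interior J. x < c}. K < s d - s x" using z by (intro bexI[of _ z]) auto
  next
    fix x assume "x \<in> {x\<in>interior J. x < c}" "0 < s d - s x"
    then have x: "x \<in> interior J" "\<not> c \<le> x" "x < d" using s_less_iff[OF interior_J dJ] by auto
    have "emeasure m {d<..c} * ennreal (s d - s x) = emeasure m {d<..c} * emeasure (stieltjes s x c) {x<..d}"
      by (subst emeasure_stieltjes_scale[OF x(1) c]) (use x d in auto)
    also have "\<dots> = (\<integral>\<^sup>+z. emeasure m {d<..c} * indicator {x<..d} z \<partial>stieltjes s x c)"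
      by (rule nn_integral_cmult_indicator[symmetric]) (simp add: sets_stieltjes)
    also have "\<dots> \<le> bdry_u s m c x"
      unfolding bdry_u_def if_not_P[OF x(2)]
    proof (rule nn_integral_mono)
      fix z
      show "emeasure m {d<..c} * indicator {x<..d} z \<le> emeasure m {z<..c} * indicator {x<..c} z"
      proof (cases "z \<in> {x<..d}")
        case True
        then have "z \<in> interior J" using interior_between[OF x(1) d(1)] by auto
        then have "emeasure m {d<..c} \<le> emeasure m {z<..c}"
          by (intro emeasure_mono sets_m_Ioc c) (use True in auto)
        then show ?thesis using True d by simp
      qed simp
    qed
    finally show "emeasure m {d<..c} * ennreal (s d - s x) \<le> bdry_u s m c x" .
  qed
qed

lemma bdry_mono_right:
  assumes c: "c \<in> interior J" and x: "c \<le> x" "x \<le> y" and y: "y \<in> interior J"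
  shows "bdry_u s m c x \<le> bdry_u s m c y" "bdry_v s m c x \<le> bdry_v s m c y"
proof -
  have cy: "c \<le> y" using x by simp
  show "bdry_v s m c x \<le> bdry_v s m c y"
    unfolding bdry_v_def if_P[OF x(1)] if_P[OF cy]
    by (rule nn_integral_mono) (use x in \<open>auto simp: indicator_def\<close>)
  have sub: "{c..y} \<subseteq> J" using interior_between[OF c y] interior_J by blast
  have "bdry_u s m c x \<le> (\<integral>\<^sup>+z\<in>{c<..x}. emeasure m {c<..z} \<partial>stieltjes s c y)"
    unfolding bdry_u_def if_P[OF x(1)]
    by (rule nn_integral_stieltjes_extend[OF continuous_on_subset[OF s_cont sub] s_mono_on_between[OF _ _ sub] order_refl x])
      (use interior_J[OF c] interior_J[OF y] in auto)
  also have "\<dots> \<le> bdry_u s m c y"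
    unfolding bdry_u_def if_P[OF cy]
    by (rule nn_integral_mono) (use x in \<open>auto simp: indicator_def\<close>)
  finally show "bdry_u s m c x \<le> bdry_u s m c y" .
qed

lemma bdry_mono_left:
  assumes c: "c \<in> interior J" and x: "x < c" "y \<le> x" and y: "y \<in> interior J"
  shows "bdry_u s m c x \<le> bdry_u s m c y" "bdry_v s m c x \<le> bdry_v s m c y"
proof -
  have nx: "\<not> c \<le> x" and ny: "\<not> c \<le> y" using x by auto
  show "bdry_v s m c x \<le> bdry_v s m c y"
    unfolding bdry_v_def if_not_P[OF nx] if_not_P[OF ny]
    by (rule nn_integral_mono) (use x in \<open>auto simp: indicator_def\<close>)
  have sub: "{y..c} \<subseteq> J" using interior_between[OF y c] interior_J by blast
  have "bdry_u s m c x \<le> (\<integral>\<^sup>+z\<in>{x<..c}. emeasure m {z<..c} \<partial>stieltjes s y c)"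
    unfolding bdry_u_def if_not_P[OF nx]
    by (rule nn_integral_stieltjes_extend[OF continuous_on_subset[OF s_cont sub] s_mono_on_between[OF _ _ sub] x(2) less_imp_le[OF x(1)] order_refl])
      (use interior_J[OF c] interior_J[OF y] in auto)
  also have "\<dots> \<le> bdry_u s m c y"
    unfolding bdry_u_def if_not_P[OF ny]
    by (rule nn_integral_mono) (use x in \<open>auto simp: indicator_def\<close>)
  finally show "bdry_u s m c x \<le> bdry_u s m c y" .
qed

lemma closure_ereal_interior: "closure (ereal ` J) = closure (ereal ` interior J)"
proof (rule antisym)
  have "convex J" using interval(1) by (simp add: is_interval_convex_1)
  then have "closure (interior J) = closure J" by (rule convex_closure_interior[OF _ interior_nonempty])
  moreover have "ereal ` closure (interior J) \<subseteq> closure (ereal ` interior J)"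
    by (rule image_closure_subset) (auto intro!: continuous_on_ereal closure_subset)
  ultimately have "ereal ` J \<subseteq> closure (ereal ` interior J)" using closure_subset[of J] by blast
  then show "closure (ereal ` J) \<subseteq> closure (ereal ` interior J)" by (rule closure_minimal) simp
  show "closure (ereal ` interior J) \<subseteq> closure (ereal ` J)"
    by (rule closure_mono) (use interior_J in auto)
qed

lemma boundary_cases:
  assumes b: "b \<in> boundary J"
  shows "(\<forall>x\<in>interior J. ereal x < b) \<or> (\<forall>x\<in>interior J. b < ereal x)"
proof (rule ccontr)
  assume "\<not> ?thesis"
  then obtain x y where xy: "x \<in> interior J" "\<not> ereal x < b" "y \<in> interior J" "\<not> b < ereal y" by blast
  have "b \<noteq> ereal x" "b \<noteq> ereal y" using b xy by (auto simp: boundary_def)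
  then have lt: "ereal y < b" "b < ereal x" using xy by auto
  then obtain r where r: "b = ereal r" by (cases b) auto
  then have "r \<in> interior J" using lt interior_between[OF xy(3,1)] by auto
  then show False using b r by (auto simp: boundary_def)
qed

lemma right_end_exists: "\<exists>b\<in>boundary J. \<forall>x\<in>interior J. ereal x < b"
proof -
  let ?b = "SUP x\<in>interior J. ereal x"
  obtain x0 where x0: "x0 \<in> interior J" using interior_nonempty by blast
  have upper: "ereal x < ?b" if x: "x \<in> interior J" for x
  proof -
    obtain d where "d \<in> interior J" "x < d" using interior_neighbours(1)[OF x] by blast
    then show ?thesis by (intro less_le_trans[OF _ SUP_upper[of d]]) auto
  qed
  obtain q :: "nat \<Rightarrow> real" where q: "\<And>n. q n \<in> interior J" "\<And>n. x0 < q n"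
    "\<And>y. y \<in> interior J \<Longrightarrow> eventually (\<lambda>n. y < q n) sequentially"
    by (rule sequence_above[OF x0]) blast
  have "(\<lambda>n. ereal (q n)) \<longlonglongrightarrow> ?b"
  proof (rule order_tendstoI)
    fix y assume "y < ?b"
    then obtain z where z: "z \<in> interior J" "y < ereal z" by (auto simp: less_SUP_iff)
    from q(3)[OF z(1)] show "eventually (\<lambda>n. y < ereal (q n)) sequentially"
      by eventually_elim (use z(2) in \<open>auto intro: less_trans\<close>)
  next
    fix y assume y: "?b < y"
    show "eventually (\<lambda>n. ereal (q n) < y) sequentially"
      by (intro always_eventually allI less_trans[OF upper[OF q(1)] y])
  qed
  note lim = this
  have "eventually (\<lambda>n. ereal (q n) \<in> closure (ereal ` interior J)) sequentially"
    by (intro always_eventually allI subsetD[OF closure_subset] imageI q(1))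
  from Lim_in_closed_set[OF closed_closure this trivial_limit_sequentially lim]
  have "?b \<in> closure (ereal ` interior J)" .
  then have "?b \<in> boundary J" using upper unfolding boundary_def closure_ereal_interior by fastforce
  then show ?thesis using upper by blast
qed

lemma left_end_exists: "\<exists>b\<in>boundary J. \<forall>x\<in>interior J. b < ereal x"
proof -
  let ?b = "INF x\<in>interior J. ereal x"
  obtain x0 where x0: "x0 \<in> interior J" using interior_nonempty by blast
  have lower: "?b < ereal x" if x: "x \<in> interior J" for x
  proof -
    obtain d where "d \<in> interior J" "d < x" using interior_neighbours(2)[OF x] by blast
    then show ?thesis by (intro le_less_trans[OF INF_lower[of d]]) auto
  qed
  obtain q :: "nat \<Rightarrow> real" where q: "\<And>n. q n \<in> interior J" "\<And>n. q n < x0"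
    "\<And>y. y \<in> interior J \<Longrightarrow> eventually (\<lambda>n. q n < y) sequentially"
    by (rule sequence_below[OF x0]) blast
  have "(\<lambda>n. ereal (q n)) \<longlonglongrightarrow> ?b"
  proof (rule order_tendstoI)
    fix y assume "?b < y"
    then obtain z where z: "z \<in> interior J" "ereal z < y" by (auto simp: INF_less_iff)
    from q(3)[OF z(1)] show "eventually (\<lambda>n. ereal (q n) < y) sequentially"
      by eventually_elim (use z(2) in \<open>auto intro: less_trans[rotated]\<close>)
  next
    fix y assume y: "y < ?b"
    show "eventually (\<lambda>n. y < ereal (q n)) sequentially"
      by (intro always_eventually allI less_trans[OF y lower[OF q(1)]])
  qed
  note lim = this
  have "eventually (\<lambda>n. ereal (q n) \<in> closure (ereal ` interior J)) sequentially"
    by (intro always_eventually allI subsetD[OF closure_subset] imageI q(1))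
  from Lim_in_closed_set[OF closed_closure this trivial_limit_sequentially lim]
  have "?b \<in> closure (ereal ` interior J)" .
  then have "?b \<in> boundary J" using lower unfolding boundary_def closure_ereal_interior by fastforce
  then show ?thesis using lower by blast
qed

lemma entrance_right_iff:
  assumes c: "c \<in> interior J" and b: "b \<in> boundary J" "\<And>x. x \<in> interior J \<Longrightarrow> ereal x < b"
  shows "entrance_boundary J s m c b \<longleftrightarrow> (\<forall>K. \<exists>z\<in>interior J. K < s z) \<and> right_mass_finite c"
proof -
  let ?D = "{x\<in>interior J. c \<le> x}"
  have clos: "b \<in> closure (ereal ` interior J)" using b(1) by (simp add: boundary_def closure_ereal_interior)
  have sup: "boundary_value J f b = (SUP x\<in>?D. f x)"
    if mono: "\<And>x y. c \<le> x \<Longrightarrow> x \<le> y \<Longrightarrow> y \<in> interior J \<Longrightarrow> f x \<le> f y" for f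
  proof (rule boundary_value_monotone[OF b(1) _ _ _ clos])
    show "?D \<noteq> {}" using c by blast
    show "\<exists>U. open U \<and> b \<in> U \<and> (\<forall>x\<in>interior J. ereal x \<in> U \<longrightarrow> x \<in> ?D \<and> f z \<le> f x)" if z: "z \<in> ?D" for z
      by (intro exI[of _ "{ereal z<..}"]) (use z b(2)[of z] mono[of z] in auto)
  qed auto
  have u: "boundary_value J (bdry_u s m c) b = (SUP x\<in>?D. bdry_u s m c x)"
    by (rule sup) (rule bdry_mono_right(1)[OF c])
  have v: "boundary_value J (bdry_v s m c) b = (SUP x\<in>?D. bdry_v s m c x)"
    by (rule sup) (rule bdry_mono_right(2)[OF c])
  have "(SUP x\<in>?D. bdry_v s m c x) < \<infinity> \<longleftrightarrow> right_mass_finite c"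
  proof
    assume "(SUP x\<in>?D. bdry_v s m c x) < \<infinity>"
    then obtain C where C: "(SUP x\<in>?D. bdry_v s m c x) = ennreal C" by (cases "SUP x\<in>?D. bdry_v s m c x") auto
    have "bdry_v s m c x \<le> ennreal C" if "x \<in> interior J" "c < x" for x
      unfolding C[symmetric] by (rule SUP_upper) (use that in auto)
    then have "\<forall>x\<in>interior J. c < x \<longrightarrow> (\<integral>\<^sup>+y\<in>{c<..x}. ennreal (s y - s c) \<partial>m) \<le> ennreal C"
      by (auto simp: bdry_v_def)
    then show "right_mass_finite c" unfolding right_mass_finite_def by blast
  next
    assume "right_mass_finite c"
    then obtain C where C: "\<And>x. x \<in> interior J \<Longrightarrow> c < x \<Longrightarrow> (\<integral>\<^sup>+y\<in>{c<..x}. ennreal (s y - s c) \<partial>m) \<le> ennreal C"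
      unfolding right_mass_finite_def by blast
    have "bdry_v s m c x \<le> ennreal C" if "x \<in> ?D" for x
      using C[of x] that by (cases "x = c") (auto simp: bdry_v_def)
    then have "(SUP x\<in>?D. bdry_v s m c x) \<le> ennreal C" by (rule SUP_least)
    then show "(SUP x\<in>?D. bdry_v s m c x) < \<infinity>" by (rule le_less_trans) simp
  qed
  moreover have "\<exists>z\<in>interior J. K < s z" if inf: "(SUP x\<in>?D. bdry_u s m c x) = \<infinity>" and mass: "right_mass_finite c" for K
  proof (rule ccontr)
    assume "\<not> ?thesis"
    then have "\<And>z. z \<in> interior J \<Longrightarrow> s z \<le> K" by (auto simp: not_less)
    from bdry_u_right_bounded[OF c mass this] obtain C where C: "C < \<infinity>" "\<forall>x\<in>interior J. c \<le> x \<longrightarrow> bdry_u s m c x \<le> C"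
      by blast
    have "(SUP x\<in>?D. bdry_u s m c x) \<le> C" by (rule SUP_least) (use C(2) in auto)
    then show False using inf C(1) by simp
  qed
  ultimately show ?thesis
    unfolding entrance_boundary_def u v using bdry_u_right_unbounded[OF c] by blast
qed

lemma entrance_left_iff:
  assumes c: "c \<in> interior J" and b: "b \<in> boundary J" "\<And>x. x \<in> interior J \<Longrightarrow> b < ereal x"
  shows "entrance_boundary J s m c b \<longleftrightarrow> (\<forall>K. \<exists>z\<in>interior J. s z < K) \<and> left_mass_finite c"
proof -
  let ?D = "{x\<in>interior J. x < c}"
  have clos: "b \<in> closure (ereal ` interior J)" using b(1) by (simp add: boundary_def closure_ereal_interior)
  have sup: "boundary_value J f b = (SUP x\<in>?D. f x)"
    if mono: "\<And>x y. x < c \<Longrightarrow> y \<le> x \<Longrightarrow> y \<in> interior J \<Longrightarrow> f x \<le> f y" for f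
  proof (rule boundary_value_monotone[OF b(1) _ _ _ clos])
    show "?D \<noteq> {}" using interior_neighbours(2)[OF c] by blast
    show "\<exists>U. open U \<and> b \<in> U \<and> (\<forall>x\<in>interior J. ereal x \<in> U \<longrightarrow> x \<in> ?D \<and> f z \<le> f x)" if z: "z \<in> ?D" for z
      by (intro exI[of _ "{..<ereal z}"]) (use z b(2)[of z] mono[of z] in auto)
  qed auto
  have u: "boundary_value J (bdry_u s m c) b = (SUP x\<in>?D. bdry_u s m c x)"
    by (rule sup) (rule bdry_mono_left(1)[OF c])
  have v: "boundary_value J (bdry_v s m c) b = (SUP x\<in>?D. bdry_v s m c x)"
    by (rule sup) (rule bdry_mono_left(2)[OF c])
  have "(SUP x\<in>?D. bdry_v s m c x) < \<infinity> \<longleftrightarrow> left_mass_finite c"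
  proof
    assume "(SUP x\<in>?D. bdry_v s m c x) < \<infinity>"
    then obtain C where C: "(SUP x\<in>?D. bdry_v s m c x) = ennreal C" by (cases "SUP x\<in>?D. bdry_v s m c x") auto
    have "bdry_v s m c x \<le> ennreal C" if "x \<in> interior J" "x < c" for x
      unfolding C[symmetric] by (rule SUP_upper) (use that in auto)
    then have "\<forall>x\<in>interior J. x < c \<longrightarrow> (\<integral>\<^sup>+y\<in>{x<..c}. ennreal (s c - s y) \<partial>m) \<le> ennreal C"
      by (auto simp: bdry_v_def)
    then show "left_mass_finite c" unfolding left_mass_finite_def by blast
  next
    assume "left_mass_finite c"
    then obtain C where C: "\<And>x. x \<in> interior J \<Longrightarrow> x < c \<Longrightarrow> (\<integral>\<^sup>+y\<in>{x<..c}. ennreal (s c - s y) \<partial>m) \<le> ennreal C"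
      unfolding left_mass_finite_def by blast
    have "bdry_v s m c x \<le> ennreal C" if "x \<in> ?D" for x
      using C[of x] that by (auto simp: bdry_v_def)
    then have "(SUP x\<in>?D. bdry_v s m c x) \<le> ennreal C" by (rule SUP_least)
    then show "(SUP x\<in>?D. bdry_v s m c x) < \<infinity>" by (rule le_less_trans) simp
  qed
  moreover have "\<exists>z\<in>interior J. s z < K" if inf: "(SUP x\<in>?D. bdry_u s m c x) = \<infinity>" and mass: "left_mass_finite c" for K
  proof (rule ccontr)
    assume "\<not> ?thesis"
    then have "\<And>z. z \<in> interior J \<Longrightarrow> K \<le> s z" by (auto simp: not_less)
    from bdry_u_left_bounded[OF c mass this] obtain C where C: "C < \<infinity>" "\<forall>x\<in>interior J. x < c \<longrightarrow> bdry_u s m c x \<le> C"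
      by blast
    have "(SUP x\<in>?D. bdry_u s m c x) \<le> C" by (rule SUP_least) (use C(2) in auto)
    then show False using inf C(1) by simp
  qed
  ultimately show ?thesis
    unfolding entrance_boundary_def u v using bdry_u_left_unbounded[OF c] by blast
qed

lemma no_max_of_unbounded:
  assumes unb: "\<And>K. \<exists>z\<in>interior J. K < s z" and x: "x \<in> J"
  shows "\<exists>y\<in>J. x < y"
proof -
  obtain z where z: "z \<in> interior J" "s x < s z" using unb by blast
  then show ?thesis using s_less_iff[OF x interior_J[OF z(1)]] interior_J by blast
qed

lemma no_min_of_unbounded:
  assumes unb: "\<And>K. \<exists>z\<in>interior J. s z < K" and x: "x \<in> J"
  shows "\<exists>y\<in>J. y < x"
proof -
  obtain z where z: "z \<in> interior J" "s z < s x" using unb by blast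
  then show ?thesis using s_less_iff[OF interior_J[OF z(1)] x] interior_J by blast
qed

theorem feller_dynkin_martingale_natural:
  assumes c: "c \<in> interior J"
  defines "mart \<equiv> \<forall>x\<in>interior J. martingale (P x) F (stopped_scaled J X s)"
    and "only_natural \<equiv> \<forall>b\<in>boundary J. open_boundary J s m c b \<longrightarrow> natural_boundary J s m c b"
  shows "FD_process J X P \<longleftrightarrow> mart" "mart \<longleftrightarrow> only_natural"
proof -
  define R where "R \<longleftrightarrow> (\<forall>K. \<exists>z\<in>interior J. K < s z) \<and> right_mass_finite c"
  define L where "L \<longleftrightarrow> (\<forall>K. \<exists>z\<in>interior J. s z < K) \<and> left_mass_finite c"
  have FD_mart: mart if FD: "FD_process J X P"
    unfolding mart_def
  proof
    fix x assume x: "x \<in> interior J"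
    show "martingale (P x) F (stopped_scaled J X s)"
    proof (rule martingale_of_not_comes_down[OF x])
      fix y assume y: "y \<in> interior J" and unb: "\<And>K. \<exists>z\<in>interior J. K < s z"
      have "\<not> comes_down c" using FD FD_process_iff[OF c] no_max_of_unbounded[OF unb] by blast
      then show "\<not> comes_down y" using comes_down_change_base[OF y c] by blast
    next
      fix y assume y: "y \<in> interior J" and unb: "\<And>K. \<exists>z\<in>interior J. s z < K"
      have "\<not> left_comes_down c" using FD FD_process_iff[OF c] no_min_of_unbounded[OF unb] by blast
      then show "\<not> left_comes_down y" using left_comes_down_facts(2)[OF y c] by blast
    qed
  qed
  have mart_RL: "\<not> R \<and> \<not> L" if mart
    using that not_mass_finite_of_martingale[OF c] not_left_mass_finite_of_martingale[OF c]
    unfolding mart_def R_def L_def by blast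
  have RL_FD: "FD_process J X P" if "\<not> R \<and> \<not> L"
    unfolding FD_process_iff[OF c]
  proof (intro conjI impI notI)
    assume no_max: "\<forall>x\<in>J. \<exists>y\<in>J. x < y" and down: "comes_down c"
    have unb: "\<exists>z\<in>interior J. K < s z" for K
      by (rule scale_unbounded_of_comes_down[OF c _ down]) (use no_max in blast)
    then have R unfolding R_def using mass_finite_of_comes_down[OF c unb down] by blast
    then show False using that by blast
  next
    assume no_min: "\<forall>x\<in>J. \<exists>y\<in>J. y < x" and down: "left_comes_down c"
    have L unfolding L_def by (rule left_comes_down_facts(1)[OF c _ down]) (use no_min in blast)
    then show False using that by blast
  qed
  have nat_RL: "only_natural \<longleftrightarrow> \<not> R \<and> \<not> L"
  proof -
    have nat_eq: "only_natural \<longleftrightarrow> (\<forall>b\<in>boundary J. \<not> entrance_boundary J s m c b)"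
      unfolding only_natural_def open_boundary_def entrance_boundary_def natural_boundary_def by auto
    obtain r l where r: "r \<in> boundary J" "\<And>x. x \<in> interior J \<Longrightarrow> ereal x < r"
      and l: "l \<in> boundary J" "\<And>x. x \<in> interior J \<Longrightarrow> l < ereal x"
      using right_end_exists left_end_exists by blast
    have "entrance_boundary J s m c r \<longleftrightarrow> R" unfolding R_def by (rule entrance_right_iff[OF c r])
    moreover have "entrance_boundary J s m c l \<longleftrightarrow> L" unfolding L_def by (rule entrance_left_iff[OF c l])
    moreover have "R \<or> L" if b: "b \<in> boundary J" "entrance_boundary J s m c b" for b
      using boundary_cases[OF b(1)]
    proof
      assume "\<forall>x\<in>interior J. ereal x < b"
      then show ?thesis using entrance_right_iff[OF c b(1)] b(2) unfolding R_def by blast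
    next
      assume "\<forall>x\<in>interior J. b < ereal x"
      then show ?thesis using entrance_left_iff[OF c b(1)] b(2) unfolding L_def by blast
    qed
    ultimately show ?thesis unfolding nat_eq using r(1) l(1) by blast
  qed
  show "FD_process J X P \<longleftrightarrow> mart" using FD_mart mart_RL RL_FD by blast
  show "mart \<longleftrightarrow> only_natural" using FD_mart mart_RL RL_FD nat_RL by blast
qed

end

text \<open>Downward exits have the complementary probability, as an interval with compact closure in the
  interior has finite speed measure and hence finite mean exit time.\<close>

lemma scaled_diffusion_of_scale_and_speed:
  assumes "regular_diffusion M F J X \<theta> P" and scale: "scale_function M J X P s"
    and speed: "speed_measure J X P s m" and c: "c \<in> interior J"
  shows "scaled_diffusion M F J X \<theta> P s m"
proof -
  interpret regular_diffusion M F J X \<theta> P by fact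
  have up: "hit_prob x b {a} = (s x - s a) / (s b - s a)"
    if "a < x" "x < b" "{a..b} \<subseteq> interior J" for a b x
  proof -
    have "{a..b} \<subseteq> J" "a < b" "x \<in> {a<..<b}" using that interior_subset by auto
    then show ?thesis using scale unfolding scale_function_def hit_prob_def by blast
  qed
  have sm: "strict_mono_on J s" using scale by (simp add: scale_function_def)
  have sets: "sets m = sets (restrict_space borel (interior J))" using speed by (simp add: speed_measure_def)
  have fin: "emeasure m K < \<infinity>" if "compact K" "K \<subseteq> interior J" for K
    using speed that unfolding speed_measure_def by blast
  have mean: "(\<integral>\<^sup>+\<omega>. min (hitting_time X a \<omega>) (hitting_time X b \<omega>) \<partial>P x) = (\<integral>\<^sup>+y. ennreal (green s a b x y) \<partial>m)"
    if "a < x" "x < b" "{a..b} \<subseteq> interior J" for a b x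
  proof -
    have "{a..b} \<subseteq> J" "a < b" "x \<in> {a<..<b}" using that interior_subset by auto
    then show ?thesis using speed unfolding speed_measure_def by blast
  qed
  have down: "hit_prob x a {b} = (s b - s x) / (s b - s a)"
    if ab: "a < x" "x < b" "{a..b} \<subseteq> interior J" for a b x
  proof -
    have sub: "{a..b} \<subseteq> J" using ab(3) interior_subset by blast
    have xJ: "x \<in> J" "a \<in> J" "b \<in> J" using sub ab by auto
    have sx: "s a < s x" "s x < s b" using strict_mono_onD[OF sm] xJ ab by auto
    interpret prob_space "P x" using prob xJ(1) .
    have [measurable]: "hitting_time X a \<in> borel_measurable (P x)" "hitting_time X b \<in> borel_measurable (P x)"
      by (auto intro!: measurable_paths_P[OF xJ(1)] measurable_entry_time_paths)
    let ?\<tau> = "\<lambda>\<omega>. min (hitting_time X a \<omega>) (hitting_time X b \<omega>)"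
    have green_le: "green s a b x y \<le> 2 * (s b - s a)" for y
    proof (cases "y \<in> {a<..<b}")
      case True
      then have "y \<in> J" using sub by auto
      then have sy: "s a < s y" "s y < s b" using strict_mono_onD[OF sm] xJ True by auto
      have "(min (s x) (s y) - s a) * (s b - max (s x) (s y)) \<le> (s b - s a) * (s b - s a)"
        by (rule mult_mono) (use sx sy in auto)
      then have "2 * ((min (s x) (s y) - s a) * (s b - max (s x) (s y))) \<le> 2 * ((s b - s a) * (s b - s a))"
        by (rule mult_left_mono) simp
      then have "2 * (min (s x) (s y) - s a) * (s b - max (s x) (s y)) \<le> 2 * (s b - s a) * (s b - s a)"
        by (simp only: mult.assoc)
      moreover have d0: "0 < s b - s a" using sx by simp
      ultimately have "2 * (min (s x) (s y) - s a) * (s b - max (s x) (s y)) / (s b - s a) \<le> 2 * (s b - s a)"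
        by (simp only: pos_divide_le_eq[OF d0])
      then show ?thesis using True ab by (simp add: green_def)
    next
      case False
      then show ?thesis using sx by (auto simp: green_def)
    qed
    have "(\<integral>\<^sup>+y. ennreal (green s a b x y) \<partial>m) \<le> (\<integral>\<^sup>+y. ennreal (2 * (s b - s a)) * indicator {a..b} y \<partial>m)"
    proof (rule nn_integral_mono)
      fix y
      show "ennreal (green s a b x y) \<le> ennreal (2 * (s b - s a)) * indicator {a..b} y"
        using ennreal_leI[OF green_le[of y]] by (cases "y \<in> {a..b}") (auto simp: green_def)
    qed
    also have "\<dots> = ennreal (2 * (s b - s a)) * emeasure m {a..b}"
      by (rule nn_integral_cmult_indicator) (use ab(3) in \<open>auto simp: sets sets_restrict_space_iff\<close>)
    also have "\<dots> < \<infinity>" using fin[OF compact_Icc ab(3)] by (simp add: ennreal_mult_less_top)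
    finally have "(\<integral>\<^sup>+\<omega>. ?\<tau> \<omega> \<partial>P x) \<noteq> \<infinity>" using mean[OF ab] by simp
    note fin_mean = this
    have "?\<tau> \<in> borel_measurable (P x)" by measurable
    from nn_integral_PInf_AE[OF this fin_mean] have AE: "AE \<omega> in P x. \<omega> \<in> {\<omega>\<in>space (P x). hitting_time X a \<omega> < hitting_time X b \<omega>} \<longleftrightarrow>
        \<omega> \<in> space (P x) - {\<omega>\<in>space (P x). hitting_time X b \<omega> < hitting_time X a \<omega>}"
      using start_eq[OF xJ(1)]
    proof eventually_elim
      case (elim \<omega>)
      have ab': "a \<noteq> b" using ab by simp
      show ?case
      proof (cases "hitting_time X a \<omega> < hitting_time X b \<omega>")
        case True
        then show ?thesis using elim xJ(1) by auto
      next
        case False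
        then have le: "hitting_time X b \<omega> \<le> hitting_time X a \<omega>" by simp
        then have "hitting_time X b \<omega> < \<infinity>" using elim(1) by (simp add: min_absorb2 less_top)
        then have "hitting_time X b \<omega> \<noteq> hitting_time X a \<omega>"
          using hitting_times_distinct[of \<omega> b a] elim(2) ab' by auto
        then have "hitting_time X b \<omega> < hitting_time X a \<omega>" using le by simp
        then show ?thesis using False elim xJ(1) by auto
      qed
    qed
    have less_sets: "{\<omega>\<in>space (P x). hitting_time X u \<omega> < hitting_time X v \<omega>} \<in> sets (P x)" for u v
      using less_entry_sets[OF xJ(1), of "{v}" u] xJ(1) by simp
    have "hit_prob x a {b} = measure (P x) {\<omega>\<in>space (P x). hitting_time X a \<omega> < hitting_time X b \<omega>}"
      using xJ(1) by (simp add: hit_prob_def)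
    also have "\<dots> = measure (P x) (space (P x) - {\<omega>\<in>space (P x). hitting_time X b \<omega> < hitting_time X a \<omega>})"
      by (rule finite_measure_eq_AE[OF AE]) (auto intro!: sets.compl_sets less_sets)
    also have "\<dots> = 1 - measure (P x) {\<omega>\<in>space (P x). hitting_time X b \<omega> < hitting_time X a \<omega>}"
      by (rule prob_compl) (rule less_sets)
    also have "\<dots> = 1 - hit_prob x b {a}" using xJ(1) by (simp add: hit_prob_def)
    also have "\<dots> = (s b - s x) / (s b - s a)" unfolding up[OF ab] using sx by (simp add: field_simps)
    finally show ?thesis .
  qed
  show ?thesis
  proof unfold_locales
    show "continuous_on J s" using scale by (simp add: scale_function_def)
  qed (use c sm up down sets fin mean in auto)
qed

theorem theorem1p1:
  fixes M :: "'a measure" and F :: "real \<Rightarrow> 'a measure" and J :: "real set"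
    and X :: "real \<Rightarrow> 'a \<Rightarrow> real" and \<theta> :: "real \<Rightarrow> 'a \<Rightarrow> 'a" and P :: "real \<Rightarrow> 'a measure"
    and s :: "real \<Rightarrow> real" and m :: "real measure" and c :: real
  assumes "regular_diffusion M F J X \<theta> P"
    and "scale_function M J X P s"
    and "speed_measure J X P s m"
    and "c \<in> interior J"
  shows "(FD_process J X P \<longleftrightarrow>
            (\<forall>x\<in>interior J. martingale (P x) F (stopped_scaled J X s))) \<and>
         ((\<forall>x\<in>interior J. martingale (P x) F (stopped_scaled J X s)) \<longleftrightarrow>
            (\<forall>b\<in>boundary J. open_boundary J s m c b \<longrightarrow> natural_boundary J s m c b))"
proof -
  interpret scaled_diffusion M F J X \<theta> P s m
    by (rule scaled_diffusion_of_scale_and_speed) fact+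
  show ?thesis
    using feller_dynkin_martingale_natural[OF assms(4)] by (rule conjI)
qed

end
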